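(* For each relation $\bowtie$ among simulation preorder $\sqsubseteq_s$, simulation equivalence $=_s$, completed simulation preorder $\sqsubseteq_{cs}$ and equivalence $=_{cs}$, ready simulation preorder $\sqsubseteq_{rs}$ and equivalence $=_{rs}$, 2-nested simulation preorder $\sqsubseteq_{2s}$ and equivalence $=_{2s}$, and bisimulation equivalence $\sim$, the following problem is decidable and EXPTIME-complete: given a visibly pushdown automaton $\Delta$ and two of its processes $pX$, $qY$, decide whether $pX\bowtie qY$ in the transition system generated by $\Delta$.
   Context: A labelled transition system (LTS) is $(S,\mathit{Act},\to)$ with $\to\subseteq S\times\mathit{Act}\times S$; $I(s)=\{a\mid \exists s'.\,s\xrightarrow{a}s'\}$. A relation $R\subseteq S\times S$ is a simulation if for all $(s,t)\in R$ and $s\xrightarrow{a}s'$ there is $t\xrightarrow{a}t'$ with $(s',t')\in R$; a completed simulation if it is a simulation and for all $(s,t)\in R$, $I(s)=\emptyset$ iff $I(t)=\emptyset$; a ready simulation if it is a simulation with $I(s)=I(t)$ for all $(s,t)\in R$; a 2-nested simulation if it is a simulation and $R^{-1}\subseteq R'$ for some simulation $R'$; a bisimulation if it is a simulation and $R^{-1}=R$. The preorders $\sqsubseteq_s,\sqsubseteq_{cs},\sqsubseteq_{rs},\sqsubseteq_{2s}$ and $\sim$ relate $s,t$ iff some relation of the respective kind contains $(s,t)$; the equivalence corresponding to a preorder $\sqsubseteq$ relates $s,t$ iff $s\sqsubseteq t$ and $t\sqsubseteq s$. A pushdown automaton over finite action set $\mathit{Act}$, stack alphabet $\Gamma$, control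 states $Q$ is a finite set $\Delta$ of rules $pX\xrightarrow{a}q\alpha$ ($p,q\in Q$, $a\in\mathit{Act}$, $X\in\Gamma$, $\alpha\in\Gamma^*$), generating the LTS on configurations $p\alpha\in Q\times\Gamma^*$ (top of stack leftmost) with $pX\gamma\xrightarrow{a}q\alpha\gamma$ for each rule and each $\gamma\in\Gamma^*$. It is visibly pushdown (vPDA) if $\mathit{Act}$ is partitioned into call, return and internal actions $\mathit{Act}_c,\mathit{Act}_r,\mathit{Act}_i$ and each rule $pX\xrightarrow{a}q\alpha$ has $|\alpha|=2$ for $a\in\mathit{Act}_c$, $|\alpha|=0$ for $a\in\mathit{Act}_r$, $|\alpha|=1$ for $a\in\mathit{Act}_i$. A process $pX$ is a configuration with a single stack symbol. *)

theory Defs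
  imports "HOL-Computational_Algebra.Polynomial"
begin

section \<open>Labelled transition systems and behavioural relations\<close>

record ('s, 'a) lts =
  states :: "'s set"
  actions :: "'a set"
  trans :: "('s \<times> 'a \<times> 's) set"

definition is_lts :: "('s, 'a) lts \<Rightarrow> bool" where
  "is_lts L \<longleftrightarrow> trans L \<subseteq> states L \<times> actions L \<times> states L"

definition initials :: "('s, 'a) lts \<Rightarrow> 's \<Rightarrow> 'a set" where
  "initials L s = {a. \<exists>s'. (s, a, s') \<in> trans L}"

definition simulation :: "('s, 'a) lts \<Rightarrow> ('s \<times> 's) set \<Rightarrow> bool" where
  "simulation L R \<longleftrightarrow> R \<subseteq> states L \<times> states L \<and>
     (\<forall>(s, t) \<in> R. \<forall>a s'. (s, a, s') \<in> trans L \<longrightarrow>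
        (\<exists>t'. (t, a, t') \<in> trans L \<and> (s', t') \<in> R))"

definition completed_simulation :: "('s, 'a) lts \<Rightarrow> ('s \<times> 's) set \<Rightarrow> bool" where
  "completed_simulation L R \<longleftrightarrow> simulation L R \<and>
     (\<forall>(s, t) \<in> R. initials L s = {} \<longleftrightarrow> initials L t = {})"

definition ready_simulation :: "('s, 'a) lts \<Rightarrow> ('s \<times> 's) set \<Rightarrow> bool" where
  "ready_simulation L R \<longleftrightarrow> simulation L R \<and>
     (\<forall>(s, t) \<in> R. initials L s = initials L t)"

definition two_nested_simulation :: "('s, 'a) lts \<Rightarrow> ('s \<times> 's) set \<Rightarrow> bool" where
  "two_nested_simulation L R \<longleftrightarrow> simulation L R \<and>
     (\<exists>R'. simulation L R' \<and> R\<inverse> \<subseteq> R')"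

definition bisimulation :: "('s, 'a) lts \<Rightarrow> ('s \<times> 's) set \<Rightarrow> bool" where
  "bisimulation L R \<longleftrightarrow> simulation L R \<and> R\<inverse> = R"

definition sim_preorder :: "('s, 'a) lts \<Rightarrow> 's \<Rightarrow> 's \<Rightarrow> bool" where
  "sim_preorder L s t \<longleftrightarrow> (\<exists>R. simulation L R \<and> (s, t) \<in> R)"

definition completed_sim_preorder :: "('s, 'a) lts \<Rightarrow> 's \<Rightarrow> 's \<Rightarrow> bool" where
  "completed_sim_preorder L s t \<longleftrightarrow> (\<exists>R. completed_simulation L R \<and> (s, t) \<in> R)"

definition ready_sim_preorder :: "('s, 'a) lts \<Rightarrow> 's \<Rightarrow> 's \<Rightarrow> bool" where
  "ready_sim_preorder L s t \<longleftrightarrow> (\<exists>R. ready_simulation L R \<and> (s, t) \<in> R)"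

definition two_nested_sim_preorder :: "('s, 'a) lts \<Rightarrow> 's \<Rightarrow> 's \<Rightarrow> bool" where
  "two_nested_sim_preorder L s t \<longleftrightarrow> (\<exists>R. two_nested_simulation L R \<and> (s, t) \<in> R)"

definition bisimilar :: "('s, 'a) lts \<Rightarrow> 's \<Rightarrow> 's \<Rightarrow> bool" where
  "bisimilar L s t \<longleftrightarrow> (\<exists>R. bisimulation L R \<and> (s, t) \<in> R)"

definition kernel_equiv ::
    "(('s, 'a) lts \<Rightarrow> 's \<Rightarrow> 's \<Rightarrow> bool) \<Rightarrow> ('s, 'a) lts \<Rightarrow> 's \<Rightarrow> 's \<Rightarrow> bool" where
  "kernel_equiv P L s t \<longleftrightarrow> P L s t \<and> P L t s"


section \<open>Visibly pushdown automata\<close>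

text \<open>A tuple \<open>(p, X, a, q, \<alpha>)\<close> stands for the rule \<open>pX \<rightarrow>\<^sup>a q\<alpha>\<close>.\<close>

type_synonym ('q, 'g, 'a) rule = "'q \<times> 'g \<times> 'a \<times> 'q \<times> 'g list"

record ('q, 'g, 'a) pda =
  control :: "'q set"
  stack :: "'g set"
  acts :: "'a set"
  rules :: "('q, 'g, 'a) rule set"

definition is_pda :: "('q, 'g, 'a) pda \<Rightarrow> bool" where
  "is_pda P \<longleftrightarrow> finite (control P) \<and> finite (stack P) \<and> finite (acts P) \<and> finite (rules P) \<and>
     rules P \<subseteq> control P \<times> stack P \<times> acts P \<times> control P \<times> lists (stack P)"

definition is_vpda ::
    "('q, 'g, 'a) pda \<Rightarrow> 'a set \<Rightarrow> 'a set \<Rightarrow> 'a set \<Rightarrow> bool" where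
  "is_vpda P Ac Ar Ai \<longleftrightarrow> is_pda P \<and>
     acts P = Ac \<union> Ar \<union> Ai \<and> Ac \<inter> Ar = {} \<and> Ac \<inter> Ai = {} \<and> Ar \<inter> Ai = {} \<and>
     (\<forall>(p, X, a, q, \<alpha>) \<in> rules P.
        (a \<in> Ac \<longrightarrow> length \<alpha> = 2) \<and> (a \<in> Ar \<longrightarrow> length \<alpha> = 0) \<and> (a \<in> Ai \<longrightarrow> length \<alpha> = 1))"

definition pda_lts :: "('q, 'g, 'a) pda \<Rightarrow> ('q \<times> 'g list, 'a) lts" where
  "pda_lts P = \<lparr>
     states = control P \<times> lists (stack P),
     actions = acts P,
     trans = {((p, X # \<gamma>), a, (q, \<alpha> @ \<gamma>)) | p X a q \<alpha> \<gamma>.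
                (p, X, a, q, \<alpha>) \<in> rules P \<and> \<gamma> \<in> lists (stack P)} \<rparr>"

lemma is_lts_pda_lts: "is_pda P \<Longrightarrow> is_lts (pda_lts P)"
  unfolding is_lts_def is_pda_def pda_lts_def by fastforce


section \<open>Turing machines and exponential time\<close>

text \<open>
  Deterministic multi-tape machines with two-way infinite tapes. States and tape symbols are
  initial segments of the naturals; symbol \<open>0\<close> is the blank, and the bits \<open>False\<close>, \<open>True\<close> are
  written as the symbols \<open>1\<close>, \<open>2\<close>.
\<close>

datatype move = Left | Stay | Right

record tm =
  num_tapes :: nat
  num_states :: nat
  num_symbols :: nat
  start :: nat
  accept :: nat
  reject :: nat
  delta :: "nat \<Rightarrow> nat list \<Rightarrow> nat \<times> (nat \<times> move) list"

definition is_tm :: "tm \<Rightarrow> bool" where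
  "is_tm M \<longleftrightarrow> 1 \<le> num_tapes M \<and> 3 \<le> num_symbols M \<and>
     start M < num_states M \<and> accept M < num_states M \<and> reject M < num_states M \<and>
     accept M \<noteq> reject M \<and>
     (\<forall>q xs. q < num_states M \<and> length xs = num_tapes M \<and> set xs \<subseteq> {..<num_symbols M} \<longrightarrow>
        (case delta M q xs of (q', ys) \<Rightarrow>
           q' < num_states M \<and> length ys = num_tapes M \<and> fst ` set ys \<subseteq> {..<num_symbols M}))"

text \<open>A tape is its contents together with the head position.\<close>

type_synonym tape = "(int \<Rightarrow> nat) \<times> int"

fun offset :: "move \<Rightarrow> int" where
  "offset Left = -1"
| "offset Stay = 0"
| "offset Right = 1"

fun update_tape :: "nat \<times> move \<Rightarrow> tape \<Rightarrow> tape" where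
  "update_tape (x, d) (c, h) = (c(h := x), h + offset d)"

fun tm_step :: "tm \<Rightarrow> nat \<times> tape list \<Rightarrow> nat \<times> tape list" where
  "tm_step M (q, ts) =
     (if q = accept M \<or> q = reject M then (q, ts)
      else case delta M q (map (\<lambda>(c, h). c h) ts) of
        (q', ys) \<Rightarrow> (q', map2 update_tape ys ts))"

definition word_contents :: "bool list \<Rightarrow> int \<Rightarrow> nat" where
  "word_contents w i =
     (if 0 \<le> i \<and> i < int (length w) then (if w ! nat i then 2 else 1) else 0)"

definition tm_init :: "tm \<Rightarrow> bool list \<Rightarrow> nat \<times> tape list" where
  "tm_init M w = (start M, (word_contents w, 0) # replicate (num_tapes M - 1) (\<lambda>_. 0, 0))"

definition tm_run :: "tm \<Rightarrow> bool list \<Rightarrow> nat \<Rightarrow> nat \<times> tape list" where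
  "tm_run M w t = (tm_step M ^^ t) (tm_init M w)"

type_synonym language = "bool list set"

definition decidable :: "language \<Rightarrow> bool" where
  "decidable L \<longleftrightarrow> (\<exists>M. is_tm M \<and>
     (\<forall>w. \<exists>t. fst (tm_run M w t) = (if w \<in> L then accept M else reject M)))"

definition decides_in_time :: "tm \<Rightarrow> language \<Rightarrow> (nat \<Rightarrow> nat) \<Rightarrow> bool" where
  "decides_in_time M L T \<longleftrightarrow> is_tm M \<and>
     (\<forall>w. \<exists>t \<le> T (length w). fst (tm_run M w t) = (if w \<in> L then accept M else reject M))"

text \<open>The result of a function computation is what the last tape holds on acceptance.\<close>

definition computes_in_time :: "tm \<Rightarrow> (bool list \<Rightarrow> bool list) \<Rightarrow> (nat \<Rightarrow> nat) \<Rightarrow> bool" where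
  "computes_in_time M f T \<longleftrightarrow> is_tm M \<and>
     (\<forall>w. \<exists>t \<le> T (length w). fst (tm_run M w t) = accept M \<and>
        fst (last (snd (tm_run M w t))) = word_contents (f w))"

definition EXPTIME :: "language set" where
  "EXPTIME = {L. \<exists>M (p :: nat poly). decides_in_time M L (\<lambda>n. 2 ^ poly p n)}"

definition poly_time_reducible :: "language \<Rightarrow> language \<Rightarrow> bool" where
  "poly_time_reducible L L' \<longleftrightarrow> (\<exists>f M (p :: nat poly).
     computes_in_time M f (poly p) \<and> (\<forall>w. w \<in> L \<longleftrightarrow> f w \<in> L'))"

definition EXPTIME_hard :: "language \<Rightarrow> bool" where
  "EXPTIME_hard L \<longleftrightarrow> (\<forall>L' \<in> EXPTIME. poly_time_reducible L' L)"

definition EXPTIME_complete :: "language \<Rightarrow> bool" where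
  "EXPTIME_complete L \<longleftrightarrow> L \<in> EXPTIME \<and> EXPTIME_hard L"


section \<open>Instances as binary words\<close>

text \<open>
  Control states, stack symbols and actions are named by naturals written in binary (least
  significant bit first). All codes are self-delimiting: each digit or list entry is preceded
  by \<open>True\<close>, and \<open>False\<close> marks the end.
\<close>

fun bin_digits :: "nat \<Rightarrow> bool list" where
  "bin_digits n = (if n = 0 then [] else odd n # bin_digits (n div 2))"

declare bin_digits.simps [simp del]

definition enc_list :: "('a \<Rightarrow> bool list) \<Rightarrow> 'a list \<Rightarrow> bool list" where
  "enc_list e xs = concat (map (\<lambda>x. True # e x) xs) @ [False]"

definition enc_nat :: "nat \<Rightarrow> bool list" where
  "enc_nat n = enc_list (\<lambda>b. [b]) (bin_digits n)"

fun enc_rule :: "(nat, nat, nat) rule \<Rightarrow> bool list" where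
  "enc_rule (p, X, a, q, \<alpha>) =
     enc_nat p @ enc_nat X @ enc_nat a @ enc_nat q @ enc_list enc_nat \<alpha>"

record vpda_instance =
  i_control :: "nat list"
  i_stack :: "nat list"
  i_call :: "nat list"
  i_return :: "nat list"
  i_internal :: "nat list"
  i_rules :: "(nat, nat, nat) rule list"
  i_proc1 :: "nat \<times> nat"
  i_proc2 :: "nat \<times> nat"

definition instance_pda :: "vpda_instance \<Rightarrow> (nat, nat, nat) pda" where
  "instance_pda I = \<lparr>
     control = set (i_control I),
     stack = set (i_stack I),
     acts = set (i_call I) \<union> set (i_return I) \<union> set (i_internal I),
     rules = set (i_rules I) \<rparr>"

definition valid_instance :: "vpda_instance \<Rightarrow> bool" where
  "valid_instance I \<longleftrightarrow>
     is_vpda (instance_pda I) (set (i_call I)) (set (i_return I)) (set (i_internal I)) \<and>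
     i_proc1 I \<in> set (i_control I) \<times> set (i_stack I) \<and>
     i_proc2 I \<in> set (i_control I) \<times> set (i_stack I)"

definition enc_instance :: "vpda_instance \<Rightarrow> bool list" where
  "enc_instance I =
     enc_list enc_nat (i_control I) @ enc_list enc_nat (i_stack I) @
     enc_list enc_nat (i_call I) @ enc_list enc_nat (i_return I) @
     enc_list enc_nat (i_internal I) @ enc_list enc_rule (i_rules I) @
     enc_nat (fst (i_proc1 I)) @ enc_nat (snd (i_proc1 I)) @
     enc_nat (fst (i_proc2 I)) @ enc_nat (snd (i_proc2 I))"

lemma enc_list_append_inject:
  assumes "\<And>x y u v. e x @ u = e y @ v \<longleftrightarrow> x = y \<and> u = v"
  shows "enc_list e xs @ u = enc_list e ys @ v \<longleftrightarrow> xs = ys \<and> u = v"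
proof (induction xs arbitrary: ys)
  case Nil
  show ?case by (cases ys) (auto simp: enc_list_def)
next
  case (Cons x xs)
  have *: "enc_list e (z # zs) @ w = True # e z @ enc_list e zs @ w" for z zs w
    by (simp add: enc_list_def)
  show ?case
  proof (cases ys)
    case Nil
    then show ?thesis by (simp add: enc_list_def)
  next
    case (Cons y ys')
    then show ?thesis by (simp only: * list.inject assms Cons.IH) auto
  qed
qed

lemma bin_digits_inject: "bin_digits m = bin_digits n \<longleftrightarrow> m = n"
proof (induction m arbitrary: n rule: less_induct)
  case (less m)
  show ?case
  proof (cases "m = 0 \<or> n = 0")
    case True
    then show ?thesis by (subst (1 2) bin_digits.simps) auto
  next
    case False
    then have "bin_digits m = bin_digits n \<longleftrightarrow> (odd m = odd n \<and> m div 2 = n div 2)"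
      using less.IH[of "m div 2" "n div 2"] by (subst (1 2) bin_digits.simps) auto
    also have "\<dots> \<longleftrightarrow> m = n" by presburger
    finally show ?thesis .
  qed
qed

lemma enc_nat_append_inject: "enc_nat m @ u = enc_nat n @ v \<longleftrightarrow> m = n \<and> u = v"
  unfolding enc_nat_def by (subst enc_list_append_inject) (auto simp: bin_digits_inject)

lemma enc_rule_append_inject: "enc_rule r @ u = enc_rule r' @ v \<longleftrightarrow> r = r' \<and> u = v"
  by (cases r; cases r')
    (auto simp: enc_nat_append_inject enc_list_append_inject[OF enc_nat_append_inject])

lemma inj_enc_instance: "inj enc_instance"
proof (rule injI)
  fix I J
  assume "enc_instance I = enc_instance J"
  then have "enc_instance I @ [] = enc_instance J @ []" by simp
  then show "I = J"
    unfolding enc_instance_def append_assoc enc_nat_append_inject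
      enc_list_append_inject[OF enc_nat_append_inject]
      enc_list_append_inject[OF enc_rule_append_inject]
    by (auto intro: vpda_instance.equality prod_eqI)
qed

definition vpda_problem ::
    "((nat \<times> nat list, nat) lts \<Rightarrow> nat \<times> nat list \<Rightarrow> nat \<times> nat list \<Rightarrow> bool) \<Rightarrow> language" where
  "vpda_problem rel = {enc_instance I | I p X q Y.
     valid_instance I \<and> i_proc1 I = (p, X) \<and> i_proc2 I = (q, Y) \<and>
     rel (pda_lts (instance_pda I)) (p, [X]) (q, [Y])}"

end

theory Submission
  imports Defs "HOL-Library.Nat_Bijection"
begin

text \<open>
  Upper bound: in a visibly pushdown automaton two related configurations always push and pop
  together, so a play between them is a game on one stack of symbol pairs. Which exits from a pair
  of heads the defender can confine the play to is a greatest fixpoint over exponentially many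
  summaries, computed by iteration.

  Lower bound: for each machine deciding in exponential time there are polynomial-time computable
  automata whose two processes are bisimilar if the machine accepts and not even in simulation
  preorder otherwise, which covers all nine relations at once. The play is a debate about the
  run: the defender claims the state, or the content of a cell relative to the head, at some time,
  and justifies the claim by what was scanned one step earlier, part of which the attacker may
  question. Times and displacements are binary counters whose bits are logged on the stack; a bit
  read wrongly is refuted by popping the log down to its last assignment.
\<close>

section \<open>Structured stack programs on Turing machines\<close>

text \<open>Both bounds need concrete machines, so much of the work goes into a class
  \<open>pt\<close> of functions closed under composition, branching and size-bounded iteration,
  each with a program and a time bound. Exponential time enters this class by padding: the procedure
  is a polynomial-time one that also receives a number \<open>2 ^ p\<close> in unary. The obstacle
  to the lower bound is that a stack is read only by destroying it, so a counter kept there cannot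
  be inspected and then used. Reading is replaced by announcing: play goes on with the announced
  bit, and only a challenge, which ends the play, touches the log. Polynomially many bits suffice
  because no configuration is ever stored: what a cell holds follows from the scanned symbols one
  step earlier and from at most one cell at that time. One reduction serves all relations because
  the two outcomes are proved in opposite extremes. The winning attacker needs moves on one side
  only, which already refutes simulation; the winning defender survives changes of side, which gives
  bisimilarity. Choices of the defender are expressed by defender's forcing: every move of the
  attacker other than the intended one can be answered so that the two sides become equal.\<close>

datatype com =
    Push nat nat
  | Pop nat
  | If nat nat "com list" "com list"
  | While nat nat "com list"

type_synonym store = "nat \<Rightarrow> nat list"

text \<open>Stack symbols are nonzero, so \<open>0\<close> signals the empty stack.\<close>

definition top_of :: "nat list \<Rightarrow> nat" where
  "top_of s = (case s of [] \<Rightarrow> 0 | x # _ \<Rightarrow> x)"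

lemma top_of_simps [simp]: "top_of [] = 0" "top_of (x # s) = x"
  by (simp_all add: top_of_def)

text \<open>The symbol given to \<open>While\<close> is an exit condition: the loops below run down
  to a marker, to the end of a value or to the empty stack.\<close>

fun step :: "com list \<times> store \<Rightarrow> com list \<times> store" where
  "step ([], s) = ([], s)"
| "step (Push i c # k, s) = (k, s(i := c # s i))"
| "step (Pop i # k, s) = (k, s(i := tl (s i)))"
| "step (If i c A B # k, s) = ((if top_of (s i) = c then A else B) @ k, s)"
| "step (While i c A # k, s) = (if top_of (s i) = c then k else A @ While i c A # k, s)"

text \<open>Quantifying over the continuation \<open>k\<close> makes fragments composable without
  side conditions. \<open>t\<close> is only an upper bound, so that step counts can be rounded
  up.\<close>

definition runs :: "com list \<Rightarrow> store \<Rightarrow> nat \<Rightarrow> store \<Rightarrow> bool" where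
  "runs A s t s' \<longleftrightarrow> (\<exists>u\<le>t. \<forall>k. (step ^^ u) (A @ k, s) = (k, s'))"

lemma runs_mono: "runs A s t s' \<Longrightarrow> t \<le> t' \<Longrightarrow> runs A s t' s'"
  unfolding runs_def by (meson order_trans)

lemma runs_Nil [simp]: "runs [] s t s"
  unfolding runs_def by (intro exI[of _ 0]) simp

lemma runs_append:
  assumes "runs A s t s'" "runs B s' u s''"
  shows "runs (A @ B) s (t + u) s''"
proof -
  obtain a b where "a \<le> t" "b \<le> u" and a: "\<And>k. (step ^^ a) (A @ k, s) = (k, s')"
    and b: "\<And>k. (step ^^ b) (B @ k, s') = (k, s'')"
    using assms unfolding runs_def by blast
  moreover have "(step ^^ (b + a)) ((A @ B) @ k, s) = (k, s'')" for k
    by (simp add: funpow_add a b)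
  ultimately show ?thesis unfolding runs_def by (intro exI[of _ "b + a"]) auto
qed

lemma runs_one:
  assumes "\<And>k. step (a # k, s) = (B @ k, s')" "runs (B @ C) s' t s''"
  shows "runs (a # C) s (Suc t) s''"
proof -
  obtain u where "u \<le> t" and u: "\<And>k. (step ^^ u) ((B @ C) @ k, s') = (k, s'')"
    using assms unfolding runs_def by blast
  have "(step ^^ Suc u) ((a # C) @ k, s) = (k, s'')" for k
    using u[of k] by (simp add: funpow_Suc_right assms(1) del: funpow.simps)
  with \<open>u \<le> t\<close> show ?thesis unfolding runs_def by (intro exI[of _ "Suc u"]) auto
qed

lemma runs_Push: "runs C (s(i := c # s i)) t s' \<Longrightarrow> runs (Push i c # C) s (Suc t) s'"
  by (rule runs_one[where B = "[]"]) auto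

lemma runs_Pop: "runs C (s(i := tl (s i))) t s' \<Longrightarrow> runs (Pop i # C) s (Suc t) s'"
  by (rule runs_one[where B = "[]"]) auto

lemma runs_If_eq: "top_of (s i) = c \<Longrightarrow> runs (A @ C) s t s' \<Longrightarrow> runs (If i c A B # C) s (Suc t) s'"
  by (rule runs_one[where B = A]) auto

lemma runs_If_neq: "top_of (s i) \<noteq> c \<Longrightarrow> runs (B @ C) s t s' \<Longrightarrow> runs (If i c A B # C) s (Suc t) s'"
  by (rule runs_one[where B = B]) auto

lemma runs_While_end: "top_of (s i) = c \<Longrightarrow> runs C s t s' \<Longrightarrow> runs (While i c A # C) s (Suc t) s'"
  by (rule runs_one[where B = "[]"]) auto

lemma runs_While_iter:
  "top_of (s i) \<noteq> c \<Longrightarrow> runs (A @ While i c A # C) s t s' \<Longrightarrow> runs (While i c A # C) s (Suc t) s'"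
  by (rule runs_one[where B = "A @ [While i c A]"]) auto

text \<open>Tape \<open>0\<close> holds the input and tape \<open>5\<close> the output, which has to
  be the last tape because \<open>computes_in_time\<close> reads the result there. The symbols are
  the blank, two letters and the marker \<open>3\<close>.\<close>

definition ntapes :: nat where "ntapes = 6"
definition nsyms :: nat where "nsyms = 4"

fun wf_com :: "com \<Rightarrow> bool" where
  "wf_com (Push i c) \<longleftrightarrow> i < ntapes \<and> 0 < c \<and> c < nsyms"
| "wf_com (Pop i) \<longleftrightarrow> i < ntapes"
| "wf_com (If i c A B) \<longleftrightarrow> i < ntapes \<and> (\<forall>a\<in>set A. wf_com a) \<and> (\<forall>a\<in>set B. wf_com a)"
| "wf_com (While i c A) \<longleftrightarrow> i < ntapes \<and> (\<forall>a\<in>set A. wf_com a)"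

abbreviation wf_prog :: "com list \<Rightarrow> bool" where
  "wf_prog A \<equiv> \<forall>a\<in>set A. wf_com a"

text \<open>The reachable continuations serve as machine states.\<close>

function conts :: "com list \<Rightarrow> com list \<Rightarrow> com list set" where
  "conts [] k = {k}"
| "conts (Push i c # A) k = insert (Push i c # A @ k) (conts A k)"
| "conts (Pop i # A) k = insert (Pop i # A @ k) (conts A k)"
| "conts (If i c B1 B2 # A) k =
     insert (If i c B1 B2 # A @ k) (conts B1 (A @ k) \<union> conts B2 (A @ k) \<union> conts A k)"
| "conts (While i c B # A) k =
     insert (While i c B # A @ k) (conts B (While i c B # A @ k) \<union> conts A k)"
  by pat_completeness auto
termination by (relation "measure (\<lambda>(A, k). size_list size A)") auto

lemma finite_conts: "finite (conts A k)"
  by (induction A k rule: conts.induct) auto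

lemma start_in_conts: "A @ k \<in> conts A k"
  by (induction A k rule: conts.induct) auto

lemma end_in_conts: "k \<in> conts A k"
  by (induction A k rule: conts.induct) auto

text \<open>The exception \<open>l = k\<close> carries the induction. For the body of a loop,
  \<open>k\<close> is the loop itself, and for a branch it is the rest of the program; what happens
  from there is supplied by the enclosing level.\<close>

lemma conts_closed:
  "l \<in> conts A k \<Longrightarrow> l = k \<or> fst (step (l, s)) \<in> conts A k"
proof (induction A k arbitrary: l rule: conts.induct)
  case (4 i c B1 B2 A k)
  have "l = If i c B1 B2 # A @ k \<or> l \<in> conts B1 (A @ k) \<or> l \<in> conts B2 (A @ k) \<or> l \<in> conts A k"
    using "4.prems" by auto
  then have "l = k \<or> fst (step (l, s)) \<in> conts B1 (A @ k) \<union> conts B2 (A @ k) \<union> conts A k"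
    using "4.IH"[of l] start_in_conts[of A k] start_in_conts[of B1 "A @ k"] start_in_conts[of B2 "A @ k"]
      "4.IH"(3)[of "A @ k"] by (elim disjE) auto
  then show ?case by auto
next
  case (5 i c B A k)
  let ?W = "While i c B # A @ k"
  have W: "fst (step (?W, s)) \<in> conts B ?W \<union> conts A k"
    using start_in_conts[of A k] start_in_conts[of B ?W] by auto
  have "l = ?W \<or> l \<in> conts B ?W \<or> l \<in> conts A k"
    using "5.prems" by auto
  then have "l = k \<or> fst (step (l, s)) \<in> conts B ?W \<union> conts A k"
    using "5.IH"[of l] W by blast
  then show ?case by auto
next
  case (2 i c A k)
  then show ?case using start_in_conts[of A k] by auto
next
  case (3 i A k)
  then show ?case using start_in_conts[of A k] by auto
qed auto

lemma wf_conts: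
  assumes "wf_prog A" "wf_prog k" "l \<in> conts A k"
  shows "wf_prog l"
  using assms
proof (induction A k rule: conts.induct)
  case (4 i c B1 B2 A k)
  have w: "wf_prog B1" "wf_prog B2" "wf_prog A" "wf_prog (A @ k)" using "4.prems"(1,2) by auto
  have "l = If i c B1 B2 # A @ k \<or> l \<in> conts B1 (A @ k) \<or> l \<in> conts B2 (A @ k) \<or> l \<in> conts A k"
    using "4.prems"(3) by auto
  then show ?case
    using "4.IH"(1)[OF w(1,4)] "4.IH"(2)[OF w(2,4)] "4.IH"(3)[OF w(3) "4.prems"(2)] "4.prems"(1,2)
    by (elim disjE) auto
next
  case (5 i c B A k)
  let ?W = "While i c B # A @ k"
  have w: "wf_prog B" "wf_prog A" "wf_prog ?W" using "5.prems"(1,2) by auto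
  have "l = ?W \<or> l \<in> conts B ?W \<or> l \<in> conts A k" using "5.prems"(3) by auto
  then show ?case
    using "5.IH"(1)[OF w(1,3)] "5.IH"(2)[OF w(2) "5.prems"(2)] w(3) by (elim disjE) auto
qed auto

lemma step_in_conts: "l \<in> conts A [] \<Longrightarrow> fst (step (l, s)) \<in> conts A []"
  using conts_closed[of l A "[]" s] by auto

subsection \<open>Simulation by a multi-tape machine\<close>

text \<open>\<open>Put\<close> is the second half of a push: the head has already moved to the fresh cell.
  \<open>Scan\<close> brings the head of the input tape to the right end of the input, which turns the tape
  into a stack.\<close>

datatype ctl = Scan | Run "com list" | Put nat nat "com list" | Acc | Rej

definition idle :: "nat list \<Rightarrow> (nat \<times> move) list" where
  "idle xs = map (\<lambda>x. (x, Stay)) xs"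

text \<open>A finished program accepts iff tape \<open>1\<close> starts with \<open>2\<close>, which
  is how a true Boolean is coded. When the scan ends all heads move left, not just the first,
  because the head of an empty stack belongs on cell \<open>-1\<close>. A pop blanks the cell it
  leaves, and on the empty stack it must not move.\<close>

fun ctl_delta :: "com list \<Rightarrow> ctl \<Rightarrow> nat list \<Rightarrow> ctl \<times> (nat \<times> move) list" where
  "ctl_delta P Scan xs =
     (if xs ! 0 = 0 then (Run P, map (\<lambda>x. (x, Left)) xs)
      else (Scan, (idle xs)[0 := (xs ! 0, Right)]))"
| "ctl_delta P (Run []) xs = (if xs ! 1 = 2 then Acc else Rej, idle xs)"
| "ctl_delta P (Run (Push i c # k)) xs = (Put i c k, (idle xs)[i := (xs ! i, Right)])"
| "ctl_delta P (Run (Pop i # k)) xs =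
     (Run k, if xs ! i = 0 then idle xs else (idle xs)[i := (0, Left)])"
| "ctl_delta P (Run (If i c A B # k)) xs = (Run ((if xs ! i = c then A else B) @ k), idle xs)"
| "ctl_delta P (Run (While i c A # k)) xs =
     (Run (if xs ! i = c then k else A @ While i c A # k), idle xs)"
| "ctl_delta P (Put i c k) xs = (Run k, (idle xs)[i := (c, Stay)])"
| "ctl_delta P Acc xs = (Acc, idle xs)"
| "ctl_delta P Rej xs = (Rej, idle xs)"

definition ctls :: "com list \<Rightarrow> ctl set" where
  "ctls P = {Scan, Acc, Rej} \<union> Run ` conts P [] \<union>
     (\<lambda>(i, c, k). Put i c k) ` ({..<ntapes} \<times> {..<nsyms} \<times> conts P [])"

lemma Put_in_ctls: "i < ntapes \<Longrightarrow> c < nsyms \<Longrightarrow> k \<in> conts P [] \<Longrightarrow> Put i c k \<in> ctls P"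
  unfolding ctls_def by (rule UnI2) force

lemma special_ctls: "Scan \<in> ctls P" "Acc \<in> ctls P" "Rej \<in> ctls P" "k \<in> conts P [] \<Longrightarrow> Run k \<in> ctls P"
  by (auto simp: ctls_def)

lemma finite_ctls: "finite (ctls P)"
  unfolding ctls_def by (auto simp: finite_conts)

lemma ctl_delta_closed:
  assumes "wf_prog P" "z \<in> ctls P" "length xs = ntapes" "set xs \<subseteq> {..<nsyms}"
    "ctl_delta P z xs = (z', ys)"
  shows "z' \<in> ctls P \<and> length ys = ntapes \<and> fst ` set ys \<subseteq> {..<nsyms}"
proof -
  have idle: "length (idle xs) = ntapes" "fst ` set (idle xs) \<subseteq> {..<nsyms}"
    using assms(3,4) by (auto simp: idle_def image_image)
  have upd: "fst ` set ((idle xs)[i := p]) \<subseteq> {..<nsyms}" if "fst p < nsyms" for i p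
    using set_update_subset_insert[of "idle xs" i p] idle that by auto
  have nth: "xs ! i < nsyms" if "i < ntapes" for i
    using assms(3,4) that by (metis lessThan_iff nth_mem subsetD)
  have pos: "0 < ntapes" "1 < ntapes" "0 < nsyms" by (auto simp: ntapes_def nsyms_def)
  have P: "P \<in> conts P []" using start_in_conts[of P "[]"] by simp
  show ?thesis
  proof (cases z)
    case Scan
    have m: "length (map (\<lambda>x. (x, Left)) xs) = ntapes" "fst ` set (map (\<lambda>x. (x, Left)) xs) \<subseteq> {..<nsyms}"
      using assms(3,4) by (auto simp: image_image)
    show ?thesis
    proof (cases "xs ! 0 = 0")
      case True
      then show ?thesis using Scan assms(5) P m special_ctls(4)[of P P] by (auto simp del: map_eq_conv set_map)
    next
      case False
      then show ?thesis using Scan assms(5) idle(1) upd[of "(xs ! 0, Right)" 0] nth[OF pos(1)] special_ctls(1)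
        by auto
    qed
  next
    case (Run k)
    then have 4: "z = Run k" "k \<in> conts P []" using assms(2) by (auto simp: ctls_def)
    have wf: "wf_prog k" using wf_conts[OF assms(1) _ 4(2)] by simp
    have st: "fst (step (k, s)) \<in> conts P []" for s using step_in_conts 4(2) by blast
    show ?thesis
    proof (cases k)
      case Nil
      then show ?thesis using 4 assms idle by (auto simp: ctls_def)
    next
      case (Cons a k')
      show ?thesis
      proof (cases a)
        case (Push i c)
        then have "k' \<in> conts P []" using st[of "\<lambda>_. []"] Cons by simp
        moreover have "i < ntapes" "c < nsyms" using wf Cons Push by auto
        ultimately show ?thesis using 4(1) assms(5) Cons idle(1) upd[of "(xs ! i, Right)" i] nth[of i] Push
          by (auto intro: Put_in_ctls)
      next
        case (Pop i)
        then have "k' \<in> conts P []" using st[of "\<lambda>_. []"] Cons by simp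
        then show ?thesis using 4(1) assms(5) Cons idle upd[of "(0, Left)" i] pos Pop
          by (cases "xs ! i = 0") (auto intro: special_ctls)
      next
        case (If i c A B)
        then show ?thesis using 4 assms(5) Cons idle st[of "\<lambda>_. [c]"] st[of "\<lambda>_. [Suc c]"]
          by (auto simp: ctls_def)
      next
        case (While i c A)
        then show ?thesis using 4 assms(5) Cons idle st[of "\<lambda>_. [c]"] st[of "\<lambda>_. [Suc c]"]
          by (auto simp: ctls_def)
      qed
    qed
  next
    case (Put i c k)
    then have "k \<in> conts P []" "c < nsyms" using assms(2) by (auto simp: ctls_def)
    then show ?thesis using Put assms(5) idle(1) upd[of "(c, Stay)" i] by (auto intro: special_ctls)
  qed (use assms idle in \<open>auto simp: ctls_def\<close>)
qed

definition contents :: "nat list \<Rightarrow> int \<Rightarrow> nat" where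
  "contents s z = (if 0 \<le> z \<and> z < int (length s) then rev s ! nat z else 0)"

text \<open>The bottom of the stack is cell \<open>0\<close>. The head of an empty stack stands on
  the blank cell \<open>-1\<close>, so that reading gives \<open>0\<close>, in agreement with
  \<open>top_of\<close>.\<close>

definition mk_tape :: "nat list \<Rightarrow> tape" where
  "mk_tape s = (contents s, int (length s) - 1)"

lemma contents_head: "contents s (int (length s) - 1) = top_of s"
  by (cases s) (auto simp: contents_def nth_append)

lemma contents_Cons: "contents (x # s) = (contents s)(int (length s) := x)"
  by (rule ext) (auto simp: contents_def nth_append)

lemma contents_tl: "s \<noteq> [] \<Longrightarrow> contents (tl s) = (contents s)(int (length s) - 1 := 0)"
  by (cases s) (auto simp: contents_def nth_append fun_eq_iff)

lemma mk_tape_bits: "(word_contents w, int (length w) - 1) = mk_tape (rev (map (\<lambda>b. if b then 2 else 1) w))"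
  by (auto simp: mk_tape_def contents_def word_contents_def fun_eq_iff)

definition tapes :: "store \<Rightarrow> tape list" where
  "tapes s = map (\<lambda>i. mk_tape (s i)) [0..<ntapes]"

lemma length_tapes [simp]: "length (tapes s) = ntapes"
  by (simp add: tapes_def)

lemma nth_tapes [simp]: "i < ntapes \<Longrightarrow> tapes s ! i = mk_tape (s i)"
  by (simp add: tapes_def)

lemma tapes_update: "i < ntapes \<Longrightarrow> tapes (s(i := x)) = (tapes s)[i := mk_tape x]"
  by (intro nth_equalityI) (auto simp: nth_list_update)

text \<open>A symbol \<open>0\<close> inside a stack would make the machine take the stack for empty
  when popping.\<close>

definition good_store :: "store \<Rightarrow> bool" where
  "good_store s \<longleftrightarrow> (\<forall>i. set (s i) \<subseteq> {1..<nsyms})"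

lemma good_store_update: "good_store s \<Longrightarrow> set x \<subseteq> {1..<nsyms} \<Longrightarrow> good_store (s(i := x))"
  by (auto simp: good_store_def)

lemma good_store_step: "good_store s \<Longrightarrow> wf_prog k \<Longrightarrow> good_store (snd (step (k, s)))"
proof (cases k)
  case (Cons a k')
  assume "good_store s" "wf_prog k"
  moreover have "set (tl xs) \<subseteq> set xs" for xs :: "nat list" by (cases xs) auto
  then have "set (tl (s i)) \<subseteq> {1..<nsyms}" for i
    using \<open>good_store s\<close> unfolding good_store_def by blast
  moreover have "set (s i) \<subseteq> {1..<nsyms}" for i using \<open>good_store s\<close> unfolding good_store_def by blast
  ultimately show ?thesis using Cons
    by (cases a) (auto intro!: good_store_update del: subsetI)
qed auto

definition reads :: "tape list \<Rightarrow> nat list" where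
  "reads ts = map (\<lambda>(c, h). c h) ts"

lemma length_reads [simp]: "length (reads ts) = length ts" by (simp add: reads_def)

lemma nth_reads_tapes: "i < ntapes \<Longrightarrow> reads (tapes s) ! i = top_of (s i)"
  by (simp add: reads_def mk_tape_def contents_head)

lemma map2_idle: "length ts = length xs \<Longrightarrow> xs = reads ts \<Longrightarrow> map2 update_tape (idle xs) ts = ts"
  by (rule nth_equalityI) (auto simp: idle_def reads_def split: prod.splits)

lemma map2_idle_upd:
  "i < length ts \<Longrightarrow> map2 update_tape ((idle (reads ts))[i := p]) ts = ts[i := update_tape p (ts ! i)]"
proof (rule nth_equalityI)
  fix j assume "i < length ts" "j < length (map2 update_tape ((idle (reads ts))[i := p]) ts)"
  then show "map2 update_tape ((idle (reads ts))[i := p]) ts ! j = ts[i := update_tape p (ts ! i)] ! j"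
    by (cases "ts ! j") (auto simp: nth_list_update idle_def reads_def)
qed (simp add: idle_def)

definition code :: "com list \<Rightarrow> ctl \<Rightarrow> nat" where
  "code P = (SOME f. bij_betw f (ctls P) {..<card (ctls P)})"

lemma bij_code: "bij_betw (code P) (ctls P) {..<card (ctls P)}"
proof -
  have "\<exists>f. bij_betw f (ctls P) {..<card (ctls P)}"
    using ex_bij_betw_finite_nat[OF finite_ctls] by (metis atLeast0LessThan)
  then show ?thesis unfolding code_def by (rule someI_ex)
qed

definition decode :: "com list \<Rightarrow> nat \<Rightarrow> ctl" where
  "decode P = inv_into (ctls P) (code P)"

lemma decode_code: "z \<in> ctls P \<Longrightarrow> decode P (code P z) = z"
  unfolding decode_def using bij_code by (metis bij_betw_def inv_into_f_f)

lemma code_less: "z \<in> ctls P \<Longrightarrow> code P z < card (ctls P)"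
  using bij_code by (metis bij_betwE lessThan_iff)

lemma decode_in: "q < card (ctls P) \<Longrightarrow> decode P q \<in> ctls P"
  unfolding decode_def using bij_code
  by (metis bij_betw_imp_surj_on inv_into_into lessThan_iff)

lemma code_inj: "z \<in> ctls P \<Longrightarrow> z' \<in> ctls P \<Longrightarrow> code P z = code P z' \<longleftrightarrow> z = z'"
  by (metis decode_code)

definition prog_tm :: "com list \<Rightarrow> tm" where
  "prog_tm P = \<lparr>num_tapes = ntapes, num_states = card (ctls P), num_symbols = nsyms,
     start = code P Scan, accept = code P Acc, reject = code P Rej,
     delta = (\<lambda>q xs. case ctl_delta P (decode P q) xs of (z, ys) \<Rightarrow> (code P z, ys))\<rparr>"

lemma is_tm_prog_tm:
  assumes "wf_prog P"
  shows "is_tm (prog_tm P)"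
proof -
  have "case delta (prog_tm P) q xs of (q', ys) \<Rightarrow>
           q' < num_states (prog_tm P) \<and> length ys = num_tapes (prog_tm P) \<and>
           fst ` set ys \<subseteq> {..<num_symbols (prog_tm P)}"
    if "q < card (ctls P)" "length xs = ntapes" "set xs \<subseteq> {..<nsyms}" for q xs
    using ctl_delta_closed[OF assms decode_in[OF that(1)] that(2,3)]
    by (auto simp: prog_tm_def code_less split: prod.splits)
  then show ?thesis unfolding is_tm_def
    by (auto simp: prog_tm_def special_ctls code_less code_inj ntapes_def nsyms_def)
qed

lemma tm_step_prog:
  assumes "z \<in> ctls P" "z \<noteq> Acc" "z \<noteq> Rej" "ctl_delta P z (reads ts) = (z', ys)"
  shows "tm_step (prog_tm P) (code P z, ts) = (code P z', map2 update_tape ys ts)"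
proof -
  have "code P z \<noteq> code P Acc" "code P z \<noteq> code P Rej"
    using assms special_ctls[of P] code_inj[of z P] by blast+
  moreover have "decode P (code P z) = z" using assms(1) by (rule decode_code)
  ultimately show ?thesis using assms(4) by (simp add: prog_tm_def reads_def)
qed

declare tm_step.simps [simp del]

lemma tm_step_Run:
  assumes "k \<in> conts P []"
  shows "tm_step (prog_tm P) (code P (Run k), ts) =
    (code P (fst (ctl_delta P (Run k) (reads ts))), map2 update_tape (snd (ctl_delta P (Run k) (reads ts))) ts)"
  by (rule tm_step_prog) (use assms special_ctls in auto)

text \<open>Only a push takes two machine steps, one to move to the fresh cell and one to write
  there.\<close>

lemma tm_simulates_step:
  assumes P: "wf_prog P" and k: "k \<in> conts P []" "k \<noteq> []" and g: "good_store s"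
    and st: "step (k, s) = (k', s')"
  shows "\<exists>j\<le>2. (tm_step (prog_tm P) ^^ j) (code P (Run k), tapes s) = (code P (Run k'), tapes s')"
proof -
  have wf: "wf_prog k" using wf_conts[OF P _ k(1)] by simp
  have c: "Run k \<in> ctls P" using k special_ctls by blast
  have idle: "map2 update_tape (idle (reads (tapes s))) (tapes s) = tapes s"
    by (rule map2_idle) auto
  obtain a l where kl: "k = a # l" using k(2) by (cases k) auto
  show ?thesis
  proof (cases a)
    case (Push i c)
    have i: "i < ntapes" "c < nsyms" using wf kl Push by auto
    let ?ts = "(tapes s)[i := (contents (s i), int (length (s i)))]"
    have l: "l \<in> conts P []" using step_in_conts[OF k(1), of s] kl Push by simp
    have p: "Put i c l \<in> ctls P" using i l by (rule Put_in_ctls)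
    have 1: "tm_step (prog_tm P) (code P (Run k), tapes s) = (code P (Put i c l), ?ts)"
      using tm_step_prog[OF c, of "tapes s"] kl Push i
      by (simp add: map2_idle_upd nth_reads_tapes)
        (simp add: mk_tape_def contents_head[symmetric])
    have 2: "tm_step (prog_tm P) (code P (Put i c l), ?ts) = (code P (Run l), ?ts[i := mk_tape (c # s i)])"
      using tm_step_prog[OF p, of "?ts"] i
      by (simp add: map2_idle_upd mk_tape_def contents_Cons)
    have "?ts[i := mk_tape (c # s i)] = tapes s'" using st kl Push i by (auto simp: tapes_update)
    with 1 2 st kl Push show ?thesis
      by (intro exI[of _ 2]) (simp add: numeral_2_eq_2)
  next
    case (Pop i)
    have i: "i < ntapes" using wf kl Pop by auto
    have s': "s' = s(i := tl (s i))" "k' = l" using st kl Pop by auto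
    have "tm_step (prog_tm P) (code P (Run k), tapes s) = (code P (Run l), tapes s')"
    proof (cases "s i = []")
      case True
      then have "s' = s" using s' by auto
      then show ?thesis using tm_step_prog[OF c, of "tapes s"] kl Pop i True idle
        by (simp add: nth_reads_tapes)
    next
      case False
      then have "top_of (s i) \<noteq> 0" using g unfolding good_store_def
        by (cases "s i") (auto dest: spec[of _ i])
      moreover have "mk_tape (tl (s i)) = update_tape (0, Left) (mk_tape (s i))"
        using False contents_tl[OF False] by (cases "s i") (simp_all add: mk_tape_def)
      ultimately show ?thesis
        unfolding tm_step_Run[OF k(1)] s' tapes_update[OF i] unfolding kl Pop
        using i by (simp add: nth_reads_tapes map2_idle_upd)
    qed
    then show ?thesis using s' by (intro exI[of _ 1]) simp
  next
    case (If i c A B)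
    have "i < ntapes" using wf kl If by auto
    then have "tm_step (prog_tm P) (code P (Run k), tapes s) = (code P (Run k'), tapes s')"
      unfolding tm_step_Run[OF k(1)] using st kl If idle by (auto simp: nth_reads_tapes)
    then show ?thesis by (intro exI[of _ 1]) simp
  next
    case (While i c A)
    have "i < ntapes" using wf kl While by auto
    then have "tm_step (prog_tm P) (code P (Run k), tapes s) = (code P (Run k'), tapes s')"
      unfolding tm_step_Run[OF k(1)] using st kl While idle
      by (auto simp: nth_reads_tapes split: if_splits)
    then show ?thesis by (intro exI[of _ 1]) simp
  qed
qed

lemma step_Nil_iter: "(step ^^ t) ([], s) = ([], s)"
  by (induction t) auto

lemma tm_simulates:
  assumes P: "wf_prog P"
  shows "k \<in> conts P [] \<Longrightarrow> good_store s \<Longrightarrow> (step ^^ t) (k, s) = ([], s') \<Longrightarrow>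
     \<exists>j\<le>2 * t. (tm_step (prog_tm P) ^^ j) (code P (Run k), tapes s) = (code P (Run []), tapes s')"
proof (induction t arbitrary: k s)
  case 0
  then show ?case by auto
next
  case (Suc t)
  show ?case
  proof (cases "k = []")
    case True
    then have "s' = s" using Suc.prems(3) step_Nil_iter[of "Suc t" s] by simp
    then show ?thesis using True by (intro exI[of _ 0]) simp
  next
    case False
    obtain k' s1 where st: "step (k, s) = (k', s1)" by fastforce
    have "k' \<in> conts P []" using step_in_conts[OF Suc.prems(1), of s] st by simp
    moreover have "good_store s1"
      using good_store_step[OF Suc.prems(2), of k] wf_conts[OF P _ Suc.prems(1)] st by simp
    moreover have "(step ^^ t) (k', s1) = ([], s')"
      using Suc.prems(3) st by (simp add: funpow_Suc_right del: funpow.simps)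
    ultimately obtain j where j: "j \<le> 2 * t"
      "(tm_step (prog_tm P) ^^ j) (code P (Run k'), tapes s1) = (code P (Run []), tapes s')"
      using Suc.IH by blast
    obtain i where i: "i \<le> 2"
      "(tm_step (prog_tm P) ^^ i) (code P (Run k), tapes s) = (code P (Run k'), tapes s1)"
      using tm_simulates_step[OF P Suc.prems(1) False Suc.prems(2) st] by blast
    have "(tm_step (prog_tm P) ^^ (j + i)) (code P (Run k), tapes s) = (code P (Run []), tapes s')"
      using i j by (simp add: funpow_add)
    then show ?thesis using i j by (intro exI[of _ "j + i"]) auto
  qed
qed

definition bits :: "bool list \<Rightarrow> nat list" where
  "bits w = map (\<lambda>b. if b then 2 else 1) w"

definition init_store :: "bool list \<Rightarrow> store" where
  "init_store w = (\<lambda>_. [])(0 := rev (bits w))"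

lemma good_init_store: "good_store (init_store w)"
  by (auto simp: good_store_def init_store_def bits_def nsyms_def)

lemma tm_init_prog: "tm_init (prog_tm P) w = (code P Scan, (word_contents w, 0) # replicate (ntapes - 1) (\<lambda>_. 0, 0))"
  by (simp add: tm_init_def prog_tm_def)

lemma scan_phase:
  assumes "i \<le> length w"
  shows "(tm_step (prog_tm P) ^^ i) (tm_init (prog_tm P) w) =
    (code P Scan, (word_contents w, int i) # replicate (ntapes - 1) (\<lambda>_. 0, 0))"
  using assms
proof (induction i)
  case 0
  then show ?case by (simp add: tm_init_prog)
next
  case (Suc i)
  let ?ts = "(word_contents w, int i) # replicate (ntapes - 1) (\<lambda>_. 0, 0) :: tape list"
  have "reads ?ts ! 0 \<noteq> 0" using Suc.prems by (simp add: reads_def word_contents_def)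
  then have "tm_step (prog_tm P) (code P Scan, ?ts) =
      (code P Scan, ?ts[0 := update_tape (reads ?ts ! 0, Right) (?ts ! 0)])"
    using tm_step_prog[OF special_ctls(1), of P ?ts] by (simp only: ctl_delta.simps) (simp add: map2_idle_upd)
  also have "?ts[0 := update_tape (reads ?ts ! 0, Right) (?ts ! 0)] =
      (word_contents w, int (Suc i)) # replicate (ntapes - 1) (\<lambda>_. 0, 0)"
    by (simp add: reads_def)
  finally show ?case using Suc by simp
qed

lemma scan_end:
  "(tm_step (prog_tm P) ^^ Suc (length w)) (tm_init (prog_tm P) w) = (code P (Run P), tapes (init_store w))"
proof -
  let ?ts = "(word_contents w, int (length w)) # replicate (ntapes - 1) (\<lambda>_. 0, 0) :: tape list"
  have r: "reads ?ts ! 0 = 0" by (simp add: reads_def word_contents_def)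
  have rs: "reads ?ts = replicate ntapes 0"
    by (simp add: reads_def word_contents_def ntapes_def numeral_eq_Suc)
  have "tm_step (prog_tm P) (code P Scan, ?ts) =
      (code P (Run P), map2 update_tape (map (\<lambda>x. (x, Left)) (reads ?ts)) ?ts)"
    using tm_step_prog[OF special_ctls(1), of P ?ts] r by (simp only: ctl_delta.simps) simp
  also have "map2 update_tape (map (\<lambda>x. (x, Left)) (reads ?ts)) ?ts = tapes (init_store w)"
  proof (rule nth_equalityI)
    fix i assume "i < length (map2 update_tape (map (\<lambda>x. (x, Left)) (reads ?ts)) ?ts)"
    then have i: "i < ntapes" by (simp add: ntapes_def)
    have w: "(word_contents w)(int (length w) := 0) = word_contents w"
      by (auto simp: word_contents_def fun_eq_iff)
    show "map2 update_tape (map (\<lambda>x. (x, Left)) (reads ?ts)) ?ts ! i = tapes (init_store w) ! i"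
      using i mk_tape_bits[of w] w unfolding rs
      by (cases i) (auto simp: init_store_def bits_def mk_tape_def contents_def fun_eq_iff)
  qed (simp add: ntapes_def)
  finally show ?thesis using scan_phase[of "length w" w P] by simp
qed

text \<open>The scan takes \<open>length w + 1\<close> steps, the program at most
  \<open>2 * t\<close>, and the verdict one more.\<close>

lemma prog_tm_run:
  assumes "wf_prog P" "runs P (init_store w) t s"
  shows "\<exists>j \<le> length w + 2 * t + 2.
     tm_run (prog_tm P) w j = (if top_of (s 1) = 2 then accept (prog_tm P) else reject (prog_tm P), tapes s)"
proof -
  obtain u where u: "u \<le> t" "(step ^^ u) (P, init_store w) = ([], s)"
    using assms(2) unfolding runs_def by (metis append_Nil2)
  have "P \<in> conts P []" using start_in_conts[of P "[]"] by simp
  then obtain j where j: "j \<le> 2 * u"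
    "(tm_step (prog_tm P) ^^ j) (code P (Run P), tapes (init_store w)) = (code P (Run []), tapes s)"
    using tm_simulates[OF assms(1) _ good_init_store u(2)] by blast
  have 1: "tm_step (prog_tm P) (code P (Run []), tapes s) =
      (code P (if top_of (s 1) = 2 then Acc else Rej), tapes s)"
    using tm_step_prog[OF special_ctls(4)[OF end_in_conts], of P "tapes s"]
      map2_idle[of "tapes s" "reads (tapes s)"]
    by (auto simp: nth_reads_tapes ntapes_def)
  have "tm_run (prog_tm P) w (Suc j + Suc (length w)) =
      (code P (if top_of (s 1) = 2 then Acc else Rej), tapes s)"
    unfolding tm_run_def funpow_add comp_apply scan_end using j(2) 1 by simp
  then show ?thesis using j(1) u(1)
    by (intro exI[of _ "Suc j + Suc (length w)"]) (auto simp: prog_tm_def)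
qed

section \<open>Programs on serialised trees\<close>

datatype tree = Leaf | Node tree tree

text \<open>Preorder notation is self-delimiting, so serialised values can be stacked without
  separators.\<close>

fun ser :: "tree \<Rightarrow> nat list" where
  "ser Leaf = [1]"
| "ser (Node a b) = 2 # ser a @ ser b"

abbreviation tsize :: "tree \<Rightarrow> nat" where
  "tsize x \<equiv> length (ser x)"

lemma tsize_pos: "0 < tsize x" by (cases x) auto

lemma set_ser: "set (ser x) \<subseteq> {1, 2}" by (induction x) auto

lemma ser_append_inject: "ser x @ u = ser y @ v \<longleftrightarrow> x = y \<and> u = v"
proof (induction x arbitrary: y u v)
  case Leaf
  then show ?case by (cases y) auto
next
  case (Node a b)
  then show ?case by (cases y) auto
qed

lemma ser_inject: "ser x = ser y \<longleftrightarrow> x = y"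
  using ser_append_inject[of x "[]" y "[]"] by simp

text \<open>Tape \<open>1\<close> holds a stack of serialised values, \<open>2\<close> and \<open>4\<close> hold values in transit (reversed
  and closed off below by the marker \<open>3\<close>), and \<open>3\<close> counts the subtrees still to be read.\<close>

lemma runs_If:
  "runs ((if top_of (s i) = c then A else B) @ C) s t s' \<Longrightarrow> runs (If i c A B # C) s (Suc t) s'"
  by (cases "top_of (s i) = c") (simp_all add: runs_If_eq runs_If_neq)

definition push_all :: "nat list \<Rightarrow> nat \<Rightarrow> com list" where
  "push_all is c = map (\<lambda>i. Push i c) is"

definition spread :: "nat list \<Rightarrow> nat list \<Rightarrow> store \<Rightarrow> store" where
  "spread is u s = (\<lambda>i. if i \<in> set is then rev u @ s i else s i)"

lemma runs_push_all:
  "distinct is \<Longrightarrow> runs K (spread is [c] s) t s' \<Longrightarrow> runs (push_all is c @ K) s (length is + t) s'"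
proof (induction "is" arbitrary: s)
  case Nil
  then show ?case by (simp add: push_all_def spread_def)
next
  case (Cons i "is")
  have "spread is [c] (s(i := c # s i)) = spread (i # is) [c] s"
    using Cons.prems(1) by (auto simp: spread_def)
  then have "runs (push_all is c @ K) (s(i := c # s i)) (length is + t) s'"
    using Cons by simp
  then show ?case using runs_Push by (fastforce simp: push_all_def)
qed

definition read_body :: "nat list \<Rightarrow> com list" where
  "read_body is = [If 1 1 (push_all is 1 @ [Pop 1, Pop 3]) (push_all is 2 @ [Pop 1, Push 3 1])]"

text \<open>A \<open>Leaf\<close> completes one outstanding subtree and a \<open>Node\<close>
  replaces one by two. The tree ends exactly when the marker on tape \<open>3\<close>
  reappears.\<close>

definition read_tree :: "nat list \<Rightarrow> com list" where
  "read_tree is = [Push 3 3, Push 3 1, While 3 3 (read_body is), Pop 3]"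

text \<open>Six steps per symbol: the loop test, the branch, at most two copies, and one command
  each for tapes \<open>1\<close> and \<open>3\<close>.\<close>

lemma runs_read_loop:
  assumes "distinct is" "1 \<notin> set is" "3 \<notin> set is" "length is \<le> 2"
  shows "s 1 = ser x @ r \<Longrightarrow> s 3 = 1 # c \<Longrightarrow>
    runs (While 3 3 (read_body is) # K) ((spread is (ser x) s)(1 := r, 3 := c)) t s' \<Longrightarrow>
    runs (While 3 3 (read_body is) # K) s (6 * tsize x + t) s'"
proof (induction x arbitrary: s r c t)
  case Leaf
  let ?s = "spread is [1] s"
  have "runs (Pop 1 # Pop 3 # While 3 3 (read_body is) # K) ?s (Suc (Suc t)) s'"
  proof (intro runs_Pop)
    have "(?s(1 := tl (?s 1)))(3 := tl ((?s(1 := tl (?s 1))) 3)) = (spread is (ser Leaf) s)(1 := r, 3 := c)"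
      using Leaf assms by (auto simp: spread_def)
    show "runs (While 3 3 (read_body is) # K) ((?s(1 := tl (?s 1)))(3 := tl ((?s(1 := tl (?s 1))) 3))) t s'"
      unfolding \<open>_ = (spread is (ser Leaf) s)(1 := r, 3 := c)\<close> by (rule Leaf(3))
  qed
  from runs_push_all[OF assms(1) this]
  have "runs (While 3 3 (read_body is) # K) s (Suc (Suc (length is + Suc (Suc t)))) s'"
    using Leaf by (intro runs_While_iter) (auto simp: read_body_def intro!: runs_If_eq)
  then show ?case by (rule runs_mono) (use assms(4) in simp)
next
  case (Node a b)
  let ?s = "spread is [2] s"
  let ?s1 = "?s(1 := ser a @ ser b @ r, 3 := 1 # 1 # c)"
  let ?s2 = "(spread is (ser a) ?s1)(1 := ser b @ r, 3 := 1 # c)"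
  let ?s3 = "(spread is (ser b) ?s2)(1 := r, 3 := c)"
  have e3: "?s3 = (spread is (ser (Node a b)) s)(1 := r, 3 := c)"
    using assms by (auto simp: spread_def)
  have "runs (While 3 3 (read_body is) # K) ?s3 t s'"
    unfolding e3 by (rule Node.prems(3))
  then have "runs (While 3 3 (read_body is) # K) ?s2 (6 * tsize b + t) s'"
    by - (rule Node.IH(2)[where r = r and c = c]; (assumption | simp))
  then have 1: "runs (While 3 3 (read_body is) # K) ?s1 (6 * tsize a + (6 * tsize b + t)) s'"
    by - (rule Node.IH(1)[where r = "ser b @ r" and c = "1 # c"]; (assumption | simp))
  have e: "(?s(1 := tl (?s 1)))(3 := 1 # (?s(1 := tl (?s 1))) 3) = ?s1"
    using Node.prems assms by (auto simp: spread_def)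
  have "runs (Pop 1 # Push 3 1 # While 3 3 (read_body is) # K) ?s
      (Suc (Suc (6 * tsize a + (6 * tsize b + t)))) s'"
    by (intro runs_Pop runs_Push) (use 1 e in simp)
  from runs_push_all[OF assms(1) this]
  have "runs (While 3 3 (read_body is) # K) s
      (Suc (Suc (length is + Suc (Suc (6 * tsize a + (6 * tsize b + t)))))) s'"
    using Node.prems by (intro runs_While_iter) (auto simp: read_body_def intro!: runs_If_neq)
  then show ?case by (rule runs_mono) (use assms(4) in simp)
qed

lemma runs_read_tree:
  assumes "distinct is" "1 \<notin> set is" "3 \<notin> set is" "length is \<le> 2" "s 1 = ser x @ r"
  shows "runs (read_tree is) s (6 * tsize x + 4) ((spread is (ser x) s)(1 := r))"
proof -
  let ?s = "s(3 := 1 # 3 # s 3)"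
  let ?s1 = "(spread is (ser x) ?s)(1 := r, 3 := 3 # s 3)"
  have "runs [While 3 3 (read_body is), Pop 3] ?s1 2 ((spread is (ser x) s)(1 := r))"
  proof -
    have "?s1(3 := tl (?s1 3)) = (spread is (ser x) s)(1 := r)"
      using assms by (auto simp: spread_def)
    then have "runs [Pop 3] ?s1 (Suc 0) ((spread is (ser x) s)(1 := r))"
      by (intro runs_Pop) (metis runs_Nil)
    then show ?thesis using runs_While_end[of ?s1 3 3] by (simp add: numeral_2_eq_2)
  qed
  then have "runs [While 3 3 (read_body is), Pop 3] ?s (6 * tsize x + 2) ((spread is (ser x) s)(1 := r))"
    using assms by (intro runs_read_loop) auto
  then have "runs (read_tree is) s (Suc (Suc (6 * tsize x + 2))) ((spread is (ser x) s)(1 := r))"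
    unfolding read_tree_def by (intro runs_Push) simp
  then show ?thesis by (simp add: numeral_eq_Suc)
qed

abbreviation DROP :: "com list" where "DROP \<equiv> read_tree []"
definition MOVE :: "nat \<Rightarrow> com list" where "MOVE i = Push i 3 # read_tree [i]"
text \<open>Transfers reverse a value; after the way out and back it is in order again.\<close>

definition BACK :: "nat \<Rightarrow> com list" where
  "BACK i = [While i 3 [If i 1 [Push 1 1, Pop i] [Push 1 2, Pop i]], Pop i]"
definition DUP :: "com list" where
  "DUP = Push 2 3 # Push 4 3 # read_tree [2, 4] @ BACK 2 @ BACK 4"

lemma runs_eqI: "runs A s t s' \<Longrightarrow> t \<le> t' \<Longrightarrow> s' = s'' \<Longrightarrow> runs A s t' s''"
  using runs_mono by blast

lemma runs_DROP: "s 1 = ser x @ r \<Longrightarrow> runs DROP s (6 * tsize x + 4) (s(1 := r))"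
  by (rule runs_eqI[OF runs_read_tree]) (auto simp: spread_def)

lemma runs_MOVE:
  assumes "i = 2 \<or> i = 4" "s 1 = ser x @ r"
  shows "runs (MOVE i) s (6 * tsize x + 5) (s(1 := r, i := rev (ser x) @ 3 # s i))"
proof -
  have "runs (read_tree [i]) (s(i := 3 # s i)) (6 * tsize x + 4) (s(1 := r, i := rev (ser x) @ 3 # s i))"
    by (rule runs_eqI[OF runs_read_tree[where x = x and r = r]]) (use assms in \<open>auto simp: spread_def\<close>)
  from runs_Push[OF this] show ?thesis unfolding MOVE_def by (simp add: numeral_eq_Suc)
qed

lemma runs_BACK:
  assumes "i \<noteq> 1"
  shows "s i = u @ 3 # z \<Longrightarrow> set u \<subseteq> {1, 2} \<Longrightarrow>
    runs (BACK i) s (4 * length u + 2) (s(1 := rev u @ s 1, i := z))"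
proof (induction u arbitrary: s)
  case Nil
  have "runs [Pop i] s (Suc 0) (s(i := tl (s i)))" by (intro runs_Pop) simp
  then have "runs (BACK i) s (Suc (Suc 0)) (s(i := tl (s i)))"
    unfolding BACK_def using Nil by (intro runs_While_end) auto
  then show ?case by (rule runs_eqI) (use Nil in auto)
next
  case (Cons a u)
  let ?s = "s(1 := a # s 1, i := u @ 3 # z)"
  have 1: "runs (BACK i) ?s (4 * length u + 2) (?s(1 := rev u @ ?s 1, i := z))"
    using Cons assms by (intro Cons.IH) auto
  have e: "(s(1 := a # s 1))(i := tl ((s(1 := a # s 1)) i)) = ?s" using Cons.prems assms by auto
  have 2: "runs ([Push 1 a, Pop i] @ BACK i) s (Suc (Suc (4 * length u + 2))) (?s(1 := rev u @ ?s 1, i := z))"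
    unfolding append_Cons append_Nil by (intro runs_Push runs_Pop) (use 1 e in simp)
  have "a = 1 \<or> a = 2" using Cons.prems by auto
  then have "runs ([If i 1 [Push 1 1, Pop i] [Push 1 2, Pop i]] @ BACK i) s
      (Suc (Suc (Suc (4 * length u + 2)))) (?s(1 := rev u @ ?s 1, i := z))"
  proof
    assume "a = 1"
    then show ?thesis unfolding append_Cons append_Nil
      by (intro runs_If_eq) (use 2 Cons.prems(1) in auto)
  next
    assume "a = 2"
    then show ?thesis unfolding append_Cons append_Nil
      by (intro runs_If_neq) (use 2 Cons.prems(1) in auto)
  qed
  then have "runs (BACK i) s (Suc (Suc (Suc (Suc (4 * length u + 2))))) (?s(1 := rev u @ ?s 1, i := z))"
    using \<open>a = 1 \<or> a = 2\<close> Cons.prems unfolding BACK_def by (intro runs_While_iter) auto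
  then show ?case by (rule runs_eqI) (use assms in auto)
qed

lemma runs_BACK_tree:
  assumes "i \<noteq> 1" "s i = rev (ser x) @ 3 # z"
  shows "runs (BACK i) s (4 * tsize x + 2) (s(1 := ser x @ s 1, i := z))"
  using runs_BACK[of i s "rev (ser x)" z] assms set_ser[of x] by simp

lemma runs_DUP:
  assumes "s 1 = ser x @ r"
  shows "runs DUP s (14 * tsize x + 10) (s(1 := ser x @ ser x @ r))"
proof -
  let ?s1 = "s(2 := 3 # s 2, 4 := 3 # s 4)"
  let ?s2 = "(spread [2, 4] (ser x) ?s1)(1 := r)"
  let ?s3 = "?s2(1 := ser x @ ?s2 1, 2 := s 2)"
  let ?s4 = "?s3(1 := ser x @ ?s3 1, 4 := s 4)"
  have 1: "runs (read_tree [2, 4]) ?s1 (6 * tsize x + 4) ?s2"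
    using assms by (intro runs_read_tree) auto
  have 2: "runs (BACK 2) ?s2 (4 * tsize x + 2) ?s3"
    by (rule runs_BACK_tree) (auto simp: spread_def)
  have 3: "runs (BACK 4) ?s3 (4 * tsize x + 2) ?s4"
    by (rule runs_BACK_tree) (auto simp: spread_def)
  have "runs (read_tree [2, 4] @ BACK 2 @ BACK 4) ?s1
      ((6 * tsize x + 4) + ((4 * tsize x + 2) + (4 * tsize x + 2))) ?s4"
    by (intro runs_append[OF 1] runs_append[OF 2] 3)
  then have "runs DUP s (Suc (Suc ((6 * tsize x + 4) + ((4 * tsize x + 2) + (4 * tsize x + 2))))) ?s4"
    unfolding DUP_def by (intro runs_Push) simp
  then show ?thesis by (rule runs_eqI) (auto simp: spread_def)
qed

lemma wf_macros [simp]: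
  "wf_prog DROP" "i < ntapes \<Longrightarrow> wf_prog (MOVE i)" "i < ntapes \<Longrightarrow> wf_prog (BACK i)" "wf_prog DUP"
  by (auto simp: read_tree_def read_body_def push_all_def MOVE_def BACK_def DUP_def ntapes_def nsyms_def)

subsection \<open>Time-bounded tree functions\<close>

text \<open>A single bound \<open>T\<close> controls both the time and the size of the result, as
  composition needs both; monotonicity allows it to be applied to a bound on an intermediate size.
  Everything below the argument and all other tapes are restored, so that implementations can be
  nested.\<close>

definition impl :: "tree set \<Rightarrow> (tree \<Rightarrow> tree) \<Rightarrow> com list \<Rightarrow> (nat \<Rightarrow> nat) \<Rightarrow> bool" where
  "impl D f P T \<longleftrightarrow> wf_prog P \<and> mono T \<and> (\<forall>x\<in>D. tsize (f x) \<le> T (tsize x)) \<and>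
     (\<forall>x\<in>D. \<forall>s r. s 1 = ser x @ r \<longrightarrow> runs P s (T (tsize x)) (s(1 := ser (f x) @ r)))"

lemma implI:
  assumes "wf_prog P" "mono T" "\<And>x. x \<in> D \<Longrightarrow> tsize (f x) \<le> T (tsize x)"
    "\<And>x s r. x \<in> D \<Longrightarrow> s 1 = ser x @ r \<Longrightarrow> runs P s (T (tsize x)) (s(1 := ser (f x) @ r))"
  shows "impl D f P T"
  using assms unfolding impl_def by blast

lemma implD:
  assumes "impl D f P T"
  shows "wf_prog P" "mono T" "x \<in> D \<Longrightarrow> tsize (f x) \<le> T (tsize x)"
    "x \<in> D \<Longrightarrow> s 1 = ser x @ r \<Longrightarrow> runs P s (T (tsize x)) (s(1 := ser (f x) @ r))"
  using assms unfolding impl_def by blast+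

lemma impl_mono: "impl D f P T \<Longrightarrow> (\<And>n. T n \<le> T' n) \<Longrightarrow> mono T' \<Longrightarrow> impl D f P T'"
  unfolding impl_def by (meson order_trans runs_mono)

lemma impl_subset: "impl D f P T \<Longrightarrow> E \<subseteq> D \<Longrightarrow> impl E f P T"
  unfolding impl_def by blast

lemma impl_comp:
  assumes f: "impl D f P T" and g: "impl E g Q U" and DE: "\<And>x. x \<in> D \<Longrightarrow> f x \<in> E"
  shows "impl D (\<lambda>x. g (f x)) (P @ Q) (\<lambda>n. T n + U (T n))"
proof (rule implI)
  note F = implD[OF f] and G = implD[OF g]
  have UT: "U (tsize (f x)) \<le> U (T (tsize x))" if "x \<in> D" for x using G(2) F(3)[OF that] by (rule monoD)
  show "wf_prog (P @ Q)" using F(1) G(1) by auto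
  show "mono (\<lambda>n. T n + U (T n))"
    using F(2) G(2) by (auto simp: mono_def intro!: add_mono)
  show "tsize (g (f x)) \<le> T (tsize x) + U (T (tsize x))" if "x \<in> D" for x
    using G(3)[OF DE[OF that]] UT[OF that] by linarith
  fix x :: tree and s :: store and r assume x: "x \<in> D" and s: "s 1 = ser x @ r"
  let ?s = "s(1 := ser (f x) @ r)"
  have "runs Q ?s (U (tsize (f x))) (?s(1 := ser (g (f x)) @ r))" by (rule G(4)[OF DE[OF x]]) simp
  from runs_append[OF F(4)[of x s r, OF x s] this]
  show "runs (P @ Q) s (T (tsize x) + U (T (tsize x))) (s(1 := ser (g (f x)) @ r))"
    by (rule runs_eqI) (use UT[OF x] in auto)
qed

lemma impl_id: "impl D (\<lambda>x. x) [] (\<lambda>n. n)"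
  by (rule implI) (auto simp: mono_def fun_upd_idem)

lemma runs_push_rev: "runs (map (Push 1) (rev u)) s (length u) (s(1 := u @ s 1))"
proof (induction u arbitrary: s rule: rev_induct)
  case Nil
  then show ?case by (auto intro: runs_eqI[OF runs_Nil])
next
  case (snoc a u)
  have "runs (Push 1 a # map (Push 1) (rev u)) s (Suc (length u)) ((s(1 := a # s 1))(1 := u @ (s(1 := a # s 1)) 1))"
    by (intro runs_Push snoc)
  then have "runs (map (Push 1) (rev (u @ [a]))) s (Suc (length u)) (s(1 := u @ a # s 1))" by simp
  then show ?case by (rule runs_eqI) auto
qed

lemma impl_const: "impl D (\<lambda>_. c) (DROP @ map (Push 1) (rev (ser c))) (\<lambda>n. 6 * n + 4 + tsize c)"
proof (rule implI)
  show "wf_prog (DROP @ map (Push 1) (rev (ser c)))"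
    using set_ser[of c] by (auto simp: ntapes_def nsyms_def)
  fix x :: tree and s :: store and r assume s: "s 1 = ser x @ r"
  show "runs (DROP @ map (Push 1) (rev (ser c))) s (6 * tsize x + 4 + tsize c) (s(1 := ser c @ r))"
    by (rule runs_eqI[OF runs_append[OF runs_DROP[of s x r, OF s] runs_push_rev]]) auto
qed (auto simp: mono_def)

text \<open>The second component is computed first and parked on tape \<open>2\<close>; the program
  for the first may use that tape above it. The factor 11 is one run, six steps per symbol for
  parking and four for fetching back.\<close>

lemma impl_pair:
  assumes f: "impl D f P T" and g: "impl D g Q U"
  shows "impl D (\<lambda>x. Node (f x) (g x)) (DUP @ Q @ MOVE 2 @ P @ MOVE 4 @ BACK 2 @ BACK 4 @ [Push 1 2])
     (\<lambda>n. 14 * n + 30 + 11 * T n + 11 * U n)"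
proof (rule implI)
  note F = implD[OF f] and G = implD[OF g]
  show "wf_prog (DUP @ Q @ MOVE 2 @ P @ MOVE 4 @ BACK 2 @ BACK 4 @ [Push 1 2])"
    unfolding set_append ball_Un using F(1) G(1) by (intro conjI wf_macros) (simp_all add: ntapes_def nsyms_def)
  show "mono (\<lambda>n. 14 * n + 30 + 11 * T n + 11 * U n)"
    using F(2) G(2) by (auto simp: mono_def intro!: add_mono)
  show "tsize (Node (f x) (g x)) \<le> 14 * tsize x + 30 + 11 * T (tsize x) + 11 * U (tsize x)" if "x \<in> D" for x
    using F(3)[OF that] G(3)[OF that] by simp
  fix x :: tree and s :: store and r assume x: "x \<in> D" and s: "s 1 = ser x @ r"
  let ?s1 = "s(1 := ser x @ ser x @ r)"
  let ?s2 = "s(1 := ser (g x) @ ser x @ r)"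
  let ?s3 = "s(1 := ser x @ r, 2 := rev (ser (g x)) @ 3 # s 2)"
  let ?s4 = "s(1 := ser (f x) @ r, 2 := rev (ser (g x)) @ 3 # s 2)"
  let ?s5 = "s(1 := r, 2 := rev (ser (g x)) @ 3 # s 2, 4 := rev (ser (f x)) @ 3 # s 4)"
  let ?s6 = "s(1 := ser (g x) @ r, 4 := rev (ser (f x)) @ 3 # s 4)"
  let ?s7 = "s(1 := ser (f x) @ ser (g x) @ r)"
  have 1: "runs DUP s (14 * tsize x + 10) ?s1" by (rule runs_DUP[of s x r, OF s])
  have 2: "runs Q ?s1 (U (tsize x)) ?s2" using G(4)[OF x, of ?s1 "ser x @ r"] by simp
  have 3: "runs (MOVE 2) ?s2 (6 * tsize (g x) + 5) ?s3"
    by (rule runs_eqI[OF runs_MOVE[where r = "ser x @ r"]]) auto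
  have 4: "runs P ?s3 (T (tsize x)) ?s4"
    by (rule runs_eqI[OF F(4)[OF x, of _ r]]) auto
  have 5: "runs (MOVE 4) ?s4 (6 * tsize (f x) + 5) ?s5"
    by (rule runs_eqI[OF runs_MOVE[where r = r and x = "f x"]]) auto
  have 6: "runs (BACK 2) ?s5 (4 * tsize (g x) + 2) ?s6"
    by (rule runs_eqI[OF runs_BACK_tree]) auto
  have 7: "runs (BACK 4) ?s6 (4 * tsize (f x) + 2) ?s7"
    by (rule runs_eqI[OF runs_BACK_tree]) auto
  have 8: "runs [Push 1 2] ?s7 (Suc 0) (?s7(1 := 2 # ?s7 1))" by (intro runs_Push) simp
  have "runs (DUP @ Q @ MOVE 2 @ P @ MOVE 4 @ BACK 2 @ BACK 4 @ [Push 1 2]) s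
     ((14 * tsize x + 10) + (U (tsize x) + ((6 * tsize (g x) + 5) + (T (tsize x) + ((6 * tsize (f x) + 5) +
       ((4 * tsize (g x) + 2) + ((4 * tsize (f x) + 2) + Suc 0))))))) (?s7(1 := 2 # ?s7 1))"
    by (intro runs_append[OF 1] runs_append[OF 2] runs_append[OF 3] runs_append[OF 4]
        runs_append[OF 5] runs_append[OF 6] runs_append[OF 7] 8)
  then show "runs (DUP @ Q @ MOVE 2 @ P @ MOVE 4 @ BACK 2 @ BACK 4 @ [Push 1 2]) s
      (14 * tsize x + 30 + 11 * T (tsize x) + 11 * U (tsize x)) (s(1 := ser (Node (f x) (g x)) @ r))"
    by (rule runs_eqI) (use F(3)[OF x] G(3)[OF x] in auto)
qed

fun tfst :: "tree \<Rightarrow> tree" where "tfst Leaf = Leaf" | "tfst (Node a b) = a"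
fun tsnd :: "tree \<Rightarrow> tree" where "tsnd Leaf = Leaf" | "tsnd (Node a b) = b"

lemma impl_tfst: "impl D tfst [If 1 2 (Pop 1 # MOVE 2 @ DROP @ BACK 2) []] (\<lambda>n. 10 * n + 20)"
proof (rule implI)
  show "wf_prog [If 1 2 (Pop 1 # MOVE 2 @ DROP @ BACK 2) []]"
    using wf_macros(1) wf_macros(2)[of 2] wf_macros(3)[of 2] by (auto simp: ntapes_def)
  show "tsize (tfst x) \<le> 10 * tsize x + 20" for x by (cases x) auto
  fix x :: tree and s :: store and r assume s: "s 1 = ser x @ r"
  show "runs [If 1 2 (Pop 1 # MOVE 2 @ DROP @ BACK 2) []] s (10 * tsize x + 20) (s(1 := ser (tfst x) @ r))"
  proof (cases x)
    case Leaf
    then show ?thesis using s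
      by (intro runs_eqI[OF runs_If_neq[of s 1 2 "[]" "[]" 0 s]]) auto
  next
    case (Node a b)
    let ?s1 = "s(1 := ser a @ ser b @ r)"
    let ?s2 = "s(1 := ser b @ r, 2 := rev (ser a) @ 3 # s 2)"
    let ?s3 = "s(1 := r, 2 := rev (ser a) @ 3 # s 2)"
    have 1: "runs (MOVE 2) ?s1 (6 * tsize a + 5) ?s2"
      by (rule runs_eqI[OF runs_MOVE[where r = "ser b @ r"]]) auto
    have 2: "runs DROP ?s2 (6 * tsize b + 4) ?s3"
      by (rule runs_eqI[OF runs_DROP[where x = b and r = r]]) auto
    have 3: "runs (BACK 2) ?s3 (4 * tsize a + 2) (s(1 := ser a @ r))"
      by (rule runs_eqI[OF runs_BACK_tree]) auto
    have 4: "runs (MOVE 2 @ DROP @ BACK 2) ?s1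
        ((6 * tsize a + 5) + ((6 * tsize b + 4) + (4 * tsize a + 2))) (s(1 := ser a @ r))"
      by (intro runs_append[OF 1] runs_append[OF 2] 3)
    have "s(1 := tl (s 1)) = ?s1" using s Node by auto
    then have "runs ((Pop 1 # MOVE 2 @ DROP @ BACK 2) @ []) s
        (Suc ((6 * tsize a + 5) + ((6 * tsize b + 4) + (4 * tsize a + 2)))) (s(1 := ser a @ r))"
      unfolding append_Nil2 by (intro runs_Pop) (use 4 in simp)
    then show ?thesis
      by (intro runs_eqI[OF runs_If_eq]) (use Node s in auto)
  qed
qed (auto simp: mono_def)

lemma impl_tsnd: "impl D tsnd [If 1 2 (Pop 1 # DROP) []] (\<lambda>n. 10 * n + 20)"
proof (rule implI)
  show "wf_prog [If 1 2 (Pop 1 # DROP) []]"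
    using wf_macros by (auto simp: ntapes_def)
  show "tsize (tsnd x) \<le> 10 * tsize x + 20" for x by (cases x) auto
  fix x :: tree and s :: store and r assume s: "s 1 = ser x @ r"
  show "runs [If 1 2 (Pop 1 # DROP) []] s (10 * tsize x + 20) (s(1 := ser (tsnd x) @ r))"
  proof (cases x)
    case Leaf
    then show ?thesis using s
      by (intro runs_eqI[OF runs_If_neq[of s 1 2 "[]" "[]" 0 s]]) auto
  next
    case (Node a b)
    let ?s1 = "s(1 := ser a @ ser b @ r)"
    have 2: "runs DROP ?s1 (6 * tsize a + 4) (s(1 := ser b @ r))"
      by (rule runs_eqI[OF runs_DROP[where x = a and r = "ser b @ r"]]) auto
    have "s(1 := tl (s 1)) = ?s1" using s Node by auto
    then have "runs ((Pop 1 # DROP) @ []) s (Suc (6 * tsize a + 4)) (s(1 := ser b @ r))"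
      unfolding append_Nil2 by (intro runs_Pop) (use 2 in simp)
    then show ?thesis
      by (intro runs_eqI[OF runs_If_eq]) (use Node s in auto)
  qed
qed (auto simp: mono_def)

text \<open>Each branch has to be implemented only where it is taken. Case distinctions on data
  depend on this, since there the branch makes sense only for one shape of the argument.\<close>

lemma impl_if:
  assumes f: "impl D f P T" and g: "impl {x \<in> D. f x \<noteq> Leaf} g Q U"
    and h: "impl {x \<in> D. f x = Leaf} h R V"
  shows "impl D (\<lambda>x. if f x = Leaf then h x else g x) (DUP @ P @ [If 1 1 (Pop 1 # R) (DROP @ Q)])
     (\<lambda>n. 14 * n + 30 + 7 * T n + U n + V n)"
proof (rule implI)
  note F = implD[OF f] and G = implD[OF g] and H = implD[OF h]
  show "wf_prog (DUP @ P @ [If 1 1 (Pop 1 # R) (DROP @ Q)])"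
    unfolding set_append ball_Un using F(1) G(1) H(1) wf_macros(1)
    by (intro conjI wf_macros) (auto simp: ntapes_def)
  show "mono (\<lambda>n. 14 * n + 30 + 7 * T n + U n + V n)"
    using F(2) G(2) H(2) by (auto simp: mono_def intro!: add_mono)
  show "tsize (if f x = Leaf then h x else g x) \<le> 14 * tsize x + 30 + 7 * T (tsize x) + U (tsize x) + V (tsize x)" if "x \<in> D" for x
    using G(3)[of x] H(3)[of x] that by auto
  fix x :: tree and s :: store and r assume x: "x \<in> D" and s: "s 1 = ser x @ r"
  let ?s1 = "s(1 := ser x @ ser x @ r)"
  let ?s2 = "s(1 := ser (f x) @ ser x @ r)"
  let ?s3 = "s(1 := ser x @ r)"
  let ?o = "s(1 := ser (if f x = Leaf then h x else g x) @ r)"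
  have 1: "runs DUP s (14 * tsize x + 10) ?s1" by (rule runs_DUP[of s x r, OF s])
  have 2: "runs P ?s1 (T (tsize x)) ?s2" using F(4)[OF x, of ?s1 "ser x @ r"] by simp
  have 3: "runs [If 1 1 (Pop 1 # R) (DROP @ Q)] ?s2 (6 * T (tsize x) + 10 + U (tsize x) + V (tsize x)) ?o"
  proof (cases "f x = Leaf")
    case True
    have "runs R (?s2(1 := tl (?s2 1))) (V (tsize x)) ?o"
      by (rule runs_eqI[OF H(4)[of x _ r]]) (use True x in auto)
    then have "runs ((Pop 1 # R) @ []) ?s2 (Suc (V (tsize x))) ?o"
      unfolding append_Nil2 by (rule runs_Pop)
    then show ?thesis by (intro runs_eqI[OF runs_If_eq]) (use True in auto)
  next
    case False
    have d: "runs DROP ?s2 (6 * tsize (f x) + 4) ?s3"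
      by (rule runs_eqI[OF runs_DROP[where x = "f x" and r = "ser x @ r"]]) auto
    have q: "runs Q ?s3 (U (tsize x)) ?o"
      by (rule runs_eqI[OF G(4)[of x _ r]]) (use False x in auto)
    have "runs ((DROP @ Q) @ []) ?s2 ((6 * tsize (f x) + 4) + U (tsize x)) ?o"
      using runs_append[OF d q] by simp
    moreover have "top_of (?s2 1) \<noteq> 1" using False by (cases "f x") auto
    ultimately show ?thesis
      by (intro runs_eqI[OF runs_If_neq]) (use F(3)[OF x] in auto)
  qed
  show "runs (DUP @ P @ [If 1 1 (Pop 1 # R) (DROP @ Q)]) s
      (14 * tsize x + 30 + 7 * T (tsize x) + U (tsize x) + V (tsize x)) ?o"
    by (rule runs_eqI[OF runs_append[OF 1 runs_append[OF 2 3]]]) auto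
qed

text \<open>For the codes used below this is the length of a list and the value of a unary number,
  so one loop construct can count with either.\<close>

fun spine :: "tree \<Rightarrow> nat" where "spine Leaf = 0" | "spine (Node a b) = Suc (spine b)"

fun titer :: "(tree \<Rightarrow> tree) \<Rightarrow> tree \<Rightarrow> tree" where
  "titer h Leaf = Leaf"
| "titer h (Node n y) = (h ^^ spine n) y"

lemma spine_le_tsize: "spine x \<le> tsize x" by (induction x) auto

text \<open>Iterating a function with a polynomial size bound may still explode, so a bound
  \<open>B\<close> on all intermediate values is a hypothesis. It is polynomial in all uses but one:
  the padding takes \<open>B\<close> exponential.\<close>

lemma impl_iter:
  assumes h: "impl D h P T" and B: "mono B" and E:
    "\<And>n y i. Node n y \<in> E \<Longrightarrow> i \<le> spine n \<Longrightarrow> (h ^^ i) y \<in> D \<and> tsize ((h ^^ i) y) \<le> B (tsize (Node n y))"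
  shows "impl E (titer h) [If 1 2 [Pop 1, While 1 1 (Pop 1 # DROP @ MOVE 2 @ P @ BACK 2), Pop 1] []]
     (\<lambda>n. n * (20 * n + 20 + T (B n)) + 10 + B n)"
proof (rule implI)
  note H = implD[OF h]
  let ?W = "While 1 1 (Pop 1 # DROP @ MOVE 2 @ P @ BACK 2)"
  let ?T = "\<lambda>n. n * (20 * n + 20 + T (B n)) + 10 + B n"
  show "wf_prog [If 1 2 [Pop 1, ?W, Pop 1] []]"
    using wf_macros(1) wf_macros(2)[of 2] wf_macros(3)[of 2] H(1) by (auto simp: ntapes_def)
  show "mono ?T" using H(2) B by (auto simp: mono_def intro!: add_mono mult_mono)
  have loop: "runs [?W, Pop 1] s (Suc (Suc (spine m * (20 * k + 20 + T b)))) (s(1 := ser ((h ^^ spine m) y) @ r))"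
    if "s 1 = ser m @ ser y @ r" "tsize m \<le> k" "\<And>i. i \<le> spine m \<Longrightarrow> (h ^^ i) y \<in> D \<and> tsize ((h ^^ i) y) \<le> b" for s m y k b r
    using that
  proof (induction m arbitrary: s y)
    case Leaf
    have "runs [Pop 1] s (Suc 0) (s(1 := tl (s 1)))" by (intro runs_Pop) simp
    then have "runs [?W, Pop 1] s (Suc (Suc 0)) (s(1 := tl (s 1)))"
      by (intro runs_While_end) (use Leaf in auto)
    then show ?case by (rule runs_eqI) (use Leaf in auto)
  next
    case (Node a m)
    let ?s1 = "s(1 := ser a @ ser m @ ser y @ r)"
    let ?s2 = "s(1 := ser m @ ser y @ r)"
    let ?s3 = "s(1 := ser y @ r, 2 := rev (ser m) @ 3 # s 2)"
    let ?s4 = "s(1 := ser (h y) @ r, 2 := rev (ser m) @ 3 # s 2)"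
    let ?s5 = "s(1 := ser m @ ser (h y) @ r)"
    let ?c = "20 * k + 20 + T b"
    have 1: "runs DROP ?s1 (6 * tsize a + 4) ?s2"
      by (rule runs_eqI[OF runs_DROP[where x = a and r = "ser m @ ser y @ r"]]) auto
    have 2: "runs (MOVE 2) ?s2 (6 * tsize m + 5) ?s3"
      by (rule runs_eqI[OF runs_MOVE[where r = "ser y @ r"]]) auto
    have 3: "runs P ?s3 (T (tsize y)) ?s4"
      by (rule runs_eqI[OF H(4)[of y _ r]]) (use Node.prems(3)[of 0] in auto)
    have 4: "runs (BACK 2) ?s4 (4 * tsize m + 2) ?s5"
      by (rule runs_eqI[OF runs_BACK_tree]) auto
    have 5: "runs [?W, Pop 1] ?s5 (Suc (Suc (spine m * ?c))) (s(1 := ser ((h ^^ spine (Node a m)) y) @ r))"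
    proof -
      have "runs [?W, Pop 1] ?s5 (Suc (Suc (spine m * ?c))) (?s5(1 := ser ((h ^^ spine m) (h y)) @ r))"
      proof (rule Node.IH(2))
        show "(h ^^ i) (h y) \<in> D \<and> tsize ((h ^^ i) (h y)) \<le> b" if "i \<le> spine m" for i
          using Node.prems(3)[of "Suc i"] that by (simp add: funpow_Suc_right del: funpow.simps)
      qed (use Node.prems in auto)
      then show ?thesis by (rule runs_eqI) (auto simp: funpow_Suc_right simp del: funpow.simps)
    qed
    have "T (tsize y) \<le> T b" using Node.prems(3)[of 0] H(2) by (simp add: monoD)
    have 6: "runs (DROP @ MOVE 2 @ P @ BACK 2 @ [?W, Pop 1]) ?s1
        ((6 * tsize a + 4) + ((6 * tsize m + 5) + (T (tsize y) + ((4 * tsize m + 2) + Suc (Suc (spine m * ?c))))))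
        (s(1 := ser ((h ^^ spine (Node a m)) y) @ r))"
      by (intro runs_append[OF 1] runs_append[OF 2] runs_append[OF 3] runs_append[OF 4] 5)
    have "s(1 := tl (s 1)) = ?s1" using Node.prems by auto
    with 6 have "runs ((Pop 1 # DROP @ MOVE 2 @ P @ BACK 2) @ [?W, Pop 1]) s
        (Suc ((6 * tsize a + 4) + ((6 * tsize m + 5) + (T (tsize y) + ((4 * tsize m + 2) + Suc (Suc (spine m * ?c)))))))
        (s(1 := ser ((h ^^ spine (Node a m)) y) @ r))"
      unfolding append_Cons append_assoc append_Nil by (intro runs_Pop) (simp del: spine.simps)
    then have "runs [?W, Pop 1] s (Suc
        (Suc ((6 * tsize a + 4) + ((6 * tsize m + 5) + (T (tsize y) + ((4 * tsize m + 2) + Suc (Suc (spine m * ?c))))))))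
        (s(1 := ser ((h ^^ spine (Node a m)) y) @ r))"
      by (intro runs_While_iter) (use Node.prems in auto)
    then show ?case by (rule runs_eqI) (use Node.prems(2) \<open>T (tsize y) \<le> T b\<close> in auto)
  qed
  show "tsize (titer h x) \<le> ?T (tsize x)" if "x \<in> E" for x
  proof (cases x)
    case (Node n y)
    then show ?thesis using E[of n y "spine n"] that by simp
  qed simp
  fix x :: tree and s :: store and r
  assume x: "x \<in> E" and s: "s 1 = ser x @ r"
  show "runs [If 1 2 [Pop 1, ?W, Pop 1] []] s (?T (tsize x)) (s(1 := ser (titer h x) @ r))"
  proof (cases x)
    case Leaf
    then show ?thesis using s
      by (intro runs_eqI[OF runs_If_neq[of s 1 2 "[]" "[]" 0 s]]) auto
  next
    case (Node n y)
    let ?s1 = "s(1 := ser n @ ser y @ r)"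
    let ?k = "tsize x"
    have "runs [?W, Pop 1] ?s1 (Suc (Suc (spine n * (20 * ?k + 20 + T (B ?k)))))
        (?s1(1 := ser ((h ^^ spine n) y) @ r))"
      by (rule loop) (use Node E[of n y] x in auto)
    moreover have "s(1 := tl (s 1)) = ?s1" using s Node by auto
    ultimately have "runs ([Pop 1, ?W, Pop 1] @ []) s (Suc (Suc (Suc (spine n * (20 * ?k + 20 + T (B ?k))))))
        (?s1(1 := ser ((h ^^ spine n) y) @ r))"
      unfolding append_Nil2 by (intro runs_Pop) simp
    then have r: "runs [If 1 2 [Pop 1, ?W, Pop 1] []] s (Suc (Suc (Suc (Suc (spine n * (20 * ?k + 20 + T (B ?k)))))))
        (?s1(1 := ser ((h ^^ spine n) y) @ r))"
      by (intro runs_If_eq) (use Node s in auto)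
    have "spine n * (20 * ?k + 20 + T (B ?k)) \<le> ?k * (20 * ?k + 20 + T (B ?k))"
      using spine_le_tsize[of n] Node by (intro mult_right_mono) auto
    then show ?thesis by (intro runs_eqI[OF r]) (use Node in auto)
  qed
qed

section \<open>Deciding equality of trees\<close>

definition tbool :: "bool \<Rightarrow> tree" where "tbool b = (if b then Node Leaf Leaf else Leaf)"

fun teq :: "tree \<Rightarrow> tree" where
  "teq Leaf = Leaf" | "teq (Node a b) = tbool (a = b)"

definition CLEAR :: "nat \<Rightarrow> com" where "CLEAR i = While i 3 [Pop i]"

lemma runs_CLEAR:
  "s i = u @ 3 # z \<Longrightarrow> 3 \<notin> set u \<Longrightarrow> runs [CLEAR i] s (2 * length u + 1) (s(i := 3 # z))"
proof (induction u arbitrary: s)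
  case Nil
  then have "runs [CLEAR i] s (Suc 0) s" unfolding CLEAR_def by (intro runs_While_end) auto
  then show ?case by (rule runs_eqI) (use Nil in auto)
next
  case (Cons a u)
  let ?s = "s(i := tl (s i))"
  have "runs [CLEAR i] ?s (2 * length u + 1) (?s(i := 3 # z))" using Cons by (intro Cons.IH) auto
  then have "runs ([Pop i] @ [CLEAR i]) s (Suc (2 * length u + 1)) (?s(i := 3 # z))"
    by (simp add: runs_Pop)
  then have "runs [CLEAR i] s (Suc (Suc (2 * length u + 1))) (?s(i := 3 # z))"
    unfolding CLEAR_def using Cons.prems by (intro runs_While_iter) auto
  then show ?case by (rule runs_eqI) auto
qed

text \<open>Emptying tape \<open>2\<close> stops the comparison. The extra symbol makes tape
  \<open>4\<close> nonempty even if its value was already used up, so that "nothing left on tape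
  \<open>4\<close>" means equality.\<close>

definition MISMATCH :: "com list" where "MISMATCH = [CLEAR 2, Push 4 1]"
definition COMPARE :: com where
  "COMPARE = While 2 3 [If 2 1 [If 4 1 [Pop 2, Pop 4] MISMATCH] [If 4 2 [Pop 2, Pop 4] MISMATCH]]"

lemma runs_COMPARE:
  "s 2 = u @ 3 # y \<Longrightarrow> s 4 = v @ 3 # z \<Longrightarrow> set u \<subseteq> {1, 2} \<Longrightarrow> set v \<subseteq> {1, 2} \<Longrightarrow>
   \<exists>w. runs [COMPARE] s (5 * length u + 10) (s(2 := 3 # y, 4 := w @ 3 # z)) \<and>
     set w \<subseteq> {1, 2} \<and> (w = [] \<longleftrightarrow> u = v) \<and> length w \<le> Suc (length v)"
proof (induction u arbitrary: s v)
  case Nil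
  then have "runs [COMPARE] s (Suc 0) s" unfolding COMPARE_def by (intro runs_While_end) auto
  then have "runs [COMPARE] s (5 * length [] + 10) (s(2 := 3 # y, 4 := v @ 3 # z))"
    by (rule runs_eqI) (use Nil in auto)
  then show ?case
    by (intro exI[of _ v] conjI, assumption) (use Nil in auto)
next
  case (Cons a u)
  have a: "a = 1 \<or> a = 2" using Cons.prems by auto
  let ?b = "[If 4 a [Pop 2, Pop 4] MISMATCH]"
  have unfold: "runs [COMPARE] s (Suc (Suc (Suc t))) s'"
    if "runs ((if top_of (s 4) = a then [Pop 2, Pop 4] else MISMATCH) @ [COMPARE]) s t s'" for t s'
  proof -
    have "runs (?b @ [COMPARE]) s (Suc t) s'"
      unfolding append_Cons append_Nil by (rule runs_If[OF that])
    then have "runs ([If 2 1 [If 4 1 [Pop 2, Pop 4] MISMATCH] [If 4 2 [Pop 2, Pop 4] MISMATCH]] @ [COMPARE])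
        s (Suc (Suc t)) s'"
      unfolding append_Cons append_Nil by - (rule runs_If, use a Cons.prems(1) in auto)
    then show ?thesis unfolding COMPARE_def using a Cons.prems(1) by (intro runs_While_iter) auto
  qed
  show ?case
  proof (cases "top_of (s 4) = a")
    case True
    then obtain v' where v: "v = a # v'" using a Cons.prems(2) by (cases v) auto
    let ?s = "s(2 := u @ 3 # y, 4 := v' @ 3 # z)"
    obtain w where w: "runs [COMPARE] ?s (5 * length u + 10) (?s(2 := 3 # y, 4 := w @ 3 # z))"
      "set w \<subseteq> {1, 2}" "w = [] \<longleftrightarrow> u = v'" "length w \<le> Suc (length v')"
    proof -
      have "\<exists>w. runs [COMPARE] ?s (5 * length u + 10) (?s(2 := 3 # y, 4 := w @ 3 # z)) \<and>
          set w \<subseteq> {1, 2} \<and> (w = [] \<longleftrightarrow> u = v') \<and> length w \<le> Suc (length v')"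
        by (rule Cons.IH) (use Cons.prems v in auto)
      then show ?thesis by (elim exE conjE) (rule that)
    qed
    have e: "(s(2 := tl (s 2)))(4 := tl ((s(2 := tl (s 2))) 4)) = ?s" using Cons.prems v by auto
    have "runs [Pop 2, Pop 4, COMPARE] s (Suc (Suc (5 * length u + 10))) (?s(2 := 3 # y, 4 := w @ 3 # z))"
      by (intro runs_Pop) (use w(1) e in simp)
    then have "runs [COMPARE] s (Suc (Suc (Suc (Suc (Suc (5 * length u + 10)))))) (?s(2 := 3 # y, 4 := w @ 3 # z))"
      using True by (intro unfold) simp
    then have "runs [COMPARE] s (5 * length (a # u) + 10) (s(2 := 3 # y, 4 := w @ 3 # z))"
      by (rule runs_eqI) auto
    then show ?thesis
      by (intro exI[of _ w] conjI, assumption) (use w v in auto)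
  next
    case False
    then have ne: "a # u \<noteq> v" using Cons.prems(2) by auto
    let ?s1 = "s(2 := 3 # y)"
    let ?s2 = "s(2 := 3 # y, 4 := 1 # v @ 3 # z)"
    have "runs [COMPARE] ?s2 (Suc 0) ?s2" unfolding COMPARE_def by (intro runs_While_end) auto
    then have 1: "runs [Push 4 1, COMPARE] ?s1 (Suc (Suc 0)) ?s2"
      using Cons.prems(2) by (intro runs_Push) simp
    have "runs [CLEAR 2] s (2 * length (a # u) + 1) ?s1"
      using Cons.prems by (intro runs_CLEAR) auto
    from runs_append[OF this 1]
    have "runs (MISMATCH @ [COMPARE]) s (2 * length (a # u) + 1 + Suc (Suc 0)) ?s2"
      by (simp add: MISMATCH_def)
    then have "runs [COMPARE] s (Suc (Suc (Suc (2 * length (a # u) + 1 + Suc (Suc 0))))) ?s2"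
      using False by (intro unfold) simp
    then have "runs [COMPARE] s (5 * length (a # u) + 10) (s(2 := 3 # y, 4 := (1 # v) @ 3 # z))"
      by (rule runs_eqI) auto
    then show ?thesis
      by (intro exI[of _ "1 # v"] conjI, assumption) (use ne Cons.prems(4) in auto)
  qed
qed

lemma impl_teq:
  "impl D teq [If 1 2 (Pop 1 # MOVE 2 @ MOVE 4 @ [COMPARE, Pop 2,
      If 4 3 [Pop 4, Push 1 1, Push 1 1, Push 1 2] [CLEAR 4, Pop 4, Push 1 1]]) []] (\<lambda>n. 20 * n + 60)"
  (is "impl D teq [If 1 2 (Pop 1 # MOVE 2 @ MOVE 4 @ [COMPARE, Pop 2, ?If]) []] ?T")
proof (rule implI)
  show "wf_prog [If 1 2 (Pop 1 # MOVE 2 @ MOVE 4 @ [COMPARE, Pop 2, ?If]) []]"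
    using wf_macros(2)[of 2] wf_macros(2)[of 4]
    by (auto simp: ntapes_def nsyms_def COMPARE_def MISMATCH_def CLEAR_def)
  show "tsize (teq x) \<le> ?T (tsize x)" for x by (cases x) (auto simp: tbool_def)
  fix x :: tree and s :: store and r assume s: "s 1 = ser x @ r"
  show "runs [If 1 2 (Pop 1 # MOVE 2 @ MOVE 4 @ [COMPARE, Pop 2, ?If]) []] s (?T (tsize x)) (s(1 := ser (teq x) @ r))"
  proof (cases x)
    case Leaf
    then show ?thesis using s
      by (intro runs_eqI[OF runs_If_neq[of s 1 2 "[]" "[]" 0 s]]) auto
  next
    case (Node a b)
    let ?o = "s(1 := ser (teq x) @ r)"
    let ?s1 = "s(1 := ser a @ ser b @ r)"
    let ?s2 = "s(1 := ser b @ r, 2 := rev (ser a) @ 3 # s 2)"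
    let ?s3 = "s(1 := r, 2 := rev (ser a) @ 3 # s 2, 4 := rev (ser b) @ 3 # s 4)"
    obtain w where w: "runs [COMPARE] ?s3 (5 * length (rev (ser a)) + 10) (?s3(2 := 3 # s 2, 4 := w @ 3 # s 4))"
      "set w \<subseteq> {1, 2}" "w = [] \<longleftrightarrow> rev (ser a) = rev (ser b)" "length w \<le> Suc (length (rev (ser b)))"
      using runs_COMPARE[of ?s3 "rev (ser a)" "s 2" "rev (ser b)" "s 4"] set_ser[of a] set_ser[of b] by auto
    have weq: "w = [] \<longleftrightarrow> a = b" using w(3) by (simp add: ser_inject)
    let ?s4 = "s(1 := r, 2 := 3 # s 2, 4 := w @ 3 # s 4)"
    let ?s5 = "s(1 := r, 4 := w @ 3 # s 4)"
    have 1: "runs (MOVE 2) ?s1 (6 * tsize a + 5) ?s2"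
      by (rule runs_eqI[OF runs_MOVE[where r = "ser b @ r"]]) auto
    have 2: "runs (MOVE 4) ?s2 (6 * tsize b + 5) ?s3"
      by (rule runs_eqI[OF runs_MOVE[where r = r]]) auto
    have 3: "runs [COMPARE] ?s3 (5 * tsize a + 10) ?s4"
      by (rule runs_eqI[OF w(1)]) auto
    have 5: "runs [?If] ?s5 (2 * tsize b + 20) ?o"
    proof (cases "w = []")
      case True
      have "runs ([Pop 4, Push 1 1, Push 1 1, Push 1 2] @ []) ?s5 4 ?o"
        unfolding append_Nil2
        by (rule runs_eqI[OF runs_Pop[OF runs_Push[OF runs_Push[OF runs_Push[OF runs_Nil[where t = 0]]]]]])
          (use True Node weq in \<open>auto simp: tbool_def\<close>)
      then show ?thesis by (intro runs_eqI[OF runs_If_eq]) (use True in auto)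
    next
      case False
      let ?s6 = "s(1 := r, 4 := 3 # s 4)"
      have c: "runs [CLEAR 4] ?s5 (2 * length w + 1) ?s6"
        by (rule runs_eqI[OF runs_CLEAR[where u = w and z = "s 4"]]) (use w(2) in auto)
      have p: "runs [Pop 4, Push 1 1] ?s6 2 ?o"
        by (rule runs_eqI[OF runs_Pop[OF runs_Push[OF runs_Nil[where t = 0]]]])
          (use False Node weq in \<open>auto simp: tbool_def\<close>)
      have "runs ([CLEAR 4, Pop 4, Push 1 1] @ []) ?s5 (2 * length w + 1 + 2) ?o"
        using runs_append[OF c p] by simp
      moreover have "top_of (?s5 4) \<noteq> 3" using False w(2) by (cases w) auto
      ultimately show ?thesis by (intro runs_eqI[OF runs_If_neq]) (use w(4) in auto)
    qed
    have "?s4(2 := tl (?s4 2)) = ?s5" by auto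
    with 5 have 4: "runs [Pop 2, ?If] ?s4 (Suc (2 * tsize b + 20)) ?o" by (intro runs_Pop) simp
    have "runs (MOVE 2 @ MOVE 4 @ [COMPARE] @ [Pop 2, ?If]) ?s1
        ((6 * tsize a + 5) + ((6 * tsize b + 5) + ((5 * tsize a + 10) + Suc (2 * tsize b + 20)))) ?o"
      by (intro runs_append[OF 1] runs_append[OF 2] runs_append[OF 3] 4)
    moreover have "s(1 := tl (s 1)) = ?s1" using s Node by auto
    ultimately have "runs ((Pop 1 # MOVE 2 @ MOVE 4 @ [COMPARE, Pop 2, ?If]) @ []) s
        (Suc ((6 * tsize a + 5) + ((6 * tsize b + 5) + ((5 * tsize a + 10) + Suc (2 * tsize b + 20))))) ?o"
      unfolding append_Nil2 by (intro runs_Pop) simp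
    then show ?thesis by (intro runs_eqI[OF runs_If_eq]) (use Node s in auto)
  qed
qed (auto simp: mono_def)

subsection \<open>Input and output\<close>

fun tword :: "bool list \<Rightarrow> tree" where
  "tword [] = Leaf"
| "tword (b # w) = Node (tbool b) (tword w)"

lemma tsize_tword: "tsize (tword w) \<le> 4 * length w + 1"
  by (induction w) (auto simp: tbool_def)

text \<open>The scanned input shows its last letter first, which is the order in which a list is
  built. Each group of pushes is, backwards, an opening \<open>Node\<close> symbol followed by the
  code of the letter.\<close>

definition INPUT :: "com list" where
  "INPUT = [Push 1 1, While 0 0 [If 0 1 [Pop 0, Push 1 1, Push 1 2] [Pop 0, Push 1 1, Push 1 1, Push 1 2, Push 1 2]]]"

lemma runs_input_loop:
  "s 0 = bits u \<Longrightarrow> s 1 = ser (tword v) \<Longrightarrow>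
   runs [While 0 0 [If 0 1 [Pop 0, Push 1 1, Push 1 2] [Pop 0, Push 1 1, Push 1 1, Push 1 2, Push 1 2]]] s
     (7 * length u + 1) (s(0 := [], 1 := ser (tword (rev u @ v))))"
  (is "_ \<Longrightarrow> _ \<Longrightarrow> runs [?W] s _ _")
proof (induction u arbitrary: s v)
  case Nil
  then have "runs [?W] s (Suc 0) s" by (intro runs_While_end) (auto simp: bits_def)
  then show ?case by (rule runs_eqI) (use Nil in \<open>auto simp: bits_def\<close>)
next
  case (Cons b u)
  let ?s = "s(0 := bits u, 1 := ser (tword (b # v)))"
  let ?o = "s(0 := [], 1 := ser (tword (rev (b # u) @ v)))"
  have IH: "runs [?W] ?s (7 * length u + 1) ?o"
    by (rule runs_eqI[OF Cons.IH[where v = "b # v"]]) auto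
  have body: "runs [If 0 1 [Pop 0, Push 1 1, Push 1 2] [Pop 0, Push 1 1, Push 1 1, Push 1 2, Push 1 2], ?W] s
      (7 * length u + 7) ?o"
  proof (cases b)
    case True
    have "runs ([Pop 0, Push 1 1, Push 1 1, Push 1 2, Push 1 2] @ [?W]) s
        (Suc (Suc (Suc (Suc (Suc (7 * length u + 1)))))) ?o"
      unfolding append_Cons append_Nil
      by (intro runs_Pop runs_Push) (rule subst[of ?s _ "\<lambda>z. runs [?W] z (7 * length u + 1) ?o"],
        use True Cons.prems IH in \<open>auto simp: bits_def tbool_def\<close>)
    then show ?thesis by (intro runs_eqI[OF runs_If_neq]) (use True Cons.prems in \<open>auto simp: bits_def\<close>)
  next
    case False
    have "runs ([Pop 0, Push 1 1, Push 1 2] @ [?W]) s (Suc (Suc (Suc (7 * length u + 1)))) ?o"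
      unfolding append_Cons append_Nil
      by (intro runs_Pop runs_Push) (rule subst[of ?s _ "\<lambda>z. runs [?W] z (7 * length u + 1) ?o"],
        use False Cons.prems IH in \<open>auto simp: bits_def tbool_def\<close>)
    then show ?thesis by (intro runs_eqI[OF runs_If_eq]) (use False Cons.prems in \<open>auto simp: bits_def\<close>)
  qed
  have "runs [?W] s (Suc (7 * length u + 7)) ?o"
    by (rule runs_While_iter) (use Cons.prems body in \<open>auto simp: bits_def\<close>)
  then show ?case by (rule runs_eqI) auto
qed

lemma runs_INPUT: "runs INPUT (init_store w) (7 * length w + 2) ((\<lambda>_. [])(1 := ser (tword w)))"
proof -
  let ?s = "(init_store w)(1 := 1 # init_store w 1)"
  have "bits (rev w) = rev (bits w)" by (simp add: bits_def rev_map)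
  then have "runs [While 0 0 [If 0 1 [Pop 0, Push 1 1, Push 1 2] [Pop 0, Push 1 1, Push 1 1, Push 1 2, Push 1 2]]]
      ?s (7 * length (rev w) + 1) (?s(0 := [], 1 := ser (tword (rev (rev w) @ []))))"
    by (intro runs_input_loop) (auto simp: init_store_def)
  from runs_Push[OF this] show ?thesis unfolding INPUT_def
    by (rule runs_eqI) (auto simp: init_store_def)
qed

text \<open>The last push leaves \<open>2\<close> on top of tape \<open>1\<close>, so the machine
  halts in its accepting state.\<close>

definition OUTPUT :: "com list" where
  "OUTPUT = [While 1 1 [Pop 1, If 1 1 [Pop 1, Push 5 1] [Pop 1, Pop 1, Pop 1, Push 5 2]], Push 1 2]"

lemma runs_OUTPUT:
  "s 1 = ser (tword u) \<Longrightarrow> runs OUTPUT s (7 * length u + 2) (s(1 := [2, 1], 5 := rev (bits u) @ s 5))"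
proof (induction u arbitrary: s)
  case Nil
  let ?o = "s(1 := 2 # s 1)"
  have "runs OUTPUT s (Suc (Suc 0)) ?o"
    unfolding OUTPUT_def by (intro runs_While_end runs_Push) (use Nil in auto)
  then show ?case by (rule runs_eqI) (use Nil in \<open>auto simp: bits_def\<close>)
next
  case (Cons b u)
  let ?s = "s(1 := ser (tword u), 5 := (if b then 2 else 1) # s 5)"
  let ?o = "s(1 := [2, 1], 5 := rev (bits (b # u)) @ s 5)"
  let ?s1 = "s(1 := tl (s 1))"
  have IH: "runs OUTPUT ?s (7 * length u + 2) ?o"
    by (rule runs_eqI[OF Cons.IH]) (auto simp: bits_def)
  have body: "runs (If 1 1 [Pop 1, Push 5 1] [Pop 1, Pop 1, Pop 1, Push 5 2] # OUTPUT) ?s1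
      (7 * length u + 7) ?o"
  proof (cases b)
    case True
    have "runs ([Pop 1, Pop 1, Pop 1, Push 5 2] @ OUTPUT) ?s1 (Suc (Suc (Suc (Suc (7 * length u + 2))))) ?o"
      unfolding append_Cons append_Nil
      by (intro runs_Pop runs_Push) (rule subst[of ?s _ "\<lambda>z. runs OUTPUT z (7 * length u + 2) ?o"],
        use True Cons.prems IH in \<open>auto simp: tbool_def\<close>)
    then show ?thesis by (intro runs_eqI[OF runs_If_neq]) (use True Cons.prems in \<open>auto simp: tbool_def\<close>)
  next
    case False
    have "runs ([Pop 1, Push 5 1] @ OUTPUT) ?s1 (Suc (Suc (7 * length u + 2))) ?o"
      unfolding append_Cons append_Nil
      by (intro runs_Pop runs_Push) (rule subst[of ?s _ "\<lambda>z. runs OUTPUT z (7 * length u + 2) ?o"],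
        use False Cons.prems IH in \<open>auto simp: tbool_def\<close>)
    then show ?thesis by (intro runs_eqI[OF runs_If_eq]) (use False Cons.prems in \<open>auto simp: tbool_def\<close>)
  qed
  have "runs ([Pop 1, If 1 1 [Pop 1, Push 5 1] [Pop 1, Pop 1, Pop 1, Push 5 2]] @ OUTPUT) s
      (Suc (7 * length u + 7)) ?o"
    unfolding append_Cons append_Nil by (rule runs_Pop) (rule body)
  then have "runs OUTPUT s (Suc (Suc (7 * length u + 7))) ?o"
    unfolding OUTPUT_def by (intro runs_While_iter) (use Cons.prems in auto)
  then show ?case by (rule runs_eqI) auto
qed

lemma wf_IO: "wf_prog INPUT" "wf_prog OUTPUT"
  by (auto simp: INPUT_def OUTPUT_def ntapes_def nsyms_def)

theorem impl_decides:
  assumes f: "impl (range tword) f P T" and Leaf: "\<And>w. f (tword w) = tbool (w \<in> A)"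
  shows "decides_in_time (prog_tm (INPUT @ P)) A (\<lambda>n. 20 * n + 10 + 2 * T (4 * n + 1))"
  unfolding decides_in_time_def
proof (intro conjI allI)
  note F = implD[OF f]
  have wf: "wf_prog (INPUT @ P)" using wf_IO F(1) by auto
  then show "is_tm (prog_tm (INPUT @ P))" by (rule is_tm_prog_tm)
  fix w
  let ?s = "(\<lambda>_::nat. [])(1 := ser (tword w))"
  have T: "T (tsize (tword w)) \<le> T (4 * length w + 1)" using F(2) tsize_tword by (rule monoD)
  have "runs P ?s (T (tsize (tword w))) (?s(1 := ser (f (tword w)) @ []))"
    by (rule F(4)) simp_all
  from prog_tm_run[OF wf runs_append[OF runs_INPUT this]] obtain j where
    "j \<le> length w + 2 * (7 * length w + 2 + T (tsize (tword w))) + 2"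
    "tm_run (prog_tm (INPUT @ P)) w j =
      (if top_of ((?s(1 := ser (f (tword w)) @ [])) 1) = 2 then accept (prog_tm (INPUT @ P)) else reject (prog_tm (INPUT @ P)),
       tapes (?s(1 := ser (f (tword w)) @ [])))"
    by (elim exE conjE) (rule that)
  then show "\<exists>t\<le>20 * length w + 10 + 2 * T (4 * length w + 1).
      fst (tm_run (prog_tm (INPUT @ P)) w t) =
      (if w \<in> A then accept (prog_tm (INPUT @ P)) else reject (prog_tm (INPUT @ P)))"
    using T Leaf[of w] by (intro exI[of _ j]) (auto simp: tbool_def)
qed

theorem impl_computes:
  assumes f: "impl (range tword) f P T" and g: "\<And>w. f (tword w) = tword (g w)"
  shows "computes_in_time (prog_tm (INPUT @ P @ OUTPUT)) g (\<lambda>n. 20 * n + 20 + 16 * T (4 * n + 1))"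
  unfolding computes_in_time_def
proof (intro conjI allI)
  note F = implD[OF f]
  let ?P = "INPUT @ P @ OUTPUT"
  have wf: "wf_prog ?P" using wf_IO F(1) by auto
  then show "is_tm (prog_tm ?P)" by (rule is_tm_prog_tm)
  fix w
  let ?s = "(\<lambda>_::nat. [])(1 := ser (tword w))"
  let ?s1 = "(\<lambda>_::nat. [])(1 := ser (tword (g w)))"
  let ?s2 = "?s1(1 := [2, 1], 5 := rev (bits (g w)) @ ?s1 5)"
  have T: "T (tsize (tword w)) \<le> T (4 * length w + 1)" using F(2) tsize_tword by (rule monoD)
  have "runs P ?s (T (tsize (tword w))) (?s(1 := ser (f (tword w)) @ []))"
    by (rule F(4)) simp_all
  then have 1: "runs P ?s (T (tsize (tword w))) ?s1" by (rule runs_eqI) (use g in auto)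
  have 2: "runs OUTPUT ?s1 (7 * length (g w) + 2) ?s2" by (rule runs_OUTPUT) simp
  have "length u \<le> tsize (tword u)" for u by (induction u) auto
  from this[of "g w"] have len: "length (g w) \<le> T (tsize (tword w))"
    using F(3)[of "tword w", OF rangeI] g by simp
  from prog_tm_run[OF wf runs_append[OF runs_INPUT runs_append[OF 1 2]]] obtain j where j:
    "j \<le> length w + 2 * (7 * length w + 2 + (T (tsize (tword w)) + (7 * length (g w) + 2))) + 2"
    "tm_run (prog_tm ?P) w j =
      (if top_of (?s2 1) = 2 then accept (prog_tm ?P) else reject (prog_tm ?P), tapes ?s2)"
    by (elim exE conjE) (rule that)
  have "last (tapes ?s2) = mk_tape (rev (bits (g w)))"
    unfolding tapes_def by (subst last_map) (auto simp: ntapes_def)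
  then have "fst (last (tapes ?s2)) = word_contents (g w)"
    using mk_tape_bits[of "g w"] unfolding bits_def by (metis fst_conv)
  then show "\<exists>t\<le>20 * length w + 20 + 16 * T (4 * length w + 1).
      fst (tm_run (prog_tm ?P) w t) = accept (prog_tm ?P) \<and>
      fst (last (snd (tm_run (prog_tm ?P) w t))) = word_contents (g w)"
    using j T len by (intro exI[of _ j]) auto
qed

section \<open>Polynomial-time functions on encodable types\<close>

lemma poly_nat_mono: "m \<le> n \<Longrightarrow> poly (p :: nat poly) m \<le> poly p n"
  by (induction p) (auto intro!: add_mono mult_mono)

definition pbd :: "(nat \<Rightarrow> nat) \<Rightarrow> bool" where
  "pbd T \<longleftrightarrow> (\<exists>p :: nat poly. \<forall>n. T n \<le> poly p n)"

lemma pbdI: "(\<And>n. T n \<le> poly p n) \<Longrightarrow> pbd T" unfolding pbd_def by blast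

lemma pbd_poly: "pbd (poly p)" by (rule pbdI[of _ p]) simp
lemma pbd_const: "pbd (\<lambda>_. c)" by (rule pbdI[of _ "[:c:]"]) simp
lemma pbd_id: "pbd (\<lambda>n. n)" by (rule pbdI[of _ "[:0, 1:]"]) simp
lemma pbd_add: "pbd f \<Longrightarrow> pbd g \<Longrightarrow> pbd (\<lambda>n. f n + g n)"
  unfolding pbd_def by (metis add_mono poly_add)
lemma pbd_mult: "pbd f \<Longrightarrow> pbd g \<Longrightarrow> pbd (\<lambda>n. f n * g n)"
  unfolding pbd_def by (metis mult_le_mono poly_mult)
lemma pbd_Suc: "pbd f \<Longrightarrow> pbd (\<lambda>n. Suc (f n))"
  using pbd_add[OF _ pbd_const[of 1]] by simp
lemma pbd_comp: "pbd f \<Longrightarrow> pbd g \<Longrightarrow> pbd (\<lambda>n. f (g n))"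
  unfolding pbd_def by (metis order_trans poly_nat_mono poly_pcompose)

lemmas pbd_poly_comp = pbd_comp[OF pbd_poly]

lemmas pbd_intros = pbd_const pbd_id pbd_poly pbd_add pbd_mult pbd_Suc

section \<open>Types coded as trees\<close>

class enc =
  fixes enc :: "'a \<Rightarrow> tree"
  assumes enc_inject: "enc x = enc y \<longleftrightarrow> x = y"

abbreviation sz :: "'a :: enc \<Rightarrow> nat" where "sz x \<equiv> tsize (enc x)"

instantiation bool :: enc begin
definition "enc_bool = tbool"
instance by standard (auto simp: enc_bool_def tbool_def)
end

instantiation prod :: (enc, enc) enc begin
definition "enc_prod p = Node (enc (fst p)) (enc (snd p))"
instance by standard (auto simp: enc_prod_def enc_inject prod_eq_iff)
end

instantiation list :: (enc) enc begin
primrec enc_list :: "'a list \<Rightarrow> tree" where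
  "enc_list [] = Leaf" | "enc_list (x # xs) = Node (enc x) (enc_list xs)"
instance
proof
  show "enc xs = enc ys \<longleftrightarrow> xs = ys" for xs ys :: "'a list"
  proof (induction xs arbitrary: ys)
    case Nil
    then show ?case by (cases ys) auto
  next
    case (Cons x xs)
    then show ?case by (cases ys) (auto simp: enc_inject)
  qed
qed
end

instantiation nat :: enc begin
primrec enc_nat :: "nat \<Rightarrow> tree" where
  "enc_nat 0 = Leaf" | "enc_nat (Suc n) = Node Leaf (enc_nat n)"
instance
proof
  show "enc m = enc n \<longleftrightarrow> m = n" for m n :: nat
  proof (induction m arbitrary: n)
    case 0
    then show ?case by (cases n) auto
  next
    case (Suc m)
    then show ?case by (cases n) auto
  qed
qed
end

lemma enc_Pair [simp]: "enc (a, b) = Node (enc a) (enc b)" by (simp add: enc_prod_def)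
lemma enc_bool_simps [simp]: "enc True = Node Leaf Leaf" "enc False = Leaf" by (auto simp: enc_bool_def tbool_def)
lemma enc_word: "enc w = tword w" by (induction w) (auto simp: enc_bool_def)

lemma sz_nat [simp]: "sz (n :: nat) = 2 * n + 1" by (induction n) auto
lemma sz_bool: "sz (b :: bool) \<le> 3" by (cases b) auto
lemma sz_list: "sz xs = Suc (sum_list (map (\<lambda>x. Suc (sz x)) xs))" by (induction xs) auto
lemma spine_list: "spine (enc xs) = length xs" by (induction xs) auto
lemma spine_nat: "spine (enc (n :: nat)) = n" by (induction n) auto
lemma sz_mem: "x \<in> set xs \<Longrightarrow> sz x < sz xs" by (induction xs) auto
lemma length_le_sz: "length xs < sz xs" by (induction xs) auto
lemma sz_append: "sz (xs @ ys) + 1 = sz xs + sz ys" by (induction xs) auto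
lemma sz_take: "sz (take i xs) \<le> sz xs"
  using sz_append[of "take i xs" "drop i xs"] tsize_pos[of "enc (drop i xs)"] unfolding append_take_drop_id by linarith
lemma sz_drop: "sz (drop i xs) \<le> sz xs"
  using sz_append[of "take i xs" "drop i xs"] tsize_pos[of "enc (take i xs)"] unfolding append_take_drop_id by linarith
lemma sz_rev [simp]: "sz (rev xs) = sz xs" by (simp add: sz_list flip: rev_map)
lemma sz_list_bound: "(\<And>x. x \<in> set xs \<Longrightarrow> sz x \<le> b) \<Longrightarrow> sz xs \<le> Suc (length xs * Suc b)"
proof (induction xs)
  case (Cons a xs)
  then have "sz a \<le> b" "sz xs \<le> Suc (length xs * Suc b)" by auto
  then show ?case by simp
qed simp

text \<open>The tree function is unconstrained outside the range of codes, so a program has to work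
  only on trees that encode something.\<close>

definition realizes :: "('a :: enc \<Rightarrow> 'b :: enc) \<Rightarrow> (tree \<Rightarrow> tree) \<Rightarrow> com list \<Rightarrow> (nat \<Rightarrow> nat) \<Rightarrow> bool" where
  "realizes f g P T \<longleftrightarrow> impl (range (enc :: 'a \<Rightarrow> tree)) g P T \<and> (\<forall>x. g (enc x) = enc (f x))"

definition pt :: "('a :: enc \<Rightarrow> 'b :: enc) \<Rightarrow> bool" where
  "pt f \<longleftrightarrow> (\<exists>g P. \<exists>p :: nat poly. realizes f g P (poly p))"

lemma realizesD:
  fixes f :: "'a :: enc \<Rightarrow> 'b :: enc"
  assumes "realizes f g P T"
  shows "impl (range (enc :: 'a \<Rightarrow> tree)) g P T" "g (enc x) = enc (f x)"
  using assms unfolding realizes_def by blast+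

lemma mono_poly: "mono (poly (p :: nat poly))" by (simp add: mono_def poly_nat_mono)

lemma ptI:
  fixes f :: "'a :: enc \<Rightarrow> 'b :: enc"
  assumes "impl (range (enc :: 'a \<Rightarrow> tree)) g P T" "pbd T" "\<And>x. g (enc x) = enc (f x)"
  shows "pt f"
proof -
  obtain p where "\<And>n. T n \<le> poly p n" using assms(2) unfolding pbd_def by blast
  from impl_mono[OF assms(1) this mono_poly] assms(3) show ?thesis unfolding pt_def realizes_def by blast
qed

lemma ptE:
  assumes "pt f"
  obtains g P p where "realizes f g P (poly p)"
  using assms unfolding pt_def by blast

lemma pt_sz:
  assumes "pt f"
  obtains p where "\<And>x. sz (f x) \<le> poly p (sz x)"
proof -
  obtain g P p where g: "realizes f g P (poly p)" using assms by (rule ptE)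
  show ?thesis using implD(3)[OF realizesD(1)[OF g] rangeI] by (intro that[of p]) (simp add: realizesD(2)[OF g])
qed

lemma pt_id: "pt (\<lambda>x. x)" by (rule ptI[OF impl_id]) (auto intro: pbd_intros)

lemma pt_const: "pt (\<lambda>_. c)"
  by (rule ptI[OF impl_const]) (auto intro!: pbd_intros)

lemma pt_comp:
  assumes "pt f" "pt g"
  shows "pt (\<lambda>x. g (f x))"
proof -
  obtain f' P p where "realizes f f' P (poly p)" using assms(1) by (rule ptE)
  note f = realizesD[OF this]
  obtain g' Q q where "realizes g g' Q (poly q)" using assms(2) by (rule ptE)
  note g = realizesD[OF this]
  show ?thesis
    by (rule ptI[OF impl_comp[OF f(1) g(1)]]) (auto simp: f g intro!: pbd_intros pbd_poly_comp)
qed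

lemma pt_pair:
  assumes "pt f" "pt g"
  shows "pt (\<lambda>x. (f x, g x))"
proof -
  obtain f' P p where "realizes f f' P (poly p)" using assms(1) by (rule ptE)
  note f = realizesD[OF this]
  obtain g' Q q where "realizes g g' Q (poly q)" using assms(2) by (rule ptE)
  note g = realizesD[OF this]
  show ?thesis
    by (rule ptI[OF impl_pair[OF f(1) g(1)]]) (auto simp: f g intro!: pbd_intros)
qed

lemma pt_fst: "pt f \<Longrightarrow> pt (\<lambda>x. fst (f x))"
  by (erule pt_comp) (rule ptI[OF impl_tfst], auto simp: enc_prod_def intro!: pbd_intros)

lemma pt_snd: "pt f \<Longrightarrow> pt (\<lambda>x. snd (f x))"
  by (erule pt_comp) (rule ptI[OF impl_tsnd], auto simp: enc_prod_def intro!: pbd_intros)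

lemma pt_eq:
  assumes "pt f" "pt g"
  shows "pt (\<lambda>x. f x = g x)"
proof -
  have "pt (\<lambda>p. fst p = snd (p :: 'b \<times> 'b))"
    by (rule ptI[OF impl_teq]) (auto simp: enc_prod_def enc_bool_def enc_inject intro!: pbd_intros)
  from pt_comp[OF pt_pair[OF assms] this] show ?thesis by simp
qed

lemma pt_if:
  assumes "pt b" "pt f" "pt g"
  shows "pt (\<lambda>x. if b x then f x else g x)"
proof -
  obtain b' R r where "realizes b b' R (poly r)" using assms(1) by (rule ptE)
  note b = realizesD[OF this]
  obtain f' P p where "realizes f f' P (poly p)" using assms(2) by (rule ptE)
  note f = realizesD[OF this]
  obtain g' Q q where "realizes g g' Q (poly q)" using assms(3) by (rule ptE)
  note g = realizesD[OF this]
  show ?thesis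
    by (rule ptI[OF impl_if[OF b(1) impl_subset[OF f(1)] impl_subset[OF g(1)]]]) (auto simp: b f g intro!: pbd_intros)
qed

text \<open>Values of different types may share a code; for instance a pair and a nonempty list are
  both a \<open>Node\<close> of two codes. Passing from one to the other costs nothing.\<close>

lemma pt_recode:
  assumes "\<And>x :: 'a :: enc. enc (f x) = enc x"
  shows "pt f"
  by (rule ptI[OF impl_id]) (auto simp: assms intro: pbd_intros)

lemma pt_Cons: "pt f \<Longrightarrow> pt g \<Longrightarrow> pt (\<lambda>x. f x # g x)"
  using pt_comp[OF pt_pair pt_recode[of "\<lambda>p. fst p # snd p"]] by (simp add: enc_prod_def)

lemma pt_tl: "pt f \<Longrightarrow> pt (\<lambda>x. tl (f x))"
proof (erule pt_comp, rule ptI[OF impl_tsnd])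
  show "tsnd (enc xs) = enc (tl xs)" for xs :: "'b list" by (cases xs) auto
qed (auto intro!: pbd_intros)


text \<open>Where the code of \<open>f x\<close> is a \<open>Node\<close>, the same tree is read as
  the code of \<open>dest (f x)\<close>, which has another type. Refining the domain of the branch
  makes this legitimate.\<close>

lemma pt_case_tree:
  fixes f :: "'a :: enc \<Rightarrow> 'b :: enc" and dest :: "'b \<Rightarrow> 'c :: enc"
  assumes "pt f" "pt g"
    and dest: "\<And>y. enc y \<noteq> Leaf \<Longrightarrow> enc y = enc (dest y)"
    and h: "pt (\<lambda>z. h (fst z) (snd z))"
  shows "pt (\<lambda>x. if enc (f x) = Leaf then g x else h x (dest (f x)))"
proof -
  obtain f' P p where "realizes f f' P (poly p)" using assms(1) by (rule ptE)
  note f = realizesD[OF this]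
  obtain g' Q q where "realizes g g' Q (poly q)" using assms(2) by (rule ptE)
  note g = realizesD[OF this]
  obtain h' R r where "realizes (\<lambda>z. h (fst z) (snd z)) h' R (poly r)" using h by (rule ptE)
  note h = realizesD[OF this]
  let ?D = "{x \<in> range (enc :: 'a \<Rightarrow> tree). f' x \<noteq> Leaf}"
  have D: "Node x (f' x) \<in> range (enc :: 'a \<times> 'c \<Rightarrow> tree)" if x: "x \<in> ?D" for x
  proof -
    obtain y :: 'a where y: "x = enc y" "f' x \<noteq> Leaf" using x by blast
    then have "Node x (f' x) = enc (y, dest (f y))" using dest f(2) by simp
    then show ?thesis by (metis rangeI)
  qed
  have "impl ?D f' P (poly p)" using f(1) by (rule impl_subset) auto
  note hh = impl_comp[OF impl_pair[OF impl_id this] h(1) D]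
  show ?thesis
  proof (rule ptI[OF impl_if[OF f(1) hh impl_subset[OF g(1)]]])
    show "(if f' (enc x) = Leaf then g' (enc x) else h' (Node (enc x) (f' (enc x)))) =
        enc (if enc (f x) = Leaf then g x else h x (dest (f x)))" for x
    proof (cases "enc (f x) = Leaf")
      case False
      then show ?thesis using h(2)[of "(x, dest (f x))"] by (simp add: f dest[OF False, symmetric])
    qed (simp add: f g)
  qed (auto intro!: pbd_intros pbd_poly_comp)
qed

lemma pt_case_list:
  assumes "pt f" "pt g" "pt (\<lambda>z. h (fst z) (fst (snd z)) (snd (snd z)))"
  shows "pt (\<lambda>x. case f x of [] \<Rightarrow> g x | a # l \<Rightarrow> h x a l)"
proof -
  have "pt (\<lambda>x. if enc (f x) = Leaf then g x else h x (fst (hd (f x), tl (f x))) (snd (hd (f x), tl (f x))))"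
    by (rule pt_case_tree[OF assms(1,2), where dest = "\<lambda>l. (hd l, tl l)" and h = "\<lambda>x p. h x (fst p) (snd p)"])
      (use assms(3) in \<open>auto simp: neq_Nil_conv\<close>, metis enc_list.simps(1) enc_list.simps(2) list.collapse)
  also have "(\<lambda>x. if enc (f x) = Leaf then g x else h x (fst (hd (f x), tl (f x))) (snd (hd (f x), tl (f x)))) =
      (\<lambda>x. case f x of [] \<Rightarrow> g x | a # l \<Rightarrow> h x a l)"
    by (rule ext) (auto split: list.splits)
  finally show ?thesis .
qed

lemma pt_Suc: "pt f \<Longrightarrow> pt (\<lambda>x. Suc (f x))"
  by (erule pt_comp, rule ptI[OF impl_pair[OF impl_const[of _ Leaf] impl_id]]) (auto intro!: pbd_intros)

text \<open>The loop on trees has no access to the parameter \<open>x\<close>, so \<open>x\<close>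
  is carried along in the iterated value and projected away at the end.\<close>

lemma pt_iter:
  fixes c :: "'a :: enc \<Rightarrow> 'c :: enc" and f :: "'a \<Rightarrow> 'b :: enc" and h :: "'a \<Rightarrow> 'b \<Rightarrow> 'b"
  assumes c: "pt c" and f: "pt f" and h: "pt (\<lambda>z. h (fst z) (snd z))"
    and b: "pbd b" "\<And>x i. i \<le> spine (enc (c x)) \<Longrightarrow> sz ((h x ^^ i) (f x)) \<le> b (sz x)"
  shows "pt (\<lambda>x. (h x ^^ spine (enc (c x))) (f x))"
proof -
  let ?H = "\<lambda>z. (fst z, h (fst z) (snd z))"
  have "pt ?H" by (intro pt_pair pt_fst pt_id h)
  then obtain H P p where HP: "realizes ?H H P (poly p)" by (rule ptE)
  note H = realizesD[OF HP]
  have iter: "(H ^^ i) (enc (x, y)) = enc (x, (h x ^^ i) y)" for i x y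
  proof (induction i)
    case (Suc i)
    then show ?case using H(2)[of "(x, (h x ^^ i) y)"] by simp
  qed simp
  obtain q where q: "\<And>n. b n \<le> poly q n" using b(1) unfolding pbd_def by blast
  let ?B = "\<lambda>n. Suc (n + poly q n)"
  have "impl ((\<lambda>x. enc (c x, x, f x)) ` UNIV) (titer H)
     [If 1 2 [Pop 1, While 1 1 (Pop 1 # DROP @ MOVE 2 @ P @ BACK 2), Pop 1] []]
     (\<lambda>n. n * (20 * n + 20 + poly p (?B n)) + 10 + ?B n)"
  proof (rule impl_iter[OF H(1)])
    show "mono ?B" by (auto simp: mono_def intro!: add_mono poly_nat_mono)
    fix n y i assume "Node n y \<in> range (\<lambda>x. enc (c x, x, f x))" and i: "i \<le> spine n"
    then obtain x where x: "n = enc (c x)" "y = enc (x, f x)" by auto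
    have "sz ((h x ^^ i) (f x)) \<le> poly q (sz x)"
      using b(2)[of i x] q[of "sz x"] i x by (meson order_trans)
    also have "\<dots> \<le> poly q (tsize (Node n y))" using x by (intro poly_nat_mono) simp
    finally have "tsize ((H ^^ i) y) \<le> ?B (tsize (Node n y))"
      unfolding x(2) iter using x by simp
    moreover have "(H ^^ i) y \<in> range (enc :: 'a \<times> 'b \<Rightarrow> tree)" unfolding x(2) iter by (rule rangeI)
    ultimately show "(H ^^ i) y \<in> range (enc :: 'a \<times> 'b \<Rightarrow> tree) \<and> tsize ((H ^^ i) y) \<le> ?B (tsize (Node n y))"
      by blast
  qed
  note I = this
  have "pt (\<lambda>x. (c x, x, f x))" by (intro pt_pair c f pt_id)
  then obtain K R r where KR: "realizes (\<lambda>x. (c x, x, f x)) K R (poly r)" by (rule ptE)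
  note K = realizesD[OF KR]
  have "pt (\<lambda>x. (x, (h x ^^ spine (enc (c x))) (f x)))"
  proof (rule ptI[OF impl_comp[OF K(1) I]])
    show "titer H (K (enc x)) = enc (x, (h x ^^ spine (enc (c x))) (f x))" for x
      using K(2)[of x] iter[of "spine (enc (c x))" x "f x"] by simp
    show "K x \<in> range (\<lambda>x. enc (c x, x, f x))" if "x \<in> range (enc :: 'a \<Rightarrow> tree)" for x
      using that K(2) by blast
  qed (auto intro!: pbd_intros pbd_poly_comp)
  from pt_snd[OF this] show ?thesis by simp
qed

lemma pt_funpow:
  fixes n :: "'a :: enc \<Rightarrow> nat" and f :: "'a \<Rightarrow> 'b :: enc" and h :: "'a \<Rightarrow> 'b \<Rightarrow> 'b"
  assumes "pt n" "pt f" "pt (\<lambda>z. h (fst z) (snd z))"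
    and "pbd b" "\<And>x i. i \<le> n x \<Longrightarrow> sz ((h x ^^ i) (f x)) \<le> b (sz x)"
  shows "pt (\<lambda>x. (h x ^^ n x) (f x))"
  using pt_iter[where c = n and h = h, OF assms(1-4)] assms(5) by (simp add: spine_nat)

text \<open>The fold becomes an iteration on the pair of remaining list and accumulator, run once
  per element. The size bound is needed for every prefix, since these are the intermediate
  accumulators.\<close>

lemma pt_fold:
  fixes f :: "'a :: enc \<Rightarrow> 'b :: enc" and g :: "'a \<Rightarrow> 'c :: enc list" and h :: "'a \<Rightarrow> 'c \<Rightarrow> 'b \<Rightarrow> 'b"
  assumes h: "pt (\<lambda>z. h (fst z) (fst (snd z)) (snd (snd z)))" and g: "pt g" and f: "pt f"
    and b: "pbd b" "\<And>x i. sz (fold (h x) (take i (g x)) (f x)) \<le> b (sz x)"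
  shows "pt (\<lambda>x. fold (h x) (g x) (f x))"
proof -
  let ?H = "\<lambda>x s. case fst s of [] \<Rightarrow> s | a # l \<Rightarrow> (l, h x a (snd s))"
  have iter: "(?H x ^^ i) (g x, f x) = (drop i (g x), fold (h x) (take i (g x)) (f x))" for x i
  proof (induction i)
    case (Suc i)
    show ?case
    proof (cases "i < length (g x)")
      case True
      then have "drop i (g x) = g x ! i # drop (Suc i) (g x)" "take (Suc i) (g x) = take i (g x) @ [g x ! i]"
        by (simp_all add: Cons_nth_drop_Suc take_Suc_conv_app_nth)
      then show ?thesis using Suc by simp
    next
      case False
      then show ?thesis using Suc by simp
    qed
  qed simp
  have pH: "pt (\<lambda>z. case fst (snd z) of [] \<Rightarrow> snd z | a # l \<Rightarrow> (l, h (fst z) a (snd (snd z))))"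
  proof (rule pt_case_list)
    have "pt (\<lambda>z :: ('a \<times> 'c list \<times> 'b) \<times> 'c \<times> 'c list. (fst (fst z), fst (snd z), snd (snd (fst z))))"
      by (intro pt_pair pt_fst pt_snd pt_id)
    from pt_comp[OF this h]
    show "pt (\<lambda>z :: ('a \<times> 'c list \<times> 'b) \<times> 'c \<times> 'c list.
        (snd (snd z), h (fst (fst z)) (fst (snd z)) (snd (snd (fst z)))))"
      by (intro pt_pair pt_snd pt_id) simp
  qed (intro pt_fst pt_snd pt_id)+
  obtain q where q: "\<And>x. sz (g x) \<le> poly q (sz x)" by (rule pt_sz[OF g]) (rule that)
  have "pt (\<lambda>x. (?H x ^^ spine (enc (g x))) (g x, f x))"
  proof (rule pt_iter[OF g, of "\<lambda>x. (g x, f x)" ?H "\<lambda>n. Suc (poly q n + b n)"])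
    show "pt (\<lambda>x. (g x, f x))" by (intro pt_pair g f)
    show "pbd (\<lambda>n. Suc (poly q n + b n))" by (intro pbd_intros b)
    show "sz ((?H x ^^ i) (g x, f x)) \<le> Suc (poly q (sz x) + b (sz x))" for x i
      unfolding iter using b(2)[of x i] q[of x] sz_drop[of i "g x"] by simp
  qed (use pH in simp)
  then have "pt (\<lambda>x. snd ((?H x ^^ spine (enc (g x))) (g x, f x)))" by (rule pt_snd)
  then show ?thesis unfolding iter by (simp add: spine_list)
qed

lemma pt_not:
  assumes "pt b"
  shows "pt (\<lambda>x. \<not> b x)"
proof -
  have "pt (\<lambda>x. if b x then False else True)" by (intro pt_if pt_const assms)
  also have "(\<lambda>x. if b x then False else True) = (\<lambda>x. \<not> b x)" by auto
  finally show ?thesis .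
qed

lemma pt_conj:
  assumes "pt b" "pt c"
  shows "pt (\<lambda>x. b x \<and> c x)"
proof -
  have "pt (\<lambda>x. if b x then c x else False)" by (intro pt_if pt_const assms)
  also have "(\<lambda>x. if b x then c x else False) = (\<lambda>x. b x \<and> c x)" by auto
  finally show ?thesis .
qed

lemma pt_disj:
  assumes "pt b" "pt c"
  shows "pt (\<lambda>x. b x \<or> c x)"
proof -
  have "pt (\<lambda>x. if b x then True else c x)" by (intro pt_if pt_const assms)
  also have "(\<lambda>x. if b x then True else c x) = (\<lambda>x. b x \<or> c x)" by auto
  finally show ?thesis .
qed

lemma pt_imp:
  assumes "pt b" "pt c"
  shows "pt (\<lambda>x. b x \<longrightarrow> c x)"
proof -
  have "pt (\<lambda>x. if b x then c x else True)" by (intro pt_if pt_const assms)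
  also have "(\<lambda>x. if b x then c x else True) = (\<lambda>x. b x \<longrightarrow> c x)" by auto
  finally show ?thesis .
qed


section \<open>Lists and arithmetic in polynomial time\<close>

lemma pt_rev: 
  assumes "pt f"
  shows "pt (\<lambda>x. rev (f x))"
proof -
  have "pt (\<lambda>xs :: 'b list. fold (\<lambda>a l. a # l) xs [])"
  proof (rule pt_fold[where b = "\<lambda>n. n"])
    show "sz (fold (\<lambda>a l. a # l) (take i xs) []) \<le> sz xs" for i and xs :: "'b list"
      using sz_take[of i xs] by (simp add: fold_Cons_rev)
  qed (intro pt_Cons pt_fst pt_snd pt_id pt_const pbd_intros)+
  from pt_comp[OF assms this] show ?thesis by (simp add: fold_Cons_rev)
qed

lemma pt_append:
  assumes "pt f" "pt g"
  shows "pt (\<lambda>x. f x @ g x)"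
proof -
  have "pt (\<lambda>p :: 'b list \<times> 'b list. fold (\<lambda>a l. a # l) (rev (fst p)) (snd p))"
  proof (rule pt_fold[where b = "\<lambda>n. n"])
    show "sz (fold (\<lambda>a l. a # l) (take i (rev (fst p))) (snd p)) \<le> sz p" for i and p :: "'b list \<times> 'b list"
      using sz_take[of i "rev (fst p)"] sz_append[of "rev (take i (rev (fst p)))" "snd p"]
      by (cases p) (simp add: fold_Cons_rev)
  qed (intro pt_Cons pt_rev pt_fst pt_snd pt_id pbd_intros)+
  from pt_comp[OF pt_pair[OF assms] this] show ?thesis by (simp add: fold_Cons_rev)
qed

lemma pt_map:
  fixes g :: "'a :: enc \<Rightarrow> 'b :: enc list"
  assumes h: "pt (\<lambda>z. h (fst z) (snd z))" and g: "pt g"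
  shows "pt (\<lambda>x. map (h x) (g x))"
proof -
  obtain p where p: "\<And>z. sz (h (fst z) (snd z)) \<le> poly p (sz z)" by (rule pt_sz[OF h]) (rule that)
  obtain q where q: "\<And>x. sz (g x) \<le> poly q (sz x)" by (rule pt_sz[OF g]) (rule that)
  have f: "fold (\<lambda>a l. h x a # l) xs ys = rev (map (h x) xs) @ ys" for x xs ys
    by (induction xs arbitrary: ys) auto
  have "pt (\<lambda>x. fold (\<lambda>a l. h x a # l) (g x) [])"
  proof (rule pt_fold[where b = "\<lambda>n. Suc (poly q n * Suc (poly p (Suc (n + poly q n))))"])
    have "pt (\<lambda>z :: 'a \<times> 'b \<times> 'c list. (fst z, fst (snd z)))" by (intro pt_pair pt_fst pt_snd pt_id)
    from pt_comp[OF this h] show "pt (\<lambda>z :: 'a \<times> 'b \<times> 'c list. h (fst z) (fst (snd z)) # snd (snd z))"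
      by (intro pt_Cons pt_snd pt_id) simp
    fix x i
    have "sz (fold (\<lambda>a l. h x a # l) (take i (g x)) []) = sz (map (h x) (take i (g x)))"
      by (simp only: f append_Nil2 sz_rev)
    also have "\<dots> \<le> Suc (length (map (h x) (take i (g x))) * Suc (poly p (Suc (sz x + poly q (sz x)))))"
    proof (rule sz_list_bound)
      fix y assume "y \<in> set (map (h x) (take i (g x)))"
      then obtain a where a: "a \<in> set (g x)" "y = h x a" by (auto dest: in_set_takeD)
      have "sz y \<le> poly p (sz (x, a))" using p[of "(x, a)"] a by simp
      also have "\<dots> \<le> poly p (Suc (sz x + poly q (sz x)))"
        using sz_mem[OF a(1)] q[of x] by (intro poly_nat_mono) simp
      finally show "sz y \<le> poly p (Suc (sz x + poly q (sz x)))" .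
    qed
    also have "\<dots> \<le> Suc (poly q (sz x) * Suc (poly p (Suc (sz x + poly q (sz x)))))"
      using length_le_sz[of "g x"] q[of x] by (intro Suc_le_mono[THEN iffD2] mult_right_mono) auto
    finally show "sz (fold (\<lambda>a l. h x a # l) (take i (g x)) [])
        \<le> Suc (poly q (sz x) * Suc (poly p (Suc (sz x + poly q (sz x)))))" .
  qed (intro g pt_const pbd_intros pbd_poly_comp)+
  from pt_rev[OF this] show ?thesis by (simp add: f)
qed

lemma pt_concat:
  assumes "pt f"
  shows "pt (\<lambda>x. concat (f x))"
proof -
  have f: "fold (\<lambda>a l. l @ a) xss ys = ys @ concat xss" for xss and ys :: "'b list"
    by (induction xss arbitrary: ys) auto
  have c: "sz (concat xss) \<le> sz xss" for xss :: "'b list list"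
  proof (induction xss)
    case (Cons xs xss)
    then show ?case using sz_append[of xs "concat xss"] by simp
  qed simp
  have "pt (\<lambda>xss :: 'b list list. fold (\<lambda>a l. l @ a) xss [])"
  proof (rule pt_fold[where b = "\<lambda>n. n"])
    show "sz (fold (\<lambda>a l. l @ a) (take i xss) []) \<le> sz xss" for i and xss :: "'b list list"
      using sz_take[of i xss] c[of "take i xss"] by (simp add: f)
  qed (intro pt_append pt_fst pt_snd pt_id pt_const pbd_intros)+
  from pt_comp[OF assms this] show ?thesis by (simp add: f)
qed

lemma pt_filter:
  fixes g :: "'a :: enc \<Rightarrow> 'b :: enc list"
  assumes "pt (\<lambda>z. h (fst z) (snd z))" "pt g"
  shows "pt (\<lambda>x. filter (h x) (g x))"
proof -
  have "filter P xs = concat (map (\<lambda>a. if P a then [a] else []) xs)" for P and xs :: "'b list"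
    by (induction xs) auto
  moreover have "pt (\<lambda>x. concat (map (\<lambda>a. if h x a then [a] else []) (g x)))"
    by (intro pt_concat pt_map pt_if pt_Cons pt_const pt_fst pt_snd pt_id assms)
  ultimately show ?thesis by simp
qed

lemma pt_Bex:
  fixes g :: "'a :: enc \<Rightarrow> 'b :: enc list"
  assumes "pt (\<lambda>z. h (fst z) (snd z))" "pt g"
  shows "pt (\<lambda>x. \<exists>a\<in>set (g x). h x a)"
proof -
  have "(\<exists>a\<in>set (g x). h x a) = (\<not> filter (h x) (g x) = [])" for x
    by (auto simp: filter_empty_conv)
  then show ?thesis
    by (simp only:) (intro pt_not pt_eq pt_filter pt_const assms)
qed

lemma pt_Ball:
  fixes g :: "'a :: enc \<Rightarrow> 'b :: enc list"
  assumes "pt (\<lambda>z. h (fst z) (snd z))" "pt g"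
  shows "pt (\<lambda>x. \<forall>a\<in>set (g x). h x a)"
proof -
  have "(\<forall>a\<in>set (g x). h x a) = (\<not> (\<exists>a\<in>set (g x). \<not> h x a))" for x by blast
  then show ?thesis by (simp only:) (intro pt_not pt_Bex assms)
qed

lemma pt_mem:
  assumes "pt f" "pt g"
  shows "pt (\<lambda>x. f x \<in> set (g x))"
proof -
  have "pt (\<lambda>p :: 'b \<times> 'b list. \<exists>a\<in>set (snd p). a = fst p)"
    by (intro pt_Bex pt_eq pt_fst pt_snd pt_id)
  from pt_comp[OF pt_pair[OF assms] this] show ?thesis by simp
qed

lemma pt_comp2:
  assumes "pt (\<lambda>z. F (fst z) (snd z))" "pt f" "pt g"
  shows "pt (\<lambda>x. F (f x) (g x))"
  using pt_comp[OF pt_pair[OF assms(2,3)] assms(1)] by simp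

lemma pt_comp3:
  assumes "pt (\<lambda>z. F (fst z) (fst (snd z)) (snd (snd z)))" "pt f" "pt g" "pt h"
  shows "pt (\<lambda>x. F (f x) (g x) (h x))"
  using pt_comp[OF pt_pair[OF assms(2) pt_pair[OF assms(3,4)]] assms(1)] by simp

lemma pt_length:
  assumes "pt (f :: 'a :: enc \<Rightarrow> 'b :: enc list)"
  shows "pt (\<lambda>x. length (f x))"
proof -
  have f: "fold (\<lambda>a n. Suc n) xs n = n + length xs" for xs :: "'b list" and n
    by (induction xs arbitrary: n) auto
  have "pt (\<lambda>xs :: 'b list. fold (\<lambda>a n. Suc n) xs 0)"
  proof (rule pt_fold[where b = "\<lambda>n. 2 * n + 1"])
    show "sz (fold (\<lambda>a n. Suc n) (take i xs) 0) \<le> 2 * sz xs + 1" for i and xs :: "'b list"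
      using length_le_sz[of xs] by (simp add: f)
  qed (intro pt_Suc pt_fst pt_snd pt_id pt_const pbd_intros)+
  from pt_comp[OF assms this] show ?thesis by (simp add: f)
qed

lemma pt_add:
  assumes "pt (f :: 'a :: enc \<Rightarrow> nat)" "pt g"
  shows "pt (\<lambda>x. f x + g x)"
proof -
  have "pt (\<lambda>p :: nat \<times> nat. (Suc ^^ fst p) (snd p))"
  proof (rule pt_funpow[where b = "\<lambda>n. n"])
    show "i \<le> fst p \<Longrightarrow> sz ((Suc ^^ i) (snd p)) \<le> sz p" for i and p :: "nat \<times> nat"
      by (cases p) (auto simp: add.commute)
  qed (intro pt_Suc pt_fst pt_snd pt_id pbd_intros)+
  then have "pt (\<lambda>p :: nat \<times> nat. fst p + snd p)" by (simp add: add.commute)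
  from pt_comp2[OF this assms] show ?thesis .
qed

lemma pt_mult:
  assumes "pt (f :: 'a :: enc \<Rightarrow> nat)" "pt g"
  shows "pt (\<lambda>x. f x * g x)"
proof -
  have f: "(((+) k) ^^ i) n = n + i * k" for i k n :: nat
    by (induction i) auto
  have "pt (\<lambda>p :: nat \<times> nat. (((+) (snd p)) ^^ fst p) 0)"
  proof (rule pt_funpow[where b = "\<lambda>n. 2 * (n * n) + 1"])
    show "sz ((((+) (snd p)) ^^ i) 0) \<le> 2 * (sz p * sz p) + 1" if "i \<le> fst p" for i and p :: "nat \<times> nat"
      using that mult_le_mono[of i "sz p" "snd p" "sz p"] by (cases p) (simp add: f)
  qed (intro pt_add pt_fst pt_snd pt_id pt_const pbd_intros)+
  then have "pt (\<lambda>p :: nat \<times> nat. fst p * snd p)" by (simp add: f)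
  from pt_comp2[OF this assms] show ?thesis .
qed

lemma pt_poly:
  assumes "pt (f :: 'a :: enc \<Rightarrow> nat)"
  shows "pt (\<lambda>x. poly p (f x))"
proof (induction p)
  case 0
  then show ?case by (simp add: pt_const)
next
  case (pCons a p)
  then show ?case by (simp add: pt_add pt_mult pt_const assms)
qed

lemma pt_upt:
  assumes "pt f"
  shows "pt (\<lambda>x. [0..<f x])"
proof -
  have f: "((\<lambda>l. l @ [length l]) ^^ i) [] = [0..<i]" for i by (induction i) auto
  have "pt (\<lambda>n :: nat. ((\<lambda>l. l @ [length l]) ^^ n) [])"
  proof (rule pt_funpow[where b = "\<lambda>n. Suc (n * Suc n)"])
    show "sz (((\<lambda>l. l @ [length l]) ^^ i) []) \<le> Suc (sz n * Suc (sz n))" if "i \<le> n" for i n :: nat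
    proof -
      have "sz [0..<i] \<le> Suc (length [0..<i] * Suc (sz n))"
        by (rule sz_list_bound) (use that in auto)
      also have "\<dots> \<le> Suc (sz n * Suc (sz n))" using that
        by (intro Suc_le_mono[THEN iffD2] mult_right_mono) auto
      finally show ?thesis by (simp only: f)
    qed
  qed (intro pt_append pt_length pt_Cons pt_fst pt_snd pt_id pt_const pbd_intros)+
  from pt_comp[OF assms this] show ?thesis by (simp add: f)
qed

lemma pt_take_length:
  assumes "pt (n :: 'a :: enc \<Rightarrow> nat)" "pt (f :: 'a \<Rightarrow> 'b :: enc list)"
  shows "pt (\<lambda>x. take (n x) (f x))"
proof -
  let ?h = "\<lambda>s :: 'b list \<times> 'b list. case fst s of [] \<Rightarrow> s | a # l \<Rightarrow> (l, a # snd s)"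
  have f: "(?h ^^ i) (xs, []) = (drop i xs, rev (take i xs))" for i xs
  proof (induction i)
    case (Suc i)
    show ?case
    proof (cases "i < length xs")
      case True
      then have "drop i xs = xs ! i # drop (Suc i) xs" "take (Suc i) xs = take i xs @ [xs ! i]"
        by (simp_all add: Cons_nth_drop_Suc take_Suc_conv_app_nth)
      then show ?thesis using Suc by simp
    next
      case False
      then show ?thesis using Suc by simp
    qed
  qed simp
  have "pt (\<lambda>p :: nat \<times> 'b list. (?h ^^ fst p) (snd p, []))"
  proof (rule pt_funpow[where b = "\<lambda>n. Suc (n + n)"])
    show "sz ((?h ^^ i) (snd p, [])) \<le> Suc (sz p + sz p)" for i and p :: "nat \<times> 'b list"
      using sz_drop[of i "snd p"] sz_take[of i "snd p"] by (cases p) (simp add: f)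
  qed (intro pt_case_list pt_pair pt_Cons pt_fst pt_snd pt_id pt_const pbd_intros)+
  from pt_rev[OF pt_snd[OF this]] have "pt (\<lambda>p :: nat \<times> 'b list. take (fst p) (snd p))"
    by (simp add: f)
  from pt_comp2[OF this assms] show ?thesis .
qed

lemmas pt_intros = pt_id pt_const pt_pair pt_fst pt_snd pt_if pt_eq pt_Cons pt_tl pt_case_list pt_Suc
  pt_not pt_conj pt_disj pt_imp pt_rev pt_append pt_map pt_concat pt_filter pt_Bex pt_Ball pt_mem
  pt_length pt_add pt_mult pt_poly pt_upt pt_take_length

section \<open>From polynomial-time functions to the complexity classes\<close>

lemma computes_in_time_mono:
  "computes_in_time M f T \<Longrightarrow> (\<And>n. T n \<le> T' n) \<Longrightarrow> computes_in_time M f T'"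
  unfolding computes_in_time_def by (meson order_trans)

lemma decides_in_time_mono:
  "decides_in_time M A T \<Longrightarrow> (\<And>n. T n \<le> T' n) \<Longrightarrow> decides_in_time M A T'"
  unfolding decides_in_time_def by (meson order_trans)

theorem pt_imp_poly_time_reducible:
  assumes "pt f" "\<And>w. w \<in> A \<longleftrightarrow> f w \<in> B"
  shows "poly_time_reducible A B"
proof -
  obtain g P p where r: "realizes f g P (poly p)" using assms(1) by (rule ptE)
  have "range (enc :: bool list \<Rightarrow> tree) = range tword" by (simp add: enc_word)
  then have g: "impl (range tword) g P (poly p)" "\<And>w. g (tword w) = tword (f w)"
    using realizesD[OF r] by (simp_all flip: enc_word)
  have "pbd (\<lambda>n. 20 * n + 20 + 16 * poly p (4 * n + 1))"
    by (intro pbd_intros pbd_poly_comp)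
  then obtain q where "\<And>n. 20 * n + 20 + 16 * poly p (4 * n + 1) \<le> poly q n"
    unfolding pbd_def by blast
  from computes_in_time_mono[OF impl_computes[OF g] this] assms(2)
  show ?thesis unfolding poly_time_reducible_def by blast
qed

definition ebd :: "(nat \<Rightarrow> nat) \<Rightarrow> bool" where
  "ebd T \<longleftrightarrow> (\<exists>p :: nat poly. \<forall>n. T n \<le> 2 ^ poly p n)"

lemma pbd_imp_ebd: "pbd T \<Longrightarrow> ebd T"
  unfolding pbd_def ebd_def by (meson less_exp less_imp_le order_trans)

lemma ebd_add:
  assumes "ebd f" "ebd g" shows "ebd (\<lambda>n. f n + g n)"
proof -
  obtain p q where p: "\<And>n. f n \<le> 2 ^ poly p n" and q: "\<And>n. g n \<le> 2 ^ poly q n"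
    using assms unfolding ebd_def by blast
  have "f n + g n \<le> 2 ^ poly (p + q + [:1:]) n" for n
  proof -
    have "f n + g n \<le> 2 ^ poly p n + 2 ^ poly q n" using p[of n] q[of n] by (rule add_mono)
    also have "(2::nat) ^ poly p n \<le> 2 ^ (poly p n + poly q n)" by (rule power_increasing) auto
    also have "(2::nat) ^ poly q n \<le> 2 ^ (poly p n + poly q n)" by (rule power_increasing) auto
    finally show ?thesis by simp
  qed
  then show ?thesis unfolding ebd_def by blast
qed

lemma ebd_mult:
  assumes "ebd f" "ebd g" shows "ebd (\<lambda>n. f n * g n)"
proof -
  obtain p q where p: "\<And>n. f n \<le> 2 ^ poly p n" and q: "\<And>n. g n \<le> 2 ^ poly q n"
    using assms unfolding ebd_def by blast
  have "f n * g n \<le> 2 ^ poly (p + q) n" for n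
    using mult_le_mono[OF p[of n] q[of n]] by (simp add: power_add)
  then show ?thesis unfolding ebd_def by blast
qed

lemma ebd_poly_comp: "ebd f \<Longrightarrow> ebd (\<lambda>n. poly p (f n))"
proof (induction p)
  case 0
  then show ?case by (simp add: pbd_imp_ebd pbd_const)
next
  case (pCons a p)
  then show ?case by (simp add: ebd_add ebd_mult pbd_imp_ebd pbd_const)
qed

text \<open>Exponential bounds are not closed under composition. It is enough that the inner
  function is polynomial, because the input is padded only once and all the rest is polynomial in
  the padded size.\<close>

lemma ebd_comp_pbd:
  assumes "ebd f" "pbd g" shows "ebd (\<lambda>n. f (g n))"
proof -
  obtain p where p: "\<And>n. f n \<le> 2 ^ poly p n" using assms(1) unfolding ebd_def by blast
  obtain q where q: "\<And>n. g n \<le> poly q n" using assms(2) unfolding pbd_def by blast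
  have "f (g n) \<le> 2 ^ poly (pcompose p q) n" for n
  proof -
    have "f (g n) \<le> 2 ^ poly p (g n)" by (rule p)
    also have "\<dots> \<le> 2 ^ poly p (poly q n)" by (intro power_increasing poly_nat_mono q) simp
    finally show ?thesis by (simp add: poly_pcompose)
  qed
  then show ?thesis unfolding ebd_def by blast
qed

lemma ebd_exp: "ebd (\<lambda>n. 2 ^ n)"
  unfolding ebd_def by (intro exI[of _ "[:0, 1:]"]) simp

lemmas ebd_intros = ebd_add ebd_mult ebd_poly_comp ebd_exp pbd_imp_ebd[OF pbd_const] pbd_imp_ebd[OF pbd_id]
  pbd_imp_ebd[OF pbd_poly]

text \<open>A deterministic exponential-time procedure is a polynomial-time one that is additionally
  given a unary number of exponential size.\<close>

theorem padded_pt_imp_EXPTIME: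
  fixes g :: "bool list \<times> nat \<Rightarrow> bool"
  assumes g: "pt g" and A: "\<And>w. w \<in> A \<longleftrightarrow> g (w, 2 ^ poly p (length w))"
  shows "A \<in> EXPTIME"
proof -
  let ?m = "\<lambda>w :: bool list. poly p (length w)"
  \<comment> \<open>The padding is \<open>1\<close> doubled \<open>?m w\<close> times. This loop is
    the one place where the size bound on intermediate values is exponential.\<close>
  have "pt (\<lambda>n :: nat. n + n)" by (intro pt_intros)
  then obtain H P h where "realizes (\<lambda>n :: nat. n + n) H P (poly h)" by (rule ptE)
  note H = realizesD[OF this]
  have iter: "(H ^^ i) (enc (1 :: nat)) = enc (2 ^ i :: nat)" for i
    by (induction i) (simp_all add: H(2) mult_2 del: enc_nat.simps One_nat_def)
  let ?E = "range (\<lambda>w. enc (?m w, 1 :: nat))"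
  have I: "impl ?E (titer H)
     [If 1 2 [Pop 1, While 1 1 (Pop 1 # DROP @ MOVE 2 @ P @ BACK 2), Pop 1] []]
     (\<lambda>n. n * (20 * n + 20 + poly h (2 ^ n)) + 10 + 2 ^ n)"
  proof (rule impl_iter[OF H(1)])
    show "mono (\<lambda>n. 2 ^ n :: nat)" by (auto simp: mono_def intro: power_increasing)
    fix n y i assume "Node n y \<in> ?E" and i: "i \<le> spine n"
    then obtain w where w: "n = enc (?m w)" "y = enc (1 :: nat)" by auto
    have "i \<le> ?m w" using i w by (simp add: spine_nat)
    then have "(2 :: nat) ^ i \<le> 2 ^ ?m w" by (rule power_increasing) simp
    moreover have "(1 :: nat) \<le> 2 ^ ?m w" "(2 :: nat) ^ (?m w + 2) = 4 * 2 ^ ?m w"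
      by (simp_all add: power_add)
    ultimately have "2 * 2 ^ i + 1 \<le> (2 :: nat) ^ (?m w + 2)" by linarith
    also have "\<dots> \<le> 2 ^ tsize (Node n y)" by (rule power_increasing) (auto simp: w)
    finally have "sz (2 ^ i :: nat) \<le> 2 ^ tsize (Node n y)" by simp
    then show "(H ^^ i) y \<in> range (enc :: nat \<Rightarrow> tree) \<and> tsize ((H ^^ i) y) \<le> 2 ^ tsize (Node n y)"
      unfolding w(2) iter by blast
  qed
  have "pt (\<lambda>w. (?m w, 1 :: nat))" by (intro pt_intros)
  then obtain K Q k where "realizes (\<lambda>w. (?m w, 1 :: nat)) K Q (poly k)" by (rule ptE)
  note K = realizesD[OF this]
  obtain G R r where "realizes g G R (poly r)" using g by (rule ptE)
  note G = realizesD[OF this]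
  have KE: "K x \<in> ?E" if "x \<in> range (enc :: bool list \<Rightarrow> tree)" for x using that K(2) by blast
  have pad: "titer H (K (enc w)) = enc (2 ^ ?m w :: nat)" for w
  proof -
    have "K (enc w) = Node (enc (?m w)) (enc (1 :: nat))" using K(2)[of w] by simp
    then show ?thesis using iter[of "?m w"] by (simp only: titer.simps spine_nat)
  qed
  have GE: "Node x (titer H (K x)) \<in> range (enc :: bool list \<times> nat \<Rightarrow> tree)"
    if "x \<in> range (enc :: bool list \<Rightarrow> tree)" for x
  proof -
    obtain w :: "bool list" where "x = enc w" using \<open>x \<in> range enc\<close> by blast
    then have "Node x (titer H (K x)) = enc (w, 2 ^ ?m w :: nat)" using pad by simp
    then show ?thesis by (metis rangeI)
  qed
  note J = impl_comp[OF impl_pair[OF impl_id impl_comp[OF K(1) I KE]] G(1) GE]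
  have "range (enc :: bool list \<Rightarrow> tree) = range tword" by (simp add: enc_word)
  note J' = J[unfolded this]
  have dec: "G (Node (tword w) (titer H (K (tword w)))) = tbool (w \<in> A)" for w
    using G(2)[of "(w, 2 ^ ?m w)"] pad[of w] A[of w] by (simp add: enc_word enc_bool_def)
  obtain M T where M: "decides_in_time M A (\<lambda>n. 20 * n + 10 + 2 * T (4 * n + 1))" "ebd T"
    using impl_decides[OF J' dec]
    by (rule that) (assumption | intro ebd_intros ebd_comp_pbd[OF ebd_exp pbd_poly])+
  have "ebd (\<lambda>n. 20 * n + 10 + 2 * T (4 * n + 1))"
    by (intro ebd_intros ebd_comp_pbd[OF M(2)] pbd_intros)
  then obtain q where "\<And>n. 20 * n + 10 + 2 * T (4 * n + 1) \<le> 2 ^ poly q n" unfolding ebd_def by blast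
  from decides_in_time_mono[OF M(1) this] show ?thesis unfolding EXPTIME_def by blast
qed

lemma EXPTIME_imp_decidable: "A \<in> EXPTIME \<Longrightarrow> decidable A"
  unfolding EXPTIME_def decides_in_time_def decidable_def by blast

section \<open>Exponential-time decision procedure\<close>

text \<open>In \<open>(m, sw, s, t)\<close> the attacker moves in \<open>s\<close>, or in \<open>t\<close> if \<open>sw\<close>; keeping the pair in
  place lets the two stacks be read as one stack of pairs. The flags switch on, in the mode
  \<open>m = True\<close>: the termination test, the readiness test, one final change of sides, and changing
  sides at any time.\<close>

definition msim :: "bool \<Rightarrow> bool \<Rightarrow> bool \<Rightarrow> bool \<Rightarrow> ('s, 'a) lts \<Rightarrow> (bool \<times> bool \<times> 's \<times> 's) set \<Rightarrow> bool" where
  "msim ce cr s1 s2 L W \<longleftrightarrow> (\<forall>(m, sw, s, t) \<in> W. s \<in> states L \<and> t \<in> states L \<and>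
     (if sw then \<forall>a t'. (t, a, t') \<in> trans L \<longrightarrow> (\<exists>s'. (s, a, s') \<in> trans L \<and> (m, sw, s', t') \<in> W)
      else \<forall>a s'. (s, a, s') \<in> trans L \<longrightarrow> (\<exists>t'. (t, a, t') \<in> trans L \<and> (m, sw, s', t') \<in> W)) \<and>
     (m \<longrightarrow> (ce \<longrightarrow> (initials L s = {} \<longleftrightarrow> initials L t = {})) \<and>
       (cr \<longrightarrow> initials L s = initials L t) \<and>
       (s1 \<longrightarrow> (False, \<not> sw, s, t) \<in> W) \<and> (s2 \<longrightarrow> (True, \<not> sw, s, t) \<in> W)))"

definition mpre :: "bool \<Rightarrow> bool \<Rightarrow> bool \<Rightarrow> bool \<Rightarrow> ('s, 'a) lts \<Rightarrow> 's \<Rightarrow> 's \<Rightarrow> bool" where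
  "mpre ce cr s1 s2 L s t \<longleftrightarrow> (\<exists>W. msim ce cr s1 s2 L W \<and> (True, False, s, t) \<in> W)"

lemma msimD:
  assumes "msim ce cr s1 s2 L W" "(m, sw, s, t) \<in> W"
  shows "s \<in> states L" "t \<in> states L"
    "sw \<Longrightarrow> (t, a, t') \<in> trans L \<Longrightarrow> \<exists>s'. (s, a, s') \<in> trans L \<and> (m, sw, s', t') \<in> W"
    "\<not> sw \<Longrightarrow> (s, a, s') \<in> trans L \<Longrightarrow> \<exists>t'. (t, a, t') \<in> trans L \<and> (m, sw, s', t') \<in> W"
    "m \<Longrightarrow> ce \<Longrightarrow> initials L s = {} \<longleftrightarrow> initials L t = {}"
    "m \<Longrightarrow> cr \<Longrightarrow> initials L s = initials L t"
    "m \<Longrightarrow> s1 \<Longrightarrow> (False, \<not> sw, s, t) \<in> W"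
    "m \<Longrightarrow> s2 \<Longrightarrow> (True, \<not> sw, s, t) \<in> W"
  using bspec[OF assms(1)[unfolded msim_def] assms(2)] unfolding prod.case by (cases sw; auto)+

lemma msimI:
  assumes "\<And>m sw s t. (m, sw, s, t) \<in> W \<Longrightarrow> s \<in> states L \<and> t \<in> states L"
    and "\<And>m s t a s'. (m, False, s, t) \<in> W \<Longrightarrow> (s, a, s') \<in> trans L \<Longrightarrow>
      \<exists>t'. (t, a, t') \<in> trans L \<and> (m, False, s', t') \<in> W"
    and "\<And>m s t a t'. (m, True, s, t) \<in> W \<Longrightarrow> (t, a, t') \<in> trans L \<Longrightarrow>
      \<exists>s'. (s, a, s') \<in> trans L \<and> (m, True, s', t') \<in> W"
    and "\<And>sw s t. (True, sw, s, t) \<in> W \<Longrightarrow>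
      (ce \<longrightarrow> (initials L s = {} \<longleftrightarrow> initials L t = {})) \<and> (cr \<longrightarrow> initials L s = initials L t) \<and>
      (s1 \<longrightarrow> (False, \<not> sw, s, t) \<in> W) \<and> (s2 \<longrightarrow> (True, \<not> sw, s, t) \<in> W)"
  shows "msim ce cr s1 s2 L W"
  unfolding msim_def
proof (rule ballI, clarify)
  fix m sw s t assume w: "(m, sw, s, t) \<in> W"
  show "s \<in> states L \<and> t \<in> states L \<and>
     (if sw then \<forall>a t'. (t, a, t') \<in> trans L \<longrightarrow> (\<exists>s'. (s, a, s') \<in> trans L \<and> (m, sw, s', t') \<in> W)
      else \<forall>a s'. (s, a, s') \<in> trans L \<longrightarrow> (\<exists>t'. (t, a, t') \<in> trans L \<and> (m, sw, s', t') \<in> W)) \<and>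
     (m \<longrightarrow> (ce \<longrightarrow> (initials L s = {} \<longleftrightarrow> initials L t = {})) \<and>
       (cr \<longrightarrow> initials L s = initials L t) \<and>
       (s1 \<longrightarrow> (False, \<not> sw, s, t) \<in> W) \<and> (s2 \<longrightarrow> (True, \<not> sw, s, t) \<in> W))"
    using assms(1)[OF w] assms(2)[of m s t] assms(3)[of m s t] assms(4)[of sw s t] w
    by (cases sw; cases m) simp_all
qed

lemma msim_left:
  assumes "msim ce cr s1 s2 L W"
  shows "simulation L {(s, t). (m, False, s, t) \<in> W}"
  unfolding simulation_def using msimD(1,2,4)[OF assms, of m False] by auto

lemma msim_right:
  assumes "msim ce cr s1 s2 L W"
  shows "simulation L {(t, s). (m, True, s, t) \<in> W}"
  unfolding simulation_def using msimD(1-3)[OF assms, of m True] by auto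

lemma simulation_Un: "simulation L R \<Longrightarrow> simulation L R' \<Longrightarrow> simulation L (R \<union> R')"
  unfolding simulation_def by (simp add: ball_Un) blast

lemma sim_preorder_mpre: "sim_preorder L s t \<longleftrightarrow> mpre False False False False L s t"
proof
  assume "sim_preorder L s t"
  then obtain R where "simulation L R" "(s, t) \<in> R" unfolding sim_preorder_def by blast
  then show "mpre False False False False L s t" unfolding mpre_def
    by (intro exI[of _ "{(True, False, s, t) | s t. (s, t) \<in> R}"]) (auto simp: msim_def simulation_def; blast)
next
  assume "mpre False False False False L s t"
  then obtain W where W: "msim False False False False L W" "(True, False, s, t) \<in> W"
    unfolding mpre_def by blast
  have "simulation L {(s, t). (True, False, s, t) \<in> W}" by (rule msim_left[OF W(1)])
  with W(2) show "sim_preorder L s t" unfolding sim_preorder_def by blast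
qed

lemma completed_sim_preorder_mpre: "completed_sim_preorder L s t \<longleftrightarrow> mpre True False False False L s t"
proof
  assume "completed_sim_preorder L s t"
  then obtain R where "completed_simulation L R" "(s, t) \<in> R" unfolding completed_sim_preorder_def by blast
  then show "mpre True False False False L s t" unfolding mpre_def
    by (intro exI[of _ "{(True, False, s, t) | s t. (s, t) \<in> R}"])
      (auto simp: msim_def completed_simulation_def simulation_def; blast)
next
  assume "mpre True False False False L s t"
  then obtain W where W: "msim True False False False L W" "(True, False, s, t) \<in> W"
    unfolding mpre_def by blast
  have "completed_simulation L {(s, t). (True, False, s, t) \<in> W}"
    unfolding completed_simulation_def using msim_left[OF W(1)] msimD(5)[OF W(1)] by auto
  with W(2) show "completed_sim_preorder L s t" unfolding completed_sim_preorder_def by blast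
qed

lemma ready_sim_preorder_mpre: "ready_sim_preorder L s t \<longleftrightarrow> mpre False True False False L s t"
proof
  assume "ready_sim_preorder L s t"
  then obtain R where "ready_simulation L R" "(s, t) \<in> R" unfolding ready_sim_preorder_def by blast
  then show "mpre False True False False L s t" unfolding mpre_def
    by (intro exI[of _ "{(True, False, s, t) | s t. (s, t) \<in> R}"])
      (auto simp: msim_def ready_simulation_def simulation_def; blast)
next
  assume "mpre False True False False L s t"
  then obtain W where W: "msim False True False False L W" "(True, False, s, t) \<in> W"
    unfolding mpre_def by blast
  have "ready_simulation L {(s, t). (True, False, s, t) \<in> W}"
    unfolding ready_simulation_def using msim_left[OF W(1)] msimD(6)[OF W(1)] by auto
  with W(2) show "ready_sim_preorder L s t" unfolding ready_sim_preorder_def by blast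
qed

text \<open>Mode \<open>True\<close> plays in \<open>R\<close>; mode \<open>False\<close>, with the
  sides switched, plays in \<open>R'\<close>. The flag \<open>s1\<close> is the inclusion of
  \<open>R\<inverse>\<close> in \<open>R'\<close>.\<close>

lemma two_nested_sim_preorder_mpre: "two_nested_sim_preorder L s t \<longleftrightarrow> mpre False False True False L s t"
proof
  assume "two_nested_sim_preorder L s t"
  then obtain R R' where R: "simulation L R" "simulation L R'" "R\<inverse> \<subseteq> R'" "(s, t) \<in> R"
    unfolding two_nested_sim_preorder_def two_nested_simulation_def by blast
  let ?W = "{(True, False, s, t) | s t. (s, t) \<in> R} \<union> {(False, True, s, t) | s t. (t, s) \<in> R'}"
  have "msim False False True False L ?W"
    using R(1,2,3) unfolding msim_def simulation_def by (auto; blast)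
  with R(4) show "mpre False False True False L s t" unfolding mpre_def by blast
next
  assume "mpre False False True False L s t"
  then obtain W where W: "msim False False True False L W" "(True, False, s, t) \<in> W"
    unfolding mpre_def by blast
  let ?R = "{(s, t). (True, False, s, t) \<in> W}" and ?R' = "{(t, s). (False, True, s, t) \<in> W}"
  have "simulation L ?R" by (rule msim_left[OF W(1)])
  moreover have "simulation L ?R'" by (rule msim_right[OF W(1)])
  moreover have "?R\<inverse> \<subseteq> ?R'" using msimD(7)[OF W(1)] by fastforce
  ultimately show "two_nested_sim_preorder L s t"
    using W(2) unfolding two_nested_sim_preorder_def two_nested_simulation_def by blast
qed

lemma bisimilar_mpre: "bisimilar L s t \<longleftrightarrow> mpre False False False True L s t"
proof
  assume "bisimilar L s t"
  then obtain R where R: "simulation L R" "R\<inverse> = R" "(s, t) \<in> R"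
    unfolding bisimilar_def bisimulation_def by blast
  have sym: "(u, v) \<in> R \<longleftrightarrow> (v, u) \<in> R" for u v using R(2) by blast
  let ?W = "{(True, sw, s, t) | sw s t. (s, t) \<in> R}"
  have "msim False False False True L ?W"
    using R(1) sym unfolding msim_def simulation_def by (auto; blast)
  with R(3) show "mpre False False False True L s t" unfolding mpre_def by blast
next
  assume "mpre False False False True L s t"
  then obtain W where W: "msim False False False True L W" "(True, False, s, t) \<in> W"
    unfolding mpre_def by blast
  \<comment> \<open>In switched positions the attacker moves in the second component. Reading these
    pairs backwards makes both halves simulations, and the free change of sides makes the union
    symmetric.\<close>
  let ?R = "{(s, t). (True, False, s, t) \<in> W \<or> (True, True, t, s) \<in> W}"
  have "?R = {(s, t). (True, False, s, t) \<in> W} \<union> {(t, s). (True, True, s, t) \<in> W}" by auto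
  then have "simulation L ?R"
    using simulation_Un[OF msim_left[OF W(1), of True] msim_right[OF W(1), of True]] by simp
  moreover have "?R\<inverse> = ?R" using msimD(8)[OF W(1), of True True] msimD(8)[OF W(1), of True False] by auto
  ultimately show "bisimilar L s t"
    using W(2) unfolding bisimilar_def bisimulation_def by blast
qed

subsection \<open>Summaries of the game on paired stacks\<close>

lemma pda_trans_Cons:
  "((p, X # \<gamma>), a, c) \<in> trans (pda_lts P) \<longleftrightarrow>
     \<gamma> \<in> lists (stack P) \<and> (\<exists>q \<alpha>. (p, X, a, q, \<alpha>) \<in> rules P \<and> c = (q, \<alpha> @ \<gamma>))"
  unfolding pda_lts_def by auto

lemma pda_trans_Nil: "((p, []), a, c) \<notin> trans (pda_lts P)"
  unfolding pda_lts_def by auto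

lemma pda_states: "states (pda_lts P) = control P \<times> lists (stack P)"
  by (simp add: pda_lts_def)

type_synonym ('q, 'g) head = "bool \<times> bool \<times> 'q \<times> 'g \<times> 'q \<times> 'g"
type_synonym 'q exit = "bool \<times> bool \<times> 'q \<times> 'q"

text \<open>A summary \<open>(h, T)\<close> states that the defender survives from the head \<open>h\<close> as long as every
  exit (a pair of control states at the first moment the top pair is popped) lies in \<open>T\<close>.\<close>

definition succ_ok :: "'q exit list list \<Rightarrow> (('q, 'g) head \<times> 'q exit list) set \<Rightarrow> 'q exit list \<Rightarrow>
    bool \<Rightarrow> bool \<Rightarrow> 'q \<Rightarrow> 'g list \<Rightarrow> 'q \<Rightarrow> 'g list \<Rightarrow> bool" where
  "succ_ok Ts D T m sw p \<alpha> q \<beta> \<longleftrightarrow>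
     (case \<alpha> of [] \<Rightarrow> (m, sw, p, q) \<in> set T
      | X # \<alpha>' \<Rightarrow> (case \<beta> of [] \<Rightarrow> False
         | Y # \<beta>' \<Rightarrow> (case \<alpha>' of [] \<Rightarrow> ((m, sw, p, X, q, Y), T) \<in> D
            | X' # \<alpha>'' \<Rightarrow> (case \<beta>' of [] \<Rightarrow> False
               | Y' # \<beta>'' \<Rightarrow> (\<exists>T'\<in>set Ts. ((m, sw, p, X, q, Y), T') \<in> D \<and>
                   (\<forall>e\<in>set T'. ((fst e, fst (snd e), fst (snd (snd e)), X', snd (snd (snd e)), Y'), T) \<in> D))))))"

definition moves_ok :: "('q, 'g, 'a) rule list \<Rightarrow> 'q exit list list \<Rightarrow>
    (('q, 'g) head \<times> 'q exit list) set \<Rightarrow> ('q, 'g) head \<times> 'q exit list \<Rightarrow> bool" where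
  "moves_ok R Ts D z = (case z of ((m, sw, p, X, q, Y), T) \<Rightarrow>
     (if sw
      then \<forall>(q0, Y0, a, q', \<beta>) \<in> set R. q0 = q \<and> Y0 = Y \<longrightarrow>
        (\<exists>(p0, X0, b, p', \<alpha>) \<in> set R. p0 = p \<and> X0 = X \<and> b = a \<and> succ_ok Ts D T m sw p' \<alpha> q' \<beta>)
      else \<forall>(p0, X0, a, p', \<alpha>) \<in> set R. p0 = p \<and> X0 = X \<longrightarrow>
        (\<exists>(q0, Y0, b, q', \<beta>) \<in> set R. q0 = q \<and> Y0 = Y \<and> b = a \<and> succ_ok Ts D T m sw p' \<alpha> q' \<beta>)))"

definition subinit :: "('q, 'g, 'a) rule list \<Rightarrow> 'q \<Rightarrow> 'g \<Rightarrow> 'q \<Rightarrow> 'g \<Rightarrow> bool" where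
  "subinit R p X q Y \<longleftrightarrow> (\<forall>(p0, X0, a, p', \<alpha>) \<in> set R. p0 = p \<and> X0 = X \<longrightarrow>
     (\<exists>(q0, Y0, b, q', \<beta>) \<in> set R. q0 = q \<and> Y0 = Y \<and> b = a))"

definition enabled :: "('q, 'g, 'a) rule list \<Rightarrow> 'q \<Rightarrow> 'g \<Rightarrow> bool" where
  "enabled R p X \<longleftrightarrow> (\<exists>(p0, X0, a, p', \<alpha>) \<in> set R. p0 = p \<and> X0 = X)"

definition head_ok :: "bool \<Rightarrow> bool \<Rightarrow> bool \<Rightarrow> bool \<Rightarrow> ('q, 'g, 'a) rule list \<Rightarrow> 'q exit list list \<Rightarrow>
    (('q, 'g) head \<times> 'q exit list) set \<Rightarrow> ('q, 'g) head \<times> 'q exit list \<Rightarrow> bool" where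
  "head_ok ce cr s1 s2 R Ts D z \<longleftrightarrow> moves_ok R Ts D z \<and> (case z of ((m, sw, p, X, q, Y), T) \<Rightarrow>
     m \<longrightarrow> (ce \<longrightarrow> enabled R p X = enabled R q Y) \<and>
       (cr \<longrightarrow> subinit R p X q Y \<and> subinit R q Y p X) \<and>
       (s1 \<longrightarrow> ((False, \<not> sw, p, X, q, Y), T) \<in> D) \<and> (s2 \<longrightarrow> ((True, \<not> sw, p, X, q, Y), T) \<in> D))"

section \<open>From summaries to positions on whole stacks\<close>

lemma succ_ok_mono: "D \<subseteq> D' \<Longrightarrow> succ_ok Ts D T m sw p \<alpha> q \<beta> \<Longrightarrow> succ_ok Ts D' T m sw p \<alpha> q \<beta>"
  unfolding succ_ok_def by (auto split: list.splits)

lemma head_ok_mono: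
  assumes "D \<subseteq> D'" "head_ok ce cr s1 s2 R Ts D z"
  shows "head_ok ce cr s1 s2 R Ts D' z"
proof -
  obtain m sw p X q Y T where z: "z = ((m, sw, p, X, q, Y), T)" by (metis prod.exhaust)
  have "moves_ok R Ts D z" using assms(2) unfolding head_ok_def by blast
  then have "moves_ok R Ts D' z"
    using succ_ok_mono[OF assms(1)] unfolding moves_ok_def z case_prod_beta fst_conv snd_conv
    by (cases sw) (simp, blast)+
  then show ?thesis using assms unfolding head_ok_def z prod.case by blast
qed

text \<open>Summaries are strung together along the stack of pairs: whichever exit the top pair is
  left by, the rest must be safe from there. Stacks of different heights are never safe.\<close>

fun safe :: "(('q, 'g) head \<times> 'q exit list) set \<Rightarrow> bool \<Rightarrow> bool \<Rightarrow> 'q \<Rightarrow> 'g list \<Rightarrow> 'q \<Rightarrow> 'g list \<Rightarrow> bool" where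
  "safe D m sw p [] q [] = True"
| "safe D m sw p (X # \<sigma>) q (Y # \<tau>) =
     (\<exists>T. ((m, sw, p, X, q, Y), T) \<in> D \<and> (\<forall>(m', sw', p', q') \<in> set T. safe D m' sw' p' \<sigma> q' \<tau>))"
| "safe D m sw p _ q _ = False"

lemma safe_Cons:
  assumes "safe D m sw p (X # \<sigma>) q \<tau>'"
  obtains Y \<tau> T where "\<tau>' = Y # \<tau>" "((m, sw, p, X, q, Y), T) \<in> D"
    "\<And>m' sw' p' q'. (m', sw', p', q') \<in> set T \<Longrightarrow> safe D m' sw' p' \<sigma> q' \<tau>"
  using assms by (cases \<tau>') fastforce+

lemma safe_Nil: "safe D m sw p [] q \<tau> \<longleftrightarrow> \<tau> = []" by (cases \<tau>) auto

text \<open>A return leaves through an exit in \<open>T\<close>, and an internal step keeps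
  \<open>T\<close>. At a call the defender commits to an intermediate exit set \<open>T'\<close> for
  the new top pair, and every exit in it must enter the pair below with a summary for the old
  \<open>T\<close>.\<close>

lemma safe_succ:
  assumes ok: "succ_ok Ts D T m sw p \<alpha> q \<beta>" and len: "length \<alpha> = length \<beta>" "length \<alpha> \<le> 2"
    and T: "\<And>m' sw' p' q'. (m', sw', p', q') \<in> set T \<Longrightarrow> safe D m' sw' p' \<sigma> q' \<tau>"
  shows "safe D m sw p (\<alpha> @ \<sigma>) q (\<beta> @ \<tau>)"
proof -
  consider "\<alpha> = []" "\<beta> = []" | X Y where "\<alpha> = [X]" "\<beta> = [Y]"
    | X Y X' Y' where "\<alpha> = [X, X']" "\<beta> = [Y, Y']"
    using len by (cases \<alpha>; cases \<beta>; cases "tl \<alpha>"; cases "tl \<beta>") auto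
  then show ?thesis
  proof cases
    case 1
    then show ?thesis using ok T by (auto simp: succ_ok_def)
  next
    case (2 X Y)
    then have "((m, sw, p, X, q, Y), T) \<in> D" using ok by (simp add: succ_ok_def)
    then show ?thesis using 2 T by auto
  next
    case (3 X Y X' Y')
    then obtain T' where T': "((m, sw, p, X, q, Y), T') \<in> D"
      "\<And>e. e \<in> set T' \<Longrightarrow> ((fst e, fst (snd e), fst (snd (snd e)), X', snd (snd (snd e)), Y'), T) \<in> D"
      using ok by (auto simp: succ_ok_def)
    have "safe D m' sw' p' (X' # \<sigma>) q' (Y' # \<tau>)" if "(m', sw', p', q') \<in> set T'" for m' sw' p' q'
      using T'(2)[OF that] T by auto
    then show ?thesis using 3 T'(1) by auto
  qed
qed

text \<open>Here visibility enters the upper bound: answering with the same action changes the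
  height of the other stack by the same amount, so the two stacks stay aligned.\<close>

lemma rules_visible:
  assumes "is_vpda P Ac Ar Ai" "(p, X, a, q, \<alpha>) \<in> rules P" "(p', X', a, q', \<beta>) \<in> rules P"
  shows "length \<alpha> = length \<beta>" "length \<alpha> \<le> 2"
proof -
  have V: "\<forall>r\<in>rules P. case r of (p, X, a, q, \<alpha>) \<Rightarrow>
      (a \<in> Ac \<longrightarrow> length \<alpha> = 2) \<and> (a \<in> Ar \<longrightarrow> length \<alpha> = 0) \<and> (a \<in> Ai \<longrightarrow> length \<alpha> = 1)"
    using assms(1) unfolding is_vpda_def by (elim conjE)
  have "rules P \<subseteq> control P \<times> stack P \<times> (Ac \<union> Ar \<union> Ai) \<times> control P \<times> lists (stack P)"
    using assms(1) unfolding is_vpda_def is_pda_def by (elim conjE) simp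
  from subsetD[OF this assms(2)] have "a \<in> Ac \<or> a \<in> Ar \<or> a \<in> Ai" by simp
  moreover note bspec[OF V assms(2), unfolded prod.case] bspec[OF V assms(3), unfolded prod.case]
  ultimately show "length \<alpha> = length \<beta>" "length \<alpha> \<le> 2" by auto
qed

lemma rules_closed:
  assumes "is_vpda P Ac Ar Ai" "(p, X, a, q, \<alpha>) \<in> rules P"
  shows "p \<in> control P" "X \<in> stack P" "q \<in> control P" "\<alpha> \<in> lists (stack P)"
  using assms unfolding is_vpda_def is_pda_def by auto

lemma initials_Cons:
  "\<sigma> \<in> lists (stack P) \<Longrightarrow> initials (pda_lts P) (p, X # \<sigma>) = {a. \<exists>q \<alpha>. (p, X, a, q, \<alpha>) \<in> rules P}"
  unfolding initials_def by (auto simp: pda_trans_Cons)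

lemma initials_Nil: "initials (pda_lts P) (p, []) = {}"
  unfolding initials_def by (auto simp: pda_trans_Nil)

lemma enabled_iff:
  "set R = rules P \<Longrightarrow> \<sigma> \<in> lists (stack P) \<Longrightarrow> enabled R p X \<longleftrightarrow> initials (pda_lts P) (p, X # \<sigma>) \<noteq> {}"
  unfolding enabled_def by (auto simp: initials_Cons)

lemma subinit_iff:
  "set R = rules P \<Longrightarrow> \<sigma> \<in> lists (stack P) \<Longrightarrow> \<tau> \<in> lists (stack P) \<Longrightarrow>
   subinit R p X q Y \<longleftrightarrow> initials (pda_lts P) (p, X # \<sigma>) \<subseteq> initials (pda_lts P) (q, Y # \<tau>)"
  unfolding subinit_def by (auto simp: initials_Cons) fastforce+

text \<open>Any set of summaries that supports itself will do; that it is the greatest one matters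
  only for completeness.\<close>

lemma summaries_sound:
  assumes v: "is_vpda P Ac Ar Ai" and R: "set R = rules P"
    and D: "\<And>z. z \<in> D \<Longrightarrow> head_ok ce cr s1 s2 R Ts D z"
  shows "msim ce cr s1 s2 (pda_lts P) {(m, sw, (p, \<sigma>), (q, \<tau>)) | m sw p \<sigma> q \<tau>. safe D m sw p \<sigma> q \<tau> \<and>
     p \<in> control P \<and> q \<in> control P \<and> \<sigma> \<in> lists (stack P) \<and> \<tau> \<in> lists (stack P)}"
    (is "msim _ _ _ _ _ ?W")
  unfolding msim_def
proof
  fix z assume "z \<in> ?W"
  then obtain m sw p \<sigma> q \<tau> where z: "z = (m, sw, (p, \<sigma>), (q, \<tau>))"
    and s: "safe D m sw p \<sigma> q \<tau>" and c: "p \<in> control P" "q \<in> control P"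
    and l: "\<sigma> \<in> lists (stack P)" "\<tau> \<in> lists (stack P)"
    by blast
  have st: "(p, \<sigma>) \<in> states (pda_lts P)" "(q, \<tau>) \<in> states (pda_lts P)"
    using c l by (auto simp: pda_states)
  have mv: "if sw then \<forall>a t'. ((q, \<tau>), a, t') \<in> trans (pda_lts P) \<longrightarrow> (\<exists>s'. ((p, \<sigma>), a, s') \<in> trans (pda_lts P) \<and> (m, sw, s', t') \<in> ?W)
      else \<forall>a s'. ((p, \<sigma>), a, s') \<in> trans (pda_lts P) \<longrightarrow> (\<exists>t'. ((q, \<tau>), a, t') \<in> trans (pda_lts P) \<and> (m, sw, s', t') \<in> ?W)"
  proof (cases \<sigma>)
    case Nil
    then have "\<tau> = []" using s by (simp add: safe_Nil)
    with Nil show ?thesis by (simp add: pda_trans_Nil)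
  next
    case (Cons X \<sigma>')
    obtain Y \<tau>' T where \<tau>: "\<tau> = Y # \<tau>'" and d: "((m, sw, p, X, q, Y), T) \<in> D"
      and T: "\<And>m' sw' p' q'. (m', sw', p', q') \<in> set T \<Longrightarrow> safe D m' sw' p' \<sigma>' q' \<tau>'"
      using s unfolding Cons by (rule safe_Cons) (rule that)
    have mo: "moves_ok R Ts D ((m, sw, p, X, q, Y), T)" using D[OF d] unfolding head_ok_def by blast
    have l': "\<sigma>' \<in> lists (stack P)" "\<tau>' \<in> lists (stack P)" using l Cons \<tau> by auto
    have fin: "(m, sw, (p', \<alpha> @ \<sigma>'), (q', \<beta> @ \<tau>')) \<in> ?W"
      if "(p, X, a, p', \<alpha>) \<in> rules P" "(q, Y, a, q', \<beta>) \<in> rules P" "succ_ok Ts D T m sw p' \<alpha> q' \<beta>"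
      for a p' \<alpha> q' \<beta>
    proof -
      have "safe D m sw p' (\<alpha> @ \<sigma>') q' (\<beta> @ \<tau>')"
        by (rule safe_succ[OF that(3) rules_visible[OF v that(1,2)] T])
      then show ?thesis using rules_closed[OF v that(1)] rules_closed[OF v that(2)] l' by auto
    qed
    show ?thesis
    proof (cases sw)
      case True
      have "\<exists>s'. ((p, \<sigma>), a, s') \<in> trans (pda_lts P) \<and> (m, sw, s', t') \<in> ?W"
        if tr: "((q, \<tau>), a, t') \<in> trans (pda_lts P)" for a t'
      proof -
        obtain q' \<beta> where q': "(q, Y, a, q', \<beta>) \<in> rules P" "t' = (q', \<beta> @ \<tau>')"
          using tr unfolding \<tau> pda_trans_Cons by blast
        then obtain p' \<alpha> where p': "(p, X, a, p', \<alpha>) \<in> rules P" "succ_ok Ts D T m sw p' \<alpha> q' \<beta>"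
          using mo True unfolding moves_ok_def R by fastforce
        then show ?thesis using fin[OF p'(1) q'(1) p'(2)] l' q'(2) unfolding Cons pda_trans_Cons by blast
      qed
      then show ?thesis using True by auto
    next
      case False
      have "\<exists>t'. ((q, \<tau>), a, t') \<in> trans (pda_lts P) \<and> (m, sw, s', t') \<in> ?W"
        if tr: "((p, \<sigma>), a, s') \<in> trans (pda_lts P)" for a s'
      proof -
        obtain p' \<alpha> where p': "(p, X, a, p', \<alpha>) \<in> rules P" "s' = (p', \<alpha> @ \<sigma>')"
          using tr unfolding Cons pda_trans_Cons by blast
        then obtain q' \<beta> where q': "(q, Y, a, q', \<beta>) \<in> rules P" "succ_ok Ts D T m sw p' \<alpha> q' \<beta>"
          using mo False unfolding moves_ok_def R by fastforce
        then show ?thesis using fin[OF p'(1) q'(1) q'(2)] l' p'(2) unfolding \<tau> pda_trans_Cons by blast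
      qed
      then show ?thesis using False by auto
    qed
  qed
  have loc: "m \<longrightarrow> (ce \<longrightarrow> (initials (pda_lts P) (p, \<sigma>) = {}) = (initials (pda_lts P) (q, \<tau>) = {})) \<and>
      (cr \<longrightarrow> initials (pda_lts P) (p, \<sigma>) = initials (pda_lts P) (q, \<tau>)) \<and>
      (s1 \<longrightarrow> (False, \<not> sw, (p, \<sigma>), q, \<tau>) \<in> ?W) \<and> (s2 \<longrightarrow> (True, \<not> sw, (p, \<sigma>), q, \<tau>) \<in> ?W)"
  proof (cases \<sigma>)
    case Nil
    then have "\<tau> = []" using s by (simp add: safe_Nil)
    with Nil c show ?thesis by (auto simp: initials_Nil)
  next
    case (Cons X \<sigma>')
    obtain Y \<tau>' T where \<tau>: "\<tau> = Y # \<tau>'" and d: "((m, sw, p, X, q, Y), T) \<in> D"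
      and T: "\<And>m' sw' p' q'. (m', sw', p', q') \<in> set T \<Longrightarrow> safe D m' sw' p' \<sigma>' q' \<tau>'"
      using s unfolding Cons by (rule safe_Cons) (rule that)
    have l': "\<sigma>' \<in> lists (stack P)" "\<tau>' \<in> lists (stack P)" using l Cons \<tau> by auto
    note h = D[OF d, unfolded head_ok_def]
    have sf: "safe D m' (\<not> sw) p (X # \<sigma>') q (Y # \<tau>')" if "((m', \<not> sw, p, X, q, Y), T) \<in> D" for m'
      using that T by auto
    note e1 = enabled_iff[OF R l'(1), of p X] and e2 = enabled_iff[OF R l'(2), of q Y]
    note i1 = subinit_iff[OF R l', of p X q Y] and i2 = subinit_iff[OF R l'(2,1), of q Y p X]
    have W: "(m', \<not> sw, (p, \<sigma>), q, \<tau>) \<in> ?W" if "((m', \<not> sw, p, X, q, Y), T) \<in> D" for m'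
      using sf[OF that] c l unfolding Cons \<tau> by blast
    show ?thesis
    proof (intro impI conjI)
      assume m: m
      show "(initials (pda_lts P) (p, \<sigma>) = {}) = (initials (pda_lts P) (q, \<tau>) = {})" if ce
        using h m that unfolding e1 e2 prod.case Cons \<tau> by blast
      show "initials (pda_lts P) (p, \<sigma>) = initials (pda_lts P) (q, \<tau>)" if cr
        using h m that unfolding i1 i2 prod.case Cons \<tau> by blast
      show "(False, \<not> sw, (p, \<sigma>), q, \<tau>) \<in> ?W" if s1
        by (rule W) (use h m that in simp)
      show "(True, \<not> sw, (p, \<sigma>), q, \<tau>) \<in> ?W" if s2
        by (rule W) (use h m that in simp)
    qed
  qed
  show "case z of (m, sw, s, t) \<Rightarrow> s \<in> states (pda_lts P) \<and> t \<in> states (pda_lts P) \<and>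
     (if sw then \<forall>a t'. (t, a, t') \<in> trans (pda_lts P) \<longrightarrow> (\<exists>s'. (s, a, s') \<in> trans (pda_lts P) \<and> (m, sw, s', t') \<in> ?W)
      else \<forall>a s'. (s, a, s') \<in> trans (pda_lts P) \<longrightarrow> (\<exists>t'. (t, a, t') \<in> trans (pda_lts P) \<and> (m, sw, s', t') \<in> ?W)) \<and>
     (m \<longrightarrow> (ce \<longrightarrow> (initials (pda_lts P) s = {} \<longleftrightarrow> initials (pda_lts P) t = {})) \<and>
       (cr \<longrightarrow> initials (pda_lts P) s = initials (pda_lts P) t) \<and>
       (s1 \<longrightarrow> (False, \<not> sw, s, t) \<in> ?W) \<and> (s2 \<longrightarrow> (True, \<not> sw, s, t) \<in> ?W))"
    unfolding z prod.case using st mv loc by blast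
qed

text \<open>For given lower stacks \<sigma>, \<tau> the canonical exit set consists of the exits
  from which \<open>W\<close> still holds on \<sigma> and \<tau>. A return lands in it by
  definition, and at a call the intermediate set is the canonical one for the stacks enlarged by the
  second symbols. Since \<open>Ts\<close> represents every subset, all these sets are
  available.\<close>

lemma summaries_complete:
  assumes v: "is_vpda P Ac Ar Ai" and R: "set R = rules P"
    and W: "msim ce cr s1 s2 (pda_lts P) W"
    and Ts: "\<And>A. A \<subseteq> UNIV \<times> UNIV \<times> control P \<times> control P \<Longrightarrow> \<exists>T\<in>set Ts. set T = A"
  defines "ex \<equiv> \<lambda>\<sigma> \<tau>. {(m, sw, p, q). (m, sw, (p, \<sigma>), (q, \<tau>)) \<in> W}"
  defines "D \<equiv> {((m, sw, p, X, q, Y), T) | m sw p X q Y T. T \<in> set Ts \<and>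
     (\<exists>\<sigma> \<tau>. set T = ex \<sigma> \<tau> \<and> (m, sw, (p, X # \<sigma>), (q, Y # \<tau>)) \<in> W)}"
  assumes z: "z \<in> D"
  shows "head_ok ce cr s1 s2 R Ts D z"
proof -
  obtain m sw p X q Y T \<sigma> \<tau> where zz: "z = ((m, sw, p, X, q, Y), T)" and T: "T \<in> set Ts" "set T = ex \<sigma> \<tau>"
    and w: "(m, sw, (p, X # \<sigma>), (q, Y # \<tau>)) \<in> W"
    using z unfolding D_def by blast
  have st: "p \<in> control P" "q \<in> control P" "\<sigma> \<in> lists (stack P)" "\<tau> \<in> lists (stack P)"
    using msimD(1,2)[OF W w] by (auto simp: pda_states)
  have ex: "ex \<sigma>' \<tau>' \<subseteq> UNIV \<times> UNIV \<times> control P \<times> control P" for \<sigma>' \<tau>'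
    using msimD(1,2)[OF W] unfolding ex_def by (fastforce simp: pda_states)
  have DI: "((m', sw', p', X', q', Y'), T') \<in> D"
    if "T' \<in> set Ts" "set T' = ex \<sigma>' \<tau>'" "(m', sw', (p', X' # \<sigma>'), (q', Y' # \<tau>')) \<in> W"
    for m' sw' p' X' q' Y' T' \<sigma>' \<tau>'
    using that unfolding D_def by blast
  have succ: "succ_ok Ts D T m sw p' \<alpha> q' \<beta>"
    if len: "length \<alpha> = length \<beta>" "length \<alpha> \<le> 2" and w': "(m, sw, (p', \<alpha> @ \<sigma>), (q', \<beta> @ \<tau>)) \<in> W"
    for p' \<alpha> q' \<beta>
  proof -
    consider "\<alpha> = []" "\<beta> = []" | X Y where "\<alpha> = [X]" "\<beta> = [Y]"
      | X Y X' Y' where "\<alpha> = [X, X']" "\<beta> = [Y, Y']"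
      using len by (cases \<alpha>; cases \<beta>; cases "tl \<alpha>"; cases "tl \<beta>") auto
    then show ?thesis
    proof cases
      case 1
      then show ?thesis using w' T(2) by (simp add: succ_ok_def ex_def)
    next
      case (2 X Y)
      then show ?thesis using w' DI[OF T] by (simp add: succ_ok_def)
    next
      case (3 X Y X' Y')
      obtain T' where T': "T' \<in> set Ts" "set T' = ex (X' # \<sigma>) (Y' # \<tau>)" using Ts[OF ex] by blast
      have "((m, sw, p', X, q', Y), T') \<in> D" using w' DI[OF T'] 3 by simp
      moreover have "((fst e, fst (snd e), fst (snd (snd e)), X', snd (snd (snd e)), Y'), T) \<in> D" if "e \<in> set T'" for e
        using that DI[OF T] unfolding T' ex_def by auto
      ultimately show ?thesis using 3 T'(1) by (auto simp: succ_ok_def)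
    qed
  qed
  have "moves_ok R Ts D z"
  proof (cases sw)
    case True
    have "\<exists>(p0, X0, b, p', \<alpha>) \<in> set R. p0 = p \<and> X0 = X \<and> b = a \<and> succ_ok Ts D T m sw p' \<alpha> q' \<beta>"
      if "(q, Y, a, q', \<beta>) \<in> set R" for a q' \<beta>
    proof -
      have "((q, Y # \<tau>), a, (q', \<beta> @ \<tau>)) \<in> trans (pda_lts P)"
        using that R st unfolding pda_trans_Cons by blast
      then obtain s' where "((p, X # \<sigma>), a, s') \<in> trans (pda_lts P)" "(m, sw, s', (q', \<beta> @ \<tau>)) \<in> W"
        using msimD(3)[OF W w True] by blast
      then obtain p' \<alpha> where p': "(p, X, a, p', \<alpha>) \<in> rules P" "(m, sw, (p', \<alpha> @ \<sigma>), (q', \<beta> @ \<tau>)) \<in> W"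
        unfolding pda_trans_Cons by blast
      have "(q, Y, a, q', \<beta>) \<in> rules P" using that R by simp
      from succ[OF rules_visible[OF v p'(1) this] p'(2)] show ?thesis using p'(1) R by fastforce
    qed
    then show ?thesis unfolding moves_ok_def zz using True by fastforce
  next
    case False
    have "\<exists>(q0, Y0, b, q', \<beta>) \<in> set R. q0 = q \<and> Y0 = Y \<and> b = a \<and> succ_ok Ts D T m sw p' \<alpha> q' \<beta>"
      if "(p, X, a, p', \<alpha>) \<in> set R" for a p' \<alpha>
    proof -
      have "((p, X # \<sigma>), a, (p', \<alpha> @ \<sigma>)) \<in> trans (pda_lts P)"
        using that R st unfolding pda_trans_Cons by blast
      then obtain t' where "((q, Y # \<tau>), a, t') \<in> trans (pda_lts P)" "(m, sw, (p', \<alpha> @ \<sigma>), t') \<in> W"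
        using msimD(4)[OF W w False] by blast
      then obtain q' \<beta> where q': "(q, Y, a, q', \<beta>) \<in> rules P" "(m, sw, (p', \<alpha> @ \<sigma>), (q', \<beta> @ \<tau>)) \<in> W"
        unfolding pda_trans_Cons by blast
      have "(p, X, a, p', \<alpha>) \<in> rules P" using that R by simp
      from succ[OF rules_visible[OF v this q'(1)] q'(2)] show ?thesis using q'(1) R by fastforce
    qed
    then show ?thesis unfolding moves_ok_def zz using False by fastforce
  qed
  moreover have "enabled R p X = enabled R q Y" if "m" "ce"
    using msimD(5)[OF W w that] by (simp add: enabled_iff[OF R st(3), of p X] enabled_iff[OF R st(4), of q Y])
  moreover have "subinit R p X q Y \<and> subinit R q Y p X" if "m" "cr"
    using msimD(6)[OF W w that] by (simp add: subinit_iff[OF R st(3,4), of p X q Y] subinit_iff[OF R st(4,3), of q Y p X])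
  moreover have "((False, \<not> sw, p, X, q, Y), T) \<in> D" if "m" "s1"
    using DI[OF T msimD(7)[OF W w that]] .
  moreover have "((True, \<not> sw, p, X, q, Y), T) \<in> D" if "m" "s2"
    using DI[OF T msimD(8)[OF W w that]] .
  ultimately show ?thesis unfolding head_ok_def zz prod.case by blast
qed

text \<open>Empty stacks have no moves and hence pass every test. With these positions added, the
  exit set below a one-symbol stack is the full one, whatever relation was given.\<close>

lemma msim_add_empty:
  assumes "msim ce cr s1 s2 (pda_lts P) W"
  shows "msim ce cr s1 s2 (pda_lts P) (W \<union> {(m, sw, (p, []), (q, [])) | m sw p q. p \<in> control P \<and> q \<in> control P})"
    (is "msim _ _ _ _ _ (W \<union> ?E)")
proof (rule msimI)
  show "s \<in> states (pda_lts P) \<and> t \<in> states (pda_lts P)" if "(m, sw, s, t) \<in> W \<union> ?E" for m sw s t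
    using that msimD(1,2)[OF assms, of m sw s t] by (auto simp: pda_states)
  show "\<exists>t'. (t, a, t') \<in> trans (pda_lts P) \<and> (m, False, s', t') \<in> W \<union> ?E"
    if "(m, False, s, t) \<in> W \<union> ?E" "(s, a, s') \<in> trans (pda_lts P)" for m s t a s'
  proof (cases "(m, False, s, t) \<in> W")
    case True
    then show ?thesis using msimD(4)[OF assms True] that(2) by blast
  next
    case False
    then have "\<exists>p. s = (p, [])" using that(1) by auto
    then show ?thesis using that(2) by (auto simp: pda_trans_Nil)
  qed
  show "\<exists>s'. (s, a, s') \<in> trans (pda_lts P) \<and> (m, True, s', t') \<in> W \<union> ?E"
    if "(m, True, s, t) \<in> W \<union> ?E" "(t, a, t') \<in> trans (pda_lts P)" for m s t a t'
  proof (cases "(m, True, s, t) \<in> W")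
    case True
    then show ?thesis using msimD(3)[OF assms True] that(2) by blast
  next
    case False
    then have "\<exists>p. t = (p, [])" using that(1) by auto
    then show ?thesis using that(2) by (auto simp: pda_trans_Nil)
  qed
  show "(ce \<longrightarrow> (initials (pda_lts P) s = {} \<longleftrightarrow> initials (pda_lts P) t = {})) \<and>
      (cr \<longrightarrow> initials (pda_lts P) s = initials (pda_lts P) t) \<and>
      (s1 \<longrightarrow> (False, \<not> sw, s, t) \<in> W \<union> ?E) \<and> (s2 \<longrightarrow> (True, \<not> sw, s, t) \<in> W \<union> ?E)"
    if "(True, sw, s, t) \<in> W \<union> ?E" for sw s t
    using that
  proof
    assume "(True, sw, s, t) \<in> W"
    then show ?thesis using msimD(5-8)[OF assms, of True sw s t] by simp
  qed (auto simp: initials_Nil)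
qed

text \<open>The query uses the full exit set \<open>T0\<close>, because after the last symbols are
  popped the defender can no longer lose.\<close>

theorem summary_correct:
  assumes v: "is_vpda P Ac Ar Ai" and R: "set R = rules P"
    and Ts: "\<And>A. A \<subseteq> UNIV \<times> UNIV \<times> control P \<times> control P \<Longrightarrow> \<exists>T\<in>set Ts. set T = A"
    and T0: "T0 \<in> set Ts" "set T0 = UNIV \<times> UNIV \<times> control P \<times> control P"
    and D: "\<And>z. z \<in> D \<Longrightarrow> head_ok ce cr s1 s2 R Ts D z"
    and max: "\<And>E. E \<subseteq> (UNIV \<times> UNIV \<times> control P \<times> stack P \<times> control P \<times> stack P) \<times> set Ts \<Longrightarrow>
       (\<And>z. z \<in> E \<Longrightarrow> head_ok ce cr s1 s2 R Ts E z) \<Longrightarrow> E \<subseteq> D"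
    and pq: "p \<in> control P" "X \<in> stack P" "q \<in> control P" "Y \<in> stack P"
  shows "((True, False, p, X, q, Y), T0) \<in> D \<longleftrightarrow> mpre ce cr s1 s2 (pda_lts P) (p, [X]) (q, [Y])"
proof
  assume "((True, False, p, X, q, Y), T0) \<in> D"
  then have s: "safe D True False p [X] q [Y]" by auto
  show "mpre ce cr s1 s2 (pda_lts P) (p, [X]) (q, [Y])"
    unfolding mpre_def
  proof (intro exI conjI)
    show "msim ce cr s1 s2 (pda_lts P) {(m, sw, (p, \<sigma>), (q, \<tau>)) | m sw p \<sigma> q \<tau>. safe D m sw p \<sigma> q \<tau> \<and>
       p \<in> control P \<and> q \<in> control P \<and> \<sigma> \<in> lists (stack P) \<and> \<tau> \<in> lists (stack P)}"
      by (rule summaries_sound[OF v R]) (rule D)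
  qed (rule CollectI, rule exI[of _ True], rule exI[of _ False], rule exI[of _ p], rule exI[of _ "[X]"],
    rule exI[of _ q], rule exI[of _ "[Y]"], use pq s in simp)
next
  assume "mpre ce cr s1 s2 (pda_lts P) (p, [X]) (q, [Y])"
  then obtain W0 where W0: "msim ce cr s1 s2 (pda_lts P) W0" "(True, False, (p, [X]), (q, [Y])) \<in> W0"
    unfolding mpre_def by blast
  let ?W = "W0 \<union> {(m, sw, (p, []), (q, [])) | m sw p q. p \<in> control P \<and> q \<in> control P}"
  let ?ex = "\<lambda>\<sigma> \<tau>. {(m, sw, p, q). (m, sw, (p, \<sigma>), (q, \<tau>)) \<in> ?W}"
  let ?E = "{((m, sw, p, X, q, Y), T) | m sw p X q Y T. T \<in> set Ts \<and>
     (\<exists>\<sigma> \<tau>. set T = ?ex \<sigma> \<tau> \<and> (m, sw, (p, X # \<sigma>), (q, Y # \<tau>)) \<in> ?W)}"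
  note W = msim_add_empty[OF W0(1)]
  have sub: "?E \<subseteq> D"
  proof (rule max)
    show "?E \<subseteq> (UNIV \<times> UNIV \<times> control P \<times> stack P \<times> control P \<times> stack P) \<times> set Ts"
    proof (rule subsetI, elim CollectE exE conjE)
      fix z m sw p X q Y T \<sigma> \<tau>
      assume "z = ((m, sw, p, X, q, Y), T)" "T \<in> set Ts" and w: "(m, sw, (p, X # \<sigma>), (q, Y # \<tau>)) \<in> ?W"
      then show "z \<in> (UNIV \<times> UNIV \<times> control P \<times> stack P \<times> control P \<times> stack P) \<times> set Ts"
        using msimD(1,2)[OF W w] by (simp add: pda_states)
    qed
    show "z \<in> ?E \<Longrightarrow> head_ok ce cr s1 s2 R Ts ?E z" for z
      by (rule summaries_complete[OF v R W Ts])
  qed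
  have eq: "?ex [] [] = UNIV \<times> UNIV \<times> control P \<times> control P"
  proof (intro equalityI subsetI)
    fix e assume e: "e \<in> ?ex [] []"
    obtain m sw p' q' where e': "e = (m, sw, p', q')" by (metis prod.exhaust)
    with e have w: "(m, sw, (p', []), (q', [])) \<in> ?W" by simp
    show "e \<in> UNIV \<times> UNIV \<times> control P \<times> control P" using msimD(1,2)[OF W w] e' by (simp add: pda_states)
  qed auto
  have "set T0 = ?ex [] []" unfolding T0(2) by (rule eq[symmetric])
  then have "\<exists>\<sigma> \<tau>. set T0 = ?ex \<sigma> \<tau> \<and> (True, False, (p, X # \<sigma>), (q, Y # \<tau>)) \<in> ?W"
    by (intro exI[of _ "[]"] conjI) (assumption, rule UnI1, rule W0(2))
  then have "((True, False, p, X, q, Y), T0) \<in> ?E"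
    by - (rule CollectI, rule exI[of _ True], rule exI[of _ False], rule exI[of _ p], rule exI[of _ X],
      rule exI[of _ q], rule exI[of _ Y], rule exI[of _ T0], intro conjI refl T0(1))
  then show "((True, False, p, X, q, Y), T0) \<in> D" by (rule subsetD[OF sub])
qed

subsection \<open>Encoding and parsing in polynomial time\<close>

lemma pt_pred: "pt f \<Longrightarrow> pt (\<lambda>x. f x - (1 :: nat))"
proof (erule pt_comp, rule ptI[OF impl_tsnd])
  show "tsnd (enc n) = enc (n - 1)" for n :: nat by (cases n) auto
qed (auto intro!: pbd_intros)

lemma pt_diff:
  assumes "pt (f :: 'a :: enc \<Rightarrow> nat)" "pt g"
  shows "pt (\<lambda>x. f x - g x)"
proof -
  have f: "((\<lambda>n. n - 1) ^^ i) n = n - i" for i n :: nat by (induction i) auto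
  have "pt (\<lambda>p :: nat \<times> nat. ((\<lambda>n. n - 1) ^^ snd p) (fst p))"
  proof (rule pt_funpow[where b = "\<lambda>n. n"])
    show "sz (((\<lambda>n. n - 1) ^^ i) (fst p)) \<le> sz p" for i and p :: "nat \<times> nat"
      unfolding f by (cases p) simp
  qed (intro pt_pred pt_fst pt_snd pt_id pbd_intros)+
  then have "pt (\<lambda>p :: nat \<times> nat. fst p - snd p)" unfolding f .
  from pt_comp2[OF this assms] show ?thesis .
qed

lemma pt_le:
  assumes "pt (f :: 'a :: enc \<Rightarrow> nat)" "pt g"
  shows "pt (\<lambda>x. f x \<le> g x)"
proof -
  have "pt (\<lambda>x. f x - g x = 0)" by (intro pt_eq pt_diff pt_const assms)
  then show ?thesis by simp
qed

lemma pt_min: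
  assumes "pt (f :: 'a :: enc \<Rightarrow> nat)" "pt g"
  shows "pt (\<lambda>x. min (f x) (g x))"
  unfolding min_def by (intro pt_if pt_le assms)

text \<open>Unary division by two is one upward count that toggles the parity.\<close>

lemma pt_half_parity:
  assumes "pt (f :: 'a :: enc \<Rightarrow> nat)"
  shows "pt (\<lambda>x. (f x div 2, odd (f x)))"
proof -
  let ?h = "\<lambda>s :: nat \<times> bool. (if snd s then Suc (fst s) else fst s, \<not> snd s)"
  have f: "(?h ^^ i) (0, False) = (i div 2, odd i)" for i
    by (induction i) (auto elim!: oddE evenE)
  have "pt (\<lambda>n :: nat. (?h ^^ n) (0, False))"
  proof (rule pt_funpow[where b = "\<lambda>n. 2 * n + 5"])
    show "sz ((?h ^^ i) (0, False)) \<le> 2 * sz n + 5" if "i \<le> n" for i n :: nat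
      unfolding f using that sz_bool[of "odd i"] by simp
  qed (intro pt_pair pt_if pt_Suc pt_not pt_fst pt_snd pt_id pt_const pbd_intros)+
  from pt_comp[OF assms this] show ?thesis by (simp add: f)
qed

lemma pt_div2: "pt (f :: 'a :: enc \<Rightarrow> nat) \<Longrightarrow> pt (\<lambda>x. f x div 2)"
  using pt_fst[OF pt_half_parity] by simp

lemma pt_odd: "pt (f :: 'a :: enc \<Rightarrow> nat) \<Longrightarrow> pt (\<lambda>x. odd (f x))"
  using pt_snd[OF pt_half_parity] by simp

lemma pt_bin_digits:
  assumes "pt f"
  shows "pt (\<lambda>x. bin_digits (f x))"
proof -
  let ?h = "\<lambda>s :: nat \<times> bool list. if fst s = 0 then s else (fst s div 2, snd s @ [odd (fst s)])"
  have f: "m \<le> i \<Longrightarrow> (?h ^^ i) (m, ds) = (0, ds @ bin_digits m)" for i m ds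
  proof (induction i arbitrary: m ds)
    case 0
    then show ?case by (simp add: bin_digits.simps[of 0])
  next
    case (Suc i)
    show ?case
    proof (cases "m = 0")
      case True
      then show ?thesis using Suc.IH[of 0 ds]
        by (simp add: funpow_Suc_right bin_digits.simps[of 0] del: funpow.simps)
    next
      case False
      then have "m div 2 \<le> i" using Suc.prems by auto
      then show ?thesis using Suc.IH[of "m div 2" "ds @ [odd m]"] False
        by (simp add: funpow_Suc_right bin_digits.simps[of m] del: funpow.simps)
    qed
  qed
  have inv: "fst ((?h ^^ i) (m, ds)) \<le> m \<and> length (snd ((?h ^^ i) (m, ds))) \<le> length ds + i" for i m ds
    by (induction i) auto
  have "pt (\<lambda>n :: nat. (?h ^^ n) (n, []))"
  proof (rule pt_funpow[where b = "\<lambda>n. 6 * n + 10"])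
    fix i n :: nat assume "i \<le> n"
    obtain k ds where kd: "(?h ^^ i) (n, []) = (k, ds)" by fastforce
    have "k \<le> n" "length ds \<le> n" using inv[of i n "[]"] \<open>i \<le> n\<close> unfolding kd by auto
    moreover have "sz ds \<le> Suc (length ds * Suc 3)" by (rule sz_list_bound) (rule sz_bool)
    ultimately show "sz ((?h ^^ i) (n, [])) \<le> 6 * sz n + 10" unfolding kd by simp
  qed (intro pt_intros pt_div2 pt_odd pbd_intros)+
  then have "pt (\<lambda>n :: nat. snd ((?h ^^ n) (n, [])))" by (rule pt_snd)
  then have "pt bin_digits" by (simp add: f)
  from pt_comp[OF assms this] show ?thesis .
qed

lemma pt_enc_list:
  assumes "pt (\<lambda>z. e (fst z) (snd z))" "pt g"
  shows "pt (\<lambda>x. Defs.enc_list (e x) (g x))"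
  unfolding Defs.enc_list_def by (intro pt_intros assms)

lemma pt_enc_nat: "pt f \<Longrightarrow> pt (\<lambda>x. Defs.enc_nat (f x))"
  unfolding Defs.enc_nat_def by (intro pt_enc_list pt_bin_digits pt_intros)

type_synonym nrule = "nat \<times> nat \<times> nat \<times> nat \<times> nat list"
type_synonym inst = "nat list \<times> nat list \<times> nat list \<times> nat list \<times> nat list \<times> nrule list \<times>
  (nat \<times> nat) \<times> (nat \<times> nat)"

fun mk_inst :: "inst \<Rightarrow> vpda_instance" where
  "mk_inst (Q, G, c, r, i, R, x, y) = \<lparr>i_control = Q, i_stack = G, i_call = c, i_return = r,
     i_internal = i, i_rules = R, i_proc1 = x, i_proc2 = y\<rparr>"

lemma mk_inst_surj: "\<exists>J. I = mk_inst J"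
  by (cases I) (metis mk_inst.simps)

lemma enc_rule_proj: "enc_rule r = Defs.enc_nat (fst r) @ Defs.enc_nat (fst (snd r)) @
   Defs.enc_nat (fst (snd (snd r))) @ Defs.enc_nat (fst (snd (snd (snd r)))) @
   Defs.enc_list Defs.enc_nat (snd (snd (snd (snd r))))"
  by (cases r) auto

lemma pt_enc_inst: "pt (f :: 'a :: enc \<Rightarrow> inst) \<Longrightarrow> pt (\<lambda>x. enc_instance (mk_inst (f x)))"
proof (erule pt_comp)
  have "enc_instance (mk_inst J) =
     Defs.enc_list Defs.enc_nat (fst J) @ Defs.enc_list Defs.enc_nat (fst (snd J)) @
     Defs.enc_list Defs.enc_nat (fst (snd (snd J))) @ Defs.enc_list Defs.enc_nat (fst (snd (snd (snd J)))) @
     Defs.enc_list Defs.enc_nat (fst (snd (snd (snd (snd J))))) @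
     Defs.enc_list enc_rule (fst (snd (snd (snd (snd (snd J)))))) @
     Defs.enc_nat (fst (fst (snd (snd (snd (snd (snd (snd J)))))))) @
     Defs.enc_nat (snd (fst (snd (snd (snd (snd (snd (snd J)))))))) @
     Defs.enc_nat (fst (snd (snd (snd (snd (snd (snd (snd J)))))))) @
     Defs.enc_nat (snd (snd (snd (snd (snd (snd (snd (snd J))))))))" for J
    by (cases J rule: mk_inst.cases) (simp add: enc_instance_def)
  then show "pt (\<lambda>J. enc_instance (mk_inst J))"
    unfolding enc_rule_proj[abs_def] by (simp only:) (intro pt_enc_list pt_enc_nat pt_intros)
qed

section \<open>Total parsers with capped numbers\<close>

definition digit_step :: "bool list \<times> bool list \<Rightarrow> bool list \<times> bool list" where
  "digit_step s = (case snd s of [] \<Rightarrow> s | b # r \<Rightarrow> if b then (case r of [] \<Rightarrow> s | c # r' \<Rightarrow> (fst s @ [c], r')) else s)"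

text \<open>A binary numeral can denote an exponentially large number, which in unary would break
  the polynomial bound. Capping at \<open>B\<close> keeps the value within the padding and has no
  effect on numbers up to \<open>B\<close>.\<close>

definition bin_value :: "nat \<Rightarrow> bool list \<Rightarrow> nat" where
  "bin_value B ds = fold (\<lambda>b n. min B (n + n + (if b then 1 else 0))) (rev ds) 0"

text \<open>As many steps as there are letters reach the end of the code, where
  \<open>digit_step\<close> stands still; \<open>tl\<close> then drops the end mark. On malformed
  words the result is arbitrary, so there is no error value to carry around.\<close>

definition parse_nat :: "nat \<Rightarrow> bool list \<Rightarrow> nat \<times> bool list" where
  "parse_nat B r = (bin_value B (fst ((digit_step ^^ length r) ([], r))), tl (snd ((digit_step ^^ length r) ([], r))))"

definition parse_step :: "(nat \<Rightarrow> bool list \<Rightarrow> 'a \<times> bool list) \<Rightarrow> nat \<Rightarrow> 'a list \<times> bool list \<Rightarrow> 'a list \<times> bool list" where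
  "parse_step p B s = (case snd s of [] \<Rightarrow> s | b # r \<Rightarrow> if b then (fst s @ [fst (p B r)], snd (p B r)) else s)"

definition parse_list :: "(nat \<Rightarrow> bool list \<Rightarrow> 'a \<times> bool list) \<Rightarrow> nat \<Rightarrow> bool list \<Rightarrow> 'a list \<times> bool list" where
  "parse_list p B r = (fst ((parse_step p B ^^ length r) ([], r)), tl (snd ((parse_step p B ^^ length r) ([], r))))"

definition parse_pair :: "(nat \<Rightarrow> bool list \<Rightarrow> 'a \<times> bool list) \<Rightarrow> (nat \<Rightarrow> bool list \<Rightarrow> 'b \<times> bool list) \<Rightarrow>
    nat \<Rightarrow> bool list \<Rightarrow> ('a \<times> 'b) \<times> bool list" where
  "parse_pair p q B r = ((fst (p B r), fst (q B (snd (p B r)))), snd (q B (snd (p B r))))"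

text \<open>That the remainder never grows is what keeps the inputs of repeated parser calls bounded
  by the original word.\<close>

definition good_parser :: "(nat \<Rightarrow> bool list \<Rightarrow> 'a :: enc \<times> bool list) \<Rightarrow> bool" where
  "good_parser p \<longleftrightarrow> pt (\<lambda>z. p (fst z) (snd z)) \<and> (\<forall>B r. length (snd (p B r)) \<le> length r)"

lemma sz_bools: "sz (r :: bool list) \<le> 4 * length r + 1"
  using sz_list_bound[of r 3] sz_bool by simp

lemma digit_step_len:
  "length (snd ((digit_step ^^ i) s)) \<le> length (snd s)"
  "length (fst ((digit_step ^^ i) s)) \<le> length (fst s) + i"
  by (induction i) (auto simp: digit_step_def split: list.splits)

lemma pt_bin_value:
  assumes "pt f" "pt g"
  shows "pt (\<lambda>x. bin_value (f x) (g x))"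
proof -
  have "pt (\<lambda>p :: nat \<times> bool list. fold (\<lambda>b n. min (fst p) (n + n + (if b then 1 else 0))) (rev (snd p)) 0)"
  proof (rule pt_fold[where b = "\<lambda>n. n"])
    fix p :: "nat \<times> bool list" and i
    have "fold (\<lambda>b n. min B (n + n + (if b then 1 else 0))) ds n \<le> B" if "n \<le> B" for B n :: nat and ds
      using that by (induction ds arbitrary: n) auto
    then show "sz (fold (\<lambda>b n. min (fst p) (n + n + (if b then 1 else 0))) (take i (rev (snd p))) 0) \<le> sz p"
      by (cases p) (simp add: le_SucI trans_le_add1)
  qed (intro pt_min pt_intros pbd_intros)+
  then have "pt (\<lambda>p. bin_value (fst p) (snd p))" by (simp add: bin_value_def)
  from pt_comp2[OF this assms] show ?thesis .
qed

lemma good_parse_nat: "good_parser parse_nat"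
  unfolding good_parser_def
proof
  have "pt (\<lambda>z :: nat \<times> bool list. (digit_step ^^ length (snd z)) ([], snd z))"
  proof (rule pt_funpow[where b = "\<lambda>n. 8 * n + 3"])
    show "pt (\<lambda>z :: (nat \<times> bool list) \<times> (bool list \<times> bool list). digit_step (snd z))"
      unfolding digit_step_def by (intro pt_intros)
    fix z :: "nat \<times> bool list" and i assume i: "i \<le> length (snd z)"
    obtain N r where z: "z = (N, r)" by fastforce
    obtain ds r' where s: "(digit_step ^^ i) ([], snd z) = (ds, r')" by fastforce
    have "length ds \<le> length r" "length r' \<le> length r"
      using digit_step_len[of i "([], snd z)"] i unfolding s by (auto simp: z)
    then have "sz ds \<le> 4 * length r + 1" "sz r' \<le> 4 * length r + 1"
      using sz_bools[of ds] sz_bools[of r'] by linarith+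
    then show "sz ((digit_step ^^ i) ([], snd z)) \<le> 8 * sz z + 3"
      unfolding s using length_le_sz[of r] by (simp add: z)
  qed (intro pt_intros pbd_intros)+
  then show "pt (\<lambda>z. parse_nat (fst z) (snd z))"
    unfolding parse_nat_def by (intro pt_pair pt_bin_value pt_fst pt_snd pt_tl pt_id)
  show "\<forall>B r. length (snd (parse_nat B r)) \<le> length r"
    using digit_step_len(1) by (auto simp: parse_nat_def intro: le_trans[OF diff_le_self])
qed

lemma good_parse_pair:
  assumes "good_parser p" "good_parser q"
  shows "good_parser (parse_pair p q)"
proof -
  have p: "pt (\<lambda>z. p (fst z) (snd z))" and q: "pt (\<lambda>z. q (fst z) (snd z))"
    and len: "\<And>B r. length (snd (p B r)) \<le> length r" "\<And>B r. length (snd (q B r)) \<le> length r"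
    using assms unfolding good_parser_def by auto
  have q': "pt (\<lambda>z. q (fst z) (snd (p (fst z) (snd z))))"
    by (rule pt_comp2[OF q]) (intro pt_fst pt_snd pt_id p)+
  have "pt (\<lambda>z. parse_pair p q (fst z) (snd z))"
    unfolding parse_pair_def by (intro pt_pair pt_fst[OF p] pt_fst[OF q'] pt_snd[OF q'])
  moreover have "length (snd (parse_pair p q B r)) \<le> length r" for B r
    unfolding parse_pair_def using len(1)[of B r] len(2)[of B "snd (p B r)"] by simp
  ultimately show ?thesis unfolding good_parser_def by blast
qed

lemma good_parse_list:
  assumes "good_parser (p :: nat \<Rightarrow> bool list \<Rightarrow> 'a :: enc \<times> bool list)"
  shows "good_parser (parse_list p)"
proof -
  have p: "pt (\<lambda>z. p (fst z) (snd z))" and len: "\<And>B r. length (snd (p B r)) \<le> length r"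
    using assms unfolding good_parser_def by auto
  obtain q where q: "\<And>z. sz (p (fst z) (snd z)) \<le> poly q (sz z)" by (rule pt_sz[OF p]) (rule that)
  \<comment> \<open>Every element is parsed from a remainder no longer than \<open>r\<close>, so one
    polynomial bounds all elements and nothing compounds over the rounds.\<close>
  have inv: "length (snd ((parse_step p B ^^ i) ([], r))) \<le> length r \<and>
      length (fst ((parse_step p B ^^ i) ([], r))) \<le> i \<and>
      (\<forall>x\<in>set (fst ((parse_step p B ^^ i) ([], r))). sz x \<le> poly q (4 * length r + 2 * B + 3))" for B i r
  proof (induction i)
    case (Suc i)
    obtain xs r' where s: "(parse_step p B ^^ i) ([], r) = (xs, r')" by fastforce
    then have st: "(parse_step p B ^^ Suc i) ([], r) = parse_step p B (xs, r')" by simp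
    show ?case
    proof (cases r')
      case Nil
      then show ?thesis using Suc unfolding st s by (auto simp: parse_step_def)
    next
      case (Cons b r1)
      have l: "length r1 \<le> length r" using Suc Cons unfolding s by simp
      have "sz (fst (p B r1)) \<le> sz (p B r1)" by (cases "p B r1") simp
      also have "\<dots> \<le> poly q (sz (B, r1))" using q[of "(B, r1)"] by simp
      also have "\<dots> \<le> poly q (4 * length r + 2 * B + 3)"
        using sz_bools[of r1] l by (intro poly_nat_mono) simp
      finally show ?thesis using Suc Cons len[of B r1] l unfolding st s
        by (auto simp: parse_step_def)
    qed
  qed simp
  have "pt (\<lambda>z :: nat \<times> bool list. (parse_step p (fst z) ^^ length (snd z)) ([], snd z))"
  proof (rule pt_funpow[where b = "\<lambda>n. Suc (Suc (n * Suc (poly q (6 * n + 3))) + (4 * n + 1))"])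
    show "pt (\<lambda>z :: (nat \<times> bool list) \<times> ('a list \<times> bool list). parse_step p (fst (fst z)) (snd z))"
    proof -
      have 1: "pt (\<lambda>x :: ((nat \<times> bool list) \<times> ('a list \<times> bool list)) \<times> bool \<times> bool list. p (fst (fst (fst x))) (snd (snd x)))"
        by (rule pt_comp2[OF p]) (intro pt_fst pt_snd pt_id)+
      show ?thesis unfolding parse_step_def by (intro pt_intros 1)
    qed
    fix z :: "nat \<times> bool list" and i assume i: "i \<le> length (snd z)"
    obtain B r where z: "z = (B, r)" by fastforce
    obtain xs r' where s: "(parse_step p B ^^ i) ([], r) = (xs, r')" by fastforce
    have I: "length r' \<le> length r" "length xs \<le> i" "\<And>x. x \<in> set xs \<Longrightarrow> sz x \<le> poly q (4 * length r + 2 * B + 3)"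
      using inv[of i B r] unfolding s by auto
    have n: "length r \<le> sz z" "4 * length r + 2 * B + 3 \<le> 6 * sz z + 3"
      using length_le_sz[of r] by (auto simp: z)
    have "sz xs \<le> Suc (length xs * Suc (poly q (6 * sz z + 3)))"
      by (rule sz_list_bound) (use I(3) poly_nat_mono[OF n(2), of q] in force)
    also have "\<dots> \<le> Suc (sz z * Suc (poly q (6 * sz z + 3)))"
      using I(2) i n(1) by (intro Suc_le_mono[THEN iffD2] mult_right_mono) (auto simp: z)
    finally show "sz ((parse_step p (fst z) ^^ i) ([], snd z))
        \<le> Suc (Suc (sz z * Suc (poly q (6 * sz z + 3))) + (4 * sz z + 1))"
      using sz_bools[of r'] I(1) n(1) by (simp add: z s)
  qed (intro pt_intros pbd_intros pbd_poly_comp)+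
  then have "pt (\<lambda>z. parse_list p (fst z) (snd z))"
    unfolding parse_list_def by (intro pt_pair pt_fst pt_snd pt_tl)
  moreover have "length (snd (parse_list p B r)) \<le> length r" for B r
    using inv[of "length r" B r] by (auto simp: parse_list_def intro: le_trans[OF diff_le_self])
  ultimately show ?thesis unfolding good_parser_def by blast
qed


section \<open>Correctness of the parsers\<close>

definition parses :: "(nat \<Rightarrow> bool list \<Rightarrow> 'a \<times> bool list) \<Rightarrow> ('a \<Rightarrow> bool list) \<Rightarrow> nat \<Rightarrow> 'a set \<Rightarrow> bool" where
  "parses p e B S \<longleftrightarrow> (\<forall>x\<in>S. \<forall>u. p B (e x @ u) = (x, u))"

lemma enc_list_simps:
  "Defs.enc_list e [] = [False]" "Defs.enc_list e (x # xs) = True # e x @ Defs.enc_list e xs"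
  by (simp_all add: Defs.enc_list_def)

lemma digit_step_stop: "(digit_step ^^ i) (ds, False # u) = (ds, False # u)"
  by (induction i) (auto simp: digit_step_def)

lemma digit_steps:
  "length cs \<le> i \<Longrightarrow> (digit_step ^^ i) (ds, Defs.enc_list (\<lambda>b. [b]) cs @ u) = (ds @ cs, False # u)"
proof (induction cs arbitrary: i ds)
  case Nil
  then show ?case by (simp add: enc_list_simps digit_step_stop)
next
  case (Cons c cs)
  then obtain j where "i = Suc j" "length cs \<le> j" by (cases i) auto
  then show ?case using Cons.IH[of j "ds @ [c]"]
    by (simp add: enc_list_simps funpow_Suc_right digit_step_def del: funpow.simps)
qed

lemma bin_value_Cons: "bin_value B (b # ds) = min B (bin_value B ds + bin_value B ds + (if b then 1 else 0))"
  by (simp add: bin_value_def)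

lemma bin_value_bin_digits: "n \<le> B \<Longrightarrow> bin_value B (bin_digits n) = n"
proof (induction n rule: less_induct)
  case (less n)
  show ?case
  proof (cases "n = 0")
    case True
    then show ?thesis by (simp add: bin_digits.simps[of 0] bin_value_def)
  next
    case False
    then have "bin_value B (bin_digits (n div 2)) = n div 2" using less by auto
    then show ?thesis using False less.prems
      by (subst bin_digits.simps) (auto simp: bin_value_Cons elim!: oddE evenE)
  qed
qed

lemma length_enc_nat: "length (Defs.enc_nat n) = 2 * length (bin_digits n) + 1"
proof -
  have "length (Defs.enc_list (\<lambda>b :: bool. [b]) ds) = 2 * length ds + 1" for ds
    by (induction ds) (simp_all add: enc_list_simps)
  then show ?thesis by (simp add: Defs.enc_nat_def)
qed

lemma parses_nat: "parses parse_nat Defs.enc_nat B {..B}"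
  unfolding parses_def
proof (intro ballI allI)
  fix n u assume "n \<in> {..B}"
  then show "parse_nat B (Defs.enc_nat n @ u) = (n, u)"
    using digit_steps[of "bin_digits n" "length (Defs.enc_nat n @ u)" "[]" u] length_enc_nat[of n]
    unfolding parse_nat_def Defs.enc_nat_def by (simp add: bin_value_bin_digits)
qed

lemma parse_step_stop: "(parse_step p B ^^ i) (xs, False # u) = (xs, False # u)"
  by (induction i) (auto simp: parse_step_def)

lemma parse_steps:
  assumes "parses p e B S"
  shows "ys \<in> lists S \<Longrightarrow> length ys \<le> i \<Longrightarrow>
    (parse_step p B ^^ i) (xs, Defs.enc_list e ys @ u) = (xs @ ys, False # u)"
proof (induction ys arbitrary: i xs)
  case Nil
  then show ?case by (simp add: enc_list_simps parse_step_stop)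
next
  case (Cons y ys)
  then obtain j where "i = Suc j" "length ys \<le> j" by (cases i) auto
  moreover have "p B (e y @ v) = (y, v)" for v using Cons.prems(1) assms unfolding parses_def by simp
  ultimately show ?case using Cons.IH[of j "xs @ [y]"] Cons.prems(1)
    by (simp add: enc_list_simps funpow_Suc_right parse_step_def del: funpow.simps)
qed

lemma length_enc_list: "length ys \<le> length (Defs.enc_list e ys)"
  by (induction ys) (auto simp: enc_list_simps)

lemma parses_list:
  assumes "parses p e B S"
  shows "parses (parse_list p) (Defs.enc_list e) B (lists S)"
  unfolding parses_def
proof (intro ballI allI)
  fix ys u assume ys: "ys \<in> lists S"
  show "parse_list p B (Defs.enc_list e ys @ u) = (ys, u)"
    using parse_steps[OF assms ys, of "length (Defs.enc_list e ys @ u)" "[]" u] length_enc_list[of ys e]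
    unfolding parse_list_def by simp
qed

lemma parses_pair:
  assumes "parses p e B S" "parses q d B T"
  shows "parses (parse_pair p q) (\<lambda>z. e (fst z) @ d (snd z)) B (S \<times> T)"
  using assms unfolding parses_def parse_pair_def by auto

definition parse_rule :: "nat \<Rightarrow> bool list \<Rightarrow> nrule \<times> bool list" where
  "parse_rule = parse_pair parse_nat (parse_pair parse_nat (parse_pair parse_nat (parse_pair parse_nat (parse_list parse_nat))))"

definition parse_inst :: "nat \<Rightarrow> bool list \<Rightarrow> inst \<times> bool list" where
  "parse_inst = parse_pair (parse_list parse_nat) (parse_pair (parse_list parse_nat)
     (parse_pair (parse_list parse_nat) (parse_pair (parse_list parse_nat) (parse_pair (parse_list parse_nat)
       (parse_pair (parse_list parse_rule)
         (parse_pair (parse_pair parse_nat parse_nat) (parse_pair parse_nat parse_nat)))))))"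

lemma pt_parse_inst: "pt f \<Longrightarrow> pt g \<Longrightarrow> pt (\<lambda>x. fst (parse_inst (f x) (g x)))"
proof (rule pt_fst, rule pt_comp2[of parse_inst])
  have "good_parser parse_inst" unfolding parse_inst_def parse_rule_def
    by (intro good_parse_pair good_parse_list good_parse_nat)
  then show "pt (\<lambda>z. parse_inst (fst z) (snd z))" unfolding good_parser_def by blast
qed

lemma nat_le_enc_nat: "n \<le> 2 ^ length (Defs.enc_nat n)"
proof -
  have "n < 2 ^ length (bin_digits n)"
  proof (induction n rule: less_induct)
    case (less n)
    show ?case
    proof (cases "n = 0")
      case False
      then have "n div 2 < 2 ^ length (bin_digits (n div 2))" using less by simp
      then show ?thesis using False by (subst bin_digits.simps) simp
    qed simp
  qed
  also have "(2 :: nat) ^ length (bin_digits n) \<le> 2 ^ length (Defs.enc_nat n)"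
    by (rule power_increasing) (auto simp: length_enc_nat)
  finally show ?thesis by simp
qed

lemma length_enc_list_mem: "x \<in> set xs \<Longrightarrow> length (e x) \<le> length (Defs.enc_list e xs)"
  by (induction xs) (auto simp: enc_list_simps)

text \<open>A number whose code fits into the word is at most \<open>2 ^ length\<close> of the word,
  so with this \<open>B\<close> the cap changes nothing.\<close>

lemma parse_enc_inst:
  assumes "2 ^ length (enc_instance (mk_inst J)) \<le> B"
  shows "fst (parse_inst B (enc_instance (mk_inst J))) = J"
proof -
  obtain Q G c r i R x1 x2 y1 y2 where J: "J = (Q, G, c, r, i, R, (x1, x2), (y1, y2))"
    by (metis prod.exhaust)
  let ?w = "enc_instance (mk_inst J)"
  have w: "?w = Defs.enc_list Defs.enc_nat Q @ Defs.enc_list Defs.enc_nat G @ Defs.enc_list Defs.enc_nat c @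
     Defs.enc_list Defs.enc_nat r @ Defs.enc_list Defs.enc_nat i @ Defs.enc_list enc_rule R @
     (Defs.enc_nat x1 @ Defs.enc_nat x2) @ Defs.enc_nat y1 @ Defs.enc_nat y2"
    by (simp add: J enc_instance_def)
  have small: "n \<le> B" if "length (Defs.enc_nat n) \<le> length ?w" for n
  proof -
    have "n \<le> 2 ^ length (Defs.enc_nat n)" by (rule nat_le_enc_nat)
    also have "\<dots> \<le> 2 ^ length ?w" using that by (rule power_increasing) simp
    finally show ?thesis using assms by simp
  qed
  have list: "l \<in> lists {..B}" if "length (Defs.enc_list Defs.enc_nat l) \<le> length ?w" for l
    using that length_enc_list_mem[of _ l Defs.enc_nat] small by (fastforce intro: le_trans)
  have S: "Q \<in> lists {..B}" "G \<in> lists {..B}" "c \<in> lists {..B}" "r \<in> lists {..B}" "i \<in> lists {..B}"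
    by (rule list, simp add: w)+
  have S': "x1 \<in> {..B}" "x2 \<in> {..B}" "y1 \<in> {..B}" "y2 \<in> {..B}"
    by (simp, rule small, simp add: w)+
  have "\<rho> \<in> {..B} \<times> {..B} \<times> {..B} \<times> {..B} \<times> lists {..B}" if "\<rho> \<in> set R" for \<rho>
  proof -
    obtain p X a q \<alpha> where \<rho>: "\<rho> = (p, X, a, q, \<alpha>)" by (metis prod.exhaust)
    have l: "length (enc_rule \<rho>) \<le> length ?w"
      using length_enc_list_mem[OF that, of enc_rule] by (simp add: w)
    have "p \<le> B" "X \<le> B" "a \<le> B" "q \<le> B" by (rule small, use l \<rho> in simp)+
    moreover have "\<alpha> \<in> lists {..B}" by (rule list) (use l \<rho> in simp)
    ultimately show ?thesis using \<rho> by simp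
  qed
  then have SR: "R \<in> lists ({..B} \<times> {..B} \<times> {..B} \<times> {..B} \<times> lists {..B})" by blast
  have "parses parse_rule enc_rule B ({..B} \<times> {..B} \<times> {..B} \<times> {..B} \<times> lists {..B})"
    unfolding parse_rule_def enc_rule_proj[abs_def]
    by (intro parses_pair parses_list parses_nat)
  note P = parses_pair[OF parses_list[OF parses_nat] parses_pair[OF parses_list[OF parses_nat]
    parses_pair[OF parses_list[OF parses_nat] parses_pair[OF parses_list[OF parses_nat]
    parses_pair[OF parses_list[OF parses_nat] parses_pair[OF parses_list[OF this]
    parses_pair[OF parses_pair[OF parses_nat parses_nat] parses_pair[OF parses_nat parses_nat]]]]]]]]
  have "J \<in> lists {..B} \<times> lists {..B} \<times> lists {..B} \<times> lists {..B} \<times> lists {..B} \<times>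
      lists ({..B} \<times> {..B} \<times> {..B} \<times> {..B} \<times> lists {..B}) \<times> ({..B} \<times> {..B}) \<times> {..B} \<times> {..B}"
    using S S' SR unfolding J by blast
  from spec[OF bspec[OF P[unfolded parses_def] this], of "[]"] have "parse_inst B (?w @ []) = (J, [])"
    unfolding parse_inst_def w by (simp add: J)
  then show ?thesis by simp
qed

text \<open>Validity is rephrased with quantifiers over list elements only, so that
  \<open>pt_intros\<close> applies.\<close>

definition valid_inst :: "inst \<Rightarrow> bool" where
  "valid_inst J = (case J of (Q, G, c, r, i, R, x, y) \<Rightarrow>
     (\<forall>(p, X, a, q, \<alpha>)\<in>set R. p \<in> set Q \<and> X \<in> set G \<and> (a \<in> set c \<or> a \<in> set r \<or> a \<in> set i) \<and> q \<in> set Q \<and>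
        (\<forall>Y\<in>set \<alpha>. Y \<in> set G) \<and> (a \<in> set c \<longrightarrow> length \<alpha> = 2) \<and> (a \<in> set r \<longrightarrow> length \<alpha> = 0) \<and>
        (a \<in> set i \<longrightarrow> length \<alpha> = 1)) \<and>
     (\<forall>a\<in>set c. \<not> a \<in> set r \<and> \<not> a \<in> set i) \<and> (\<forall>a\<in>set r. \<not> a \<in> set i) \<and>
     fst x \<in> set Q \<and> snd x \<in> set G \<and> fst y \<in> set Q \<and> snd y \<in> set G)"

lemma valid_inst_iff: "valid_inst J \<longleftrightarrow> valid_instance (mk_inst J)"
proof -
  obtain Q G c r i R x1 x2 y1 y2 where J: "J = (Q, G, c, r, i, R, (x1, x2), (y1, y2))"
    by (metis prod.exhaust)
  show ?thesis
    unfolding J valid_inst_def valid_instance_def is_vpda_def is_pda_def instance_pda_def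
    by (auto simp: in_lists_conv_set; fastforce)
qed

lemma pt_valid_inst: "pt f \<Longrightarrow> pt (\<lambda>x. valid_inst (f x))"
  by (erule pt_comp) (unfold valid_inst_def case_prod_beta, intro pt_intros)


subsection \<open>The decision procedure\<close>

text \<open>The greatest fixpoint on a finite universe: every round that changes the list shortens
  it, so as many rounds as there are elements suffice. By monotonicity no self-supporting set ever
  loses an element.\<close>

lemma filter_iteration:
  fixes P :: "'a set \<Rightarrow> 'a \<Rightarrow> bool" and U :: "'a list"
  assumes mono: "\<forall>A B z. A \<subseteq> B \<longrightarrow> P A z \<longrightarrow> P B z"
  defines "F \<equiv> \<lambda>D. filter (P (set D)) D"
  defines "D \<equiv> (F ^^ length U) U"
  shows "\<And>z. z \<in> set D \<Longrightarrow> P (set D) z"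
    and "\<And>E. E \<subseteq> set U \<Longrightarrow> (\<And>z. z \<in> E \<Longrightarrow> P E z) \<Longrightarrow> E \<subseteq> set D"
proof -
  have less: "length (F A) < length A" if "F A \<noteq> A" for A
    using that unfolding F_def by (metis filter_id_conv length_filter_less)
  \<comment> \<open>If the iteration is not stationary by then, \<open>length U\<close> rounds have
    emptied the list, and the empty list is stationary as well.\<close>
  have prog: "F ((F ^^ i) U) = (F ^^ i) U \<or> length ((F ^^ i) U) + i \<le> length U" for i
  proof (induction i)
    case (Suc i)
    show ?case
    proof (cases "F ((F ^^ i) U) = (F ^^ i) U")
      case False
      then have "length (F ((F ^^ i) U)) < length ((F ^^ i) U)"
        by (rule less)
      then show ?thesis using Suc False by simp
    qed simp
  qed simp
  have "F D = D \<or> D = []" using prog[of "length U"] unfolding D_def by simp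
  then have fixp: "F D = D" by (auto simp: F_def)
  have setF: "set (F A) = {z \<in> set A. P (set A) z}" for A by (simp add: F_def)
  show "P (set D) z" if "z \<in> set D" for z
    using fixp that unfolding F_def by (metis filter_id_conv)
  show "E \<subseteq> set D" if E: "E \<subseteq> set U" "\<And>z. z \<in> E \<Longrightarrow> P E z" for E
  proof -
    have "E \<subseteq> set ((F ^^ i) U)" for i
    proof (induction i)
      case (Suc i)
      then have "P (set ((F ^^ i) U)) z" if "z \<in> E" for z using E(2)[OF that] mono by blast
      then show ?case using Suc by (auto simp: setF)
    qed (use E(1) in simp)
    then show ?thesis unfolding D_def .
  qed
qed

definition exits :: "nat list \<Rightarrow> nat exit list" where
  "exits Q = concat (map (\<lambda>m. concat (map (\<lambda>sw. concat (map (\<lambda>p. map (\<lambda>q. (m, sw, p, q)) Q) Q)) [True, False])) [True, False])"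

definition heads :: "nat list \<Rightarrow> nat list \<Rightarrow> (nat, nat) head list" where
  "heads Q G = concat (map (\<lambda>m. concat (map (\<lambda>sw. concat (map (\<lambda>p. concat (map (\<lambda>X.
     concat (map (\<lambda>q. map (\<lambda>Y. (m, sw, p, X, q, Y)) G) Q)) G)) Q)) [True, False])) [True, False])"

text \<open>The cut-off \<open>B\<close> keeps this polynomial in the unary number \<open>B\<close>.\<close>

definition subsets :: "nat \<Rightarrow> 'a list \<Rightarrow> 'a list list" where
  "subsets B E = fold (\<lambda>x A. take B (map (\<lambda>T. x # T) A @ A)) E [[]]"

definition universe :: "nat list \<Rightarrow> nat list \<Rightarrow> nat exit list list \<Rightarrow> ((nat, nat) head \<times> nat exit list) list" where
  "universe Q G Ts = concat (map (\<lambda>h. map (\<lambda>T. (h, T)) Ts) (heads Q G))"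

definition refine :: "bool \<Rightarrow> bool \<Rightarrow> bool \<Rightarrow> bool \<Rightarrow> nrule list \<Rightarrow> nat exit list list \<Rightarrow>
    ((nat, nat) head \<times> nat exit list) list \<Rightarrow> ((nat, nat) head \<times> nat exit list) list" where
  "refine ce cr s1 s2 R Ts D = filter (head_ok ce cr s1 s2 R Ts (set D)) D"

definition summaries :: "bool \<Rightarrow> bool \<Rightarrow> bool \<Rightarrow> bool \<Rightarrow> nat \<Rightarrow> nat list \<Rightarrow> nat list \<Rightarrow> nrule list \<Rightarrow>
    ((nat, nat) head \<times> nat exit list) list" where
  "summaries ce cr s1 s2 B Q G R =
     (refine ce cr s1 s2 R (subsets B (exits Q)) ^^ length (universe Q G (subsets B (exits Q))))
       (universe Q G (subsets B (exits Q)))"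

text \<open>Exit sets are compared as lists here. \<open>rev (exits Q)\<close> is the order in which
  \<open>subsets\<close> produces the full set.\<close>

definition decide :: "bool \<Rightarrow> bool \<Rightarrow> bool \<Rightarrow> bool \<Rightarrow> nat \<Rightarrow> inst \<Rightarrow> nat \<times> nat \<Rightarrow> nat \<times> nat \<Rightarrow> bool" where
  "decide ce cr s1 s2 B J x y \<longleftrightarrow>
     ((True, False, fst x, snd x, fst y, snd y), rev (exits (fst J)))
     \<in> set (summaries ce cr s1 s2 B (fst J) (fst (snd J)) (fst (snd (snd (snd (snd (snd J)))))))"

lemma set_exits: "set (exits Q) = UNIV \<times> UNIV \<times> set Q \<times> set Q"
proof (rule set_eqI)
  fix e :: "nat exit"
  obtain m sw p q where e: "e = (m, sw, p, q)" by (metis prod.exhaust)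
  show "e \<in> set (exits Q) \<longleftrightarrow> e \<in> UNIV \<times> UNIV \<times> set Q \<times> set Q"
    unfolding e exits_def by (cases m; cases sw) auto
qed

lemma length_exits: "length (exits Q) = 4 * (length Q * length Q)"
  unfolding exits_def by (simp add: length_concat comp_def sum_list_triv)

lemma set_universe: "set (universe Q G Ts) = (UNIV \<times> UNIV \<times> set Q \<times> set G \<times> set Q \<times> set G) \<times> set Ts"
proof -
  have "set (heads Q G) = UNIV \<times> UNIV \<times> set Q \<times> set G \<times> set Q \<times> set G"
  proof (rule set_eqI)
    fix h :: "(nat, nat) head"
    obtain m sw p X q Y where h: "h = (m, sw, p, X, q, Y)" by (metis prod.exhaust)
    show "h \<in> set (heads Q G) \<longleftrightarrow> h \<in> UNIV \<times> UNIV \<times> set Q \<times> set G \<times> set Q \<times> set G"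
      unfolding h heads_def by (cases m; cases sw) (auto simp: image_iff)
  qed
  then show ?thesis unfolding universe_def by auto
qed

lemma subsets_spec:
  assumes "2 ^ length E \<le> B"
  shows "set ` set (subsets B E) = Pow (set E)" "rev E \<in> set (subsets B E)"
proof -
  have "length (subsets B E) = 2 ^ length E \<and> set ` set (subsets B E) = Pow (set E) \<and> rev E \<in> set (subsets B E)"
    using assms
  proof (induction E rule: rev_induct)
    case Nil
    then show ?case by (simp add: subsets_def)
  next
    case (snoc x E)
    let ?A = "subsets B E"
    have IH: "length ?A = 2 ^ length E" "set ` set ?A = Pow (set E)" "rev E \<in> set ?A"
      using snoc by auto
    have s: "subsets B (E @ [x]) = map (\<lambda>T. x # T) ?A @ ?A"
      using snoc.prems IH(1) by (simp add: subsets_def)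
    have "set ` set (map (\<lambda>T. x # T) ?A @ ?A) = insert x ` (set ` set ?A) \<union> set ` set ?A"
      by (auto simp: image_image image_Un)
    also have "\<dots> = Pow (set (E @ [x]))" unfolding IH(2) by (auto simp: Pow_insert)
    finally show ?case using IH by (simp add: s)
  qed
  then show "set ` set (subsets B E) = Pow (set E)" "rev E \<in> set (subsets B E)" by auto
qed

theorem decide_correct:
  assumes "valid_inst J" "2 ^ (4 * (length (fst J) * length (fst J))) \<le> B"
    and x: "fst x \<in> set (fst J)" "snd x \<in> set (fst (snd J))"
    and y: "fst y \<in> set (fst J)" "snd y \<in> set (fst (snd J))"
  shows "decide ce cr s1 s2 B J x y \<longleftrightarrow>
    mpre ce cr s1 s2 (pda_lts (instance_pda (mk_inst J))) (fst x, [snd x]) (fst y, [snd y])"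
proof -
  obtain Q G c r i R x' y' where J: "J = (Q, G, c, r, i, R, x', y')" by (metis prod.exhaust)
  let ?P = "instance_pda (mk_inst J)" and ?Ts = "subsets B (exits Q)"
  have P: "control ?P = set Q" "stack ?P = set G" "rules ?P = set R"
    by (simp_all add: J instance_pda_def)
  have v: "is_vpda ?P (set c) (set r) (set i)"
    using assms(1) unfolding valid_inst_iff valid_instance_def by (simp add: J)
  have "2 ^ length (exits Q) \<le> B" using assms(2) by (simp add: length_exits J)
  note S = subsets_spec[OF this]
  let ?D = "set (summaries ce cr s1 s2 B Q G R)"
  have mono: "\<forall>A B z. A \<subseteq> B \<longrightarrow> head_ok ce cr s1 s2 R ?Ts A z \<longrightarrow> head_ok ce cr s1 s2 R ?Ts B z"
    by (intro allI impI) (rule head_ok_mono)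
  note I = filter_iteration[where P = "head_ok ce cr s1 s2 R ?Ts" and U = "universe Q G ?Ts", OF mono,
      folded refine_def summaries_def]
  have "((True, False, fst x, snd x, fst y, snd y), rev (exits Q)) \<in> ?D \<longleftrightarrow>
     mpre ce cr s1 s2 (pda_lts ?P) (fst x, [snd x]) (fst y, [snd y])"
  proof (rule summary_correct[OF v])
    show "\<exists>T\<in>set ?Ts. set T = A" if "A \<subseteq> UNIV \<times> UNIV \<times> control ?P \<times> control ?P" for A
    proof -
      have "A \<in> set ` set ?Ts" using that unfolding S(1) set_exits P by blast
      then show ?thesis by blast
    qed
    show "rev (exits Q) \<in> set ?Ts" by (rule S)
    show "set (rev (exits Q)) = UNIV \<times> UNIV \<times> control ?P \<times> control ?P" by (simp add: set_exits P)
    show "head_ok ce cr s1 s2 R ?Ts ?D z" if "z \<in> ?D" for z using I(1) that by blast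
    show "E \<subseteq> ?D" if "E \<subseteq> (UNIV \<times> UNIV \<times> control ?P \<times> stack ?P \<times> control ?P \<times> stack ?P) \<times> set ?Ts"
      "\<And>z. z \<in> E \<Longrightarrow> head_ok ce cr s1 s2 R ?Ts E z" for E
      by (rule I(2)) (use that in \<open>simp_all add: set_universe P\<close>)
  qed (unfold P, use x y in \<open>simp_all add: J\<close>)
  then show ?thesis by (simp add: decide_def J)
qed

lemma pt_exits: "pt f \<Longrightarrow> pt (\<lambda>x. exits (f x))"
  by (erule pt_comp) (unfold exits_def, intro pt_intros)

lemma pt_heads: "pt f \<Longrightarrow> pt g \<Longrightarrow> pt (\<lambda>x. heads (f x) (g x))"
  by (rule pt_comp2[of heads]) (unfold heads_def, intro pt_intros)

lemma pt_universe: "pt f \<Longrightarrow> pt g \<Longrightarrow> pt h \<Longrightarrow> pt (\<lambda>x. universe (f x) (g x) (h x))"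
  by (rule pt_comp3[of universe]) (unfold universe_def, intro pt_intros pt_heads)

lemma pt_subsets:
  assumes "pt f" "pt g"
  shows "pt (\<lambda>x. subsets (f x) (g x :: 'b :: enc list))"
proof -
  have "pt (\<lambda>p :: nat \<times> 'b list. fold (\<lambda>x A. take (fst p) (map (\<lambda>T. x # T) A @ A)) (snd p) [[]])"
  proof (rule pt_fold[where b = "\<lambda>n. Suc (Suc n * Suc n)"])
    fix p :: "nat \<times> 'b list" and i
    obtain B E where p: "p = (B, E)" by fastforce
    have inv: "length (subsets B E') \<le> Suc B \<and> (\<forall>T\<in>set (subsets B E'). sz T \<le> sz E')" for E' :: "'b list"
    proof (induction E' rule: rev_induct)
      case Nil
      then show ?case by (simp add: subsets_def)
    next
      case (snoc x E')
      have s: "subsets B (E' @ [x]) = take B (map (\<lambda>T. x # T) (subsets B E') @ subsets B E')"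
        by (simp add: subsets_def)
      have "sz T \<le> sz (E' @ [x])" if "T \<in> set (subsets B (E' @ [x]))" for T
        using that snoc sz_append[of E' "[x]"] unfolding s by (auto dest!: in_set_takeD)
      then show ?case unfolding s by simp
    qed
    have "sz (subsets B (take i E)) \<le> Suc (length (subsets B (take i E)) * Suc (sz E))"
      by (rule sz_list_bound) (use inv[of "take i E"] sz_take[of i E] in force)
    also have "\<dots> \<le> Suc (Suc (sz p) * Suc (sz p))"
      using inv[of "take i E"] by (intro Suc_le_mono[THEN iffD2] mult_mono) (auto simp: p)
    finally show "sz (fold (\<lambda>x A. take (fst p) (map (\<lambda>T. x # T) A @ A)) (take i (snd p)) [[]])
        \<le> Suc (Suc (sz p) * Suc (sz p))" by (simp add: p subsets_def)
  qed (intro pt_intros pbd_intros)+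
  then have "pt (\<lambda>p :: nat \<times> 'b list. subsets (fst p) (snd p))" by (simp add: subsets_def)
  from pt_comp2[OF this assms] show ?thesis .
qed

lemma pt_head_ok:
  "pt (\<lambda>x :: nrule list \<times> nat exit list list \<times> ((nat, nat) head \<times> nat exit list) list \<times> ((nat, nat) head \<times> nat exit list).
     head_ok ce cr s1 s2 (fst x) (fst (snd x)) (set (fst (snd (snd x)))) (snd (snd (snd x))))"
  unfolding head_ok_def moves_ok_def succ_ok_def subinit_def enabled_def case_prod_beta
  by (intro pt_intros)

lemma sz_filter: "sz (filter P xs) \<le> sz xs" by (induction xs) auto

lemma pt_summaries:
  "pt (\<lambda>x :: nat \<times> nat list \<times> nat list \<times> nrule list.
     summaries ce cr s1 s2 (fst x) (fst (snd x)) (fst (snd (snd x))) (snd (snd (snd x))))"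
proof -
  let ?Ts = "\<lambda>x :: nat \<times> nat list \<times> nat list \<times> nrule list. subsets (fst x) (exits (fst (snd x)))"
  let ?U = "\<lambda>x. universe (fst (snd x)) (fst (snd (snd x))) (?Ts x)"
  have Ts: "pt ?Ts" by (intro pt_subsets pt_exits pt_intros)
  have U: "pt ?U" by (intro pt_universe pt_subsets pt_exits pt_intros)
  obtain q where q: "\<And>x. sz (?U x) \<le> poly q (sz x)" by (rule pt_sz[OF U]) (rule that)
  have "pt (\<lambda>x. (refine ce cr s1 s2 (snd (snd (snd x))) (?Ts x) ^^ length (?U x)) (?U x))"
  proof (rule pt_funpow[OF _ U, where b = "poly q"])
    show "pt (\<lambda>x. length (?U x))" by (rule pt_length[OF U])
    show "pt (\<lambda>z. refine ce cr s1 s2 (snd (snd (snd (fst z)))) (?Ts (fst z)) (snd z))"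
      unfolding refine_def
    proof (rule pt_filter)
      let ?f = "\<lambda>z :: ((nat \<times> nat list \<times> nat list \<times> nrule list) \<times> ((nat, nat) head \<times> nat exit list) list) \<times>
          ((nat, nat) head \<times> nat exit list).
          (snd (snd (snd (fst (fst z)))), ?Ts (fst (fst z)), snd (fst z), snd z)"
      have "pt ?f" by (intro pt_subsets pt_exits pt_intros)
      from pt_comp[OF this pt_head_ok] show "pt (\<lambda>z :: ((nat \<times> nat list \<times> nat list \<times> nrule list) \<times> ((nat, nat) head \<times> nat exit list) list) \<times>
          ((nat, nat) head \<times> nat exit list). head_ok ce cr s1 s2 (snd (snd (snd (fst (fst z))))) (?Ts (fst (fst z)))
          (set (snd (fst z))) (snd z))" by simp
    qed (intro pt_intros)
    \<comment> \<open>Refinement only removes elements, so the size of the initial universe bounds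
      every round.\<close>
    show "sz ((refine ce cr s1 s2 (snd (snd (snd x))) (?Ts x) ^^ i) (?U x)) \<le> poly q (sz x)" for x i
    proof (induction i)
      case (Suc i)
      then show ?case using sz_filter le_trans unfolding funpow.simps comp_def refine_def by blast
    qed (simp add: q)
  qed (rule pbd_poly)
  then show ?thesis unfolding summaries_def .
qed

lemma pt_decide:
  assumes "pt B" "pt (J :: 'a :: enc \<Rightarrow> inst)" "pt x" "pt y"
  shows "pt (\<lambda>z. decide ce cr s1 s2 (B z) (J z) (x z) (y z))"
proof -
  have "pt (\<lambda>z. (B z, fst (J z), fst (snd (J z)), fst (snd (snd (snd (snd (snd (J z))))))))"
    by (intro pt_intros assms)
  from pt_comp[OF this pt_summaries]
  have "pt (\<lambda>z. summaries ce cr s1 s2 (B z) (fst (J z)) (fst (snd (J z))) (fst (snd (snd (snd (snd (snd (J z))))))))"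
    by simp
  then show ?thesis unfolding decide_def by (intro pt_exits pt_intros assms)
qed

text \<open>Non-canonical inputs are rejected by re-encoding the parsed instance.\<close>

theorem vpda_problem_EXPTIME:
  fixes chk :: "nat \<times> inst \<Rightarrow> bool"
  assumes rel: "\<And>B J. valid_inst J \<Longrightarrow> 2 ^ (4 * (length (fst J) * length (fst J))) \<le> B \<Longrightarrow>
      chk (B, J) \<longleftrightarrow> rel (pda_lts (instance_pda (mk_inst J)))
        (fst (i_proc1 (mk_inst J)), [snd (i_proc1 (mk_inst J))]) (fst (i_proc2 (mk_inst J)), [snd (i_proc2 (mk_inst J))])"
    and chk: "pt chk"
  shows "vpda_problem rel \<in> EXPTIME"
proof (rule padded_pt_imp_EXPTIME)
  let ?J = "\<lambda>z. fst (parse_inst (snd z) (fst z))"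
  let ?g = "\<lambda>z. enc_instance (mk_inst (?J z)) = fst z \<and> valid_inst (?J z) \<and> chk (snd z, ?J z)"
  have J: "pt ?J" by (intro pt_parse_inst pt_intros)
  show "pt ?g"
    by (intro pt_conj pt_eq pt_enc_inst pt_valid_inst J pt_comp[OF _ chk] pt_pair pt_fst pt_snd pt_id)
  fix w :: "bool list"
  \<comment> \<open>With n the length of the word, the exponent is n plus four times n squared: the
    linear part covers the values of the numerals, the quadratic part the number of exit sets, as
    there are at most n control states and two flags per exit.\<close>
  let ?B = "2 ^ poly [:0, 1, 4:] (length w)"
  show "w \<in> vpda_problem rel \<longleftrightarrow> ?g (w, ?B)"
  proof
    assume "w \<in> vpda_problem rel"
    then obtain I p X q Y where I: "w = enc_instance I" "valid_instance I" "i_proc1 I = (p, X)"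
      "i_proc2 I = (q, Y)" "rel (pda_lts (instance_pda I)) (p, [X]) (q, [Y])"
      unfolding vpda_problem_def by blast
    obtain J where IJ: "I = mk_inst J" using mk_inst_surj by blast
    have "(2 :: nat) ^ length w \<le> ?B" by (rule power_increasing) auto
    then have P: "fst (parse_inst ?B w) = J" using parse_enc_inst[of J ?B] I(1) IJ by simp
    have l: "length (fst J) \<le> length w"
      using length_enc_list[of "fst J" Defs.enc_nat] I(1) IJ
      by (cases J rule: mk_inst.cases) (simp add: enc_instance_def)
    have "(2 :: nat) ^ (4 * (length (fst J) * length (fst J))) \<le> ?B"
    proof (rule power_increasing)
      have "length (fst J) * length (fst J) \<le> length w * length w" using l by (intro mult_mono) auto
      then show "4 * (length (fst J) * length (fst J)) \<le> poly [:0, 1, 4:] (length w)" by (simp add: algebra_simps)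
    qed simp
    moreover have v: "valid_inst J" using I(2) IJ by (simp add: valid_inst_iff)
    ultimately show "?g (w, ?B)" using rel[of J ?B] I IJ P by simp
  next
    assume g: "?g (w, ?B)"
    define J where "J = fst (parse_inst ?B w)"
    have J: "w = enc_instance (mk_inst J)" "valid_inst J" "chk (?B, J)" using g by (auto simp: J_def)
    have l: "length (fst J) \<le> length w"
      using length_enc_list[of "fst J" Defs.enc_nat] J(1)
      by (cases J rule: mk_inst.cases) (simp add: enc_instance_def)
    have "(2 :: nat) ^ (4 * (length (fst J) * length (fst J))) \<le> ?B"
    proof (rule power_increasing)
      have "length (fst J) * length (fst J) \<le> length w * length w" using l by (intro mult_mono) auto
      then show "4 * (length (fst J) * length (fst J)) \<le> poly [:0, 1, 4:] (length w)" by (simp add: algebra_simps)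
    qed simp
    from rel[OF J(2) this] J show "w \<in> vpda_problem rel"
      unfolding vpda_problem_def valid_inst_iff
      by (intro CollectI exI[of _ "mk_inst J"]) (metis prod.collapse)
  qed
qed

theorem mpre_EXPTIME: "vpda_problem (mpre ce cr s1 s2) \<in> EXPTIME"
proof (rule vpda_problem_EXPTIME)
  let ?x = "\<lambda>J :: inst. fst (snd (snd (snd (snd (snd (snd J))))))" and ?y = "\<lambda>J :: inst. snd (snd (snd (snd (snd (snd (snd J))))))"
  show "pt (\<lambda>z. decide ce cr s1 s2 (fst z) (snd z) (?x (snd z)) (?y (snd z)))"
    by (intro pt_decide pt_intros)
  fix B :: nat and J assume v: "valid_inst J" "2 ^ (4 * (length (fst J) * length (fst J))) \<le> B"
  obtain Q G c r i R x y where J: "J = (Q, G, c, r, i, R, x, y)" by (metis prod.exhaust)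
  show "decide ce cr s1 s2 (fst (B, J)) (snd (B, J)) (?x (snd (B, J))) (?y (snd (B, J))) \<longleftrightarrow>
     mpre ce cr s1 s2 (pda_lts (instance_pda (mk_inst J)))
        (fst (i_proc1 (mk_inst J)), [snd (i_proc1 (mk_inst J))]) (fst (i_proc2 (mk_inst J)), [snd (i_proc2 (mk_inst J))])"
    using decide_correct[OF v, of x y] v(1) by (simp add: J valid_inst_def)
qed

theorem kernel_mpre_EXPTIME: "vpda_problem (kernel_equiv (mpre ce cr s1 s2)) \<in> EXPTIME"
proof (rule vpda_problem_EXPTIME)
  let ?x = "\<lambda>J :: inst. fst (snd (snd (snd (snd (snd (snd J))))))" and ?y = "\<lambda>J :: inst. snd (snd (snd (snd (snd (snd (snd J))))))"
  show "pt (\<lambda>z. decide ce cr s1 s2 (fst z) (snd z) (?x (snd z)) (?y (snd z)) \<and>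
      decide ce cr s1 s2 (fst z) (snd z) (?y (snd z)) (?x (snd z)))"
    by (intro pt_conj pt_decide pt_intros)
  fix B :: nat and J assume v: "valid_inst J" "2 ^ (4 * (length (fst J) * length (fst J))) \<le> B"
  obtain Q G c r i R x y where J: "J = (Q, G, c, r, i, R, x, y)" by (metis prod.exhaust)
  show "(decide ce cr s1 s2 (fst (B, J)) (snd (B, J)) (?x (snd (B, J))) (?y (snd (B, J))) \<and>
      decide ce cr s1 s2 (fst (B, J)) (snd (B, J)) (?y (snd (B, J))) (?x (snd (B, J)))) \<longleftrightarrow>
     kernel_equiv (mpre ce cr s1 s2) (pda_lts (instance_pda (mk_inst J)))
        (fst (i_proc1 (mk_inst J)), [snd (i_proc1 (mk_inst J))]) (fst (i_proc2 (mk_inst J)), [snd (i_proc2 (mk_inst J))])"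
    using decide_correct[OF v, of x y] decide_correct[OF v, of y x] v(1)
    by (simp add: J valid_inst_def kernel_equiv_def)
qed

section \<open>Alternating programs as visibly pushdown automata\<close>

text \<open>A program is a list of named instructions over Boolean registers: \<open>Assign\<close> sets a register,
  \<open>Att\<close> and \<open>Dfn\<close> let the attacker or the defender choose among indexed successors, and \<open>Check\<close>
  ends the play, won by the attacker iff the register differs from the claimed value. The
  registers are kept as a log of assignments on the stack.\<close>

type_synonym instr = "nat \<times> nat \<times> bool \<times> nat \<times> (nat \<times> nat) list"

text \<open>Instructions are tuples headed by an opcode instead of a datatype, which makes them an
  \<open>enc\<close> type that the reduction can compute with.\<close>

definition Assign :: "nat \<Rightarrow> bool \<Rightarrow> nat \<Rightarrow> instr" where "Assign \<rho> b s = (0, \<rho>, b, s, [])"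
definition Att :: "(nat \<times> nat) list \<Rightarrow> instr" where "Att l = (1, 0, False, 0, l)"
definition Dfn :: "(nat \<times> nat) list \<Rightarrow> instr" where "Dfn l = (2, 0, False, 0, l)"
definition Check :: "nat \<Rightarrow> bool \<Rightarrow> instr" where "Check \<rho> b = (3, \<rho>, b, 0, [])"

lemmas instr_defs = Assign_def Att_def Dfn_def Check_def

text \<open>An unassigned register counts as \<open>False\<close>; accordingly the bottom of the
  stack is treated in \<open>game_rules\<close> like an entry \<open>False\<close>.\<close>

fun lookup :: "nat \<Rightarrow> (nat \<times> bool) list \<Rightarrow> bool" where
  "lookup \<rho> [] = False"
| "lookup \<rho> ((\<rho>', b) # \<sigma>) = (if \<rho>' = \<rho> then b else lookup \<rho> \<sigma>)"

text \<open>The least fixpoint gives infinite plays to the defender, as in simulation and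
  bisimulation games.\<close>

inductive aw :: "(nat \<times> instr) list \<Rightarrow> nat \<Rightarrow> (nat \<times> bool) list \<Rightarrow> bool" for P where
  aw_Assign: "(s, Assign \<rho> b s') \<in> set P \<Longrightarrow> aw P s' ((\<rho>, b) # \<sigma>) \<Longrightarrow> aw P s \<sigma>"
| aw_Att: "(s, Att l) \<in> set P \<Longrightarrow> (i, s') \<in> set l \<Longrightarrow> aw P s' \<sigma> \<Longrightarrow> aw P s \<sigma>"
| aw_Dfn: "(s, Dfn l) \<in> set P \<Longrightarrow> (\<And>i s'. (i, s') \<in> set l \<Longrightarrow> aw P s' \<sigma>) \<Longrightarrow> aw P s \<sigma>"
| aw_Check: "(s, Check \<rho> b) \<in> set P \<Longrightarrow> lookup \<rho> \<sigma> \<noteq> b \<Longrightarrow> aw P s \<sigma>"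

text \<open>\<open>K\<close> bounds the choice indices, which become actions, and \<open>M\<close>
  the registers, which become stack symbols. Distinct indices ensure that an action determines the
  successor, so the other side cannot answer with a different one.\<close>

definition wf_instr :: "nat \<Rightarrow> nat \<Rightarrow> nat set \<Rightarrow> instr \<Rightarrow> bool" where
  "wf_instr K M S i \<longleftrightarrow> (\<exists>\<rho> b s. i = Assign \<rho> b s \<and> \<rho> < M \<and> s \<in> S) \<or>
     (\<exists>l. (i = Att l \<or> i = Dfn l) \<and> distinct (map fst l) \<and> (\<forall>(j, s)\<in>set l. j < K \<and> s \<in> S)) \<or>
     (\<exists>\<rho> b. i = Check \<rho> b \<and> \<rho> < M)"

lemma wf_instr_simps:
  "wf_instr K M S (Assign \<rho> b s) \<longleftrightarrow> \<rho> < M \<and> s \<in> S"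
  "wf_instr K M S (Att l) \<longleftrightarrow> distinct (map fst l) \<and> (\<forall>(j, s)\<in>set l. j < K \<and> s \<in> S)"
  "wf_instr K M S (Dfn l) \<longleftrightarrow> distinct (map fst l) \<and> (\<forall>(j, s)\<in>set l. j < K \<and> s \<in> S)"
  "wf_instr K M S (Check \<rho> b) \<longleftrightarrow> \<rho> < M"
  unfolding wf_instr_def instr_defs by auto

definition wf_program :: "nat \<Rightarrow> nat \<Rightarrow> (nat \<times> instr) list \<Rightarrow> bool" where
  "wf_program K M P \<longleftrightarrow> distinct (map fst P) \<and> (\<forall>(s, i)\<in>set P. wf_instr K M (fst ` set P) i)"

definition rsym :: "nat \<Rightarrow> bool \<Rightarrow> nat" where "rsym \<rho> b = Suc (2 * \<rho> + (if b then 1 else 0))"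

lemma rsym_inject [simp]: "rsym \<rho> b = rsym \<rho>' b' \<longleftrightarrow> \<rho> = \<rho>' \<and> b = b'"
  unfolding rsym_def by (auto split: if_splits; presburger)

lemma rsym_neq_0 [simp]: "rsym \<rho> b \<noteq> 0" "0 \<noteq> rsym \<rho> b" by (auto simp: rsym_def)

text \<open>Control states are pairs of a tag and a program state: tag \<open>2\<close> on the left, \<open>3\<close> on the right,
  and \<open>4\<close>, \<open>5 + i\<close> for the intermediate states of the gadget with which the defender forces the
  choice \<open>i\<close>: any other continuation leads to identical configurations.\<close>

definition game_rules :: "nat list \<Rightarrow> nat \<Rightarrow> instr \<Rightarrow> (nat \<times> nat \<times> nat \<times> nat \<times> nat \<times> nat list) list" where
  "game_rules G s i = (case i of (k, \<rho>, b, s', l) \<Rightarrow> concat (map (\<lambda>X.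
     if k = 0 then [(2, X, 0, 2, s', [rsym \<rho> b, X]), (3, X, 0, 3, s', [rsym \<rho> b, X])]
     else if k = 1 then map (\<lambda>x. (2, X, 2 + fst x, 2, snd x, [X])) l @ map (\<lambda>x. (3, X, 2 + fst x, 3, snd x, [X])) l
     else if k = 2 then (2, X, 2, 4, s, [X]) #
        map (\<lambda>x. (2, X, 2, 5 + fst x, s, [X])) l @ map (\<lambda>x. (3, X, 2, 5 + fst x, s, [X])) l @
        map (\<lambda>x. (4, X, 2 + fst x, 2, snd x, [X])) l @
        concat (map (\<lambda>x. map (\<lambda>y. (5 + fst x, X, 2 + fst y, if fst x = fst y then 3 else 2, snd y, [X])) l) l)
     else if X = 0 \<or> X = rsym \<rho> False then (if b then [(2, X, 2, 2, s, [X])] else [])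
     else if X = rsym \<rho> True then (if b then [] else [(2, X, 2, 2, s, [X])])
     else [(2, X, 1, 2, s, []), (3, X, 1, 3, s, [])]) G))"

definition cd :: "nat \<Rightarrow> nat \<Rightarrow> nat" where "cd t s = prod_encode (t, s)"

lemma cd_inject [simp]: "cd t s = cd t' s' \<longleftrightarrow> t = t' \<and> s = s'"
  unfolding cd_def by (simp add: prod_encode_eq)

definition syms :: "nat \<Rightarrow> nat list" where "syms M = [0..<1 + 2 * M]"

lemma set_syms: "X \<in> set (syms M) \<longleftrightarrow> X \<le> 2 * M" by (auto simp: syms_def)

lemma rsym_in_syms: "\<rho> < M \<Longrightarrow> rsym \<rho> b \<in> set (syms M)" by (auto simp: set_syms rsym_def)

definition game_inst :: "nat \<Rightarrow> nat \<Rightarrow> nat \<Rightarrow> (nat \<times> instr) list \<Rightarrow> inst" where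
  "game_inst K M s0 P =
     (concat (map (\<lambda>t. map (\<lambda>x. cd t (fst x)) P) [0..<5 + K]),
      syms M, [0], [1], map (\<lambda>i. 2 + i) [0..<1 + K],
      concat (map (\<lambda>x. map (\<lambda>r. (cd (fst r) (fst x), fst (snd r), fst (snd (snd r)),
          cd (fst (snd (snd (snd r)))) (fst (snd (snd (snd (snd r))))), snd (snd (snd (snd (snd r))))))
        (game_rules (syms M) (fst x) (snd x))) P),
      (cd 2 s0, 0), (cd 3 s0, 0))"

section \<open>The transition system of a program\<close>

locale game =
  fixes K M s0 :: nat and P :: "(nat \<times> instr) list"
  assumes wf: "wf_program K M P" and s0: "s0 \<in> fst ` set P"
begin

abbreviation "G \<equiv> syms M"
abbreviation "A \<equiv> instance_pda (mk_inst (game_inst K M s0 P))"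
abbreviation "LT \<equiv> pda_lts A"

lemma control_A: "control A = {cd t s | t s. t < 5 + K \<and> s \<in> fst ` set P}"
  by (auto simp: game_inst_def instance_pda_def) force

lemma stack_A: "stack A = set G"
  by (simp add: game_inst_def instance_pda_def)

lemma rules_A: "rules A = {(cd t s, X, a, cd t' s', \<alpha>) | t s X a t' s' \<alpha>.
    \<exists>i. (s, i) \<in> set P \<and> (t, X, a, t', s', \<alpha>) \<in> set (game_rules G s i)}"
  by (auto simp: game_inst_def instance_pda_def image_iff) force+

lemma instr_unique: "(s, i) \<in> set P \<Longrightarrow> (s, i') \<in> set P \<Longrightarrow> i = i'"
  using wf unfolding wf_program_def by (meson eq_key_imp_eq_value)

lemma aw_Assign_iff:
  assumes "(s, Assign \<rho> b s') \<in> set P"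
  shows "aw P s \<sigma> \<longleftrightarrow> aw P s' ((\<rho>, b) # \<sigma>)"
proof
  assume "aw P s \<sigma>"
  then show "aw P s' ((\<rho>, b) # \<sigma>)"
  proof cases
    case (aw_Assign \<rho>' b' s1)
    then show ?thesis using instr_unique[OF assms aw_Assign(1)] by (simp add: instr_defs)
  qed (auto simp: instr_defs dest!: instr_unique[OF assms])
qed (rule aw.aw_Assign[OF assms])

lemma aw_Att_iff:
  assumes "(s, Att l) \<in> set P"
  shows "aw P s \<sigma> \<longleftrightarrow> (\<exists>x\<in>set l. aw P (snd x) \<sigma>)"
proof
  assume "aw P s \<sigma>"
  then show "\<exists>x\<in>set l. aw P (snd x) \<sigma>"
  proof cases
    case (aw_Att l' i s')
    then have "l' = l" using instr_unique[OF assms aw_Att(1)] by (simp add: instr_defs)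
    then show ?thesis using aw_Att(2,3) by (intro bexI[of _ "(i, s')"]) simp_all
  qed (auto simp: instr_defs dest!: instr_unique[OF assms])
next
  assume "\<exists>x\<in>set l. aw P (snd x) \<sigma>"
  then obtain x where x: "x \<in> set l" "aw P (snd x) \<sigma>" by blast
  show "aw P s \<sigma>" by (rule aw.aw_Att[OF assms _ x(2), of "fst x"]) (use x(1) in simp)
qed

lemma aw_Dfn_iff:
  assumes "(s, Dfn l) \<in> set P"
  shows "aw P s \<sigma> \<longleftrightarrow> (\<forall>x\<in>set l. aw P (snd x) \<sigma>)"
proof
  assume "aw P s \<sigma>"
  then show "\<forall>x\<in>set l. aw P (snd x) \<sigma>"
  proof cases
    case (aw_Dfn l')
    then have "l' = l" using instr_unique[OF assms aw_Dfn(1)] by (simp add: instr_defs)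
    then show ?thesis using aw_Dfn(2) by (metis prod.collapse)
  qed (auto simp: instr_defs dest!: instr_unique[OF assms])
next
  assume "\<forall>x\<in>set l. aw P (snd x) \<sigma>"
  then show "aw P s \<sigma>" by (intro aw.aw_Dfn[OF assms]) force
qed

lemma aw_Check_iff:
  assumes "(s, Check \<rho> b) \<in> set P"
  shows "aw P s \<sigma> \<longleftrightarrow> lookup \<rho> \<sigma> \<noteq> b"
proof
  assume "aw P s \<sigma>"
  then show "lookup \<rho> \<sigma> \<noteq> b"
  proof cases
    case (aw_Check \<rho>' b')
    then show ?thesis using instr_unique[OF assms aw_Check(1)] by (simp add: instr_defs)
  qed (auto simp: instr_defs dest!: instr_unique[OF assms])
qed (rule aw.aw_Check[OF assms])

lemma wf_in: "(s, i) \<in> set P \<Longrightarrow> wf_instr K M (fst ` set P) i"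
  using wf unfolding wf_program_def by blast

lemma mem_Assign_rules:
  "(t, Y, a, t', u, \<alpha>) \<in> set (game_rules G s (Assign \<rho> b s')) \<longleftrightarrow>
     Y \<in> set G \<and> (t = 2 \<or> t = 3) \<and> t' = t \<and> a = 0 \<and> u = s' \<and> \<alpha> = [rsym \<rho> b, Y]"
  unfolding game_rules_def instr_defs by auto

lemma mem_Att_rules:
  "(t, Y, a, t', u, \<alpha>) \<in> set (game_rules G s (Att l)) \<longleftrightarrow>
     Y \<in> set G \<and> (t = 2 \<or> t = 3) \<and> t' = t \<and> \<alpha> = [Y] \<and> (\<exists>x\<in>set l. u = snd x \<and> a = 2 + fst x)"
  unfolding game_rules_def instr_defs by (auto simp: image_iff)

text \<open>The attacker's only useful opening is the left move to tag \<open>4\<close>, since each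
  move to a tag \<open>5 + i\<close> can be copied. The answer \<open>5 + j\<close> fixes the
  defender's choice: now action \<open>2 + j\<close> leads to tags \<open>2\<close> and
  \<open>3\<close> at successor \<open>j\<close>, while any other action takes both sides to tag
  \<open>2\<close> in the same state.\<close>

lemma mem_Dfn_rules:
  "(t, Y, a, t', u, \<alpha>) \<in> set (game_rules G s (Dfn l)) \<longleftrightarrow> Y \<in> set G \<and> \<alpha> = [Y] \<and>
     (t = 2 \<and> a = 2 \<and> t' = 4 \<and> u = s \<or>
      (t = 2 \<or> t = 3) \<and> a = 2 \<and> u = s \<and> (\<exists>x\<in>set l. t' = 5 + fst x) \<or>
      t = 4 \<and> t' = 2 \<and> (\<exists>x\<in>set l. u = snd x \<and> a = 2 + fst x) \<or>
      (\<exists>x\<in>set l. \<exists>y\<in>set l. u = snd y \<and> t = 5 + fst x \<and> a = 2 + fst y \<and>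
         t' = (if fst x = fst y then 3 else 2)))"
proof -
  have "set (game_rules G s (Dfn l)) = (\<Union>X\<in>set G. {(2, X, 2, 4, s, [X])} \<union>
      ((\<lambda>x. (2, X, 2, 5 + fst x, s, [X])) ` set l \<union> ((\<lambda>x. (3, X, 2, 5 + fst x, s, [X])) ` set l \<union>
      ((\<lambda>x. (4, X, 2 + fst x, 2, snd x, [X])) ` set l \<union>
      (\<Union>x\<in>set l. (\<lambda>y. (5 + fst x, X, 2 + fst y, if fst x = fst y then 3 else 2, snd y, [X])) ` set l)))))"
    unfolding game_rules_def instr_defs by simp
  then have E: "z \<in> set (game_rules G s (Dfn l)) \<longleftrightarrow> (\<exists>X\<in>set G. z = (2, X, 2, 4, s, [X]) \<or>
      (\<exists>x\<in>set l. z = (2, X, 2, 5 + fst x, s, [X])) \<or> (\<exists>x\<in>set l. z = (3, X, 2, 5 + fst x, s, [X])) \<or>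
      (\<exists>x\<in>set l. z = (4, X, 2 + fst x, 2, snd x, [X])) \<or>
      (\<exists>x\<in>set l. \<exists>y\<in>set l. z = (5 + fst x, X, 2 + fst y, if fst x = fst y then 3 else 2, snd y, [X])))" for z
    by (simp only: UN_iff Un_iff image_iff singleton_iff)
  show ?thesis (is "?l \<longleftrightarrow> ?r")
  proof
    assume ?l
    then show ?r unfolding E prod.inject by (elim bexE disjE conjE; hypsubst; blast)
  next
    assume ?r
    then have "Y \<in> set G" by blast
    then show ?l using \<open>?r\<close> unfolding E prod.inject by (intro bexI[of _ Y]) blast+
  qed
qed

text \<open>Both sides pop the log in step until an entry for \<rho> or the bottom appears. There
  only the left side can move, and only if the value found differs from the claim; otherwise both
  are stuck and the defender has survived.\<close>

lemma mem_Check_rules: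
  "(t, Y, a, t', u, \<alpha>) \<in> set (game_rules G s (Check \<rho> b)) \<longleftrightarrow> Y \<in> set G \<and> u = s \<and>
     (if Y = 0 \<or> Y = rsym \<rho> False then b \<and> t = 2 \<and> a = 2 \<and> t' = 2 \<and> \<alpha> = [Y]
      else if Y = rsym \<rho> True then \<not> b \<and> t = 2 \<and> a = 2 \<and> t' = 2 \<and> \<alpha> = [Y]
      else (t = 2 \<or> t = 3) \<and> t' = t \<and> a = 1 \<and> \<alpha> = [])"
  unfolding game_rules_def instr_defs by (auto split: if_splits)

lemmas mem_game_rules = mem_Assign_rules mem_Att_rules mem_Dfn_rules mem_Check_rules

lemma valid_game_inst: "valid_inst (game_inst K M s0 P)"
proof -
  have r: "t < 5 + K \<and> X \<in> set G \<and> t' < 5 + K \<and> s' \<in> fst ` set P \<and> set \<alpha> \<subseteq> set G \<and>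
      (a = 0 \<and> length \<alpha> = 2 \<or> a = 1 \<and> \<alpha> = [] \<or> 2 \<le> a \<and> a < 3 + K \<and> length \<alpha> = 1)"
    if pi: "(s, i) \<in> set P" and gr: "(t, X, a, t', s', \<alpha>) \<in> set (game_rules G s i)" for s i t X a t' s' \<alpha>
  proof -
    have s: "s \<in> fst ` set P" using pi by force
    consider \<rho> b s1 where "i = Assign \<rho> b s1" "\<rho> < M" "s1 \<in> fst ` set P"
      | l where "i = Att l" "\<forall>(j, s)\<in>set l. j < K \<and> s \<in> fst ` set P"
      | l where "i = Dfn l" "\<forall>(j, s)\<in>set l. j < K \<and> s \<in> fst ` set P"
      | \<rho> b where "i = Check \<rho> b" "\<rho> < M"
      using wf_in[OF pi] unfolding wf_instr_def by metis
    then show ?thesis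
    proof cases
      case 1
      then show ?thesis using gr rsym_in_syms[OF 1(2), of b] unfolding 1(1) mem_game_rules by auto
    next
      case 2
      then show ?thesis using gr unfolding 2(1) mem_game_rules by auto
    next
      case 3
      then show ?thesis using gr s unfolding 3(1) mem_game_rules by (auto split: if_splits)
    next
      case 4
      then show ?thesis using gr s unfolding 4(1) mem_game_rules by (auto split: if_splits)
    qed
  qed
  let ?J = "game_inst K M s0 P"
  have R: "\<exists>t s X' a' t' s' i. p = cd t s \<and> X = X' \<and> a = a' \<and> q = cd t' s' \<and> (s, i) \<in> set P \<and>
      (t, X', a', t', s', \<alpha>) \<in> set (game_rules G s i)"
    if "(p, X, a, q, \<alpha>) \<in> rules A" for p X a q \<alpha>
    using that unfolding rules_A by blast
  have "p \<in> control A \<and> X \<in> stack A \<and> (a = 0 \<or> a = 1 \<or> a \<in> (\<lambda>i. 2 + i) ` set [0..<1 + K]) \<and> q \<in> control A \<and> set \<alpha> \<subseteq> stack A \<and>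
      (a = 0 \<longrightarrow> length \<alpha> = 2) \<and> (a = 1 \<longrightarrow> length \<alpha> = 0) \<and> (a \<in> (\<lambda>i. 2 + i) ` set [0..<1 + K] \<longrightarrow> length \<alpha> = 1)"
    if pr: "(p, X, a, q, \<alpha>) \<in> rules A" for p X a q \<alpha>
  proof -
    obtain t s t' s' i where c: "p = cd t s" "q = cd t' s'" "(s, i) \<in> set P"
      "(t, X, a, t', s', \<alpha>) \<in> set (game_rules G s i)" using R[OF pr] by blast
    have s: "s \<in> fst ` set P" using c(3) by force
    note h = r[OF c(3,4)]
    have "2 \<le> a \<and> a < 3 + K \<longleftrightarrow> a \<in> (\<lambda>i. 2 + i) ` set [0..<1 + K]"
    proof
      assume "2 \<le> a \<and> a < 3 + K"
      then have "a = 2 + (a - 2)" "a - 2 \<in> set [0..<1 + K]" by auto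
      then show "a \<in> (\<lambda>i. 2 + i) ` set [0..<1 + K]" by (rule image_eqI)
    qed auto
    then show ?thesis using h s c(1,2) unfolding control_A stack_A by auto
  qed
  note R' = this
  have rs: "rules A = set (fst (snd (snd (snd (snd (snd ?J))))))" and cs: "control A = set (fst ?J)"
    and ss: "stack A = set (fst (snd ?J))"
    by (simp_all add: game_inst_def instance_pda_def)
  have x: "cd 2 s0 \<in> control A" "cd 3 s0 \<in> control A" "0 \<in> stack A"
    using s0 unfolding control_A stack_A by (auto simp: set_syms)
  have "(\<forall>(p, X, a, q, \<alpha>)\<in>rules A. p \<in> control A \<and> X \<in> stack A \<and>
       (a \<in> {0} \<or> a \<in> {1} \<or> a \<in> (\<lambda>i. 2 + i) ` set [0..<1 + K]) \<and> q \<in> control A \<and> (\<forall>Y\<in>set \<alpha>. Y \<in> stack A) \<and>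
       (a \<in> {0} \<longrightarrow> length \<alpha> = 2) \<and> (a \<in> {1} \<longrightarrow> length \<alpha> = 0) \<and> (a \<in> (\<lambda>i. 2 + i) ` set [0..<1 + K] \<longrightarrow> length \<alpha> = 1))"
    using R' by blast
  then show ?thesis using x unfolding rs cs ss valid_inst_def
    by (auto simp: game_inst_def simp del: set_upt upt_Suc)
qed

text \<open>The bottom symbol \<open>0\<close>, which no \<open>rsym\<close> equals, is never
  popped, so there is always a top symbol for a rule to act on.\<close>

definition st :: "(nat \<times> bool) list \<Rightarrow> nat list" where
  "st \<sigma> = map (\<lambda>(\<rho>, b). rsym \<rho> b) \<sigma> @ [0]"

definition logs :: "(nat \<times> bool) list set" where "logs = lists ({..<M} \<times> UNIV)"

lemma st_in: "\<sigma> \<in> logs \<Longrightarrow> st \<sigma> \<in> lists (stack A)"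
proof -
  assume "\<sigma> \<in> logs"
  then have "\<forall>x\<in>set \<sigma>. fst x < M" unfolding logs_def by auto
  then show ?thesis unfolding st_def stack_A using rsym_in_syms[of _ M] by (force simp: set_syms)
qed

lemma st_neq: "st \<sigma> \<noteq> []" by (simp add: st_def)

lemma trans_A:
  assumes "(s, i) \<in> set P" "X # \<gamma> \<in> lists (stack A)"
  shows "((cd t s, X # \<gamma>), a, c) \<in> trans LT \<longleftrightarrow>
    (\<exists>t' s' \<alpha>. (t, X, a, t', s', \<alpha>) \<in> set (game_rules G s i) \<and> c = (cd t' s', \<alpha> @ \<gamma>))"
proof -
  have "(cd t s, X, a, q, \<alpha>) \<in> rules A \<longleftrightarrow>
      (\<exists>t' s'. q = cd t' s' \<and> (t, X, a, t', s', \<alpha>) \<in> set (game_rules G s i))" for q \<alpha>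
  proof
    assume "(cd t s, X, a, q, \<alpha>) \<in> rules A"
    then obtain t1 s1 t' s' i' where h: "cd t s = cd t1 s1" "q = cd t' s'" "(s1, i') \<in> set P"
      "(t1, X, a, t', s', \<alpha>) \<in> set (game_rules G s1 i')"
      unfolding rules_A by blast
    then have "t1 = t" "s1 = s" by simp_all
    moreover then have "i' = i" using instr_unique[OF assms(1)] h(3) by blast
    ultimately show "\<exists>t' s'. q = cd t' s' \<and> (t, X, a, t', s', \<alpha>) \<in> set (game_rules G s i)" using h by blast
  next
    assume "\<exists>t' s'. q = cd t' s' \<and> (t, X, a, t', s', \<alpha>) \<in> set (game_rules G s i)"
    then show "(cd t s, X, a, q, \<alpha>) \<in> rules A" unfolding rules_A using assms(1) by blast
  qed
  then show ?thesis unfolding pda_trans_Cons using assms(2) by (simp add: conj_commute) blast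
qed

lemma st_Cons: obtains X \<gamma> where "st \<sigma> = X # \<gamma>"
  using st_neq by (cases "st \<sigma>") auto

lemma trans_Assign:
  assumes "(s, Assign \<rho> b s') \<in> set P" "\<sigma> \<in> logs"
  shows "((cd t s, st \<sigma>), a, c) \<in> trans LT \<longleftrightarrow> a = 0 \<and> (t = 2 \<or> t = 3) \<and> c = (cd t s', st ((\<rho>, b) # \<sigma>))"
proof -
  obtain X \<gamma> where X: "st \<sigma> = X # \<gamma>" by (rule st_Cons)
  have l: "X # \<gamma> \<in> lists (stack A)" using st_in[OF assms(2)] X by simp
  then have "X \<in> set G" unfolding stack_A by simp
  moreover have "st ((\<rho>, b) # \<sigma>) = [rsym \<rho> b, X] @ \<gamma>" using X by (simp add: st_def)
  ultimately show ?thesis unfolding X trans_A[OF assms(1) l] mem_game_rules by auto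
qed

lemma trans_Att:
  assumes "(s, Att l) \<in> set P" "\<sigma> \<in> logs"
  shows "((cd t s, st \<sigma>), a, c) \<in> trans LT \<longleftrightarrow>
    (t = 2 \<or> t = 3) \<and> (\<exists>x\<in>set l. a = 2 + fst x \<and> c = (cd t (snd x), st \<sigma>))"
proof -
  obtain X \<gamma> where X: "st \<sigma> = X # \<gamma>" by (rule st_Cons)
  have l: "X # \<gamma> \<in> lists (stack A)" using st_in[OF assms(2)] X by simp
  then have "X \<in> set G" unfolding stack_A by simp
  then show ?thesis unfolding X trans_A[OF assms(1) l] mem_game_rules by auto
qed

lemma trans_Dfn:
  assumes "(s, Dfn l) \<in> set P" "\<sigma> \<in> logs"
  shows "((cd 2 s, st \<sigma>), a, c) \<in> trans LT \<longleftrightarrow> a = 2 \<and>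
      (c = (cd 4 s, st \<sigma>) \<or> (\<exists>x\<in>set l. c = (cd (5 + fst x) s, st \<sigma>)))"
    "((cd 3 s, st \<sigma>), a, c) \<in> trans LT \<longleftrightarrow> a = 2 \<and> (\<exists>x\<in>set l. c = (cd (5 + fst x) s, st \<sigma>))"
    "((cd 4 s, st \<sigma>), a, c) \<in> trans LT \<longleftrightarrow> (\<exists>x\<in>set l. a = 2 + fst x \<and> c = (cd 2 (snd x), st \<sigma>))"
    "(j, u) \<in> set l \<Longrightarrow> ((cd (5 + j) s, st \<sigma>), a, c) \<in> trans LT \<longleftrightarrow>
      (\<exists>y\<in>set l. a = 2 + fst y \<and> c = (cd (if j = fst y then 3 else 2) (snd y), st \<sigma>))"
proof -
  obtain X \<gamma> where X: "st \<sigma> = X # \<gamma>" by (rule st_Cons)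
  have l: "X # \<gamma> \<in> lists (stack A)" using st_in[OF assms(2)] X by simp
  then have XG: "X \<in> set G" unfolding stack_A by simp
  define f :: "nat \<Rightarrow> nat \<Rightarrow> nat" where "f = (\<lambda>i k. if i = k then 3 else 2)"
  have aux: "(\<exists>\<alpha>. (X \<in> set G \<and> \<alpha> = [X] \<and> Q) \<and> c = (z, \<alpha> @ \<gamma>)) \<longleftrightarrow> c = (z, X # \<gamma>) \<and> Q" for z Q
    using XG by auto
  have E: "((cd t s, st \<sigma>), a, c) \<in> trans LT \<longleftrightarrow> (\<exists>t' u. c = (cd t' u, st \<sigma>) \<and>
     (t = 2 \<and> a = 2 \<and> t' = 4 \<and> u = s \<or>
      (t = 2 \<or> t = 3) \<and> a = 2 \<and> u = s \<and> (\<exists>x\<in>set l. t' = 5 + fst x) \<or>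
      t = 4 \<and> t' = 2 \<and> (\<exists>x\<in>set l. u = snd x \<and> a = 2 + fst x) \<or>
      (\<exists>x\<in>set l. \<exists>y\<in>set l. u = snd y \<and> t = 5 + fst x \<and> a = 2 + fst y \<and> t' = f (fst x) (fst y))))" for t
    unfolding X trans_A[OF assms(1) l] mem_Dfn_rules f_def
    by (simp only: aux)
  have n: "t \<noteq> 5 + n" if "t < 5" for t n :: nat using that by simp
  show "((cd 2 s, st \<sigma>), a, c) \<in> trans LT \<longleftrightarrow> a = 2 \<and>
      (c = (cd 4 s, st \<sigma>) \<or> (\<exists>x\<in>set l. c = (cd (5 + fst x) s, st \<sigma>)))"
    unfolding E by (simp add: n) blast
  show "((cd 3 s, st \<sigma>), a, c) \<in> trans LT \<longleftrightarrow> a = 2 \<and> (\<exists>x\<in>set l. c = (cd (5 + fst x) s, st \<sigma>))"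
    unfolding E by (simp add: n) blast
  show "((cd 4 s, st \<sigma>), a, c) \<in> trans LT \<longleftrightarrow> (\<exists>x\<in>set l. a = 2 + fst x \<and> c = (cd 2 (snd x), st \<sigma>))"
    unfolding E by (simp add: n) blast
  show "((cd (5 + j) s, st \<sigma>), a, c) \<in> trans LT \<longleftrightarrow>
      (\<exists>y\<in>set l. a = 2 + fst y \<and> c = (cd (if j = fst y then 3 else 2) (snd y), st \<sigma>))" if ju: "(j, u) \<in> set l"
  proof -
    have "((cd (5 + j) s, st \<sigma>), a, c) \<in> trans LT \<longleftrightarrow>
        (\<exists>t' u. c = (cd t' u, st \<sigma>) \<and> (\<exists>x\<in>set l. \<exists>y\<in>set l. u = snd y \<and> j = fst x \<and> a = 2 + fst y \<and> t' = f (fst x) (fst y)))"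
      unfolding E by simp
    also have "\<dots> \<longleftrightarrow> (\<exists>y\<in>set l. a = 2 + fst y \<and> c = (cd (f j (fst y)) (snd y), st \<sigma>))"
      using ju by (metis fst_conv)
    finally show ?thesis unfolding f_def .
  qed
qed

lemma trans_Check:
  assumes "(s, Check \<rho> b) \<in> set P" "\<sigma> \<in> logs"
  shows "((cd t s, st \<sigma>), a, c) \<in> trans LT \<longleftrightarrow>
    (case \<sigma> of [] \<Rightarrow> b \<and> t = 2 \<and> a = 2 \<and> c = (cd 2 s, st \<sigma>)
     | (\<rho>', b') # \<sigma>' \<Rightarrow> if \<rho>' = \<rho> then b' \<noteq> b \<and> t = 2 \<and> a = 2 \<and> c = (cd 2 s, st \<sigma>)
         else (t = 2 \<or> t = 3) \<and> a = 1 \<and> c = (cd t s, st \<sigma>'))"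
proof (cases \<sigma>)
  case Nil
  have l: "[0] \<in> lists (stack A)" by (simp add: stack_A set_syms)
  show ?thesis unfolding Nil st_def using trans_A[OF assms(1) l, of t a c] unfolding mem_game_rules
    by (auto simp: set_syms)
next
  case (Cons x \<sigma>')
  obtain \<rho>' b' where x: "x = (\<rho>', b')" by fastforce
  have s: "st \<sigma> = rsym \<rho>' b' # st \<sigma>'" by (simp add: Cons x st_def)
  have l: "rsym \<rho>' b' # st \<sigma>' \<in> lists (stack A)" using st_in[OF assms(2)] s by simp
  then have G: "rsym \<rho>' b' \<in> set G" unfolding stack_A by simp
  show ?thesis unfolding s trans_A[OF assms(1) l] mem_game_rules
    using G by (cases b; cases b') (auto simp: Cons x split: if_splits)
qed

lemma instr_cases:
  assumes "(s, i) \<in> set P"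
  obtains \<rho> b s' where "i = Assign \<rho> b s'" "\<rho> < M" "s' \<in> fst ` set P"
    | l where "i = Att l" "distinct (map fst l)" "\<And>j u. (j, u) \<in> set l \<Longrightarrow> u \<in> fst ` set P"
    | l where "i = Dfn l" "distinct (map fst l)" "\<And>j u. (j, u) \<in> set l \<Longrightarrow> j < K \<and> u \<in> fst ` set P"
    | \<rho> b where "i = Check \<rho> b"
  using wf_in[OF assms] unfolding wf_instr_def
proof (elim disjE exE conjE)
  fix \<rho> b s' assume "i = Assign \<rho> b s'" "\<rho> < M" "s' \<in> fst ` set P"
  then show thesis by (rule that(1))
next
  fix l assume h: "i = Att l" "distinct (map fst l)" and l: "\<forall>(j, s)\<in>set l. j < K \<and> s \<in> fst ` set P"
  have "u \<in> fst ` set P" if "(j, u) \<in> set l" for j u using bspec[OF l that] by simp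
  with h show thesis by (rule that(2))
next
  fix l assume h: "i = Dfn l" "distinct (map fst l)" and l: "\<forall>(j, s)\<in>set l. j < K \<and> s \<in> fst ` set P"
  have "j < K \<and> u \<in> fst ` set P" if "(j, u) \<in> set l" for j u using bspec[OF l that] by simp
  with h show thesis by (rule that(3))
next
  fix \<rho> b assume "i = Check \<rho> b"
  then show thesis by (rule that(4))
qed

text \<open>The strategy moves on the left only, so a simulation already has to respond to it.
  Induction follows the winning strategy; in the case of \<open>Check\<close> a second induction
  descends through the log.\<close>

theorem attacker_wins:
  assumes R: "simulation LT R"
  shows "aw P s \<sigma> \<Longrightarrow> \<sigma> \<in> logs \<Longrightarrow> ((cd 2 s, st \<sigma>), (cd 3 s, st \<sigma>)) \<notin> R"
proof (induction rule: aw.induct)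
  have sim: "\<exists>d'. (d, a, d') \<in> trans LT \<and> (c', d') \<in> R" if "(c, d) \<in> R" "(c, a, c') \<in> trans LT" for c d a c'
    using bspec[OF conjunct2[OF R[unfolded simulation_def]] that(1), unfolded prod.case] that(2) by blast
  {
    case (aw_Assign s \<rho> b s' \<sigma>)
    have "\<rho> < M" using wf_in[OF aw_Assign(1)] unfolding wf_instr_simps by auto
    then have l: "(\<rho>, b) # \<sigma> \<in> logs" using aw_Assign.prems unfolding logs_def by simp
    note T = trans_Assign[OF aw_Assign(1) aw_Assign.prems]
    show ?case
    proof
      assume r: "((cd 2 s, st \<sigma>), (cd 3 s, st \<sigma>)) \<in> R"
      have "((cd 2 s, st \<sigma>), 0, (cd 2 s', st ((\<rho>, b) # \<sigma>))) \<in> trans LT" using T by simp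
      from sim[OF r this] obtain d where d: "((cd 3 s, st \<sigma>), 0, d) \<in> trans LT"
        "((cd 2 s', st ((\<rho>, b) # \<sigma>)), d) \<in> R" by blast
      then have "d = (cd 3 s', st ((\<rho>, b) # \<sigma>))" using T by simp
      with d aw_Assign.IH[OF l] show False by simp
    qed
  next
    case (aw_Att s l i s' \<sigma>)
    have dis: "distinct (map fst l)" using wf_in[OF aw_Att(1)] unfolding wf_instr_simps by auto
    note T = trans_Att[OF aw_Att(1) aw_Att.prems]
    show ?case
    proof
      assume r: "((cd 2 s, st \<sigma>), (cd 3 s, st \<sigma>)) \<in> R"
      have "((cd 2 s, st \<sigma>), 2 + i, (cd 2 s', st \<sigma>)) \<in> trans LT" using T aw_Att(2) by force
      from sim[OF r this] obtain d where d: "((cd 3 s, st \<sigma>), 2 + i, d) \<in> trans LT"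
        "((cd 2 s', st \<sigma>), d) \<in> R" by blast
      then obtain x where x: "x \<in> set l" "fst x = i" "d = (cd 3 (snd x), st \<sigma>)" unfolding T by auto
      have "(i, snd x) \<in> set l" using x(1,2) by (metis prod.collapse)
      then have "snd x = s'" using aw_Att(2) dis by (meson eq_key_imp_eq_value)
      moreover note x(3)
      ultimately show False using d aw_Att.IH[OF aw_Att.prems] by simp
    qed
  next
    case (aw_Dfn s l \<sigma>)
    have dis: "distinct (map fst l)" using wf_in[OF aw_Dfn(1)] unfolding wf_instr_simps by auto
    note T = trans_Dfn[OF aw_Dfn(1) aw_Dfn.prems]
    show ?case
    proof
      assume r: "((cd 2 s, st \<sigma>), (cd 3 s, st \<sigma>)) \<in> R"
      have "((cd 2 s, st \<sigma>), 2, (cd 4 s, st \<sigma>)) \<in> trans LT" using T(1) by blast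
      from sim[OF r this] obtain d where d: "((cd 3 s, st \<sigma>), 2, d) \<in> trans LT"
        "((cd 4 s, st \<sigma>), d) \<in> R" by blast
      then obtain x where "x \<in> set l" "d = (cd (5 + fst x) s, st \<sigma>)" unfolding T(2) by blast
      then obtain j u where ju: "(j, u) \<in> set l" "d = (cd (5 + j) s, st \<sigma>)" by (metis prod.collapse)
      have "((cd 4 s, st \<sigma>), 2 + j, (cd 2 u, st \<sigma>)) \<in> trans LT" using T(3) ju(1) by force
      from sim[OF d(2) this] obtain e where e: "(d, 2 + j, e) \<in> trans LT" "((cd 2 u, st \<sigma>), e) \<in> R" by blast
      then obtain y where "y \<in> set l" "fst y = j" "e = (cd 3 (snd y), st \<sigma>)"
        unfolding ju(2) T(4)[OF ju(1)] by auto
      then obtain u' where "(j, u') \<in> set l" "e = (cd 3 u', st \<sigma>)" by (metis prod.collapse)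
      moreover then have "u' = u" using ju(1) dis by (meson eq_key_imp_eq_value)
      ultimately show False using e(2) aw_Dfn.IH[OF ju(1) aw_Dfn.prems] by simp
    qed
  next
    case (aw_Check s \<rho> b \<sigma>)
    then show ?case
    proof (induction \<sigma>)
      case Nil
      note T = trans_Check[OF Nil(1) Nil(3)]
      show ?case
      proof
        assume r: "((cd 2 s, st []), (cd 3 s, st [])) \<in> R"
        have "((cd 2 s, st []), 2, (cd 2 s, st [])) \<in> trans LT" unfolding T using Nil(2) by simp
        from sim[OF r this] show False unfolding T by simp
      qed
    next
      case (Cons x \<sigma>)
      obtain \<rho>' b' where x: "x = (\<rho>', b')" by fastforce
      note T = trans_Check[OF Cons.prems(1) Cons.prems(3)]
      have l: "\<sigma> \<in> logs" using Cons.prems(3) unfolding logs_def by simp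
      show ?case
      proof
        assume r: "((cd 2 s, st (x # \<sigma>)), (cd 3 s, st (x # \<sigma>))) \<in> R"
        show False
        proof (cases "\<rho>' = \<rho>")
          case True
          have "((cd 2 s, st (x # \<sigma>)), 2, (cd 2 s, st (x # \<sigma>))) \<in> trans LT"
            unfolding T using Cons.prems(2) True by (simp add: x)
          from sim[OF r this] show False unfolding T using True by (simp add: x)
        next
          case False
          have "((cd 2 s, st (x # \<sigma>)), 1, (cd 2 s, st \<sigma>)) \<in> trans LT"
            unfolding T using False by (simp add: x)
          from sim[OF r this] have "((cd 2 s, st \<sigma>), (cd 3 s, st \<sigma>)) \<in> R"
            unfolding T using False by (auto simp: x)
          moreover have "lookup \<rho> \<sigma> \<noteq> b" using Cons.prems(2) False by (simp add: x)
          ultimately show False using Cons.IH[OF Cons.prems(1) _ l] by blast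
        qed
      qed
    qed
  }
qed

section \<open>The bisimulation played by the defender\<close>

lemma cd_in_states: "t < 5 + K \<Longrightarrow> s \<in> fst ` set P \<Longrightarrow> \<sigma> \<in> logs \<Longrightarrow> (cd t s, st \<sigma>) \<in> states LT"
  using st_in by (auto simp: pda_states control_A)

text \<open>The second set holds the positions inside the forcing gadget, after the defender has
  answered with a choice \<open>j\<close> whose successor is not won by the attacker.\<close>

definition duel :: "((nat \<times> nat list) \<times> (nat \<times> nat list)) set" where
  "duel = {((cd 2 s, st \<sigma>), (cd 3 s, st \<sigma>)) | s \<sigma>. s \<in> fst ` set P \<and> \<sigma> \<in> logs \<and> \<not> aw P s \<sigma>} \<union>
     {((cd 4 s, st \<sigma>), (cd (5 + j) s, st \<sigma>)) | s \<sigma> l j u.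
        (s, Dfn l) \<in> set P \<and> (j, u) \<in> set l \<and> \<sigma> \<in> logs \<and> \<not> aw P u \<sigma>}"

lemma duel_step:
  assumes "(c, d) \<in> duel"
  shows "(c, a, c') \<in> trans LT \<Longrightarrow> \<exists>d'. (d, a, d') \<in> trans LT \<and> ((c', d') \<in> duel \<or> c' = d')"
    and "(d, a, d') \<in> trans LT \<Longrightarrow> \<exists>c'. (c, a, c') \<in> trans LT \<and> ((c', d') \<in> duel \<or> c' = d')"
proof -
  have both: "((c, a, c') \<in> trans LT \<longrightarrow> (\<exists>d'. (d, a, d') \<in> trans LT \<and> ((c', d') \<in> duel \<or> c' = d'))) \<and>
      ((d, a, d') \<in> trans LT \<longrightarrow> (\<exists>c'. (c, a, c') \<in> trans LT \<and> ((c', d') \<in> duel \<or> c' = d')))" for c' d'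
  proof -
    have "(\<exists>s \<sigma>. (c, d) = ((cd 2 s, st \<sigma>), (cd 3 s, st \<sigma>)) \<and> s \<in> fst ` set P \<and> \<sigma> \<in> logs \<and> \<not> aw P s \<sigma>) \<or>
      (\<exists>s \<sigma> l' j u. (c, d) = ((cd 4 s, st \<sigma>), (cd (5 + j) s, st \<sigma>)) \<and>
        (s, Dfn l') \<in> set P \<and> (j, u) \<in> set l' \<and> \<sigma> \<in> logs \<and> \<not> aw P u \<sigma>)"
      using assms unfolding duel_def by blast
    then show ?thesis
  proof (elim disjE exE conjE)
    fix s \<sigma> assume cd: "(c, d) = ((cd 2 s, st \<sigma>), (cd 3 s, st \<sigma>))" and s: "s \<in> fst ` set P"
      and l: "\<sigma> \<in> logs" and n: "\<not> aw P s \<sigma>"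
    have D: "((cd 2 u, st \<tau>), (cd 3 u, st \<tau>)) \<in> duel" if "u \<in> fst ` set P" "\<tau> \<in> logs" "\<not> aw P u \<tau>" for u \<tau>
      using that unfolding duel_def by blast
    have cd': "c = (cd 2 s, st \<sigma>)" "d = (cd 3 s, st \<sigma>)" using cd by simp_all
    obtain i where i: "(s, i) \<in> set P" using s by auto
    from i show ?thesis
    proof (cases rule: instr_cases)
      case (1 \<rho> b s')
      have si: "(s, Assign \<rho> b s') \<in> set P" using i 1 by simp
      have "\<not> aw P s' ((\<rho>, b) # \<sigma>)" using n aw_Assign[OF si] by blast
      moreover have "(\<rho>, b) # \<sigma> \<in> logs" using l 1(2) unfolding logs_def by simp
      ultimately have "((cd 2 s', st ((\<rho>, b) # \<sigma>)), (cd 3 s', st ((\<rho>, b) # \<sigma>))) \<in> duel"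
        using D[OF 1(3)] by blast
      then show ?thesis unfolding cd' trans_Assign[OF si l] by blast
    next
      case (2 l')
      have si: "(s, Att l') \<in> set P" using i 2 by simp
      have "\<not> aw P u \<sigma>" if "(j, u) \<in> set l'" for j u using n aw_Att[OF si that] by blast
      then have "((cd 2 u, st \<sigma>), (cd 3 u, st \<sigma>)) \<in> duel" if "(j, u) \<in> set l'" for j u
        using D[OF 2(3)[OF that] l] that by blast
      then have "((cd 2 (snd x), st \<sigma>), (cd 3 (snd x), st \<sigma>)) \<in> duel" if "x \<in> set l'" for x
        using that by (metis prod.collapse)
      then show ?thesis unfolding cd' trans_Att[OF si l] by blast
    next
      case (3 l')
      have si: "(s, Dfn l') \<in> set P" using i 3 by simp
      obtain j u where ju: "(j, u) \<in> set l'" "\<not> aw P u \<sigma>" using n aw_Dfn[OF si] by blast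
      then have "((cd 4 s, st \<sigma>), (cd (5 + j) s, st \<sigma>)) \<in> duel" using si l unfolding duel_def by blast
      moreover have "\<exists>x\<in>set l'. (cd (5 + j) s, st \<sigma>) = (cd (5 + fst x) s, st \<sigma>)" using ju(1) by force
      ultimately show ?thesis unfolding cd' trans_Dfn(1,2)[OF si l] by blast
    next
      case (4 \<rho> b)
      have si: "(s, Check \<rho> b) \<in> set P" using i 4 by simp
      have lk: "lookup \<rho> \<sigma> = b" using n aw_Check[OF si] by blast
      note T = trans_Check[OF si l]
      show ?thesis
      proof (cases \<sigma>)
        case Nil
        then show ?thesis unfolding cd' T using lk by simp
      next
        case (Cons x \<sigma>')
        obtain \<rho>' b' where x: "x = (\<rho>', b')" by fastforce
        have l': "\<sigma>' \<in> logs" using l Cons unfolding logs_def by simp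
        have "\<not> aw P s \<sigma>'" if "\<rho>' \<noteq> \<rho>" using lk that by (simp add: aw_Check_iff[OF si] Cons x)
        then have D': "\<rho>' \<noteq> \<rho> \<Longrightarrow> ((cd 2 s, st \<sigma>'), (cd 3 s, st \<sigma>')) \<in> duel" using D[OF s l'] by blast
        show ?thesis
        proof (cases "\<rho>' = \<rho>")
          case True
          then show ?thesis unfolding cd' T using lk by (simp add: Cons x)
        next
          case False
          then show ?thesis unfolding cd' T using D'[OF False] by (simp add: Cons x)
        qed
      qed
    qed
  next
    fix s \<sigma> l' j u assume cd: "(c, d) = ((cd 4 s, st \<sigma>), (cd (5 + j) s, st \<sigma>))"
      and si: "(s, Dfn l') \<in> set P" and ju: "(j, u) \<in> set l'" and l: "\<sigma> \<in> logs" and n: "\<not> aw P u \<sigma>"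
    have dis: "distinct (map fst l')" and u: "u \<in> fst ` set P"
      using wf_in[OF si] ju unfolding wf_instr_simps by auto
    have "snd y = u" if "y \<in> set l'" "fst y = j" for y
      using ju that dis by (metis eq_key_imp_eq_value prod.collapse)
    moreover have "((cd 2 u, st \<sigma>), (cd 3 u, st \<sigma>)) \<in> duel" using u l n unfolding duel_def by blast
    ultimately have "((cd 2 (snd y), st \<sigma>), (cd (if j = fst y then 3 else 2) (snd y), st \<sigma>)) \<in> duel \<or>
        (cd 2 (snd y), st \<sigma>) = (cd (if j = fst y then 3 else 2) (snd y), st \<sigma>)" if "y \<in> set l'" for y
      using that by simp
    moreover have "c = (cd 4 s, st \<sigma>)" "d = (cd (5 + j) s, st \<sigma>)" using cd by simp_all
    ultimately show ?thesis by (simp only: trans_Dfn(3)[OF si l] trans_Dfn(4)[OF si l ju]) blast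
  qed
  qed
  show "(c, a, c') \<in> trans LT \<Longrightarrow> \<exists>d'. (d, a, d') \<in> trans LT \<and> ((c', d') \<in> duel \<or> c' = d')"
    and "(d, a, d') \<in> trans LT \<Longrightarrow> \<exists>c'. (c, a, c') \<in> trans LT \<and> ((c', d') \<in> duel \<or> c' = d')"
    using both[of c' d'] by simp_all
qed

theorem defender_wins:
  assumes "\<not> aw P s0 []"
  shows "bisimilar LT (cd 2 s0, [0]) (cd 3 s0, [0])"
proof -
  have pda: "is_pda A" using valid_game_inst unfolding valid_inst_iff valid_instance_def is_vpda_def by blast
  have lts: "trans LT \<subseteq> states LT \<times> actions LT \<times> states LT"
    using is_lts_pda_lts[OF pda] unfolding is_lts_def .
  \<comment> \<open>The converse allows for changes of side, and the diagonal absorbs the plays that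
    have reached identical configurations.\<close>
  let ?R = "duel \<union> duel\<inverse> \<union> {(c, c) | c. c \<in> states LT}"
  have D: "duel \<subseteq> states LT \<times> states LT"
  proof -
    have "(cd 4 s, st \<sigma>) \<in> states LT" "(cd (5 + j) s, st \<sigma>) \<in> states LT"
      if "(s, Dfn l) \<in> set P" "(j, u) \<in> set l" "\<sigma> \<in> logs" for s l j u \<sigma>
    proof -
      have "j < K" using wf_in[OF that(1)] that(2) unfolding wf_instr_simps by auto
      moreover have "s \<in> fst ` set P" using that(1) by force
      ultimately show "(cd 4 s, st \<sigma>) \<in> states LT" "(cd (5 + j) s, st \<sigma>) \<in> states LT"
        using cd_in_states that(3) by auto
    qed
    moreover have "(cd 2 s, st \<sigma>) \<in> states LT" "(cd 3 s, st \<sigma>) \<in> states LT"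
      if "s \<in> fst ` set P" "\<sigma> \<in> logs" for s \<sigma>
      using cd_in_states[OF _ that] by auto
    ultimately show ?thesis unfolding duel_def by blast
  qed
  have "simulation LT ?R"
    unfolding simulation_def
  proof (intro conjI ballI)
    show "?R \<subseteq> states LT \<times> states LT" using D by auto
    fix z assume "z \<in> ?R"
    moreover obtain c d where z: "z = (c, d)" by (rule prod.exhaust)
    ultimately have cd: "(c, d) \<in> duel \<or> (d, c) \<in> duel \<or> c = d" by auto
    have "\<exists>d'. (d, a, d') \<in> trans LT \<and> (c', d') \<in> ?R" if t: "(c, a, c') \<in> trans LT" for a c'
    proof -
      have c': "c' \<in> states LT" using lts t by blast
      from cd consider "(c, d) \<in> duel" | "(d, c) \<in> duel" | "c = d" by blast
      then show ?thesis
      proof cases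
        case 1
        from duel_step(1)[OF 1 t] c' show ?thesis by blast
      next
        case 2
        from duel_step(2)[OF 2 t] c' show ?thesis by blast
      next
        case 3
        then show ?thesis using t c' by blast
      qed
    qed
    then show "case z of (s, t) \<Rightarrow> \<forall>a s'. (s, a, s') \<in> trans LT \<longrightarrow> (\<exists>t'. (t, a, t') \<in> trans LT \<and> (s', t') \<in> ?R)"
      unfolding z by blast
  qed
  moreover have "?R\<inverse> = ?R" by auto
  moreover have "((cd 2 s0, [0]), (cd 3 s0, [0])) \<in> duel"
  proof -
    have "[] \<in> logs" by (simp add: logs_def)
    then have "((cd 2 s0, st []), (cd 3 s0, st [])) \<in> duel" using s0 assms unfolding duel_def by blast
    then show ?thesis by (simp add: st_def)
  qed
  ultimately show ?thesis unfolding bisimilar_def bisimulation_def by blast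
qed

end

section \<open>Alternating programs for exponential time\<close>

text \<open>A continuation says what to do after decrementing or incrementing a counter, both without and
  with overflow: \<open>CQ q\<close> claims the state \<open>q\<close>, \<open>CR j x\<close> the symbol \<open>x\<close> at the current displacement
  on tape \<open>j\<close>, \<open>CI x\<close> locates the displacement in the input, \<open>CM\<close> accounts for the head
  movement after scanning \<open>z\<close>, \<open>CZ\<close> tests for displacement \<open>0\<close>, and \<open>CB\<close> undoes that test.\<close>

datatype cont = CQ nat | CR nat nat | CI nat | CM "nat \<times> nat list" nat nat
  | CZ "nat \<times> nat list" nat nat | CB nat nat

text \<open>\<open>Add r b a\<close> increments (\<open>b\<close>) or decrements the counter \<open>r\<close>; at each bit the defender announces
  the value \<open>v\<close> (\<open>Clm\<close>), which the attacker checks (\<open>Chk\<close>) or accepts (\<open>Go\<close>).\<close>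

datatype label = Add nat bool cont | Clm nat bool cont bool | Chk nat bool | Go nat bool cont bool
  | Fill nat bool cont | Fin bool | PickQ nat | PickR nat nat | PR "nat \<times> nat list" nat nat
  | Inp nat | Wrd nat | Cfg "nat \<times> nat list"

text \<open>Such a \<open>z\<close> is what a machine sees at one moment, its state and the symbols
  under the heads. The next step depends on nothing else, and for a fixed machine there are finitely
  many \<open>z\<close>.\<close>

definition okz :: "tm \<Rightarrow> nat \<times> nat list \<Rightarrow> bool" where
  "okz M z \<longleftrightarrow> fst z < num_states M \<and> length (snd z) = num_tapes M \<and> set (snd z) \<subseteq> {..<num_symbols M}"

fun okc :: "tm \<Rightarrow> cont \<Rightarrow> bool" where
  "okc M (CQ q) \<longleftrightarrow> q < num_states M"
| "okc M (CR j x) \<longleftrightarrow> j < num_tapes M \<and> x < num_symbols M"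
| "okc M (CI x) \<longleftrightarrow> x < num_symbols M"
| "okc M (CM z j x) \<longleftrightarrow> okz M z \<and> j < num_tapes M \<and> x < num_symbols M"
| "okc M (CZ z j x) \<longleftrightarrow> okz M z \<and> j < num_tapes M \<and> x < num_symbols M"
| "okc M (CB j x) \<longleftrightarrow> j < num_tapes M \<and> x < num_symbols M"

fun okl :: "tm \<Rightarrow> label \<Rightarrow> bool" where
  "okl M (Add r b a) \<longleftrightarrow> r < 2 \<and> okc M a"
| "okl M (Clm r b a v) \<longleftrightarrow> r < 2 \<and> okc M a"
| "okl M (Chk r v) \<longleftrightarrow> r < 2"
| "okl M (Go r b a v) \<longleftrightarrow> r < 2 \<and> okc M a"
| "okl M (Fill r v a) \<longleftrightarrow> r < 2 \<and> okc M a"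
| "okl M (Fin b) \<longleftrightarrow> True"
| "okl M (PickQ q) \<longleftrightarrow> q < num_states M"
| "okl M (PickR j x) \<longleftrightarrow> j < num_tapes M \<and> x < num_symbols M"
| "okl M (PR z j x) \<longleftrightarrow> okz M z \<and> j < num_tapes M \<and> x < num_symbols M"
| "okl M (Inp x) \<longleftrightarrow> x < num_symbols M"
| "okl M (Wrd x) \<longleftrightarrow> x < num_symbols M"
| "okl M (Cfg z) \<longleftrightarrow> okz M z"

definition all_z :: "tm \<Rightarrow> (nat \<times> nat list) list" where
  "all_z M = List.product [0..<num_states M] (List.n_lists (num_tapes M) [0..<num_symbols M])"

lemma set_all_z: "set (all_z M) = {z. okz M z}"
  by (auto simp: all_z_def okz_def set_n_lists)

lemma finite_okc: "finite {a. okc M a}"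
proof -
  let ?J = "{..<num_tapes M}" and ?X = "{..<num_symbols M}" and ?Z = "set (all_z M)"
  let ?U = "CQ ` {..<num_states M} \<union> case_prod CR ` (?J \<times> ?X) \<union> CI ` ?X \<union>
    (\<lambda>(z, j, x). CM z j x) ` (?Z \<times> ?J \<times> ?X) \<union> (\<lambda>(z, j, x). CZ z j x) ` (?Z \<times> ?J \<times> ?X) \<union>
    case_prod CB ` (?J \<times> ?X)"
  have "a \<in> ?U" if "okc M a" for a
    using that by (cases a; simp add: set_all_z image_iff Bex_def; metis surj_pair)
  moreover have "finite ?U" by simp
  ultimately show ?thesis by (metis (no_types, lifting) finite_subset mem_Collect_eq subsetI)
qed

lemma finite_okl: "finite {l. okl M l}"
proof -
  let ?J = "{..<num_tapes M}" and ?X = "{..<num_symbols M}" and ?Z = "set (all_z M)"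
  let ?A = "{a. okc M a}" and ?B = "UNIV :: bool set" and ?R = "{..<2::nat}"
  let ?U = "(\<lambda>(r, b, a). Add r b a) ` (?R \<times> ?B \<times> ?A) \<union> (\<lambda>(r, b, a, v). Clm r b a v) ` (?R \<times> ?B \<times> ?A \<times> ?B) \<union>
    case_prod Chk ` (?R \<times> ?B) \<union> (\<lambda>(r, b, a, v). Go r b a v) ` (?R \<times> ?B \<times> ?A \<times> ?B) \<union>
    (\<lambda>(r, b, a). Fill r b a) ` (?R \<times> ?B \<times> ?A) \<union> range Fin \<union> PickQ ` {..<num_states M} \<union>
    case_prod PickR ` (?J \<times> ?X) \<union> (\<lambda>(z, j, x). PR z j x) ` (?Z \<times> ?J \<times> ?X) \<union> Inp ` ?X \<union> Wrd ` ?X \<union> Cfg ` ?Z"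
  have "l \<in> ?U" if "okl M l" for l
    using that by (cases l; simp add: set_all_z image_iff Bex_def; metis surj_pair)
  moreover have "finite ?U" by (simp add: finite_okc)
  ultimately show ?thesis by (metis (no_types, lifting) finite_subset mem_Collect_eq subsetI)
qed

text \<open>A halted machine is made to rewrite what it scans without moving, so that
  \<open>stp\<close> describes \<open>tm_step\<close> in every case.\<close>

definition stp :: "tm \<Rightarrow> nat \<times> nat list \<Rightarrow> nat \<times> (nat \<times> move) list" where
  "stp M z = (if fst z = accept M \<or> fst z = reject M then (fst z, map (\<lambda>x. (x, Stay)) (snd z))
     else delta M (fst z) (snd z))"

lemma stp_ok:
  assumes "is_tm M" "okz M z"
  shows "fst (stp M z) < num_states M" "length (snd (stp M z)) = num_tapes M"
    "fst ` set (snd (stp M z)) \<subseteq> {..<num_symbols M}"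
proof -
  have "\<forall>q xs. q < num_states M \<and> length xs = num_tapes M \<and> set xs \<subseteq> {..<num_symbols M} \<longrightarrow>
      fst (delta M q xs) < num_states M \<and> length (snd (delta M q xs)) = num_tapes M \<and>
      fst ` set (snd (delta M q xs)) \<subseteq> {..<num_symbols M}"
    using assms(1) unfolding is_tm_def case_prod_beta by blast
  then show "fst (stp M z) < num_states M" "length (snd (stp M z)) = num_tapes M"
    "fst ` set (snd (stp M z)) \<subseteq> {..<num_symbols M}"
    using assms(2) unfolding stp_def okz_def by (auto simp: image_image)
qed

definition scan :: "tm \<Rightarrow> bool list \<Rightarrow> nat \<Rightarrow> nat \<times> nat list" where
  "scan M w t = (fst (tm_run M w t), map (\<lambda>(c, h). c h) (snd (tm_run M w t)))"

lemma tm_run_Suc: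
  assumes "is_tm M" "okz M (scan M w t)"
  shows "fst (tm_run M w (Suc t)) = fst (stp M (scan M w t))"
    and "length (snd (tm_run M w (Suc t))) = num_tapes M"
    and "j < num_tapes M \<Longrightarrow>
      snd (tm_run M w (Suc t)) ! j = update_tape (snd (stp M (scan M w t)) ! j) (snd (tm_run M w t) ! j)"
proof -
  obtain q ts where qt: "tm_run M w t = (q, ts)" by (rule prod.exhaust)
  have l: "length ts = num_tapes M" using assms(2) unfolding okz_def scan_def qt by simp
  have s: "tm_run M w (Suc t) = tm_step M (q, ts)" using qt by (simp add: tm_run_def)
  note ok = stp_ok[OF assms]
  have sc: "scan M w t = (q, map (\<lambda>(c, h). c h) ts)" by (simp add: scan_def qt)
  show "fst (tm_run M w (Suc t)) = fst (stp M (scan M w t))"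
    unfolding s sc by (auto simp: stp_def case_prod_beta tm_step.simps)
  show "length (snd (tm_run M w (Suc t))) = num_tapes M"
    using ok(2) l unfolding s sc by (auto simp: stp_def case_prod_beta tm_step.simps)
  show "snd (tm_run M w (Suc t)) ! j = update_tape (snd (stp M (scan M w t)) ! j) (snd (tm_run M w t) ! j)"
    if j: "j < num_tapes M"
  proof (cases "q = accept M \<or> q = reject M")
    case True
    obtain c h where ch: "ts ! j = (c, h)" by (rule prod.exhaust)
    show ?thesis using True j l unfolding s sc qt by (auto simp: stp_def ch tm_step.simps)
  next
    case False
    then show ?thesis using ok(2) j l unfolding s sc qt by (simp add: stp_def case_prod_beta tm_step.simps)
  qed
qed

lemma okz_scan:
  assumes "is_tm M"
  shows "okz M (scan M w t) \<and> (\<forall>tp\<in>set (snd (tm_run M w t)). \<forall>i. fst tp i < num_symbols M)"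
proof (induction t)
  case 0
  have "word_contents w i < num_symbols M" for i using assms by (auto simp: word_contents_def is_tm_def)
  then show ?case using assms
    by (auto simp: okz_def scan_def tm_run_def tm_init_def is_tm_def)
next
  case (Suc t)
  note z = conjunct1[OF Suc] and R = tm_run_Suc[OF assms conjunct1[OF Suc]] and ok = stp_ok[OF assms conjunct1[OF Suc]]
  have l: "length (snd (tm_run M w t)) = num_tapes M" using z unfolding okz_def scan_def by simp
  have c: "\<forall>tp\<in>set (snd (tm_run M w (Suc t))). \<forall>i. fst tp i < num_symbols M"
  proof (intro ballI allI)
    fix tp i assume "tp \<in> set (snd (tm_run M w (Suc t)))"
    then obtain j where j: "j < num_tapes M" "tp = snd (tm_run M w (Suc t)) ! j"
      using R(2) by (metis in_set_conv_nth)
    obtain c h where ch: "snd (tm_run M w t) ! j = (c, h)" by (rule prod.exhaust)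
    obtain x d where xd: "snd (stp M (scan M w t)) ! j = (x, d)" by (rule prod.exhaust)
    have "(c, h) \<in> set (snd (tm_run M w t))" using ch j(1) l by (metis nth_mem)
    then have "c i < num_symbols M" using Suc by (metis fst_conv)
    moreover have "(x, d) \<in> set (snd (stp M (scan M w t)))" using xd j(1) ok(2) by (metis nth_mem)
    then have "x < num_symbols M" using ok(3) by force
    ultimately show "fst tp i < num_symbols M" unfolding j(2) R(3)[OF j(1)] ch xd by simp
  qed
  moreover have "okz M (scan M w (Suc t))"
    using ok(1) R(1,2) c unfolding okz_def scan_def by (auto simp: case_prod_beta)
  ultimately show ?case by blast
qed

definition head :: "tm \<Rightarrow> bool list \<Rightarrow> nat \<Rightarrow> nat \<Rightarrow> int" where
  "head M w j t = snd (snd (tm_run M w t) ! j)"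

definition cell :: "tm \<Rightarrow> bool list \<Rightarrow> nat \<Rightarrow> nat \<Rightarrow> int \<Rightarrow> nat" where
  "cell M w j t d = fst (snd (tm_run M w t) ! j) (head M w j t + d)"

lemma cell_0: "cell M w j 0 d = (if j = 0 then word_contents w d else 0)" if "j < num_tapes M"
  using that by (cases j) (auto simp: cell_def head_def tm_run_def tm_init_def)

text \<open>Tape cells are addressed relative to the head, so that the head positions need not be known.\<close>

lemma cell_Suc:
  fixes w t
  assumes "is_tm M" "j < num_tapes M"
  defines "y \<equiv> snd (stp M (scan M w t)) ! j"
  shows "cell M w j (Suc t) d = (if d + offset (snd y) = 0 then fst y else cell M w j t (d + offset (snd y)))"
proof -
  obtain c h where ch: "snd (tm_run M w t) ! j = (c, h)" by (rule prod.exhaust)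
  obtain x e where xe: "y = (x, e)" by (rule prod.exhaust)
  have "snd (tm_run M w (Suc t)) ! j = (c(h := x), h + offset e)"
    using tm_run_Suc(3)[OF assms(1) conjunct1[OF okz_scan[OF assms(1)]] assms(2)] ch xe unfolding y_def by simp
  then show ?thesis unfolding cell_def head_def ch xe by (auto simp: algebra_simps)
qed

lemma snd_scan_nth: "is_tm M \<Longrightarrow> j < num_tapes M \<Longrightarrow> snd (scan M w t) ! j = cell M w j t 0"
  using conjunct1[OF okz_scan, of M w t] unfolding okz_def scan_def cell_def head_def
  by (auto simp: case_prod_beta)

text \<open>Zero is tested by decrementing: overflow occurs exactly at zero. At \<open>CZ\<close>
  overflow means that the cell in question was the one just written, so its content is known;
  otherwise the decrement is undone on the way to \<open>CB\<close>. At \<open>CM\<close> and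
  \<open>CB\<close> the counter may wrap around in passing, so both exits agree.\<close>

fun ex :: "cont \<Rightarrow> label" where
  "ex (CQ q) = PickQ q"
| "ex (CR j x) = PickR j x"
| "ex (CI x) = Inp x"
| "ex (CM z j x) = Add 1 False (CZ z j x)"
| "ex (CZ z j x) = Add 1 True (CB j x)"
| "ex (CB j x) = Add 0 False (CR j x)"

fun ov :: "tm \<Rightarrow> cont \<Rightarrow> label" where
  "ov M (CQ q) = Fin (q = start M)"
| "ov M (CR j x) = (if j = 0 then Inp x else Fin (x = 0))"
| "ov M (CI x) = Wrd x"
| "ov M (CM z j x) = Add 1 False (CZ z j x)"
| "ov M (CZ z j x) = Fin (fst (snd (stp M z) ! j) = x)"
| "ov M (CB j x) = Add 0 False (CR j x)"

text \<open>The parameter \<open>c\<close> matters only while the input is searched: it counts the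
  decrements made, so when the displacement hits zero it is the position of the letter. The minimum
  merely keeps names in range.\<close>

fun exc :: "cont \<Rightarrow> nat \<Rightarrow> nat \<Rightarrow> nat" where
  "exc (CI x) n c = min (Suc c) n" | "exc _ n c = 0"

fun ovc :: "cont \<Rightarrow> nat \<Rightarrow> nat" where
  "ovc (CI x) c = c" | "ovc _ c = 0"

definition mov :: "tm \<Rightarrow> nat \<times> nat list \<Rightarrow> nat \<Rightarrow> nat \<Rightarrow> label" where
  "mov M z j x = (case snd (snd (stp M z) ! j) of Left \<Rightarrow> Add 1 False (CM z j x)
     | Right \<Rightarrow> Add 1 True (CM z j x) | Stay \<Rightarrow> Add 1 False (CZ z j x))"

text \<open>Bit \<open>k\<close> of the time is register \<open>2 * k\<close>, bit \<open>k\<close> of the displacement is register \<open>2 * k + 1\<close>.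
  Displacements stay between \<open>- 2 ^ (m + 1)\<close> and \<open>2 ^ (m + 1)\<close>, so with two extra bits the residue
  in the register is \<open>0\<close> only if the displacement is.\<close>

definition width :: "nat \<Rightarrow> nat \<Rightarrow> nat" where "width m r = m + 2 * r"

text \<open>All this depends on the machine alone and is constant for the reduction. Hence
  \<open>code\<close> can be any injection on the finitely many labels; nothing has to compute
  it.\<close>

locale tm_labels =
  fixes M :: tm and labels :: "label list" and code :: "label \<Rightarrow> nat"
  assumes tm: "is_tm M" and labels: "distinct labels" "set labels = {l. okl M l}"
    and code: "inj_on code (set labels)"
begin

definition nm :: "label \<Rightarrow> nat \<Rightarrow> nat \<Rightarrow> nat" where
  "nm l c k = prod_encode (code l, prod_encode (c, k))"

definition pick :: "(nat \<times> nat list \<Rightarrow> bool) \<Rightarrow> (nat \<times> nat list \<Rightarrow> label) \<Rightarrow> (nat \<times> nat) list" where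
  "pick f g = map (\<lambda>i. (i, nm (g (all_z M ! i)) 0 0)) (filter (\<lambda>i. f (all_z M ! i)) [0..<length (all_z M)])"

text \<open>A player who must choose among no successors loses.\<close>

definition verdict :: "bool \<Rightarrow> instr" where "verdict b = (if b then Att [] else Dfn [])"

text \<open>\<open>Att\<close> with one successor serves as a jump. In \<open>Go\<close> the
  announced bit is flipped, and carry or borrow propagates iff it equals \<open>b\<close>; the bound
  on \<open>k\<close> there only keeps names in range. At \<open>Cfg z\<close> the attacker picks
  the component of \<open>z\<close> to question: a symbol under a head becomes a cell claim with the
  displacement reset to zero.\<close>

fun ins :: "bool list \<Rightarrow> nat \<Rightarrow> label \<Rightarrow> nat \<Rightarrow> nat \<Rightarrow> instr" where
  "ins w m (Add r b a) c k = (if k < width m r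
     then Dfn [(0, nm (Clm r b a False) c k), (1, nm (Clm r b a True) c k)]
     else Att [(0, nm (ov M a) (ovc a c) 0)])"
| "ins w m (Clm r b a v) c k = Att [(0, nm (Go r b a v) c k), (1, nm (Chk r v) c k)]"
| "ins w m (Chk r v) c k = Check (2 * k + r) v"
| "ins w m (Go r b a v) c k = Assign (2 * k + r) (\<not> v)
     (if v = b \<and> k < width m r then nm (Add r b a) c (Suc k) else nm (ex a) (exc a (length w) c) 0)"
| "ins w m (Fill r v a) c k = (if k < width m r then Assign (2 * k + r) v (nm (Fill r v a) c (Suc k))
     else Att [(0, nm (Add 0 False a) 0 0)])"
| "ins w m (Fin b) c k = verdict b"
| "ins w m (PickQ q) c k = Dfn (pick (\<lambda>z. fst (stp M z) = q) Cfg)"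
| "ins w m (PickR j x) c k = Dfn (pick (\<lambda>_. True) (\<lambda>z. PR z j x))"
| "ins w m (PR z j x) c k = Att [(0, nm (Cfg z) 0 0), (1, nm (mov M z j x) 0 0)]"
| "ins w m (Inp x) c k = (if c < length w then Att [(0, nm (Add 1 False (CI x)) c 0)] else verdict (x = 0))"
| "ins w m (Wrd x) c k = verdict ((if c < length w \<and> w ! c then 2 else 1) = x)"
| "ins w m (Cfg z) c k = Att ((0, nm (Add 0 False (CQ (fst z))) 0 0) #
     map (\<lambda>j. (Suc j, nm (Fill 1 False (CR j (snd z ! j))) 0 0)) [0..<num_tapes M])"

text \<open>The bit index runs up to \<open>m + 2\<close>, the width of the displacement, because
  that index marks the end of a carry.\<close>

definition prog :: "bool list \<Rightarrow> nat \<Rightarrow> (nat \<times> instr) list" where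
  "prog w m = map (\<lambda>(l, c, k). (nm l c k, ins w m l c k))
     (List.product labels (List.product [0..<Suc (length w)] [0..<m + 3]))"

definition num_choices :: nat where "num_choices = length (all_z M) + num_tapes M + 2"

abbreviation "init_state \<equiv> nm (Fill 0 True (CQ (accept M))) 0 0"

lemma nm_inj: "okl M l \<Longrightarrow> okl M l' \<Longrightarrow> nm l c k = nm l' c' k' \<longleftrightarrow> l = l' \<and> c = c' \<and> k = k'"
  using inj_onD[OF code, of l l'] labels(2) by (auto simp: nm_def prod_encode_eq)

lemma prog_mem: "okl M l \<Longrightarrow> c \<le> length w \<Longrightarrow> k < m + 3 \<Longrightarrow> (nm l c k, ins w m l c k) \<in> set (prog w m)"
  unfolding prog_def using labels(2) by (intro image_eqI[of _ _ "(l, c, k)"] iffD2[OF set_map[THEN eqset_imp_iff]]) (auto simp: less_Suc_eq_le simp del: upt_Suc)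

lemma prog_names: "okl M l \<Longrightarrow> c \<le> length w \<Longrightarrow> k < m + 3 \<Longrightarrow> nm l c k \<in> fst ` set (prog w m)"
  using prog_mem by (metis fst_conv image_eqI)

lemma okl_ex: "okc M a \<Longrightarrow> okl M (ex a)" by (cases a) auto

lemma okl_ov: "okc M a \<Longrightarrow> okl M (ov M a)" by (cases a) auto

lemma okl_mov: "okz M z \<Longrightarrow> j < num_tapes M \<Longrightarrow> x < num_symbols M \<Longrightarrow> okl M (mov M z j x)"
  by (auto simp: mov_def split: move.splits)

lemma exc_le: "exc a n c \<le> n" by (cases a) auto

lemma ovc_le: "ovc a c \<le> c" by (cases a) auto

lemma wf_verdict: "wf_instr K R S (verdict b)"
  by (simp add: verdict_def wf_instr_simps)

lemma wf_ins:
  assumes "okl M l" "c \<le> length w" "k < m + 3"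
  shows "wf_instr num_choices (2 * (m + 3)) (fst ` set (prog w m)) (ins w m l c k)"
proof -
  let ?N = "fst ` set (prog w m)"
  have n: "nm l' c' k' \<in> ?N" if "okl M l'" "c' \<le> length w" "k' \<le> k \<or> k' = 0" for l' c' k'
    using prog_names[of l' c' w k' m] that assms by auto
  have K: "0 < num_choices" "Suc 0 < num_choices" by (simp_all add: num_choices_def)
  have z: "okz M (all_z M ! i)" if "i < length (all_z M)" for i
    using that set_all_z[of M] nth_mem by blast
  have p: "wf_instr num_choices R ?N (Dfn (pick f g))" if "\<And>z. okz M z \<Longrightarrow> okl M (g z)" for f g R
    unfolding wf_instr_simps pick_def using z that n
    by (auto simp: comp_def num_choices_def)
  show ?thesis
  proof (cases l)
    case (Add r b a)
    then show ?thesis using assms K n okl_ov[of a] ovc_le[of a c] by (auto simp: wf_instr_simps)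
  next
    case (Clm r b a v)
    then show ?thesis using assms K n by (auto simp: wf_instr_simps)
  next
    case (Chk r v)
    then show ?thesis using assms by (auto simp: wf_instr_simps)
  next
    case (Go r b a v)
    have "nm (Add r b a) c (Suc k) \<in> ?N" if "k < width m r"
      using prog_names[of "Add r b a" c w "Suc k" m] that assms Go by (auto simp: width_def)
    then show ?thesis using assms Go n okl_ex[of a] exc_le[of a "length w" c] by (auto simp: wf_instr_simps)
  next
    case (Fill r v a)
    have "nm (Fill r v a) c (Suc k) \<in> ?N" if "k < width m r"
      using prog_names[of "Fill r v a" c w "Suc k" m] that assms Fill by (auto simp: width_def)
    then show ?thesis using assms Fill n K by (auto simp: wf_instr_simps)
  next
    case (Fin b)
    then show ?thesis by (simp add: wf_verdict)
  next
    case (PickQ q)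
    then show ?thesis using p by simp
  next
    case (PickR j x)
    then show ?thesis using p assms by simp
  next
    case (PR z j x)
    then show ?thesis using assms K n okl_mov[of z j x] by (auto simp: wf_instr_simps)
  next
    case (Inp x)
    then show ?thesis using assms K n by (auto simp: wf_instr_simps wf_verdict)
  next
    case (Wrd x)
    then show ?thesis by (simp add: wf_verdict)
  next
    case (Cfg z)
    have "snd z ! j < num_symbols M" if "j < num_tapes M" for j
      using assms(1) that unfolding Cfg okl.simps okz_def by (metis lessThan_iff nth_mem subsetD)
    then show ?thesis using assms(1) K n unfolding Cfg
      by (auto simp: wf_instr_simps comp_def num_choices_def distinct_map okz_def)
  qed
qed

lemma game_prog: "game num_choices (2 * (m + 3)) init_state (prog w m)"
proof
  have d: "distinct (map fst (prog w m))"
    unfolding prog_def map_map distinct_map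
    using labels nm_inj by (auto simp: inj_on_def distinct_product simp del: upt_Suc)
  show "wf_program num_choices (2 * (m + 3)) (prog w m)"
    unfolding wf_program_def
  proof (intro conjI d ballI)
    fix y assume "y \<in> set (prog w m)"
    then obtain l c k where "y = (nm l c k, ins w m l c k)" "okl M l" "c \<le> length w" "k < m + 3"
      unfolding prog_def using labels(2) by (auto simp: less_Suc_eq_le simp del: upt_Suc)
    then show "case y of (s, i) \<Rightarrow> wf_instr num_choices (2 * (m + 3)) (fst ` set (prog w m)) i"
      using wf_ins by simp
  qed
  show "init_state \<in> fst ` set (prog w m)"
    using tm by (intro prog_names) (auto simp: is_tm_def)
qed

end

section \<open>Counters kept in the log of assignments\<close>

fun pval :: "nat \<Rightarrow> nat \<Rightarrow> nat \<Rightarrow> (nat \<times> bool) list \<Rightarrow> nat" where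
  "pval r 0 k \<sigma> = 0"
| "pval r (Suc N) k \<sigma> = (if lookup (2 * k + r) \<sigma> then 1 else 0) + 2 * pval r N (Suc k) \<sigma>"

lemma pval_less: "pval r N k \<sigma> < 2 ^ N"
proof (induction N arbitrary: k)
  case (Suc N)
  show ?case using Suc[of "Suc k"] by simp
qed simp

lemma all_from_Suc:
  "(\<forall>i. k \<le> i \<and> i < k + Suc N \<longrightarrow> Q i) \<longleftrightarrow> Q k \<and> (\<forall>i. Suc k \<le> i \<and> i < Suc k + N \<longrightarrow> Q i)"
  by (metis Suc_le_eq add_Suc_right add_Suc le_eq_less_or_eq less_add_Suc1)

lemma pval_eq_0: "pval r N k \<sigma> = 0 \<longleftrightarrow> (\<forall>i. k \<le> i \<and> i < k + N \<longrightarrow> \<not> lookup (2 * i + r) \<sigma>)"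
proof (induction N arbitrary: k)
  case (Suc N)
  show ?case unfolding all_from_Suc using Suc by simp
qed auto

lemma pval_cong:
  "(\<And>i. k \<le> i \<Longrightarrow> lookup (2 * i + r) \<sigma> = lookup (2 * i + r) \<tau>) \<Longrightarrow> pval r N k \<sigma> = pval r N k \<tau>"
proof (induction N arbitrary: k)
  case (Suc N)
  have "pval r N (Suc k) \<sigma> = pval r N (Suc k) \<tau>" using Suc.prems by (intro Suc.IH) simp
  then show ?case using Suc.prems[of k] by simp
qed simp

lemma pval_const:
  assumes "\<And>i. k \<le> i \<Longrightarrow> i < k + N \<Longrightarrow> lookup (2 * i + r) \<sigma> = v"
  shows "pval r N k \<sigma> = (if v then 2 ^ N - 1 else 0)"
  using assms
proof (induction N arbitrary: k)
  case (Suc N)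
  have "pval r N (Suc k) \<sigma> = (if v then 2 ^ N - 1 else 0)" using Suc.prems by (intro Suc.IH) simp
  moreover have "lookup (2 * k + r) \<sigma> = v" using Suc.prems[of k] by simp
  moreover have "1 + 2 * (2 ^ N - 1) = (2 ^ Suc N - 1 :: nat)"
  proof -
    have "1 \<le> (2::nat) ^ N" by simp
    then show ?thesis unfolding power_Suc by linarith
  qed
  ultimately show ?case by simp
qed simp

locale tm_game = tm_labels +
  fixes w :: "bool list" and m :: nat
  assumes w_short: "length w < 2 ^ m"
begin

abbreviation "PP \<equiv> prog w m"

definition wins :: "label \<Rightarrow> nat \<Rightarrow> nat \<Rightarrow> (nat \<times> bool) list \<Rightarrow> bool" where
  "wins l c k \<sigma> \<longleftrightarrow> \<not> aw PP (nm l c k) \<sigma>"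

lemmas awA = game.aw_Assign_iff[OF game_prog] and awT = game.aw_Att_iff[OF game_prog]
  and awD = game.aw_Dfn_iff[OF game_prog] and awC = game.aw_Check_iff[OF game_prog]

lemma mem: "okl M l \<Longrightarrow> c \<le> length w \<Longrightarrow> k < m + 3 \<Longrightarrow> i = ins w m l c k \<Longrightarrow> (nm l c k, i) \<in> set PP"
  using prog_mem by simp

lemma width_less: "r < 2 \<Longrightarrow> k \<le> width m r \<Longrightarrow> k < m + 3"
  by (simp add: width_def)

lemma verdict_iff: "(s, verdict b) \<in> set PP \<Longrightarrow> \<not> aw PP s \<sigma> \<longleftrightarrow> b"
  by (cases b) (auto simp: verdict_def awT awD)

lemma wins_Fin: "wins (Fin b) 0 0 \<sigma> \<longleftrightarrow> b"
  unfolding wins_def by (rule verdict_iff, rule mem) auto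

lemma wins_Wrd: "x < num_symbols M \<Longrightarrow> c < length w \<Longrightarrow> wins (Wrd x) c 0 \<sigma> \<longleftrightarrow> (if w ! c then 2 else 1) = x"
  unfolding wins_def by (rule verdict_iff, rule mem) auto

lemma wins_Inp:
  assumes "x < num_symbols M" "c \<le> length w"
  shows "wins (Inp x) c 0 \<sigma> \<longleftrightarrow> (if c < length w then wins (Add 1 False (CI x)) c 0 \<sigma> else x = 0)"
proof -
  have "(nm (Inp x) c 0, ins w m (Inp x) c 0) \<in> set PP" by (rule mem) (use assms in auto)
  then show ?thesis by (auto simp: wins_def awT verdict_iff split: if_splits)
qed

lemma wins_Add_end:
  assumes "r < 2" "okc M a" "c \<le> length w"
  shows "wins (Add r b a) c (width m r) \<sigma> \<longleftrightarrow> wins (ov M a) (ovc a c) 0 \<sigma>"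
proof -
  have "(nm (Add r b a) c (width m r), Att [(0, nm (ov M a) (ovc a c) 0)]) \<in> set PP"
    by (rule mem) (use assms width_less in auto)
  then show ?thesis by (auto simp: wins_def awT)
qed

text \<open>A false announcement loses to \<open>Chk\<close>, and challenging a true one loses as
  well, so the play follows the actual bit.\<close>

lemma wins_Add:
  fixes \<sigma>
  assumes "r < 2" "okc M a" "c \<le> length w" "k < width m r"
  defines "v \<equiv> lookup (2 * k + r) \<sigma>"
  shows "wins (Add r b a) c k \<sigma> \<longleftrightarrow>
    (if v = b then wins (Add r b a) c (Suc k) ((2 * k + r, \<not> v) # \<sigma>)
     else wins (ex a) (exc a (length w) c) 0 ((2 * k + r, \<not> v) # \<sigma>))"
proof -
  have k: "k < m + 3" using width_less[of r k] assms by simp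
  have 1: "(nm (Add r b a) c k, Dfn [(0, nm (Clm r b a False) c k), (1, nm (Clm r b a True) c k)]) \<in> set PP"
    by (rule mem) (use assms k in auto)
  have 2: "(nm (Clm r b a u) c k, Att [(0, nm (Go r b a u) c k), (1, nm (Chk r u) c k)]) \<in> set PP" for u
    by (rule mem) (use assms k in auto)
  have 3: "(nm (Chk r u) c k, Check (2 * k + r) u) \<in> set PP" for u
    by (rule mem) (use assms k in auto)
  have 4: "(nm (Go r b a u) c k, Assign (2 * k + r) (\<not> u)
     (if u = b then nm (Add r b a) c (Suc k) else nm (ex a) (exc a (length w) c) 0)) \<in> set PP" for u
    by (rule mem) (use assms k in auto)
  show ?thesis unfolding wins_def v_def
    by (cases "lookup (2 * k + r) \<sigma>") (simp_all add: awD[OF 1] awT[OF 2] awC[OF 3] awA[OF 4])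
qed

definition same_below :: "nat \<Rightarrow> nat \<Rightarrow> (nat \<times> bool) list \<Rightarrow> (nat \<times> bool) list \<Rightarrow> bool" where
  "same_below r k \<sigma> \<tau> \<longleftrightarrow> (\<forall>i r'. r' < 2 \<and> (r' \<noteq> r \<or> i < k) \<longrightarrow> lookup (2 * i + r') \<tau> = lookup (2 * i + r') \<sigma>)"

lemma reg_eq: "r < 2 \<Longrightarrow> r' < 2 \<Longrightarrow> 2 * i + r = 2 * j + r' \<longleftrightarrow> i = j \<and> r = (r'::nat)" by presburger

text \<open>The result is a congruence because the counter wraps around. A bit different from
  \<open>b\<close> is flipped and ends the carry; a bit equal to \<open>b\<close> is flipped and
  passes it on. Overflow therefore means that all remaining bits equal \<open>b\<close>.\<close>

lemma Add_loop:
  assumes "r < 2" "okc M a" "c \<le> length w" "k + N = width m r"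
  shows "\<exists>\<tau>. same_below r k \<sigma> \<tau> \<and>
    (2 ^ N) dvd (int (pval r N k \<tau>) - int (pval r N k \<sigma>) - (if b then 1 else - 1)) \<and>
    (wins (Add r b a) c k \<sigma> \<longleftrightarrow>
      (if \<forall>i. k \<le> i \<and> i < k + N \<longrightarrow> lookup (2 * i + r) \<sigma> = b then wins (ov M a) (ovc a c) 0 \<tau>
       else wins (ex a) (exc a (length w) c) 0 \<tau>))"
  using assms(4)
proof (induction N arbitrary: k \<sigma>)
  case 0
  then show ?case using wins_Add_end[OF assms(1-3), of b \<sigma>]
    by (intro exI[of _ \<sigma>]) (auto simp: same_below_def)
next
  case (Suc N)
  have k: "k < width m r" "Suc k + N = width m r" using Suc.prems by auto
  let ?v = "lookup (2 * k + r) \<sigma>" and ?s = "(2 * k + r, \<not> lookup (2 * k + r) \<sigma>) # \<sigma>"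
  have ls: "lookup (2 * i + r') ?s = (if i = k \<and> r' = r then \<not> ?v else lookup (2 * i + r') \<sigma>)" if "r' < 2" for i r'
    using reg_eq[OF assms(1) that, of k i] by auto
  have pv: "pval r N (Suc k) ?s = pval r N (Suc k) \<sigma>"
    by (rule pval_cong) (use ls[OF assms(1)] in auto)
  note W = wins_Add[OF assms(1-3) k(1), of b \<sigma>]
  show ?case
  proof (cases "?v = b")
    case True
    obtain \<tau> where t: "same_below r (Suc k) ?s \<tau>"
      "2 ^ N dvd (int (pval r N (Suc k) \<tau>) - int (pval r N (Suc k) ?s) - (if b then 1 else - 1))"
      "wins (Add r b a) c (Suc k) ?s \<longleftrightarrow> (if \<forall>i. Suc k \<le> i \<and> i < Suc k + N \<longrightarrow> lookup (2 * i + r) ?s = b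
         then wins (ov M a) (ovc a c) 0 \<tau> else wins (ex a) (exc a (length w) c) 0 \<tau>)"
      using Suc.IH[OF k(2), of ?s] by blast
    have "same_below r k \<sigma> \<tau>" using t(1) ls unfolding same_below_def by (metis less_Suc_eq nat_neq_iff)
    moreover have lk: "lookup (2 * k + r) \<tau> = (\<not> b)" using t(1) ls[OF assms(1), of k] True assms(1)
      unfolding same_below_def by (metis lessI)
    moreover have "2 ^ Suc N dvd (int (pval r (Suc N) k \<tau>) - int (pval r (Suc N) k \<sigma>) - (if b then 1 else - 1))"
    proof -
      have "int (pval r (Suc N) k \<tau>) - int (pval r (Suc N) k \<sigma>) - (if b then 1 else - 1) =
          2 * (int (pval r N (Suc k) \<tau>) - int (pval r N (Suc k) ?s) - (if b then 1 else - 1))"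
        unfolding pv using lk True by (cases b) (auto simp: algebra_simps)
      then show ?thesis using mult_dvd_mono[OF dvd_refl[of "2::int"] t(2)] by (simp only: power_Suc)
    qed
    moreover have "(\<forall>i. Suc k \<le> i \<and> i < Suc k + N \<longrightarrow> lookup (2 * i + r) ?s = b) \<longleftrightarrow>
        (\<forall>i. k \<le> i \<and> i < k + Suc N \<longrightarrow> lookup (2 * i + r) \<sigma> = b)"
      unfolding ls[OF assms(1)] all_from_Suc using True by auto
    ultimately show ?thesis using W True t(3) by (intro exI[of _ \<tau>]) auto
  next
    case False
    have "same_below r k \<sigma> ?s" unfolding same_below_def using ls by auto
    moreover have "pval r (Suc N) k ?s = pval r (Suc N) k \<sigma> + 1 \<longleftrightarrow> b" "pval r (Suc N) k ?s + 1 = pval r (Suc N) k \<sigma> \<longleftrightarrow> \<not> b"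
      using False pv by auto
    then have "int (pval r (Suc N) k ?s) - int (pval r (Suc N) k \<sigma>) - (if b then 1 else - 1) = 0"
      by (cases b) auto
    moreover have "\<not> (\<forall>i. k \<le> i \<and> i < k + Suc N \<longrightarrow> lookup (2 * i + r) \<sigma> = b)"
      using False by auto
    ultimately show ?thesis using W False by (intro exI[of _ ?s]) auto
  qed
qed

definition val :: "nat \<Rightarrow> (nat \<times> bool) list \<Rightarrow> nat" where "val r \<sigma> = pval r (width m r) 0 \<sigma>"

lemma val_cong: "same_below r 0 \<sigma> \<tau> \<Longrightarrow> r' \<noteq> r \<Longrightarrow> r' < 2 \<Longrightarrow> val r' \<tau> = val r' \<sigma>"
  unfolding val_def by (rule pval_cong) (auto simp: same_below_def)

text \<open>For increments the overflow condition stays open: they are played only in front of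
  \<open>CM\<close> and \<open>CB\<close>, where it makes no difference.\<close>

lemma Add_result:
  assumes "r < 2" "okc M a" "c \<le> length w"
  shows "\<exists>\<tau>. (\<forall>r'. r' < 2 \<and> r' \<noteq> r \<longrightarrow> val r' \<tau> = val r' \<sigma>) \<and>
    2 ^ width m r dvd (int (val r \<tau>) - int (val r \<sigma>) - (if b then 1 else - 1)) \<and>
    (\<exists>e. wins (Add r b a) c 0 \<sigma> \<longleftrightarrow>
      (if e then wins (ov M a) (ovc a c) 0 \<tau> else wins (ex a) (exc a (length w) c) 0 \<tau>)) \<and>
    (\<not> b \<longrightarrow> (wins (Add r b a) c 0 \<sigma> \<longleftrightarrow>
      (if val r \<sigma> = 0 then wins (ov M a) (ovc a c) 0 \<tau> else wins (ex a) (exc a (length w) c) 0 \<tau>)))"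
proof -
  have "0 + width m r = width m r" by simp
  from Add_loop[OF assms this, of \<sigma> b] obtain \<tau> where t: "same_below r 0 \<sigma> \<tau>"
    "2 ^ width m r dvd (int (pval r (width m r) 0 \<tau>) - int (pval r (width m r) 0 \<sigma>) - (if b then 1 else - 1))"
    "wins (Add r b a) c 0 \<sigma> \<longleftrightarrow>
      (if \<forall>i. 0 \<le> i \<and> i < 0 + width m r \<longrightarrow> lookup (2 * i + r) \<sigma> = b then wins (ov M a) (ovc a c) 0 \<tau>
       else wins (ex a) (exc a (length w) c) 0 \<tau>)"
    by blast
  show ?thesis
  proof (intro exI[of _ \<tau>] conjI)
    show "\<forall>r'. r' < 2 \<and> r' \<noteq> r \<longrightarrow> val r' \<tau> = val r' \<sigma>" using val_cong[OF t(1)] by blast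
    show "2 ^ width m r dvd (int (val r \<tau>) - int (val r \<sigma>) - (if b then 1 else - 1))" using t(2) unfolding val_def .
    show "\<exists>e. wins (Add r b a) c 0 \<sigma> \<longleftrightarrow> (if e then wins (ov M a) (ovc a c) 0 \<tau> else wins (ex a) (exc a (length w) c) 0 \<tau>)"
      using t(3) by blast
    show "\<not> b \<longrightarrow> (wins (Add r b a) c 0 \<sigma> \<longleftrightarrow>
      (if val r \<sigma> = 0 then wins (ov M a) (ovc a c) 0 \<tau> else wins (ex a) (exc a (length w) c) 0 \<tau>))"
      using t(3) unfolding val_def pval_eq_0 by (cases b) simp_all
  qed
qed

lemma Fill_result:
  assumes "r < 2" "okc M a"
  shows "\<exists>\<tau>. (\<forall>r'. r' < 2 \<and> r' \<noteq> r \<longrightarrow> val r' \<tau> = val r' \<sigma>) \<and>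
    val r \<tau> = (if v then 2 ^ width m r - 1 else 0) \<and>
    (wins (Fill r v a) 0 0 \<sigma> \<longleftrightarrow> wins (Add 0 False a) 0 0 \<tau>)"
proof -
  have "\<exists>\<tau>. same_below r k \<sigma> \<tau> \<and> (\<forall>i. k \<le> i \<and> i < k + N \<longrightarrow> lookup (2 * i + r) \<tau> = v) \<and>
      (wins (Fill r v a) 0 k \<sigma> \<longleftrightarrow> wins (Add 0 False a) 0 0 \<tau>)" if "k + N = width m r" for k N
    using that
  proof (induction N arbitrary: k \<sigma>)
    case 0
    have "(nm (Fill r v a) 0 k, Att [(0, nm (Add 0 False a) 0 0)]) \<in> set PP"
      by (rule mem) (use assms width_less[of r k] 0 in auto)
    then show ?case by (intro exI[of _ \<sigma>]) (auto simp: same_below_def wins_def awT)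
  next
    case (Suc N)
    let ?s = "(2 * k + r, v) # \<sigma>"
    have ls: "lookup (2 * i + r') ?s = (if i = k \<and> r' = r then v else lookup (2 * i + r') \<sigma>)" if "r' < 2" for i r'
      using reg_eq[OF assms(1) that, of k i] by auto
    have "(nm (Fill r v a) 0 k, Assign (2 * k + r) v (nm (Fill r v a) 0 (Suc k))) \<in> set PP"
      by (rule mem) (use assms width_less[of r k] Suc.prems in auto)
    then have W: "wins (Fill r v a) 0 k \<sigma> \<longleftrightarrow> wins (Fill r v a) 0 (Suc k) ?s" by (simp add: wins_def awA)
    obtain \<tau> where t: "same_below r (Suc k) ?s \<tau>" "\<forall>i. Suc k \<le> i \<and> i < Suc k + N \<longrightarrow> lookup (2 * i + r) \<tau> = v"
      "wins (Fill r v a) 0 (Suc k) ?s \<longleftrightarrow> wins (Add 0 False a) 0 0 \<tau>"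
      using Suc.IH[of "Suc k" ?s] Suc.prems by auto
    have "same_below r k \<sigma> \<tau>" using t(1) ls unfolding same_below_def by (metis less_Suc_eq nat_neq_iff)
    moreover have "lookup (2 * k + r) \<tau> = v" using t(1) ls[OF assms(1), of k] assms(1)
      unfolding same_below_def by (metis lessI)
    then have "\<forall>i. k \<le> i \<and> i < k + Suc N \<longrightarrow> lookup (2 * i + r) \<tau> = v"
      unfolding all_from_Suc using t(2) by blast
    ultimately show ?case using W t(3) by blast
  qed
  from this[of 0 "width m r"] obtain \<tau> where t: "same_below r 0 \<sigma> \<tau>"
    "\<forall>i. 0 \<le> i \<and> i < 0 + width m r \<longrightarrow> lookup (2 * i + r) \<tau> = v"
    "wins (Fill r v a) 0 0 \<sigma> \<longleftrightarrow> wins (Add 0 False a) 0 0 \<tau>" by auto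
  show ?thesis
  proof (intro exI[of _ \<tau>] conjI t(3))
    show "\<forall>r'. r' < 2 \<and> r' \<noteq> r \<longrightarrow> val r' \<tau> = val r' \<sigma>" using val_cong[OF t(1)] by blast
    show "val r \<tau> = (if v then 2 ^ width m r - 1 else 0)"
      unfolding val_def by (rule pval_const) (use t(2) in auto)
  qed
qed

lemma val_less: "val r \<sigma> < 2 ^ width m r" unfolding val_def by (rule pval_less)

lemma dvd_small: "2 ^ N dvd (x :: int) \<Longrightarrow> \<bar>x\<bar> < 2 ^ N \<Longrightarrow> x = 0"
  using dvd_imp_le_int[of x "2 ^ N"] by fastforce

lemma val_less_int: "int (val r \<sigma>) < 2 ^ width m r"
  using val_less[of r \<sigma>] by (metis of_nat_less_iff of_nat_numeral of_nat_power)

text \<open>A positive value stays in range when decremented, so the congruence is an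
  equality.\<close>

lemma dec_time:
  assumes "okc M a" "val 0 \<sigma> = Suc t" "exc a (length w) 0 = 0"
  shows "\<exists>\<tau>. val 1 \<tau> = val 1 \<sigma> \<and> val 0 \<tau> = t \<and> (wins (Add 0 False a) 0 0 \<sigma> \<longleftrightarrow> wins (ex a) 0 0 \<tau>)"
proof -
  obtain \<tau> where t: "\<forall>r'. r' < 2 \<and> r' \<noteq> 0 \<longrightarrow> val r' \<tau> = val r' \<sigma>"
    "2 ^ width m 0 dvd (int (val 0 \<tau>) - int (val 0 \<sigma>) - (if False then 1 else - 1))"
    "wins (Add 0 False a) 0 0 \<sigma> \<longleftrightarrow> (if val 0 \<sigma> = 0 then wins (ov M a) (ovc a 0) 0 \<tau> else wins (ex a) (exc a (length w) 0) 0 \<tau>)"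
    using Add_result[OF _ assms(1), of 0 0 \<sigma> False] by auto
  have "2 ^ width m 0 dvd (int (val 0 \<tau>) - int t)" using t(2) assms(2) by simp
  moreover have "\<bar>int (val 0 \<tau>) - int t\<bar> < 2 ^ width m 0"
    using val_less_int[of 0 \<tau>] val_less_int[of 0 \<sigma>] assms(2) by linarith
  ultimately have "int (val 0 \<tau>) - int t = 0" by (rule dvd_small)
  then show ?thesis using t(1,3) assms(2,3) by (intro exI[of _ \<tau>]) simp
qed

text \<open>Displacements may be negative, so the register holds only a residue;
  \<open>m + 2\<close> is its width.\<close>

definition disp :: "(nat \<times> bool) list \<Rightarrow> int \<Rightarrow> bool" where
  "disp \<sigma> d \<longleftrightarrow> 2 ^ (m + 2) dvd (int (val 1 \<sigma>) - d)"

lemma disp_zero: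
  assumes "disp \<sigma> d" "\<bar>d\<bar> < 2 ^ (m + 2)"
  shows "val 1 \<sigma> = 0 \<longleftrightarrow> d = 0"
proof
  assume "val 1 \<sigma> = 0"
  then have "2 ^ (m + 2) dvd d" using assms(1) by (simp add: disp_def)
  then show "d = 0" using assms(2) by (rule dvd_small)
next
  assume "d = 0"
  then have "2 ^ (m + 2) dvd int (val 1 \<sigma>)" using assms(1) by (simp add: disp_def)
  moreover have "\<bar>int (val 1 \<sigma>)\<bar> < 2 ^ (m + 2)" using val_less_int[of 1 \<sigma>] by (simp add: width_def)
  ultimately have "int (val 1 \<sigma>) = 0" by (rule dvd_small)
  then show "val 1 \<sigma> = 0" by simp
qed

lemma add_disp:
  assumes "okc M a" "c \<le> length w" "disp \<sigma> d"
  shows "\<exists>\<tau>. val 0 \<tau> = val 0 \<sigma> \<and> disp \<tau> (d + (if b then 1 else - 1)) \<and>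
    (\<exists>e. wins (Add 1 b a) c 0 \<sigma> \<longleftrightarrow>
      (if e then wins (ov M a) (ovc a c) 0 \<tau> else wins (ex a) (exc a (length w) c) 0 \<tau>)) \<and>
    (\<not> b \<and> \<bar>d\<bar> < 2 ^ (m + 2) \<longrightarrow> (wins (Add 1 b a) c 0 \<sigma> \<longleftrightarrow>
      (if d = 0 then wins (ov M a) (ovc a c) 0 \<tau> else wins (ex a) (exc a (length w) c) 0 \<tau>)))"
proof -
  have "(1::nat) < 2" by simp
  from Add_result[OF this assms(1,2), of \<sigma> b] obtain \<tau> where t: "\<forall>r'. r' < 2 \<and> r' \<noteq> 1 \<longrightarrow> val r' \<tau> = val r' \<sigma>"
    "2 ^ width m 1 dvd (int (val 1 \<tau>) - int (val 1 \<sigma>) - (if b then 1 else - 1))"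
    "\<exists>e. wins (Add 1 b a) c 0 \<sigma> \<longleftrightarrow> (if e then wins (ov M a) (ovc a c) 0 \<tau> else wins (ex a) (exc a (length w) c) 0 \<tau>)"
    "\<not> b \<longrightarrow> (wins (Add 1 b a) c 0 \<sigma> \<longleftrightarrow> (if val 1 \<sigma> = 0 then wins (ov M a) (ovc a c) 0 \<tau> else wins (ex a) (exc a (length w) c) 0 \<tau>))"
    by blast
  show ?thesis
  proof (intro exI[of _ \<tau>] conjI t(3) impI)
    show "val 0 \<tau> = val 0 \<sigma>" using t(1) by simp
    have "2 ^ (m + 2) dvd ((int (val 1 \<tau>) - int (val 1 \<sigma>) - (if b then 1 else - 1)) + (int (val 1 \<sigma>) - d))"
      using t(2) assms(3) unfolding disp_def width_def by (intro dvd_add) simp_all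
    then show "disp \<tau> (d + (if b then 1 else - 1))" unfolding disp_def by (simp add: algebra_simps)
    assume "\<not> b \<and> \<bar>d\<bar> < 2 ^ (m + 2)"
    then show "wins (Add 1 b a) c 0 \<sigma> \<longleftrightarrow>
      (if d = 0 then wins (ov M a) (ovc a c) 0 \<tau> else wins (ex a) (exc a (length w) c) 0 \<tau>)"
      using t(4) disp_zero[OF assms(3)] by simp
  qed
qed

text \<open>For steps that may cross zero, where the two exits coincide.\<close>

lemma add_disp_same:
  assumes "okc M a" "disp \<sigma> d" "ov M a = ex a" "ovc a 0 = 0" "exc a (length w) 0 = 0"
  shows "\<exists>\<tau>. val 0 \<tau> = val 0 \<sigma> \<and> disp \<tau> (d + (if b then 1 else - 1)) \<and>
    (wins (Add 1 b a) 0 0 \<sigma> \<longleftrightarrow> wins (ex a) 0 0 \<tau>)"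
  using add_disp[OF assms(1) _ assms(2), of 0 b] unfolding assms(3-5) if_cancel by blast

text \<open>The register holds the position minus \<open>c\<close>, and both are below
  \<open>2 ^ m\<close> in absolute value, so each zero test is exact. Once the position lies below
  \<open>c\<close> the test never succeeds again and the claim is settled as a blank.\<close>

lemma wins_Inp_iff:
  assumes "x < num_symbols M" "c \<le> length w" "disp \<sigma> (i - int c)" "\<bar>i\<bar> < 2 ^ m"
  shows "wins (Inp x) c 0 \<sigma> \<longleftrightarrow> (if int c \<le> i then word_contents w i else 0) = x"
  using assms(2,3)
proof (induction "length w - c" arbitrary: c \<sigma>)
  case 0
  then show ?case using wins_Inp[OF assms(1), of c] by (auto simp: word_contents_def)
next
  case (Suc n)
  then have c: "c < length w" by simp
  have "int c < 2 ^ m" using c w_short by (metis less_trans of_nat_less_iff of_nat_numeral of_nat_power)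
  moreover have "(2::int) ^ (m + 2) = 4 * 2 ^ m" by (simp add: power_add)
  ultimately have b: "\<bar>i - int c\<bar> < 2 ^ (m + 2)" using assms(4) by linarith
  obtain \<tau> where t: "disp \<tau> (i - int c + (if False then 1 else - 1))"
    "wins (Add 1 False (CI x)) c 0 \<sigma> \<longleftrightarrow> (if i - int c = 0 then wins (ov M (CI x)) (ovc (CI x) c) 0 \<tau>
       else wins (ex (CI x)) (exc (CI x) (length w) c) 0 \<tau>)"
    using add_disp[of "CI x" c \<sigma> "i - int c" False] Suc.prems assms(1) b by auto
  have IH: "wins (Inp x) (Suc c) 0 \<tau> \<longleftrightarrow> (if int (Suc c) \<le> i then word_contents w i else 0) = x"
    by (rule Suc.hyps(1)) (use Suc.hyps(2) c t(1) in \<open>auto simp: algebra_simps\<close>)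
  show ?case
  proof (cases "i = int c")
    case True
    then show ?thesis using t(2) wins_Inp[OF assms(1), of c \<sigma>] wins_Wrd[OF assms(1), of c \<tau>] c
      by (simp add: word_contents_def)
  next
    case False
    then show ?thesis using t(2) wins_Inp[OF assms(1), of c \<sigma>] IH c by (auto simp: min_def)
  qed
qed

section \<open>True claims are exactly the ones the defender can uphold\<close>

lemma wins_pick:
  assumes "(nm l 0 0, Dfn (pick f g)) \<in> set PP"
  shows "wins l 0 0 \<sigma> \<longleftrightarrow> (\<exists>z. okz M z \<and> f z \<and> wins (g z) 0 0 \<sigma>)"
proof -
  have "wins l 0 0 \<sigma> \<longleftrightarrow> (\<exists>i<length (all_z M). f (all_z M ! i) \<and> wins (g (all_z M ! i)) 0 0 \<sigma>)"
    unfolding wins_def awD[OF assms] by (auto simp: pick_def)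
  also have "\<dots> \<longleftrightarrow> (\<exists>z\<in>set (all_z M). f z \<and> wins (g z) 0 0 \<sigma>)" by (metis in_set_conv_nth)
  finally show ?thesis unfolding set_all_z by blast
qed

text \<open>State claims and cell claims are proved together, as each is justified through the
  scanned situation one step earlier. One step back lowers the time by one and moves the
  displacement by at most one, so the bound on their sum persists; it keeps the zero tests
  exact.\<close>

lemma claims_correct:
  "(\<forall>\<sigma> q. val 0 \<sigma> = t \<and> q < num_states M \<longrightarrow>
      (wins (Add 0 False (CQ q)) 0 0 \<sigma> \<longleftrightarrow> fst (tm_run M w t) = q)) \<and>
   (\<forall>\<sigma> j x d. val 0 \<sigma> = t \<and> j < num_tapes M \<and> x < num_symbols M \<and> disp \<sigma> d \<and> \<bar>d\<bar> + int t < 2 ^ m \<longrightarrow>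
      (wins (Add 0 False (CR j x)) 0 0 \<sigma> \<longleftrightarrow> cell M w j t d = x))"
proof (induction t)
  case 0
  show ?case
  proof (intro conjI allI impI)
    fix \<sigma> q assume h: "val 0 \<sigma> = 0 \<and> q < num_states M"
    obtain \<tau> where "wins (Add 0 False (CQ q)) 0 0 \<sigma> \<longleftrightarrow> wins (ov M (CQ q)) 0 0 \<tau>"
      using Add_result[of 0 "CQ q" 0 \<sigma> False] h by auto
    then show "wins (Add 0 False (CQ q)) 0 0 \<sigma> \<longleftrightarrow> fst (tm_run M w 0) = q"
      by (auto simp: wins_Fin tm_run_def tm_init_def)
  next
    fix \<sigma> j x d assume h: "val 0 \<sigma> = 0 \<and> j < num_tapes M \<and> x < num_symbols M \<and> disp \<sigma> d \<and> \<bar>d\<bar> + int 0 < 2 ^ m"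
    obtain \<tau> where t': "\<forall>r'. r' < 2 \<and> r' \<noteq> 0 \<longrightarrow> val r' \<tau> = val r' \<sigma>"
      and t: "wins (Add 0 False (CR j x)) 0 0 \<sigma> \<longleftrightarrow> wins (ov M (CR j x)) 0 0 \<tau>"
      using Add_result[of 0 "CR j x" 0 \<sigma> False] h by auto
    have "val 1 \<tau> = val 1 \<sigma>" using t' by simp
    note t = this t
    have "disp \<tau> (d - int 0)" using h t(1) by (simp add: disp_def)
    then have "wins (Inp x) 0 0 \<tau> \<longleftrightarrow> (if int 0 \<le> d then word_contents w d else 0) = x"
      using h by (intro wins_Inp_iff) auto
    moreover have "(if int 0 \<le> d then word_contents w d else 0) = word_contents w d"
      by (simp add: word_contents_def)
    ultimately show "wins (Add 0 False (CR j x)) 0 0 \<sigma> \<longleftrightarrow> cell M w j 0 d = x"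
      using t(2) cell_0[of j M w d] h by (auto simp: wins_Fin)
  qed
next
  case (Suc t)
  have Q: "wins (Add 0 False (CQ q)) 0 0 \<sigma> \<longleftrightarrow> fst (tm_run M w t) = q"
    if "val 0 \<sigma> = t" "q < num_states M" for \<sigma> q using Suc that by blast
  have R: "wins (Add 0 False (CR j x)) 0 0 \<sigma> \<longleftrightarrow> cell M w j t d = x"
    if "val 0 \<sigma> = t" "j < num_tapes M" "x < num_symbols M" "disp \<sigma> d" "\<bar>d\<bar> + int t < 2 ^ m" for \<sigma> j x d
    using Suc that by blast
  let ?z = "scan M w t"
  have okz: "okz M ?z" using okz_scan[OF tm] by blast
  \<comment> \<open>The state claim together with the cell claims at displacement zero pins down
    every component of \<open>z\<close>.\<close>
  have C: "wins (Cfg z) 0 0 \<sigma> \<longleftrightarrow> z = ?z" if v: "val 0 \<sigma> = t" and z: "okz M z" for \<sigma> z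
  proof -
    have "(nm (Cfg z) 0 0, ins w m (Cfg z) 0 0) \<in> set PP" by (rule mem) (use z in auto)
    then have W: "wins (Cfg z) 0 0 \<sigma> \<longleftrightarrow> wins (Add 0 False (CQ (fst z))) 0 0 \<sigma> \<and>
        (\<forall>j<num_tapes M. wins (Fill 1 False (CR j (snd z ! j))) 0 0 \<sigma>)"
      unfolding ins.simps wins_def by (auto simp: awT)
    have t: "int t < 2 ^ m" using val_less_int[of 0 \<sigma>] v by (simp add: width_def)
    have "wins (Fill 1 False (CR j (snd z ! j))) 0 0 \<sigma> \<longleftrightarrow> snd z ! j = snd ?z ! j" if j: "j < num_tapes M" for j
    proof -
      have x: "snd z ! j < num_symbols M" using z j unfolding okz_def by (metis lessThan_iff nth_mem subsetD)
      obtain \<tau> where f': "\<forall>r'. r' < 2 \<and> r' \<noteq> 1 \<longrightarrow> val r' \<tau> = val r' \<sigma>" and f'': "val 1 \<tau> = 0"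
        "wins (Fill 1 False (CR j (snd z ! j))) 0 0 \<sigma> \<longleftrightarrow> wins (Add 0 False (CR j (snd z ! j))) 0 0 \<tau>"
        using Fill_result[of 1 "CR j (snd z ! j)" \<sigma> False] j x by auto
      have "val 0 \<tau> = val 0 \<sigma>" using f' by simp
      note f = this f''
      have "wins (Add 0 False (CR j (snd z ! j))) 0 0 \<tau> \<longleftrightarrow> cell M w j t 0 = snd z ! j"
        by (rule R) (use f v j x t in \<open>auto simp: disp_def\<close>)
      then show ?thesis using f(3) snd_scan_nth[OF tm j, of w t] by auto
    qed
    moreover have "fst z < num_states M" using z by (simp add: okz_def)
    ultimately have "wins (Cfg z) 0 0 \<sigma> \<longleftrightarrow> fst z = fst ?z \<and> (\<forall>j<num_tapes M. snd z ! j = snd ?z ! j)"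
      using W Q[OF v] by (auto simp: scan_def)
    also have "(\<forall>j<num_tapes M. snd z ! j = snd ?z ! j) \<longleftrightarrow> snd z = snd ?z"
      using z okz unfolding okz_def by (auto simp: list_eq_iff_nth_eq)
    finally show ?thesis by (auto simp: prod_eq_iff)
  qed
  show ?case
  proof (intro conjI allI impI)
    fix \<sigma> q assume h: "val 0 \<sigma> = Suc t \<and> q < num_states M"
    obtain \<tau> where t: "val 0 \<tau> = t" "wins (Add 0 False (CQ q)) 0 0 \<sigma> \<longleftrightarrow> wins (PickQ q) 0 0 \<tau>"
      using dec_time[of "CQ q" \<sigma> t] h by auto
    have "(nm (PickQ q) 0 0, Dfn (pick (\<lambda>z. fst (stp M z) = q) Cfg)) \<in> set PP" by (rule mem) (use h in auto)
    from wins_pick[OF this, of \<tau>] have "wins (PickQ q) 0 0 \<tau> \<longleftrightarrow> fst (stp M ?z) = q" using C[OF t(1)] okz by blast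
    then show "wins (Add 0 False (CQ q)) 0 0 \<sigma> \<longleftrightarrow> fst (tm_run M w (Suc t)) = q"
      using t(2) tm_run_Suc(1)[OF tm okz] by simp
  next
    fix \<sigma> j x d assume h: "val 0 \<sigma> = Suc t \<and> j < num_tapes M \<and> x < num_symbols M \<and> disp \<sigma> d \<and> \<bar>d\<bar> + int (Suc t) < 2 ^ m"
    obtain \<tau> where t: "val 1 \<tau> = val 1 \<sigma>" "val 0 \<tau> = t" "wins (Add 0 False (CR j x)) 0 0 \<sigma> \<longleftrightarrow> wins (PickR j x) 0 0 \<tau>"
      using dec_time[of "CR j x" \<sigma> t] h by auto
    have dt: "disp \<tau> d" using h t(1) by (simp add: disp_def)
    have "(nm (PickR j x) 0 0, Dfn (pick (\<lambda>_. True) (\<lambda>z. PR z j x))) \<in> set PP" by (rule mem) (use h in auto)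
    from wins_pick[OF this, of \<tau>] have "wins (PickR j x) 0 0 \<tau> \<longleftrightarrow> (\<exists>z. okz M z \<and> wins (PR z j x) 0 0 \<tau>)" by simp
    moreover have "wins (PR z j x) 0 0 \<tau> \<longleftrightarrow> wins (Cfg z) 0 0 \<tau> \<and> wins (mov M z j x) 0 0 \<tau>" if "okz M z" for z
    proof -
      have "(nm (PR z j x) 0 0, ins w m (PR z j x) 0 0) \<in> set PP" by (rule mem) (use h that in auto)
      then show ?thesis by (auto simp: wins_def awT)
    qed
    \<comment> \<open>Any wrong \<open>z\<close> loses when questioned and questioning the true one
      is futile, so play continues with the true scan.\<close>
    ultimately have W: "wins (PickR j x) 0 0 \<tau> \<longleftrightarrow> wins (mov M ?z j x) 0 0 \<tau>" using C[OF t(2)] okz by blast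
    define y where "y = snd (stp M ?z) ! j"
    \<comment> \<open>Decrement to test for zero: at zero the claim is compared with the symbol just
      written, elsewhere the displacement is restored and the claim moves to the earlier
      time.\<close>
    have Z: "wins (Add 1 False (CZ ?z j x)) 0 0 \<upsilon> \<longleftrightarrow> (if d' = 0 then fst y = x else cell M w j t d' = x)"
      if u: "val 0 \<upsilon> = t" "disp \<upsilon> d'" "\<bar>d'\<bar> + int t < 2 ^ m" for \<upsilon> d'
    proof -
      have ok: "okc M (CZ ?z j x)" "okc M (CB j x)" using okz h by auto
      have b: "\<bar>d'\<bar> < 2 ^ (m + 2)" using u(3) by (simp add: power_add)
      have "0 \<le> length w" by simp
      from add_disp[OF ok(1) this u(2), of False] b obtain \<rho>
        where r': "val 0 \<rho> = val 0 \<upsilon>" "disp \<rho> (d' + (if False then 1 else - 1))"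
        "wins (Add 1 False (CZ ?z j x)) 0 0 \<upsilon> \<longleftrightarrow>
          (if d' = 0 then wins (ov M (CZ ?z j x)) (ovc (CZ ?z j x) 0) 0 \<rho>
           else wins (ex (CZ ?z j x)) (exc (CZ ?z j x) (length w) 0) 0 \<rho>)"
        by blast
      have r: "val 0 \<rho> = val 0 \<upsilon>" "disp \<rho> (d' - 1)"
        "wins (Add 1 False (CZ ?z j x)) 0 0 \<upsilon> \<longleftrightarrow> (if d' = 0 then wins (Fin (fst y = x)) 0 0 \<rho>
          else wins (Add 1 True (CB j x)) 0 0 \<rho>)"
        using r' unfolding y_def by simp_all
      obtain \<phi> where p: "val 0 \<phi> = val 0 \<rho>" "disp \<phi> d'"
        "wins (Add 1 True (CB j x)) 0 0 \<rho> \<longleftrightarrow> wins (Add 0 False (CR j x)) 0 0 \<phi>"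
        using add_disp_same[OF ok(2) r(2), of True] by auto
      have "wins (Add 0 False (CR j x)) 0 0 \<phi> \<longleftrightarrow> cell M w j t d' = x"
        by (rule R) (use p r u h in auto)
      then show ?thesis using r(3) p(3) by (simp add: wins_Fin)
    qed
    have ok: "okc M (CM ?z j x)" using okz h by auto
    have "wins (mov M ?z j x) 0 0 \<tau> \<longleftrightarrow> (if d + offset (snd y) = 0 then fst y = x else cell M w j t (d + offset (snd y)) = x)"
    proof (cases "snd y")
      case Left
      obtain \<upsilon> where u: "val 0 \<upsilon> = val 0 \<tau>" "disp \<upsilon> (d - 1)"
        "wins (Add 1 False (CM ?z j x)) 0 0 \<tau> \<longleftrightarrow> wins (Add 1 False (CZ ?z j x)) 0 0 \<upsilon>"
        using add_disp_same[OF ok dt, of False] by auto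
      have "\<bar>d - 1\<bar> + int t < 2 ^ m" using h by linarith
      then show ?thesis using Z[of \<upsilon> "d - 1"] u t(2) Left unfolding mov_def y_def[symmetric] by simp
    next
      case Stay
      have "\<bar>d\<bar> + int t < 2 ^ m" using h by linarith
      then show ?thesis using Z[OF t(2) dt] Stay unfolding mov_def y_def[symmetric] by simp
    next
      case Right
      obtain \<upsilon> where u: "val 0 \<upsilon> = val 0 \<tau>" "disp \<upsilon> (d + 1)"
        "wins (Add 1 True (CM ?z j x)) 0 0 \<tau> \<longleftrightarrow> wins (Add 1 False (CZ ?z j x)) 0 0 \<upsilon>"
        using add_disp_same[OF ok dt, of True] by auto
      have "\<bar>d + 1\<bar> + int t < 2 ^ m" using h by linarith
      then show ?thesis using Z[of \<upsilon> "d + 1"] u t(2) Right unfolding mov_def y_def[symmetric] by simp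
    qed
    then show "wins (Add 0 False (CR j x)) 0 0 \<sigma> \<longleftrightarrow> cell M w j (Suc t) d = x"
      using t(3) W cell_Suc[OF tm, of j w t d] h unfolding y_def by auto
  qed
qed

text \<open>Filling the time counter with ones sets it to \<open>2 ^ m - 1\<close>, and the defender
  has to justify that the machine is then in its accepting state.\<close>

theorem prog_correct: "aw PP init_state [] \<longleftrightarrow> fst (tm_run M w (2 ^ m - 1)) \<noteq> accept M"
proof -
  have a: "accept M < num_states M" using tm by (simp add: is_tm_def)
  obtain \<tau> where t: "val 0 \<tau> = 2 ^ m - 1"
    "wins (Fill 0 True (CQ (accept M))) 0 0 [] \<longleftrightarrow> wins (Add 0 False (CQ (accept M))) 0 0 \<tau>"
    using Fill_result[of 0 "CQ (accept M)" "[]" True] a by (auto simp: width_def)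
  then show ?thesis using conjunct1[OF claims_correct[of "2 ^ m - 1"]] a unfolding wins_def by blast
qed

end

section \<open>Completeness\<close>

lemma pt_less: "pt (f :: 'a :: enc \<Rightarrow> nat) \<Longrightarrow> pt g \<Longrightarrow> pt (\<lambda>x. f x < g x)"
  unfolding less_eq_Suc_le by (intro pt_le pt_Suc)

lemma pt_prod_encode: "pt f \<Longrightarrow> pt g \<Longrightarrow> pt (\<lambda>x. prod_encode (f x, g x))"
  unfolding prod_encode_def triangle_def case_prod_beta fst_conv snd_conv
  by (intro pt_add pt_div2 pt_mult pt_Suc)

text \<open>Stated with the range guard, as \<open>!\<close> is unspecified beyond the end; the
  instruction for \<open>Wrd\<close> has the same form.\<close>

lemma pt_nth_bool:
  assumes "pt f" "pt g"
  shows "pt (\<lambda>x. g x < length (f x) \<and> f x ! g x)"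
proof -
  have d: "(tl ^^ i) l = drop i l" for i and l :: "bool list" by (induction i) (simp_all add: drop_Suc tl_drop)
  have "pt (\<lambda>z :: bool list \<times> nat. (tl ^^ snd z) (fst z))"
  proof (rule pt_funpow[where b = "\<lambda>n. n"])
    show "sz ((tl ^^ i) (fst z)) \<le> sz z" for i and z :: "bool list \<times> nat"
      using sz_drop[of i "fst z"] by (cases z) (simp add: d)
  qed (intro pt_intros pbd_intros)+
  then have "pt (\<lambda>z :: bool list \<times> nat. case drop (snd z) (fst z) of [] \<Rightarrow> False | b # _ \<Rightarrow> b)"
    unfolding d by (intro pt_intros)
  moreover have "(case drop (snd z) (fst z) of [] \<Rightarrow> False | b # _ \<Rightarrow> b) \<longleftrightarrow> snd z < length (fst z) \<and> fst z ! snd z"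
    for z :: "bool list \<times> nat"
    by (cases "snd z < length (fst z)") (simp_all add: Cons_nth_drop_Suc[symmetric])
  ultimately have "pt (\<lambda>z :: bool list \<times> nat. snd z < length (fst z) \<and> fst z ! snd z)" by simp
  from pt_comp2[OF this assms] show ?thesis .
qed

lemma pt_rsym: "pt f \<Longrightarrow> pt g \<Longrightarrow> pt (\<lambda>x. rsym (f x) (g x))"
  unfolding rsym_def by (intro pt_intros)

lemma pt_cd: "pt f \<Longrightarrow> pt g \<Longrightarrow> pt (\<lambda>x. cd (f x) (g x))"
  unfolding cd_def by (rule pt_prod_encode)

lemma pt_syms: "pt f \<Longrightarrow> pt (\<lambda>x. syms (f x))"
  unfolding syms_def by (intro pt_intros)

lemma pt_game_rules:
  "pt (\<lambda>z :: nat list \<times> nat \<times> instr. game_rules (fst z) (fst (snd z)) (snd (snd z)))"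
  unfolding game_rules_def case_prod_beta by (intro pt_rsym pt_intros)

lemma pt_game_inst:
  assumes "pt M" "pt P"
  shows "pt (\<lambda>x. game_inst K (M x) s0 (P x))"
proof -
  have "pt (\<lambda>z :: nat \<times> (nat \<times> instr) list. game_inst K (fst z) s0 (snd z))"
    unfolding game_inst_def by (intro pt_comp3[OF pt_game_rules] pt_cd pt_syms pt_intros)
  from pt_comp2[OF this assms] show ?thesis .
qed

context tm_labels
begin

lemma pt_nm: "pt f \<Longrightarrow> pt g \<Longrightarrow> pt (\<lambda>x. nm l (f x) (g x))"
  unfolding nm_def by (intro pt_prod_encode pt_const)

lemma pt_exc: "pt f \<Longrightarrow> pt g \<Longrightarrow> pt (\<lambda>x. exc a (f x) (g x))"
  by (cases a) (auto intro!: pt_min pt_Suc pt_const)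

lemma pt_ovc: "pt f \<Longrightarrow> pt (\<lambda>x. ovc a (f x))"
  by (cases a) (auto intro!: pt_const)

lemma pt_verdict: "pt f \<Longrightarrow> pt (\<lambda>x. verdict (f x))"
  unfolding verdict_def instr_defs by (intro pt_intros)

lemma pt_ins:
  "pt (\<lambda>z :: bool list \<times> nat \<times> nat \<times> nat. ins (fst z) (fst (snd z)) l (fst (snd (snd z))) (snd (snd (snd z))))"
  by (cases l; simp only: ins.simps width_def instr_defs)
    (intro pt_const pt_nm pt_exc pt_ovc pt_verdict pt_less pt_nth_bool pt_intros)+

lemma prog_concat: "prog w m = concat (map (\<lambda>l. concat (map (\<lambda>c. map (\<lambda>k. (nm l c k, ins w m l c k))
    [0..<m + 3]) [0..<Suc (length w)])) labels)"
  unfolding prog_def by (simp add: product_concat_map map_concat comp_def del: upt_Suc)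

lemma pt_prog:
  assumes "pt w" "pt m"
  shows "pt (\<lambda>x. prog (w x) (m x))"
proof -
  \<comment> \<open>Induction over the fixed list of labels: each label contributes its own constant
    program fragment, so labels themselves need no encoding as data.\<close>
  have "pt (\<lambda>z :: bool list \<times> nat. concat (map (\<lambda>l. concat (map (\<lambda>c. map (\<lambda>k. (nm l c k, ins (fst z) (snd z) l c k))
      [0..<snd z + 3]) [0..<Suc (length (fst z))])) ls))" for ls
  proof (induction ls)
    case Nil
    show ?case by (simp add: pt_const)
  next
    case (Cons l ls)
    have I: "pt (\<lambda>y. ins (a y) (b y) l (c y) (d y))"
      if "pt a" "pt b" "pt c" "pt d" for a b c d
      using pt_comp[OF pt_pair[OF that(1) pt_pair[OF that(2) pt_pair[OF that(3,4)]]] pt_ins[of l]] by simp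
    show ?case unfolding list.map concat.simps
      by (intro pt_append Cons pt_concat pt_map pt_upt pt_Suc pt_length pt_pair pt_nm I pt_fst pt_snd pt_id pt_add pt_const)
  qed
  then have "pt (\<lambda>z. prog (fst z) (snd z))" unfolding prog_concat .
  from pt_comp2[OF this assms] show ?thesis .
qed

end

lemma tm_run_halted:
  assumes "fst (tm_run M w t) = accept M \<or> fst (tm_run M w t) = reject M" "t \<le> t'"
  shows "tm_run M w t' = tm_run M w t"
  using assms(2)
proof (induction t' rule: dec_induct)
  case (step n)
  have "tm_run M w (Suc n) = tm_step M (tm_run M w n)" by (simp add: tm_run_def)
  then show ?case using step assms(1) by (cases "tm_run M w t") (auto simp: tm_step.simps)
qed simp

text \<open>Words in the language give bisimilar processes, other words give processes unrelated
  even by simulation preorder. Any relation squeezed between the two therefore answers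
  correctly.\<close>

lemma EXPTIME_hard_between:
  assumes lower: "\<And>L s t. bisimilar L s t \<Longrightarrow> rel L s t" and upper: "\<And>L s t. rel L s t \<Longrightarrow> sim_preorder L s t"
  shows "EXPTIME_hard (vpda_problem rel)"
  unfolding EXPTIME_hard_def
proof
  fix A assume "A \<in> EXPTIME"
  then obtain M p where d: "decides_in_time M A (\<lambda>n. 2 ^ poly p n)" unfolding EXPTIME_def by blast
  have tm: "is_tm M" using d unfolding decides_in_time_def by blast
  obtain labels where labels: "set labels = {l. okl M l}" "distinct labels"
    using finite_distinct_list[OF finite_okl] by blast
  obtain code :: "label \<Rightarrow> nat" where code: "inj_on code (set labels)"
    using finite_imp_inj_to_nat_seg[OF finite_set[of labels]] by blast
  interpret tm_labels M labels code
    by unfold_locales (use tm labels code in auto)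
  \<comment> \<open>The first summand and the \<open>1\<close> put the running time below
    \<open>2 ^ m\<close>, so the halting state persists at time \<open>2 ^ m - 1\<close>; the second
    summand makes the input shorter than \<open>2 ^ m\<close>.\<close>
  define m where "m w = poly p (length w) + length w + 1" for w :: "bool list"
  define f where "f w = game_inst num_choices (2 * (m w + 3)) init_state (prog w (m w))" for w
  show "poly_time_reducible A (vpda_problem rel)"
  proof (rule pt_imp_poly_time_reducible)
    have "pt m" unfolding m_def by (intro pt_intros)
    then show "pt (\<lambda>w. enc_instance (mk_inst (f w)))"
      unfolding f_def by (intro pt_enc_inst pt_game_inst pt_prog pt_intros) auto
    fix w
    interpret G: game num_choices "2 * (m w + 3)" init_state "prog w (m w)" by (rule game_prog)
    have "length w < 2 ^ length w" by (rule less_exp)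
    also have "(2::nat) ^ length w \<le> 2 ^ m w" by (rule power_increasing) (simp_all add: m_def)
    finally interpret T: tm_game M labels code w "m w" by unfold_locales
    obtain t where t: "t \<le> 2 ^ poly p (length w)" "fst (tm_run M w t) = (if w \<in> A then accept M else reject M)"
      using d unfolding decides_in_time_def by blast
    have "(2::nat) ^ Suc (poly p (length w)) \<le> 2 ^ m w" by (rule power_increasing) (simp_all add: m_def)
    moreover have "1 \<le> (2::nat) ^ poly p (length w)" by simp
    ultimately have "t \<le> 2 ^ m w - 1" using t(1) unfolding power_Suc by linarith
    from tm_run_halted[OF _ this] t(2)
    have "fst (tm_run M w (2 ^ m w - 1)) = (if w \<in> A then accept M else reject M)" by (auto split: if_splits)
    moreover have "accept M \<noteq> reject M" using tm by (simp add: is_tm_def)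
    ultimately have aw: "aw (prog w (m w)) init_state [] \<longleftrightarrow> w \<notin> A" using T.prog_correct by auto
    have procs: "i_proc1 (mk_inst (f w)) = (cd 2 init_state, 0)" "i_proc2 (mk_inst (f w)) = (cd 3 init_state, 0)"
      by (simp_all add: f_def game_inst_def)
    have "enc_instance (mk_inst (f w)) \<in> vpda_problem rel \<longleftrightarrow>
        valid_instance (mk_inst (f w)) \<and> rel (pda_lts (instance_pda (mk_inst (f w)))) (cd 2 init_state, [0]) (cd 3 init_state, [0])"
      unfolding vpda_problem_def using procs by (auto simp: inj_eq[OF inj_enc_instance])
    also have "\<dots> \<longleftrightarrow> rel (pda_lts (instance_pda (mk_inst (f w)))) (cd 2 init_state, [0]) (cd 3 init_state, [0])"
      using G.valid_game_inst unfolding valid_inst_iff f_def by simp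
    also have "\<dots> \<longleftrightarrow> w \<in> A"
    proof
      assume "w \<in> A"
      then show "rel (pda_lts (instance_pda (mk_inst (f w)))) (cd 2 init_state, [0]) (cd 3 init_state, [0])"
        unfolding f_def using aw by (intro lower G.defender_wins) simp
    next
      assume "rel (pda_lts (instance_pda (mk_inst (f w)))) (cd 2 init_state, [0]) (cd 3 init_state, [0])"
      from upper[OF this] obtain R where R: "simulation (pda_lts (instance_pda (mk_inst (f w)))) R"
        "((cd 2 init_state, [0]), (cd 3 init_state, [0])) \<in> R" unfolding sim_preorder_def by blast
      show "w \<in> A"
      proof (rule ccontr)
        assume "w \<notin> A"
        then have "aw (prog w (m w)) init_state []" using aw by simp
        moreover have "[] \<in> G.logs" unfolding G.logs_def by simp
        ultimately show False using G.attacker_wins[OF R(1)[unfolded f_def]] R(2) by (force simp: G.st_def)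
      qed
    qed
    finally show "w \<in> A \<longleftrightarrow> enc_instance (mk_inst (f w)) \<in> vpda_problem rel" by simp
  qed
qed

section \<open>The relations between bisimilarity and simulation preorder\<close>

lemma bisimilar_sym: "bisimilar L s t \<Longrightarrow> bisimilar L t s"
  unfolding bisimilar_def bisimulation_def by blast

lemma bisimilar_imp_two_nested: "bisimilar L s t \<Longrightarrow> two_nested_sim_preorder L s t"
  unfolding bisimilar_def bisimulation_def two_nested_sim_preorder_def two_nested_simulation_def by blast

text \<open>By symmetry each side simulates the other, so each enabled action is enabled on the
  other side too.\<close>

lemma bisimulation_imp_ready: "bisimulation L R \<Longrightarrow> ready_simulation L R"
  unfolding bisimulation_def ready_simulation_def
proof (intro conjI ballI)
  fix z assume R: "simulation L R \<and> R\<inverse> = R" and "z \<in> R"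
  moreover obtain s t where z: "z = (s, t)" by (rule prod.exhaust)
  ultimately have "(s, t) \<in> R" "(t, s) \<in> R" by auto
  then show "case z of (s, t) \<Rightarrow> initials L s = initials L t"
    using R unfolding z simulation_def initials_def by fast
qed simp

lemma bisimilar_imp_ready: "bisimilar L s t \<Longrightarrow> ready_sim_preorder L s t"
  unfolding bisimilar_def ready_sim_preorder_def using bisimulation_imp_ready by blast

lemma bisimilar_imp_completed: "bisimilar L s t \<Longrightarrow> completed_sim_preorder L s t"
  unfolding bisimilar_def completed_sim_preorder_def completed_simulation_def
  using bisimulation_imp_ready[of L] unfolding ready_simulation_def by fastforce

lemma imp_sim_preorder:
  "completed_sim_preorder L s t \<Longrightarrow> sim_preorder L s t" "ready_sim_preorder L s t \<Longrightarrow> sim_preorder L s t"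
  "two_nested_sim_preorder L s t \<Longrightarrow> sim_preorder L s t" "bisimilar L s t \<Longrightarrow> sim_preorder L s t"
  unfolding sim_preorder_def completed_sim_preorder_def completed_simulation_def ready_sim_preorder_def
    ready_simulation_def two_nested_sim_preorder_def two_nested_simulation_def bisimilar_def bisimulation_def
  by blast+

lemma rels_mpre:
  "sim_preorder = mpre False False False False" "completed_sim_preorder = mpre True False False False"
  "ready_sim_preorder = mpre False True False False" "two_nested_sim_preorder = mpre False False True False"
  "bisimilar = mpre False False False True"
  by (intro ext; simp only: sim_preorder_mpre completed_sim_preorder_mpre ready_sim_preorder_mpre
    two_nested_sim_preorder_mpre bisimilar_mpre)+

theorem theorem3p3:
  assumes "rel \<in> {sim_preorder, kernel_equiv sim_preorder,
                   completed_sim_preorder, kernel_equiv completed_sim_preorder,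
                   ready_sim_preorder, kernel_equiv ready_sim_preorder,
                   two_nested_sim_preorder, kernel_equiv two_nested_sim_preorder,
                   bisimilar}"
  shows "decidable (vpda_problem rel) \<and> EXPTIME_complete (vpda_problem rel)"
proof -
  have "(\<exists>ce cr s1 s2. rel = mpre ce cr s1 s2) \<or> (\<exists>ce cr s1 s2. rel = kernel_equiv (mpre ce cr s1 s2))"
    using assms unfolding rels_mpre by blast
  then have E: "vpda_problem rel \<in> EXPTIME" using mpre_EXPTIME kernel_mpre_EXPTIME by auto
  note b = imp_sim_preorder(4) bisimilar_imp_completed bisimilar_imp_ready bisimilar_imp_two_nested
  have "EXPTIME_hard (vpda_problem rel)"
  proof (rule EXPTIME_hard_between)
    show "rel L s t" if "bisimilar L s t" for L s t
      using assms b[OF that] b[OF bisimilar_sym[OF that]] that by (auto simp: kernel_equiv_def)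
    show "sim_preorder L s t" if "rel L s t" for L s t
      using assms that imp_sim_preorder by (auto simp: kernel_equiv_def)
  qed
  with E show ?thesis using EXPTIME_imp_decidable unfolding EXPTIME_complete_def by blast
qed

end
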